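(* Let $X$ be a quandle, and let $A$ be an abelian group. Then, for every integer $n\geqslant 0$, there is an isomorphism of abelian groups \[ \mathrm{HQ}^{n+1}(X;A)\cong \mathrm{D}^n_X(X;A) \] between the quandle cohomology of $X$ with coefficients in $A$ in degree $n+1$ and the Quillen cohomology (for the algebraic theory of quandles) of $X$ with coefficients in the trivial Beck module $A\times X\to X$ in degree $n$.
   Context: **Racks and quandles.** A rack is a set $X$ with a binary operation $\rhd$ such that for every $x\in X$ the left multiplication $y\mapsto x\rhd y$ is an automorphism of $(X,\rhd)$ (a bijection with $x\rhd(y\rhd z)=(x\rhd y)\rhd(x\rhd z)$). A quandle is a rack with $x\rhd x=x$ for all $x$. Let $\mathbf{Q}$ be the category of quandles and $\mathbf{Q}_X$ the slice category of quandles over $X$. The forgetful functor $R$ from quandles to sets has a left adjoint $L$ (free quandles). **Quandle cohomology.** For $n\geqslant 0$ let $\mathrm{CR}_n(X)$ be the free abelian group with basis $X^n$. Define homomorphisms $\mathrm{CR}_n(X)\to\mathrm{CR}_{n-1}(X)$ by linear extension of \[ \delta_j^0(x_1,\dots,x_n)=(x_1,\dots,\widehat{x_j},\dots,x_n),\qquad \delta_j^1(x_1,\dots,x_n)=(x_1,\dots,x_{j-1},x_j\rhd x_{j+1},\dots,x_j\rhd x_n), \] and set $\delta^i=\sum_{j=1}^n(-1)^j\delta^i_j$ and $\delta=\delta^0-\delta^1$. Then $(\mathrm{CR}_\bullet(X),\delta)$ is a chain complex. The subgroups $\mathrm{CD}_n(X)\subseteq\mathrm{CR}_n(X)$ generated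 by the $n$-tuples in which at least two neighboring entries agree form a subcomplex; let $\mathrm{CQ}_\bullet(X)=\mathrm{CR}_\bullet(X)/\mathrm{CD}_\bullet(X)$. Then $\mathrm{HQ}^*(X;A)$ is the cohomology of the cochain complex $\mathrm{Hom}(\mathrm{CQ}_\bullet(X),A)$ (homomorphisms of abelian groups). **Beck modules.** A Beck module over $X$ is an abelian group object in $\mathbf{Q}_X$; these form the abelian category $\mathrm{Ab}(\mathbf{Q}_X)$. The forgetful functor $\mathrm{Ab}(\mathbf{Q}_X)\to\mathbf{Q}_X$ has a left adjoint $\Omega_X$. An abelian group $A$ is regarded as a quandle with the trivial operation $a\rhd b=b$; it is an abelian group object in $\mathbf{Q}$, and the projection $A\times X\to X$ from the product quandle is a Beck module over $X$, again denoted $A$. **Quillen cohomology.** A map of simplicial quandles is a weak equivalence (or fibration) if the underlying map of simplicial sets is one in the Kan--Quillen model structure; this defines a model structure on simplicial quandles. Its cofibrant objects are the retracts of free simplicial quandles, where $F_\bullet$ is free if there are subsets $B_q\subseteq F_q$, preserved by the degeneracies, such that the canonical map $LB_q\to F_q$ is an isomorphism for all $q$. Choose a cofibrant replacement $F_\bullet\to X$, that is, a weak equivalence from a cofibrant simplicial quandle $F_\bullet$ to the constant simplicial quandle $X$ (for example $F_q=(LR)^{q+1}X$). The cotangent complex $\mathbb{L}_X(X)$ is the simplicial Beck module $\Omega_X(F_\bullet)$, obtained by applying $\Omega_X$ level-wise, each $F_q$ being an object over $X$ by means of the augmentation. For a Beck module $M$ over $X$, the group $\mathrm{D}^n_X(X;M)$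 is the $n$-th cohomology ($n\geqslant 0$) of the cochain complex with $\mathrm{Hom}_{\mathrm{Ab}(\mathbf{Q}_X)}(\Omega_X(F_q),M)$ in degree $q$ and differential the alternating sum of the maps induced by the simplicial face maps. It does not depend on the choice of $F_\bullet$ up to canonical isomorphism. *)

theory Defs
  imports "HOL-Homology.Homology"
begin

section \<open>Racks and quandles\<close>

record 'a magma = "'a partial_object" +
  lact :: "'a \<Rightarrow> 'a \<Rightarrow> 'a" (infixr "\<rhd>\<index>" 70)

locale rack =
  fixes X (structure)
  assumes lact_bij: "x \<in> carrier X \<Longrightarrow> bij_betw (\<lambda>y. x \<rhd> y) (carrier X) (carrier X)"
    and lact_distrib: "\<lbrakk>x \<in> carrier X; y \<in> carrier X; z \<in> carrier X\<rbrakk>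
      \<Longrightarrow> x \<rhd> (y \<rhd> z) = (x \<rhd> y) \<rhd> (x \<rhd> z)"

locale quandle = rack +
  assumes lact_idem: "x \<in> carrier X \<Longrightarrow> x \<rhd> x = x"

definition quandle_hom :: "('a, 'm) magma_scheme \<Rightarrow> ('b, 'n) magma_scheme \<Rightarrow> ('a \<Rightarrow> 'b) set" where
  "quandle_hom X Y = {f. f \<in> carrier X \<rightarrow> carrier Y \<and>
     (\<forall>x\<in>carrier X. \<forall>y\<in>carrier X. f (x \<rhd>\<^bsub>X\<^esub> y) = f x \<rhd>\<^bsub>Y\<^esub> f y)}"

text \<open>The inverse of the left multiplication by \<open>x\<close>.\<close>

definition ldiv :: "('a, 'm) magma_scheme \<Rightarrow> 'a \<Rightarrow> 'a \<Rightarrow> 'a" where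
  "ldiv X x y = inv_into (carrier X) (\<lambda>z. x \<rhd>\<^bsub>X\<^esub> z) y"

lemma (in rack) lact_closed [simp, intro]:
  "\<lbrakk>x \<in> carrier X; y \<in> carrier X\<rbrakk> \<Longrightarrow> x \<rhd> y \<in> carrier X"
  using lact_bij bij_betwE by blast

lemma (in rack) ldiv_closed [simp, intro]:
  "\<lbrakk>x \<in> carrier X; y \<in> carrier X\<rbrakk> \<Longrightarrow> ldiv X x y \<in> carrier X"
  unfolding ldiv_def using lact_bij[of x] by (metis bij_betw_imp_surj_on inv_into_into)

lemma (in rack) lact_ldiv [simp]:
  "\<lbrakk>x \<in> carrier X; y \<in> carrier X\<rbrakk> \<Longrightarrow> x \<rhd> ldiv X x y = y"
  unfolding ldiv_def using lact_bij[of x]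
  by (metis (no_types, lifting) bij_betw_imp_surj_on f_inv_into_f)

lemma (in rack) ldiv_lact [simp]:
  "\<lbrakk>x \<in> carrier X; y \<in> carrier X\<rbrakk> \<Longrightarrow> ldiv X x (x \<rhd> y) = y"
  unfolding ldiv_def using lact_bij[of x] by (simp add: bij_betw_def)

lemma (in rack) ldiv_unique:
  "\<lbrakk>x \<in> carrier X; y \<in> carrier X; z \<in> carrier X; x \<rhd> z = y\<rbrakk> \<Longrightarrow> ldiv X x y = z"
  using ldiv_lact by blast

lemma quandle_hom_closed: "\<lbrakk>f \<in> quandle_hom X Y; x \<in> carrier X\<rbrakk> \<Longrightarrow> f x \<in> carrier Y"
  by (auto simp: quandle_hom_def)

lemma quandle_hom_lact:
  "\<lbrakk>f \<in> quandle_hom X Y; x \<in> carrier X; y \<in> carrier X\<rbrakk> \<Longrightarrow> f (x \<rhd>\<^bsub>X\<^esub> y) = f x \<rhd>\<^bsub>Y\<^esub> f y"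
  by (auto simp: quandle_hom_def)

lemma quandle_hom_ldiv:
  assumes "rack X" "rack Y" "f \<in> quandle_hom X Y" "x \<in> carrier X" "y \<in> carrier X"
  shows "f (ldiv X x y) = ldiv Y (f x) (f y)"
proof -
  interpret X: rack X by fact
  interpret Y: rack Y by fact
  have "f x \<rhd>\<^bsub>Y\<^esub> f (ldiv X x y) = f y"
    using assms by (metis X.lact_ldiv X.ldiv_closed quandle_hom_lact)
  then show ?thesis
    using assms by (metis Y.ldiv_unique X.ldiv_closed quandle_hom_closed)
qed

subsection \<open>Free quandles\<close>

text \<open>The free quandle on \<open>B\<close> consists of the terms in generators from \<open>B\<close>, modulo the
  congruence generated by the quandle axioms. The constructor \<open>QDiv\<close> stands for the inverse of
  the left multiplication.\<close>

datatype 'b qterm = QGen 'b | QOp "'b qterm" "'b qterm" | QDiv "'b qterm" "'b qterm"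

abbreviation qterms :: "'b set \<Rightarrow> 'b qterm set" where
  "qterms B \<equiv> {t. set_qterm t \<subseteq> B}"

inductive qterm_cong :: "'b set \<Rightarrow> 'b qterm \<Rightarrow> 'b qterm \<Rightarrow> bool" for B where
  refl: "t \<in> qterms B \<Longrightarrow> qterm_cong B t t"
| sym: "qterm_cong B s t \<Longrightarrow> qterm_cong B t s"
| trans: "qterm_cong B s t \<Longrightarrow> qterm_cong B t u \<Longrightarrow> qterm_cong B s u"
| Op_cong: "qterm_cong B s s' \<Longrightarrow> qterm_cong B t t' \<Longrightarrow> qterm_cong B (QOp s t) (QOp s' t')"
| Div_cong: "qterm_cong B s s' \<Longrightarrow> qterm_cong B t t' \<Longrightarrow> qterm_cong B (QDiv s t) (QDiv s' t')"
| distrib: "\<lbrakk>s \<in> qterms B; t \<in> qterms B; u \<in> qterms B\<rbrakk>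
    \<Longrightarrow> qterm_cong B (QOp s (QOp t u)) (QOp (QOp s t) (QOp s u))"
| idem: "t \<in> qterms B \<Longrightarrow> qterm_cong B (QOp t t) t"
| Op_Div: "\<lbrakk>s \<in> qterms B; t \<in> qterms B\<rbrakk> \<Longrightarrow> qterm_cong B (QOp s (QDiv s t)) t"
| Div_Op: "\<lbrakk>s \<in> qterms B; t \<in> qterms B\<rbrakk> \<Longrightarrow> qterm_cong B (QDiv s (QOp s t)) t"

definition qterm_rel :: "'b set \<Rightarrow> ('b qterm \<times> 'b qterm) set" where
  "qterm_rel B = {(s, t). qterm_cong B s t}"

definition free_quandle :: "'b set \<Rightarrow> 'b qterm set magma" where
  "free_quandle B = \<lparr>carrier = qterms B // qterm_rel B,
     lact = (\<lambda>C D. \<Union>s\<in>C. \<Union>t\<in>D. qterm_rel B `` {QOp s t})\<rparr>"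

definition free_quandle_unit :: "'b set \<Rightarrow> 'b \<Rightarrow> 'b qterm set" where
  "free_quandle_unit B b = qterm_rel B `` {QGen b}"

primrec qterm_eval :: "('a, 'm) magma_scheme \<Rightarrow> ('b \<Rightarrow> 'a) \<Rightarrow> 'b qterm \<Rightarrow> 'a" where
  "qterm_eval Q g (QGen b) = g b"
| "qterm_eval Q g (QOp s t) = qterm_eval Q g s \<rhd>\<^bsub>Q\<^esub> qterm_eval Q g t"
| "qterm_eval Q g (QDiv s t) = ldiv Q (qterm_eval Q g s) (qterm_eval Q g t)"

definition free_quandle_lift :: "('a, 'm) magma_scheme \<Rightarrow> ('b \<Rightarrow> 'a) \<Rightarrow> 'b qterm set \<Rightarrow> 'a" where
  "free_quandle_lift Q g C = the_elem (qterm_eval Q g ` C)"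

lemma qterm_cong_qterms: "qterm_cong B s t \<Longrightarrow> s \<in> qterms B \<and> t \<in> qterms B"
  by (induction rule: qterm_cong.induct) auto

lemma equiv_qterm_rel: "equiv (qterms B) (qterm_rel B)"
proof (rule equivI)
  show "qterm_rel B \<subseteq> qterms B \<times> qterms B"
    using qterm_cong_qterms by (fastforce simp: qterm_rel_def)
  show "refl_on (qterms B) (qterm_rel B)"
    by (auto simp: refl_on_def qterm_rel_def intro: qterm_cong.refl)
  show "sym (qterm_rel B)"
    by (auto simp: sym_def qterm_rel_def intro: qterm_cong.sym)
  show "trans (qterm_rel B)"
    by (auto simp: trans_def qterm_rel_def intro: qterm_cong.trans)
qed

lemma qterm_class_eq:
  "\<lbrakk>s \<in> qterms B; t \<in> qterms B\<rbrakk> \<Longrightarrow>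
    qterm_rel B `` {s} = qterm_rel B `` {t} \<longleftrightarrow> qterm_cong B s t"
  using eq_equiv_class_iff[OF equiv_qterm_rel, of s B t] unfolding qterm_rel_def by simp

lemma carrier_free_quandle: "carrier (free_quandle B) = (\<lambda>t. qterm_rel B `` {t}) ` qterms B"
  by (auto simp: free_quandle_def quotient_def)

lemma free_quandle_lact:
  assumes "s \<in> qterms B" "t \<in> qterms B"
  shows "(qterm_rel B `` {s}) \<rhd>\<^bsub>free_quandle B\<^esub> (qterm_rel B `` {t}) = qterm_rel B `` {QOp s t}"
proof -
  have "congruent2 (qterm_rel B) (qterm_rel B) (\<lambda>s t. qterm_rel B `` {QOp s t})"
    unfolding congruent2_def
  proof safe
    fix s s' t t' u assume h: "(s, s') \<in> qterm_rel B" "(t, t') \<in> qterm_rel B"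
    then have "qterm_cong B (QOp s t) (QOp s' t')"
      by (auto simp: qterm_rel_def intro: qterm_cong.Op_cong)
    then have "(QOp s t, QOp s' t') \<in> qterm_rel B" by (simp add: qterm_rel_def)
    then have "qterm_rel B `` {QOp s t} = qterm_rel B `` {QOp s' t'}"
      by (rule equiv_class_eq[OF equiv_qterm_rel])
    then show "(QOp s t, u) \<in> qterm_rel B \<Longrightarrow> (QOp s' t', u) \<in> qterm_rel B"
      and "(QOp s' t', u) \<in> qterm_rel B \<Longrightarrow> (QOp s t, u) \<in> qterm_rel B" by auto
  qed
  from UN_equiv_class2[OF equiv_qterm_rel equiv_qterm_rel this assms]
  show ?thesis by (simp add: free_quandle_def)
qed

lemma free_quandle_cases:
  assumes "x \<in> carrier (free_quandle B)"
  obtains t where "t \<in> qterms B" "x = qterm_rel B `` {t}"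
  using assms unfolding carrier_free_quandle by blast

lemma quandle_free_quandle: "quandle (free_quandle B)"
proof
  let ?L = "free_quandle B"
  note intro = qterm_class_eq[THEN iffD2] and dest = qterm_class_eq[THEN iffD1]
  have mem: "qterm_rel B `` {t} \<in> carrier ?L" if "t \<in> qterms B" for t
    using that unfolding carrier_free_quandle by blast
  show "bij_betw (\<lambda>y. x \<rhd>\<^bsub>?L\<^esub> y) (carrier ?L) (carrier ?L)" if x: "x \<in> carrier ?L" for x
  proof -
    obtain s where s: "s \<in> qterms B" "x = qterm_rel B `` {s}" using x by (rule free_quandle_cases)
    show ?thesis
    proof (rule bij_betw_byWitness[where f' = "\<lambda>y. \<Union>t\<in>y. qterm_rel B `` {QDiv s t}"])
      have D: "(\<Union>t\<in>qterm_rel B `` {t}. qterm_rel B `` {QDiv s t}) = qterm_rel B `` {QDiv s t}"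
        if "t \<in> qterms B" for t
      proof (rule UN_equiv_class[OF equiv_qterm_rel _ that])
        show "(\<lambda>t. qterm_rel B `` {QDiv s t}) respects qterm_rel B"
        proof (rule congruentI)
          fix t u assume "(t, u) \<in> qterm_rel B"
          then have "qterm_cong B (QDiv s t) (QDiv s u)"
            using qterm_cong.Div_cong[OF qterm_cong.refl[OF s(1)]] by (simp add: qterm_rel_def)
          then have "(QDiv s t, QDiv s u) \<in> qterm_rel B" by (simp add: qterm_rel_def)
          then show "qterm_rel B `` {QDiv s t} = qterm_rel B `` {QDiv s u}"
            by (rule equiv_class_eq[OF equiv_qterm_rel])
        qed
      qed
      have S: "QDiv s t \<in> qterms B" "QOp s t \<in> qterms B" if "t \<in> qterms B" for t
        using s(1) that by simp_all
      have A: "x \<rhd>\<^bsub>?L\<^esub> (qterm_rel B `` {t}) = qterm_rel B `` {QOp s t}" if "t \<in> qterms B" for t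
        using free_quandle_lact[OF s(1) that] s(2) by simp
      show "\<forall>y\<in>carrier ?L. (\<Union>t\<in>x \<rhd>\<^bsub>?L\<^esub> y. qterm_rel B `` {QDiv s t}) = y"
      proof
        fix y assume "y \<in> carrier ?L"
        then obtain t where t: "t \<in> qterms B" "y = qterm_rel B `` {t}" by (rule free_quandle_cases)
        show "(\<Union>t\<in>x \<rhd>\<^bsub>?L\<^esub> y. qterm_rel B `` {QDiv s t}) = y"
          unfolding t(2) A[OF t(1)] D[OF S(2)[OF t(1)]]
          by (rule intro[OF S(1)[OF S(2)[OF t(1)]] t(1) qterm_cong.Div_Op[OF s(1) t(1)]])
      qed
      show "\<forall>y\<in>carrier ?L. x \<rhd>\<^bsub>?L\<^esub> (\<Union>t\<in>y. qterm_rel B `` {QDiv s t}) = y"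
      proof
        fix y assume "y \<in> carrier ?L"
        then obtain t where t: "t \<in> qterms B" "y = qterm_rel B `` {t}" by (rule free_quandle_cases)
        show "x \<rhd>\<^bsub>?L\<^esub> (\<Union>t\<in>y. qterm_rel B `` {QDiv s t}) = y"
          unfolding t(2) D[OF t(1)] A[OF S(1)[OF t(1)]]
          by (rule intro[OF S(2)[OF S(1)[OF t(1)]] t(1) qterm_cong.Op_Div[OF s(1) t(1)]])
      qed
      show "(\<lambda>y. x \<rhd>\<^bsub>?L\<^esub> y) ` carrier ?L \<subseteq> carrier ?L"
      proof (rule image_subsetI)
        fix y assume "y \<in> carrier ?L"
        then obtain t where t: "t \<in> qterms B" "y = qterm_rel B `` {t}" by (rule free_quandle_cases)
        show "x \<rhd>\<^bsub>?L\<^esub> y \<in> carrier ?L"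
          unfolding t(2) A[OF t(1)] by (rule mem[OF S(2)[OF t(1)]])
      qed
      show "(\<lambda>y. \<Union>t\<in>y. qterm_rel B `` {QDiv s t}) ` carrier ?L \<subseteq> carrier ?L"
      proof (rule image_subsetI)
        fix y assume "y \<in> carrier ?L"
        then obtain t where t: "t \<in> qterms B" "y = qterm_rel B `` {t}" by (rule free_quandle_cases)
        show "(\<Union>t\<in>y. qterm_rel B `` {QDiv s t}) \<in> carrier ?L"
          unfolding t(2) D[OF t(1)] by (rule mem[OF S(1)[OF t(1)]])
      qed
    qed
  qed
  show "x \<rhd>\<^bsub>?L\<^esub> x = x" if x: "x \<in> carrier ?L" for x
  proof -
    obtain s where s: "s \<in> qterms B" "x = qterm_rel B `` {s}" using x by (rule free_quandle_cases)
    show ?thesis unfolding s(2) free_quandle_lact[OF s(1) s(1)]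
      by (rule intro[OF _ s(1) qterm_cong.idem[OF s(1)]]) (use s(1) in simp)
  qed
  show "x \<rhd>\<^bsub>?L\<^esub> (y \<rhd>\<^bsub>?L\<^esub> z) = (x \<rhd>\<^bsub>?L\<^esub> y) \<rhd>\<^bsub>?L\<^esub> (x \<rhd>\<^bsub>?L\<^esub> z)"
    if x: "x \<in> carrier ?L" and y: "y \<in> carrier ?L" and z: "z \<in> carrier ?L" for x y z
  proof -
    obtain s where s: "s \<in> qterms B" "x = qterm_rel B `` {s}" using x by (rule free_quandle_cases)
    obtain t where t: "t \<in> qterms B" "y = qterm_rel B `` {t}" using y by (rule free_quandle_cases)
    obtain u where u: "u \<in> qterms B" "z = qterm_rel B `` {u}" using z by (rule free_quandle_cases)
    have S: "QOp t u \<in> qterms B" "QOp s t \<in> qterms B" "QOp s u \<in> qterms B"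
      "QOp s (QOp t u) \<in> qterms B" "QOp (QOp s t) (QOp s u) \<in> qterms B"
      using s(1) t(1) u(1) by simp_all
    have "x \<rhd>\<^bsub>?L\<^esub> (y \<rhd>\<^bsub>?L\<^esub> z) = qterm_rel B `` {QOp s (QOp t u)}"
      unfolding s(2) t(2) u(2) free_quandle_lact[OF t(1) u(1)] free_quandle_lact[OF s(1) S(1)] ..
    also have "\<dots> = qterm_rel B `` {QOp (QOp s t) (QOp s u)}"
      by (rule intro[OF S(4,5) qterm_cong.distrib[OF s(1) t(1) u(1)]])
    also have "\<dots> = (x \<rhd>\<^bsub>?L\<^esub> y) \<rhd>\<^bsub>?L\<^esub> (x \<rhd>\<^bsub>?L\<^esub> z)"
      unfolding s(2) t(2) u(2) free_quandle_lact[OF s(1) t(1)] free_quandle_lact[OF s(1) u(1)]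
        free_quandle_lact[OF S(2,3)] ..
    finally show ?thesis .
  qed
qed

lemma qterm_eval_closed:
  assumes "rack Q" "g \<in> B \<rightarrow> carrier Q" "t \<in> qterms B"
  shows "qterm_eval Q g t \<in> carrier Q"
proof -
  interpret rack Q by fact
  have "set_qterm t \<subseteq> B" using assms(3) by simp
  then show ?thesis
    using assms(2) by (induction t) (simp_all add: Pi_iff)
qed

lemma qterm_eval_cong:
  assumes "quandle Q" "g \<in> B \<rightarrow> carrier Q" "qterm_cong B s t"
  shows "qterm_eval Q g s = qterm_eval Q g t"
proof -
  interpret quandle Q by fact
  note cl = qterm_eval_closed[OF rack_axioms assms(2)]
  show ?thesis using assms(3)
  proof (induction rule: qterm_cong.induct)
    case (distrib s t u)
    then show ?case
      unfolding qterm_eval.simps by (intro lact_distrib cl)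
  next
    case (idem t)
    then show ?case unfolding qterm_eval.simps by (intro lact_idem cl)
  next
    case (Op_Div s t)
    then show ?case unfolding qterm_eval.simps by (intro lact_ldiv cl)
  next
    case (Div_Op s t)
    then show ?case unfolding qterm_eval.simps by (intro ldiv_lact cl)
  qed simp_all
qed

lemma free_quandle_lift_class:
  assumes "quandle Q" "g \<in> B \<rightarrow> carrier Q" "t \<in> qterms B"
  shows "free_quandle_lift Q g (qterm_rel B `` {t}) = qterm_eval Q g t"
proof -
  have "t \<in> qterm_rel B `` {t}"
    using qterm_cong.refl[OF assms(3)] by (simp add: qterm_rel_def)
  moreover have "qterm_eval Q g u = qterm_eval Q g t" if "u \<in> qterm_rel B `` {t}" for u
    using that qterm_eval_cong[OF assms(1,2), of t u] by (simp add: qterm_rel_def)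
  ultimately have "qterm_eval Q g ` (qterm_rel B `` {t}) = {qterm_eval Q g t}"
    by blast
  then show ?thesis by (simp add: free_quandle_lift_def)
qed

text \<open>Universal property: \<^const>\<open>free_quandle\<close> is left adjoint to the forgetful functor
  to sets.\<close>

theorem free_quandle_universal:
  assumes Q: "quandle Q" and g: "g \<in> B \<rightarrow> carrier Q"
  shows "free_quandle_lift Q g \<in> quandle_hom (free_quandle B) Q"
    and "b \<in> B \<Longrightarrow> free_quandle_lift Q g (free_quandle_unit B b) = g b"
    and "\<lbrakk>h \<in> quandle_hom (free_quandle B) Q; \<And>b. b \<in> B \<Longrightarrow> h (free_quandle_unit B b) = g b;
         C \<in> carrier (free_quandle B)\<rbrakk> \<Longrightarrow> h C = free_quandle_lift Q g C"
proof -
  interpret Q: quandle Q by fact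
  interpret L: quandle "free_quandle B" by (rule quandle_free_quandle)
  let ?c = "\<lambda>t. qterm_rel B `` {t}"
  note lift = free_quandle_lift_class[OF Q g]
  note cl = qterm_eval_closed[OF Q.rack_axioms g]
  have mem: "?c t \<in> carrier (free_quandle B)" if "t \<in> qterms B" for t
    using that unfolding carrier_free_quandle by blast
  show "free_quandle_lift Q g \<in> quandle_hom (free_quandle B) Q"
    unfolding quandle_hom_def
  proof (intro CollectI conjI ballI funcsetI)
    fix x assume "x \<in> carrier (free_quandle B)"
    then obtain s where s: "s \<in> qterms B" "x = ?c s" by (rule free_quandle_cases)
    show "free_quandle_lift Q g x \<in> carrier Q"
      unfolding s(2) lift[OF s(1)] by (rule cl[OF s(1)])
    fix y assume "y \<in> carrier (free_quandle B)"
    then obtain t where t: "t \<in> qterms B" "y = ?c t" by (rule free_quandle_cases)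
    have "QOp s t \<in> qterms B" using s(1) t(1) by simp
    then show "free_quandle_lift Q g (x \<rhd>\<^bsub>free_quandle B\<^esub> y)
        = free_quandle_lift Q g x \<rhd>\<^bsub>Q\<^esub> free_quandle_lift Q g y"
      unfolding s(2) t(2) free_quandle_lact[OF s(1) t(1)] lift[OF s(1)] lift[OF t(1)]
      by (simp only: lift qterm_eval.simps)
  qed
  show "free_quandle_lift Q g (free_quandle_unit B b) = g b" if "b \<in> B"
    using that unfolding free_quandle_unit_def by (subst lift) simp_all
  show "h C = free_quandle_lift Q g C"
    if h: "h \<in> quandle_hom (free_quandle B) Q"
      and hg: "\<And>b. b \<in> B \<Longrightarrow> h (free_quandle_unit B b) = g b"
      and C: "C \<in> carrier (free_quandle B)"
  proof -
    have "h (?c t) = qterm_eval Q g t" if "set_qterm t \<subseteq> B" for t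
      using that
    proof (induction t)
      case (QGen b)
      then show ?case using hg[of b] by (simp add: free_quandle_unit_def)
    next
      case (QOp s t)
      then have st: "s \<in> qterms B" "t \<in> qterms B"
        and IH: "h (?c s) = qterm_eval Q g s" "h (?c t) = qterm_eval Q g t" by simp_all
      show ?case
        unfolding qterm_eval.simps free_quandle_lact[OF st, symmetric]
          quandle_hom_lact[OF h mem[OF st(1)] mem[OF st(2)]] IH ..
    next
      case (QDiv s t)
      then have st: "s \<in> qterms B" "t \<in> qterms B" "QDiv s t \<in> qterms B"
        and IH: "h (?c s) = qterm_eval Q g s" "h (?c t) = qterm_eval Q g t" by simp_all
      have "?c (QOp s (QDiv s t)) = ?c t"
        using st qterm_cong.Op_Div[OF st(1,2)] by (subst qterm_class_eq) simp_all
      then have "?c s \<rhd>\<^bsub>free_quandle B\<^esub> ?c (QDiv s t) = ?c t"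
        unfolding free_quandle_lact[OF st(1,3)] .
      then have "ldiv (free_quandle B) (?c s) (?c t) = ?c (QDiv s t)"
        by (rule L.ldiv_unique[OF mem mem mem, OF st])
      then show ?case
        using quandle_hom_ldiv[OF L.rack_axioms Q.rack_axioms h mem[OF st(1)] mem[OF st(2)]]
        unfolding qterm_eval.simps IH by simp
    qed
    moreover obtain t where "t \<in> qterms B" "C = ?c t" using C by (rule free_quandle_cases)
    ultimately show ?thesis using lift by simp
  qed
qed


section \<open>Cohomology of cochain complexes\<close>

definition hom_group :: "('a, 'm) monoid_scheme \<Rightarrow> ('b, 'n) monoid_scheme \<Rightarrow> ('a \<Rightarrow> 'b) monoid" where
  "hom_group G A = \<lparr>carrier = hom G A \<inter> extensional (carrier G),
     monoid.mult = (\<lambda>f g. \<lambda>x\<in>carrier G. f x \<otimes>\<^bsub>A\<^esub> g x),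
     one = (\<lambda>x\<in>carrier G. \<one>\<^bsub>A\<^esub>)\<rparr>"

definition coboundaries :: "(nat \<Rightarrow> ('a, 'm) monoid_scheme) \<Rightarrow> (nat \<Rightarrow> 'a \<Rightarrow> 'a) \<Rightarrow> nat \<Rightarrow> 'a set" where
  "coboundaries C d n = (case n of 0 \<Rightarrow> {\<one>\<^bsub>C 0\<^esub>} | Suc m \<Rightarrow> d m ` carrier (C m))"

definition cohomology :: "(nat \<Rightarrow> ('a, 'm) monoid_scheme) \<Rightarrow> (nat \<Rightarrow> 'a \<Rightarrow> 'a) \<Rightarrow> nat \<Rightarrow> 'a set monoid" where
  "cohomology C d n = (C n)\<lparr>carrier := kernel (C n) (C (Suc n)) (d n)\<rparr> Mod coboundaries C d n"


section \<open>Quandle cohomology\<close>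

definition tuples :: "('a, 'm) magma_scheme \<Rightarrow> nat \<Rightarrow> 'a list set" where
  "tuples X n = {xs. length xs = n \<and> set xs \<subseteq> carrier X}"

definition CR :: "('a, 'm) magma_scheme \<Rightarrow> nat \<Rightarrow> ('a list \<Rightarrow>\<^sub>0 int) monoid" where
  "CR X n = free_Abelian_group (tuples X n)"

text \<open>The index \<open>j\<close> runs from \<open>1\<close> to the length of the tuple, so that \<open>x\<^sub>j\<close> is \<open>xs ! (j - 1)\<close>.\<close>

definition delta0 :: "nat \<Rightarrow> 'a list \<Rightarrow> 'a list" where
  "delta0 j xs = take (j - 1) xs @ drop j xs"

definition delta1 :: "('a, 'm) magma_scheme \<Rightarrow> nat \<Rightarrow> 'a list \<Rightarrow> 'a list" where
  "delta1 X j xs = take (j - 1) xs @ map (\<lambda>y. xs ! (j - 1) \<rhd>\<^bsub>X\<^esub> y) (drop j xs)"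

definition rack_boundary :: "('a, 'm) magma_scheme \<Rightarrow> nat \<Rightarrow> ('a list \<Rightarrow>\<^sub>0 int) \<Rightarrow> ('a list \<Rightarrow>\<^sub>0 int)" where
  "rack_boundary X n c =
     frag_extend (\<lambda>xs. \<Sum>j=1..n. frag_cmul ((-1) ^ j) (frag_of (delta0 j xs))) c
   - frag_extend (\<lambda>xs. \<Sum>j=1..n. frag_cmul ((-1) ^ j) (frag_of (delta1 X j xs))) c"

definition CD :: "('a, 'm) magma_scheme \<Rightarrow> nat \<Rightarrow> ('a list \<Rightarrow>\<^sub>0 int) set" where
  "CD X n = generate (CR X n)
     (frag_of ` {xs \<in> tuples X n. \<exists>i. Suc i < n \<and> xs ! i = xs ! Suc i})"

definition CQ :: "('a, 'm) magma_scheme \<Rightarrow> nat \<Rightarrow> ('a list \<Rightarrow>\<^sub>0 int) set monoid" where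
  "CQ X n = CR X n Mod CD X n"

text \<open>The map \<open>CQ\<^sub>n\<^sub>+\<^sub>1 \<rightarrow> CQ\<^sub>n\<close> induced by \<open>\<delta>\<close> on cosets.\<close>

definition quandle_boundary ::
  "('a, 'm) magma_scheme \<Rightarrow> nat \<Rightarrow> ('a list \<Rightarrow>\<^sub>0 int) set \<Rightarrow> ('a list \<Rightarrow>\<^sub>0 int) set" where
  "quandle_boundary X n C = (\<Union>c\<in>C. CD X n #>\<^bsub>CR X n\<^esub> rack_boundary X (Suc n) c)"

definition quandle_cochains ::
  "('x, 'm) magma_scheme \<Rightarrow> ('a, 'n) monoid_scheme \<Rightarrow> nat \<Rightarrow> (('x list \<Rightarrow>\<^sub>0 int) set \<Rightarrow> 'a) monoid" where
  "quandle_cochains X A n = hom_group (CQ X n) A"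

definition quandle_coboundary ::
  "('x, 'm) magma_scheme \<Rightarrow> nat \<Rightarrow> (('x list \<Rightarrow>\<^sub>0 int) set \<Rightarrow> 'a) \<Rightarrow> (('x list \<Rightarrow>\<^sub>0 int) set \<Rightarrow> 'a)" where
  "quandle_coboundary X n f = (\<lambda>C\<in>carrier (CQ X (Suc n)). f (quandle_boundary X n C))"

definition HQ ::
  "('x, 'm) magma_scheme \<Rightarrow> ('a, 'n) monoid_scheme \<Rightarrow> nat \<Rightarrow> (('x list \<Rightarrow>\<^sub>0 int) set \<Rightarrow> 'a) set monoid" where
  "HQ X A n = cohomology (quandle_cochains X A) (quandle_coboundary X) n"


section \<open>Beck modules\<close>

text \<open>An abelian group object in the slice category over \<open>X\<close> is an object \<open>proj: M \<rightarrow> X\<close> together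
  with a zero \<open>X \<rightarrow> M\<close> (\<open>X\<close> being terminal in the slice category), an addition
  \<open>M \<times>\<^sub>X M \<rightarrow> M\<close> and a negation \<open>M \<rightarrow> M\<close> which are morphisms over \<open>X\<close>. The values of \<open>badd\<close> outside
  of the fibre product are irrelevant.\<close>

record ('m, 'x) beck = "'m magma" +
  proj :: "'m \<Rightarrow> 'x"
  bzero :: "'x \<Rightarrow> 'm"
  badd :: "'m \<Rightarrow> 'm \<Rightarrow> 'm"
  bneg :: "'m \<Rightarrow> 'm"

definition fibre_product ::
  "('a, 'm) magma_scheme \<Rightarrow> ('a \<Rightarrow> 'x) \<Rightarrow> ('b, 'n) magma_scheme \<Rightarrow> ('b \<Rightarrow> 'x) \<Rightarrow> ('a \<times> 'b) magma" where
  "fibre_product M p N q = \<lparr>carrier = {(a, b). a \<in> carrier M \<and> b \<in> carrier N \<and> p a = q b},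
     lact = (\<lambda>(a, b) (a', b'). (a \<rhd>\<^bsub>M\<^esub> a', b \<rhd>\<^bsub>N\<^esub> b'))\<rparr>"

text \<open>Morphisms in the category of quandles over \<open>X\<close>.\<close>

definition slice_hom ::
  "('a, 'm) magma_scheme \<Rightarrow> ('a \<Rightarrow> 'x) \<Rightarrow> ('b, 'n) magma_scheme \<Rightarrow> ('b \<Rightarrow> 'x) \<Rightarrow> ('a \<Rightarrow> 'b) set" where
  "slice_hom Y p Z q = {f \<in> quandle_hom Y Z. \<forall>y\<in>carrier Y. q (f y) = p y}"

locale beck_module =
  fixes X :: "('x, 'n) magma_scheme" and M :: "('m, 'x, 'k) beck_scheme"
  assumes base_quandle: "quandle X"
    and total_quandle: "quandle M"
    and proj_hom: "proj M \<in> quandle_hom M X"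
    and zero_hom: "bzero M \<in> slice_hom X id M (proj M)"
    and add_hom: "(\<lambda>(a, b). badd M a b)
      \<in> slice_hom (fibre_product M (proj M) M (proj M)) (\<lambda>(a, b). proj M a) M (proj M)"
    and neg_hom: "bneg M \<in> slice_hom M (proj M) M (proj M)"
    and add_assoc: "\<lbrakk>a \<in> carrier M; b \<in> carrier M; c \<in> carrier M; proj M a = proj M b; proj M b = proj M c\<rbrakk>
      \<Longrightarrow> badd M (badd M a b) c = badd M a (badd M b c)"
    and add_comm: "\<lbrakk>a \<in> carrier M; b \<in> carrier M; proj M a = proj M b\<rbrakk> \<Longrightarrow> badd M a b = badd M b a"
    and add_zero: "a \<in> carrier M \<Longrightarrow> badd M (bzero M (proj M a)) a = a"
    and add_neg: "a \<in> carrier M \<Longrightarrow> badd M (bneg M a) a = bzero M (proj M a)"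

text \<open>As usual for group objects, compatibility with the addition implies compatibility with
  zero and negation.\<close>

definition beck_hom :: "('a, 'x, 'm) beck_scheme \<Rightarrow> ('b, 'x, 'n) beck_scheme \<Rightarrow> ('a \<Rightarrow> 'b) set" where
  "beck_hom N M = {h \<in> slice_hom N (proj N) M (proj M).
     \<forall>a\<in>carrier N. \<forall>b\<in>carrier N. proj N a = proj N b \<longrightarrow> h (badd N a b) = badd M (h a) (h b)}"

definition beck_hom_group ::
  "('a, 'x, 'm) beck_scheme \<Rightarrow> ('b, 'x, 'n) beck_scheme \<Rightarrow> ('a \<Rightarrow> 'b) monoid" where
  "beck_hom_group N M = \<lparr>carrier = beck_hom N M \<inter> extensional (carrier N),
     monoid.mult = (\<lambda>f g. \<lambda>a\<in>carrier N. badd M (f a) (g a)),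
     one = (\<lambda>a\<in>carrier N. bzero M (proj N a))\<rparr>"

subsection \<open>Trivial Beck modules\<close>

definition trivial_quandle :: "('a, 'm) monoid_scheme \<Rightarrow> 'a magma" where
  "trivial_quandle A = \<lparr>carrier = carrier A, lact = (\<lambda>a b. b)\<rparr>"

definition prod_quandle :: "('a, 'm) magma_scheme \<Rightarrow> ('b, 'n) magma_scheme \<Rightarrow> ('a \<times> 'b) magma" where
  "prod_quandle X Y = \<lparr>carrier = carrier X \<times> carrier Y,
     lact = (\<lambda>(x, y) (x', y'). (x \<rhd>\<^bsub>X\<^esub> x', y \<rhd>\<^bsub>Y\<^esub> y'))\<rparr>"

definition trivial_beck ::
  "('a, 'm) monoid_scheme \<Rightarrow> ('x, 'n) magma_scheme \<Rightarrow> ('a \<times> 'x, 'x) beck" where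
  "trivial_beck A X = magma.extend (prod_quandle (trivial_quandle A) X)
     \<lparr>proj = snd,
      bzero = (\<lambda>x. (\<one>\<^bsub>A\<^esub>, x)),
      badd = (\<lambda>(a, x) (b, y). (a \<otimes>\<^bsub>A\<^esub> b, x)),
      bneg = (\<lambda>(a, x). (inv\<^bsub>A\<^esub> a, x))\<rparr>"

lemma trivial_beck_simps [simp]:
  "carrier (trivial_beck A X) = carrier A \<times> carrier X"
  "lact (trivial_beck A X) = (\<lambda>(a, x) (b, y). (b, x \<rhd>\<^bsub>X\<^esub> y))"
  "proj (trivial_beck A X) = snd"
  "bzero (trivial_beck A X) = (\<lambda>x. (\<one>\<^bsub>A\<^esub>, x))"
  "badd (trivial_beck A X) = (\<lambda>(a, x) (b, y). (a \<otimes>\<^bsub>A\<^esub> b, x))"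
  "bneg (trivial_beck A X) = (\<lambda>(a, x). (inv\<^bsub>A\<^esub> a, x))"
  by (auto simp: trivial_beck_def prod_quandle_def trivial_quandle_def magma.defs fun_eq_iff)

lemma beck_module_trivial_beck:
  assumes "quandle X" "comm_group A"
  shows "beck_module X (trivial_beck A X)"
proof -
  interpret X: quandle X by fact
  interpret A: comm_group A by fact
  have bij: "bij_betw (\<lambda>q. p \<rhd>\<^bsub>trivial_beck A X\<^esub> q)
        (carrier (trivial_beck A X)) (carrier (trivial_beck A X))"
    if pc: "p \<in> carrier (trivial_beck A X)" for p
  proof -
    obtain a x where p: "p = (a, x)" "a \<in> carrier A" "x \<in> carrier X" using pc by auto
    have "bij_betw (map_prod id (\<lambda>y. x \<rhd>\<^bsub>X\<^esub> y)) (carrier A \<times> carrier X) (carrier A \<times> carrier X)"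
      using X.lact_bij[OF p(3)] by (auto simp: bij_betw_def map_prod_inj_on map_prod_surj_on)
    moreover have "map_prod id (\<lambda>y. x \<rhd>\<^bsub>X\<^esub> y) = (\<lambda>q. p \<rhd>\<^bsub>trivial_beck A X\<^esub> q)"
      using p by auto
    ultimately show ?thesis by simp
  qed
  have "quandle (trivial_beck A X)"
  proof
    show "p \<rhd>\<^bsub>trivial_beck A X\<^esub> (q \<rhd>\<^bsub>trivial_beck A X\<^esub> r)
        = (p \<rhd>\<^bsub>trivial_beck A X\<^esub> q) \<rhd>\<^bsub>trivial_beck A X\<^esub> (p \<rhd>\<^bsub>trivial_beck A X\<^esub> r)"
      if "p \<in> carrier (trivial_beck A X)" "q \<in> carrier (trivial_beck A X)"
        "r \<in> carrier (trivial_beck A X)" for p q r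
      using that X.lact_distrib[of "snd p" "snd q" "snd r"] by (auto split: prod.splits)
  qed (use bij X.lact_idem in auto)
  then show ?thesis
    using assms(1)
    by (intro beck_module.intro)
      (auto simp: slice_hom_def quandle_hom_def fibre_product_def A.m_ac A.l_inv)
qed

lemma (in beck_module) fibre_closed:
  "a \<in> carrier M \<Longrightarrow> proj M a \<in> carrier X"
  "x \<in> carrier X \<Longrightarrow> bzero M x \<in> carrier M \<and> proj M (bzero M x) = x"
  "a \<in> carrier M \<Longrightarrow> bneg M a \<in> carrier M \<and> proj M (bneg M a) = proj M a"
  "\<lbrakk>a \<in> carrier M; b \<in> carrier M; proj M a = proj M b\<rbrakk>
    \<Longrightarrow> badd M a b \<in> carrier M \<and> proj M (badd M a b) = proj M a"
  using proj_hom zero_hom add_hom neg_hom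
  by (auto simp: slice_hom_def quandle_hom_def fibre_product_def Pi_iff)

lemma (in beck_module) fibre_lact:
  "\<lbrakk>a \<in> carrier M; b \<in> carrier M\<rbrakk> \<Longrightarrow> proj M (a \<rhd>\<^bsub>M\<^esub> b) = proj M a \<rhd>\<^bsub>X\<^esub> proj M b"
  "\<lbrakk>x \<in> carrier X; y \<in> carrier X\<rbrakk> \<Longrightarrow> bzero M (x \<rhd>\<^bsub>X\<^esub> y) = bzero M x \<rhd>\<^bsub>M\<^esub> bzero M y"
  "\<lbrakk>a \<in> carrier M; b \<in> carrier M\<rbrakk> \<Longrightarrow> bneg M (a \<rhd>\<^bsub>M\<^esub> b) = bneg M a \<rhd>\<^bsub>M\<^esub> bneg M b"
  "\<lbrakk>a \<in> carrier M; b \<in> carrier M; c \<in> carrier M; d \<in> carrier M;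
    proj M a = proj M b; proj M c = proj M d\<rbrakk>
    \<Longrightarrow> badd M (a \<rhd>\<^bsub>M\<^esub> c) (b \<rhd>\<^bsub>M\<^esub> d) = badd M a b \<rhd>\<^bsub>M\<^esub> badd M c d"
  using proj_hom zero_hom add_hom neg_hom
  by (auto simp: slice_hom_def quandle_hom_def fibre_product_def)

lemma (in beck_module) add_neg_cancel:
  assumes "a \<in> carrier M" "b \<in> carrier M" "proj M a = proj M b"
  shows "badd M (bneg M b) (badd M a b) = a"
proof -
  have "badd M (bneg M b) (badd M a b) = badd M (bneg M b) (badd M b a)"
    by (simp only: add_comm[OF assms])
  also have "\<dots> = badd M (badd M (bneg M b) b) a"
    using fibre_closed(3)[OF assms(2)] assms by (intro add_assoc[symmetric]) auto
  also have "\<dots> = a"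
    unfolding add_neg[OF assms(2)] assms(3)[symmetric] by (rule add_zero[OF assms(1)])
  finally show ?thesis .
qed

lemma (in beck_module) add_cancel:
  assumes "a \<in> carrier M" "b \<in> carrier M" "proj M a = proj M b" "badd M a b = b"
  shows "a = bzero M (proj M a)"
  using add_neg_cancel[OF assms(1-3)]
  unfolding assms(3,4) add_neg[OF assms(2)] by metis

lemma (in beck_module) neg_unique:
  assumes "a \<in> carrier M" "b \<in> carrier M" "proj M a = proj M b" "badd M a b = bzero M (proj M b)"
  shows "a = bneg M b"
proof -
  note n = fibre_closed(3)[OF assms(2)] and z = fibre_closed(2)[OF fibre_closed(1)[OF assms(2)]]
  have "a = badd M (bneg M b) (bzero M (proj M b))"
    using add_neg_cancel[OF assms(1-3)] unfolding assms(4) by metis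
  also have "\<dots> = badd M (bzero M (proj M b)) (bneg M b)"
    using n z by (intro add_comm) auto
  also have "\<dots> = bneg M b"
    using add_zero[of "bneg M b"] conjunct1[OF n] unfolding conjunct2[OF n] by simp
  finally show ?thesis .
qed

lemma (in beck_module) add_add_swap:
  assumes "a \<in> carrier M" "b \<in> carrier M" "c \<in> carrier M" "d \<in> carrier M"
    and "proj M a = proj M b" "proj M b = proj M c" "proj M c = proj M d"
  shows "badd M (badd M a b) (badd M c d) = badd M (badd M a c) (badd M b d)"
proof -
  have "badd M (badd M a b) (badd M c d) = badd M a (badd M (badd M b c) d)"
    using assms fibre_closed(4)[of c d] by (subst (1 2) add_assoc) auto
  also have "badd M b c = badd M c b" using assms by (intro add_comm)
  also have "badd M a (badd M (badd M c b) d) = badd M (badd M a c) (badd M b d)"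
    using assms fibre_closed(4)[of b d] by (subst (1 2) add_assoc) auto
  finally show ?thesis .
qed

lemma beck_homD:
  assumes "h \<in> beck_hom N M"
  shows "h \<in> quandle_hom N M"
    and "a \<in> carrier N \<Longrightarrow> h a \<in> carrier M \<and> proj M (h a) = proj N a"
    and "\<lbrakk>a \<in> carrier N; b \<in> carrier N\<rbrakk> \<Longrightarrow> h (a \<rhd>\<^bsub>N\<^esub> b) = h a \<rhd>\<^bsub>M\<^esub> h b"
    and "\<lbrakk>a \<in> carrier N; b \<in> carrier N; proj N a = proj N b\<rbrakk> \<Longrightarrow> h (badd N a b) = badd M (h a) (h b)"
  using assms by (auto simp: beck_hom_def slice_hom_def quandle_hom_def)

lemma beck_hom_zero:
  assumes "beck_module X N" "beck_module X M" "h \<in> beck_hom N M" "x \<in> carrier X"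
  shows "h (bzero N x) = bzero M x"
proof -
  interpret N: beck_module X N by fact
  interpret M: beck_module X M by fact
  note z = N.fibre_closed(2)[OF assms(4)]
  note hz = beck_homD(2)[OF assms(3) conjunct1[OF z]]
  have "badd N (bzero N x) (bzero N x) = bzero N x"
    using N.add_zero[of "bzero N x"] z by simp
  then have "badd M (h (bzero N x)) (h (bzero N x)) = h (bzero N x)"
    using beck_homD(4)[OF assms(3), of "bzero N x" "bzero N x"] z by simp
  with M.add_cancel[of "h (bzero N x)" "h (bzero N x)"] hz z show ?thesis by simp
qed

lemma beck_hom_neg:
  assumes "beck_module X N" "beck_module X M" "h \<in> beck_hom N M" "a \<in> carrier N"
  shows "h (bneg N a) = bneg M (h a)"
proof -
  interpret N: beck_module X N by fact
  interpret M: beck_module X M by fact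
  note n = N.fibre_closed(3)[OF assms(4)]
  note ha = beck_homD(2)[OF assms(3,4)]
  have "badd M (h (bneg N a)) (h a) = h (bzero N (proj N a))"
    using beck_homD(4)[OF assms(3), of "bneg N a" a] n assms(4) N.add_neg[of a] by simp
  also have "\<dots> = bzero M (proj M (h a))"
    using beck_hom_zero[OF assms(1-3) N.fibre_closed(1)[OF assms(4)]] ha by simp
  finally show ?thesis
    using M.neg_unique[of "h (bneg N a)" "h a"] ha n beck_homD(2)[OF assms(3), of "bneg N a"] by simp
qed

lemma comm_group_beck_hom_group:
  assumes "beck_module X N" "beck_module X M"
  shows "comm_group (beck_hom_group N M)"
proof -
  interpret N: beck_module X N by fact
  interpret M: beck_module X M by fact
  interpret NQ: quandle N by (rule N.total_quandle)
  interpret MQ: quandle M by (rule M.total_quandle)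
  let ?H = "beck_hom_group N M"
  have mem: "restrict f (carrier N) \<in> carrier ?H"
    if "\<And>a. a \<in> carrier N \<Longrightarrow> f a \<in> carrier M \<and> proj M (f a) = proj N a"
      and "\<And>a b. \<lbrakk>a \<in> carrier N; b \<in> carrier N\<rbrakk> \<Longrightarrow> f (a \<rhd>\<^bsub>N\<^esub> b) = f a \<rhd>\<^bsub>M\<^esub> f b"
      and "\<And>a b. \<lbrakk>a \<in> carrier N; b \<in> carrier N; proj N a = proj N b\<rbrakk> \<Longrightarrow> f (badd N a b) = badd M (f a) (f b)"
    for f
    using that N.fibre_closed(4)
    by (simp add: beck_hom_group_def beck_hom_def slice_hom_def quandle_hom_def Pi_iff)
  have D: "f \<in> beck_hom N M" "f \<in> extensional (carrier N)" if "f \<in> carrier ?H" for f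
    using that by (simp_all add: beck_hom_group_def)
  note D2 = beck_homD(2)[OF D(1)]
  have [simp]: "(f \<otimes>\<^bsub>?H\<^esub> g) a = badd M (f a) (g a)" "\<one>\<^bsub>?H\<^esub> a = bzero M (proj N a)"
    if "a \<in> carrier N" for f g a using that by (simp_all add: beck_hom_group_def)
  have ext: "f = g" if "f \<in> extensional (carrier N)" "g \<in> extensional (carrier N)"
    "\<And>a. a \<in> carrier N \<Longrightarrow> f a = g a" for f g :: "'c \<Rightarrow> 'e"
    using that by (rule extensionalityI)
  have mult_ext: "f \<otimes>\<^bsub>?H\<^esub> g \<in> extensional (carrier N)" for f g
    by (simp add: beck_hom_group_def)
  have closed: "f \<otimes>\<^bsub>?H\<^esub> g \<in> carrier ?H" if f: "f \<in> carrier ?H" and g: "g \<in> carrier ?H" for f g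
  proof -
    have "(\<lambda>a\<in>carrier N. badd M (f a) (g a)) \<in> carrier ?H"
    proof (rule mem)
      fix a assume a: "a \<in> carrier N"
      show "badd M (f a) (g a) \<in> carrier M \<and> proj M (badd M (f a) (g a)) = proj N a"
        using M.fibre_closed(4)[of "f a" "g a"] D2[OF f a] D2[OF g a] by simp
      fix b assume b: "b \<in> carrier N"
      note fg = D2[OF f a] D2[OF g a] D2[OF f b] D2[OF g b]
      show "badd M (f (a \<rhd>\<^bsub>N\<^esub> b)) (g (a \<rhd>\<^bsub>N\<^esub> b)) = badd M (f a) (g a) \<rhd>\<^bsub>M\<^esub> badd M (f b) (g b)"
        using M.fibre_lact(4)[of "f a" "g a" "f b" "g b"] fg
          beck_homD(3)[OF D(1)[OF f] a b] beck_homD(3)[OF D(1)[OF g] a b] by simp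
      assume ab: "proj N a = proj N b"
      show "badd M (f (badd N a b)) (g (badd N a b)) = badd M (badd M (f a) (g a)) (badd M (f b) (g b))"
        using M.add_add_swap[of "f a" "f b" "g a" "g b"] fg ab
          beck_homD(4)[OF D(1)[OF f] a b ab] beck_homD(4)[OF D(1)[OF g] a b ab] by simp
    qed
    then show ?thesis by (simp add: beck_hom_group_def)
  qed
  have one: "\<one>\<^bsub>?H\<^esub> \<in> carrier ?H"
  proof -
    have "(\<lambda>a\<in>carrier N. bzero M (proj N a)) \<in> carrier ?H"
    proof (rule mem)
      fix a assume a: "a \<in> carrier N"
      note x = N.fibre_closed(1)[OF a]
      show "bzero M (proj N a) \<in> carrier M \<and> proj M (bzero M (proj N a)) = proj N a"
        by (rule M.fibre_closed(2)[OF x])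
      fix b assume b: "b \<in> carrier N"
      show "bzero M (proj N (a \<rhd>\<^bsub>N\<^esub> b)) = bzero M (proj N a) \<rhd>\<^bsub>M\<^esub> bzero M (proj N b)"
        using N.fibre_lact(1)[OF a b] M.fibre_lact(2)[OF x N.fibre_closed(1)[OF b]] by simp
      assume ab: "proj N a = proj N b"
      show "bzero M (proj N (badd N a b)) = badd M (bzero M (proj N a)) (bzero M (proj N b))"
        using N.fibre_closed(4)[OF a b ab] M.add_zero[of "bzero M (proj N a)"]
          M.fibre_closed(2)[OF x] ab by simp
    qed
    then show ?thesis by (simp add: beck_hom_group_def)
  qed
  show ?thesis
  proof (rule comm_groupI)
    show "f \<otimes>\<^bsub>?H\<^esub> g \<in> carrier ?H" if "f \<in> carrier ?H" "g \<in> carrier ?H" for f g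
      using that by (rule closed)
    show "\<one>\<^bsub>?H\<^esub> \<in> carrier ?H" by (rule one)
    show "f \<otimes>\<^bsub>?H\<^esub> g \<otimes>\<^bsub>?H\<^esub> k = f \<otimes>\<^bsub>?H\<^esub> (g \<otimes>\<^bsub>?H\<^esub> k)"
      if "f \<in> carrier ?H" "g \<in> carrier ?H" "k \<in> carrier ?H" for f g k
    proof (rule ext[OF mult_ext mult_ext])
      fix a assume a: "a \<in> carrier N"
      show "(f \<otimes>\<^bsub>?H\<^esub> g \<otimes>\<^bsub>?H\<^esub> k) a = (f \<otimes>\<^bsub>?H\<^esub> (g \<otimes>\<^bsub>?H\<^esub> k)) a"
        using M.add_assoc[of "f a" "g a" "k a"] D2[OF that(1) a] D2[OF that(2) a] D2[OF that(3) a] a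
        by simp
    qed
    show "f \<otimes>\<^bsub>?H\<^esub> g = g \<otimes>\<^bsub>?H\<^esub> f" if "f \<in> carrier ?H" "g \<in> carrier ?H" for f g
    proof (rule ext[OF mult_ext mult_ext])
      fix a assume a: "a \<in> carrier N"
      show "(f \<otimes>\<^bsub>?H\<^esub> g) a = (g \<otimes>\<^bsub>?H\<^esub> f) a"
        using M.add_comm[of "f a" "g a"] D2[OF that(1) a] D2[OF that(2) a] a by simp
    qed
    show "\<one>\<^bsub>?H\<^esub> \<otimes>\<^bsub>?H\<^esub> f = f" if "f \<in> carrier ?H" for f
    proof (rule ext[OF mult_ext D(2)[OF that]])
      fix a assume a: "a \<in> carrier N"
      show "(\<one>\<^bsub>?H\<^esub> \<otimes>\<^bsub>?H\<^esub> f) a = f a"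
        using M.add_zero[of "f a"] D2[OF that a] a by simp
    qed
    show "\<exists>g\<in>carrier ?H. g \<otimes>\<^bsub>?H\<^esub> f = \<one>\<^bsub>?H\<^esub>" if f: "f \<in> carrier ?H" for f
    proof
      show "(\<lambda>a\<in>carrier N. bneg M (f a)) \<in> carrier ?H"
      proof (rule mem)
        fix a assume a: "a \<in> carrier N"
        note n = M.fibre_closed(3)[OF conjunct1[OF D2[OF f a]]]
        show "bneg M (f a) \<in> carrier M \<and> proj M (bneg M (f a)) = proj N a"
          using n D2[OF f a] by simp
        fix b assume b: "b \<in> carrier N"
        note n' = M.fibre_closed(3)[OF conjunct1[OF D2[OF f b]]]
        show "bneg M (f (a \<rhd>\<^bsub>N\<^esub> b)) = bneg M (f a) \<rhd>\<^bsub>M\<^esub> bneg M (f b)"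
          using beck_homD(3)[OF D(1)[OF f] a b] M.fibre_lact(3)[of "f a" "f b"] D2[OF f a] D2[OF f b]
          by simp
        assume ab: "proj N a = proj N b"
        let ?u = "f a" and ?v = "f b" and ?u' = "bneg M (f a)" and ?v' = "bneg M (f b)"
        note uv = n n' D2[OF f a] D2[OF f b] ab
        note cl = M.fibre_closed(4)[of ?u ?v] M.fibre_closed(4)[of ?u' ?v'] M.fibre_closed(4)[of ?v' ?v]
        have "badd M (badd M ?u' ?v') (badd M ?u ?v) = bzero M (proj M (badd M ?u ?v))"
          using M.add_add_swap[of ?u' ?v' ?u ?v] M.add_neg[of ?u] M.add_neg[of ?v]
            M.add_zero[of "bzero M (proj N b)"] M.fibre_closed(2)[OF N.fibre_closed(1)[OF b]]
            uv cl by simp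
        then have "badd M ?u' ?v' = bneg M (badd M ?u ?v)"
          using M.neg_unique[of "badd M ?u' ?v'" "badd M ?u ?v"] uv cl by simp
        then show "bneg M (f (badd N a b)) = badd M ?u' ?v'"
          using beck_homD(4)[OF D(1)[OF f] a b ab] by simp
      qed
      show "(\<lambda>a\<in>carrier N. bneg M (f a)) \<otimes>\<^bsub>?H\<^esub> f = \<one>\<^bsub>?H\<^esub>"
      proof (rule ext[OF mult_ext])
        show "\<one>\<^bsub>?H\<^esub> \<in> extensional (carrier N)" by (simp add: beck_hom_group_def)
        fix a assume a: "a \<in> carrier N"
        show "((\<lambda>a\<in>carrier N. bneg M (f a)) \<otimes>\<^bsub>?H\<^esub> f) a = \<one>\<^bsub>?H\<^esub> a"
          using M.add_neg[of "f a"] D2[OF f a] a by simp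
      qed
    qed
  qed
qed

subsection \<open>The free Beck module on a quandle over \<open>X\<close>\<close>

text \<open>For a quandle \<open>p: Y \<rightarrow> X\<close> over \<open>X\<close>, the Beck module \<open>\<Omega>\<^sub>X(Y)\<close> consists of the well-formed terms
  built from the elements of \<open>Y\<close> by means of the quandle operations and the fibrewise group
  operations, modulo the congruence generated by the axioms for Beck modules and by the
  requirement that the inclusion of the generators is a morphism of quandles.\<close>

datatype ('y, 'x) beck_term =
    BGen 'y
  | BZero 'x
  | BAdd "('y, 'x) beck_term" "('y, 'x) beck_term"
  | BNeg "('y, 'x) beck_term"
  | BOp "('y, 'x) beck_term" "('y, 'x) beck_term"
  | BDiv "('y, 'x) beck_term" "('y, 'x) beck_term"

primrec beck_base :: "('x, 'm) magma_scheme \<Rightarrow> ('y \<Rightarrow> 'x) \<Rightarrow> ('y, 'x) beck_term \<Rightarrow> 'x" where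
  "beck_base X p (BGen y) = p y"
| "beck_base X p (BZero x) = x"
| "beck_base X p (BAdd s t) = beck_base X p s"
| "beck_base X p (BNeg t) = beck_base X p t"
| "beck_base X p (BOp s t) = beck_base X p s \<rhd>\<^bsub>X\<^esub> beck_base X p t"
| "beck_base X p (BDiv s t) = ldiv X (beck_base X p s) (beck_base X p t)"

primrec beck_wf :: "('x, 'm) magma_scheme \<Rightarrow> ('y, 'n) magma_scheme \<Rightarrow> ('y \<Rightarrow> 'x) \<Rightarrow> ('y, 'x) beck_term \<Rightarrow> bool" where
  "beck_wf X Y p (BGen y) \<longleftrightarrow> y \<in> carrier Y"
| "beck_wf X Y p (BZero x) \<longleftrightarrow> x \<in> carrier X"
| "beck_wf X Y p (BAdd s t) \<longleftrightarrow> beck_wf X Y p s \<and> beck_wf X Y p t \<and> beck_base X p s = beck_base X p t"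
| "beck_wf X Y p (BNeg t) \<longleftrightarrow> beck_wf X Y p t"
| "beck_wf X Y p (BOp s t) \<longleftrightarrow> beck_wf X Y p s \<and> beck_wf X Y p t"
| "beck_wf X Y p (BDiv s t) \<longleftrightarrow> beck_wf X Y p s \<and> beck_wf X Y p t"

inductive beck_cong :: "('x, 'm) magma_scheme \<Rightarrow> ('y, 'n) magma_scheme \<Rightarrow> ('y \<Rightarrow> 'x) \<Rightarrow>
    ('y, 'x) beck_term \<Rightarrow> ('y, 'x) beck_term \<Rightarrow> bool" for X Y p where
  refl: "beck_wf X Y p t \<Longrightarrow> beck_cong X Y p t t"
| sym: "beck_cong X Y p s t \<Longrightarrow> beck_cong X Y p t s"
| trans: "beck_cong X Y p s t \<Longrightarrow> beck_cong X Y p t u \<Longrightarrow> beck_cong X Y p s u"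
| Add_cong: "\<lbrakk>beck_cong X Y p s s'; beck_cong X Y p t t'; beck_base X p s = beck_base X p t\<rbrakk>
    \<Longrightarrow> beck_cong X Y p (BAdd s t) (BAdd s' t')"
| Neg_cong: "beck_cong X Y p t t' \<Longrightarrow> beck_cong X Y p (BNeg t) (BNeg t')"
| Op_cong: "\<lbrakk>beck_cong X Y p s s'; beck_cong X Y p t t'\<rbrakk> \<Longrightarrow> beck_cong X Y p (BOp s t) (BOp s' t')"
| Div_cong: "\<lbrakk>beck_cong X Y p s s'; beck_cong X Y p t t'\<rbrakk> \<Longrightarrow> beck_cong X Y p (BDiv s t) (BDiv s' t')"
| gen_hom: "\<lbrakk>y \<in> carrier Y; y' \<in> carrier Y\<rbrakk>
    \<Longrightarrow> beck_cong X Y p (BGen (y \<rhd>\<^bsub>Y\<^esub> y')) (BOp (BGen y) (BGen y'))"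
| distrib: "\<lbrakk>beck_wf X Y p s; beck_wf X Y p t; beck_wf X Y p u\<rbrakk>
    \<Longrightarrow> beck_cong X Y p (BOp s (BOp t u)) (BOp (BOp s t) (BOp s u))"
| idem: "beck_wf X Y p t \<Longrightarrow> beck_cong X Y p (BOp t t) t"
| Op_Div: "\<lbrakk>beck_wf X Y p s; beck_wf X Y p t\<rbrakk> \<Longrightarrow> beck_cong X Y p (BOp s (BDiv s t)) t"
| Div_Op: "\<lbrakk>beck_wf X Y p s; beck_wf X Y p t\<rbrakk> \<Longrightarrow> beck_cong X Y p (BDiv s (BOp s t)) t"
| zero_hom: "\<lbrakk>x \<in> carrier X; x' \<in> carrier X\<rbrakk>
    \<Longrightarrow> beck_cong X Y p (BZero (x \<rhd>\<^bsub>X\<^esub> x')) (BOp (BZero x) (BZero x'))"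
| neg_hom: "\<lbrakk>beck_wf X Y p s; beck_wf X Y p t\<rbrakk>
    \<Longrightarrow> beck_cong X Y p (BNeg (BOp s t)) (BOp (BNeg s) (BNeg t))"
| add_hom: "\<lbrakk>beck_wf X Y p (BAdd s t); beck_wf X Y p (BAdd s' t')\<rbrakk>
    \<Longrightarrow> beck_cong X Y p (BAdd (BOp s s') (BOp t t')) (BOp (BAdd s t) (BAdd s' t'))"
| add_assoc: "beck_wf X Y p (BAdd (BAdd s t) u) \<Longrightarrow> beck_wf X Y p (BAdd s (BAdd t u))
    \<Longrightarrow> beck_cong X Y p (BAdd (BAdd s t) u) (BAdd s (BAdd t u))"
| add_comm: "beck_wf X Y p (BAdd s t) \<Longrightarrow> beck_cong X Y p (BAdd s t) (BAdd t s)"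
| add_zero: "beck_wf X Y p t \<Longrightarrow> beck_cong X Y p (BAdd (BZero (beck_base X p t)) t) t"
| add_neg: "beck_wf X Y p t \<Longrightarrow> beck_cong X Y p (BAdd (BNeg t) t) (BZero (beck_base X p t))"

definition beck_rel :: "('x, 'm) magma_scheme \<Rightarrow> ('y, 'n) magma_scheme \<Rightarrow> ('y \<Rightarrow> 'x) \<Rightarrow>
    (('y, 'x) beck_term \<times> ('y, 'x) beck_term) set" where
  "beck_rel X Y p = {(s, t). beck_cong X Y p s t}"

definition Omega :: "('x, 'm) magma_scheme \<Rightarrow> ('y, 'n) magma_scheme \<Rightarrow> ('y \<Rightarrow> 'x) \<Rightarrow>
    (('y, 'x) beck_term set, 'x) beck" where
  "Omega X Y p = \<lparr>carrier = {t. beck_wf X Y p t} // beck_rel X Y p,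
     lact = (\<lambda>C D. \<Union>s\<in>C. \<Union>t\<in>D. beck_rel X Y p `` {BOp s t}),
     proj = (\<lambda>C. the_elem (beck_base X p ` C)),
     bzero = (\<lambda>x. beck_rel X Y p `` {BZero x}),
     badd = (\<lambda>C D. \<Union>s\<in>C. \<Union>t\<in>D. beck_rel X Y p `` {BAdd s t}),
     bneg = (\<lambda>C. \<Union>t\<in>C. beck_rel X Y p `` {BNeg t})\<rparr>"

definition Omega_unit :: "('x, 'm) magma_scheme \<Rightarrow> ('y, 'n) magma_scheme \<Rightarrow> ('y \<Rightarrow> 'x) \<Rightarrow>
    'y \<Rightarrow> ('y, 'x) beck_term set" where
  "Omega_unit X Y p y = beck_rel X Y p `` {BGen y}"

primrec beck_eval :: "('m, 'x, 'k) beck_scheme \<Rightarrow> ('y \<Rightarrow> 'm) \<Rightarrow> ('y, 'x) beck_term \<Rightarrow> 'm" where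
  "beck_eval N g (BGen y) = g y"
| "beck_eval N g (BZero x) = bzero N x"
| "beck_eval N g (BAdd s t) = badd N (beck_eval N g s) (beck_eval N g t)"
| "beck_eval N g (BNeg t) = bneg N (beck_eval N g t)"
| "beck_eval N g (BOp s t) = beck_eval N g s \<rhd>\<^bsub>N\<^esub> beck_eval N g t"
| "beck_eval N g (BDiv s t) = ldiv N (beck_eval N g s) (beck_eval N g t)"

definition Omega_lift :: "('m, 'x, 'k) beck_scheme \<Rightarrow> ('y \<Rightarrow> 'm) \<Rightarrow> ('y, 'x) beck_term set \<Rightarrow> 'm" where
  "Omega_lift N g C = the_elem (beck_eval N g ` C)"

text \<open>The effect of \<open>\<Omega>\<^sub>X\<close> on a morphism \<open>f\<close> over \<open>X\<close> with codomain \<open>q: Z \<rightarrow> X\<close>.\<close>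

definition Omega_map :: "('x, 'm) magma_scheme \<Rightarrow> ('z, 'n) magma_scheme \<Rightarrow> ('z \<Rightarrow> 'x) \<Rightarrow>
    ('y \<Rightarrow> 'z) \<Rightarrow> ('y, 'x) beck_term set \<Rightarrow> ('z, 'x) beck_term set" where
  "Omega_map X Z q f = Omega_lift (Omega X Z q) (\<lambda>y. Omega_unit X Z q (f y))"

locale quandle_over = base: quandle X + total: quandle Y
  for X :: "('x, 'm) magma_scheme" and Y :: "('y, 'n) magma_scheme" +
  fixes p :: "'y \<Rightarrow> 'x"
  assumes structure_hom: "p \<in> quandle_hom Y X"
begin

abbreviation wf_term where "wf_term \<equiv> beck_wf X Y p"
abbreviation base_of where "base_of \<equiv> beck_base X p"
abbreviation cong_term (infix "\<simeq>" 50) where "cong_term \<equiv> beck_cong X Y p"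
abbreviation cls where "cls t \<equiv> beck_rel X Y p `` {t}"

lemma base_of_closed: "wf_term t \<Longrightarrow> base_of t \<in> carrier X"
  by (induction t) (simp_all add: quandle_hom_closed[OF structure_hom])

lemma cong_wf_base: "s \<simeq> t \<Longrightarrow> wf_term s \<and> wf_term t \<and> base_of s = base_of t"
proof (induction rule: beck_cong.induct)
  case (gen_hom y y')
  then show ?case by (simp add: quandle_hom_lact[OF structure_hom])
next
  case (distrib s t u)
  moreover have "base_of s \<rhd>\<^bsub>X\<^esub> (base_of t \<rhd>\<^bsub>X\<^esub> base_of u)
      = (base_of s \<rhd>\<^bsub>X\<^esub> base_of t) \<rhd>\<^bsub>X\<^esub> (base_of s \<rhd>\<^bsub>X\<^esub> base_of u)"
    using distrib by (intro base.lact_distrib base_of_closed)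
  ultimately show ?case by (simp only: beck_wf.simps beck_base.simps simp_thms)
qed (simp_all add: base_of_closed base.lact_idem)

lemma equiv_beck_rel: "equiv {t. wf_term t} (beck_rel X Y p)"
proof (rule equivI)
  show "beck_rel X Y p \<subseteq> {t. wf_term t} \<times> {t. wf_term t}"
    using conjunct1[OF cong_wf_base] conjunct1[OF conjunct2[OF cong_wf_base]]
    by (auto simp: beck_rel_def)
  show "refl_on {t. wf_term t} (beck_rel X Y p)"
    by (auto simp: refl_on_def beck_rel_def intro: beck_cong.refl)
  show "sym (beck_rel X Y p)"
    unfolding sym_def beck_rel_def using beck_cong.sym by fastforce
  show "trans (beck_rel X Y p)"
    unfolding trans_def beck_rel_def using beck_cong.trans by fastforce
qed

lemma cls_eqI: "s \<simeq> t \<Longrightarrow> cls s = cls t"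
  by (rule equiv_class_eq[OF equiv_beck_rel]) (simp add: beck_rel_def)

lemma in_cls: "u \<in> cls t \<longleftrightarrow> t \<simeq> u"
  by (simp add: beck_rel_def)

lemma cls_self: "wf_term t \<Longrightarrow> t \<in> cls t"
  unfolding in_cls by (rule beck_cong.refl)

lemma cls_mem: "wf_term t \<Longrightarrow> cls t \<in> carrier (Omega X Y p)"
  by (simp add: Omega_def quotientI)

lemma Omega_cases:
  assumes "C \<in> carrier (Omega X Y p)"
  obtains t where "wf_term t" "C = cls t"
proof -
  have "C \<in> {t. wf_term t} // beck_rel X Y p" using assms by (simp add: Omega_def)
  then show ?thesis using that by (elim quotientE) simp
qed

lemma UN_cls:
  assumes "wf_term t" "\<And>u. t \<simeq> u \<Longrightarrow> F u = F t"
  shows "(\<Union>u\<in>cls t. F u) = F t"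
proof -
  have "(\<Union>u\<in>cls t. F u) = (\<Union>u\<in>cls t. F t)"
    by (rule SUP_cong[OF HOL.refl]) (simp only: in_cls assms(2))
  then show ?thesis using cls_self[OF assms(1)] by auto
qed

lemma Omega_zero: "bzero (Omega X Y p) x = cls (BZero x)"
  by (simp add: Omega_def)

lemma Omega_proj:
  assumes "wf_term t"
  shows "proj (Omega X Y p) (cls t) = base_of t"
proof -
  have "base_of ` cls t = {base_of t}"
  proof
    show "base_of ` cls t \<subseteq> {base_of t}"
    proof (rule image_subsetI)
      fix u assume "u \<in> cls t"
      then have "base_of t = base_of u" unfolding in_cls using cong_wf_base[of t u] by simp
      then show "base_of u \<in> {base_of t}" by simp
    qed
    show "{base_of t} \<subseteq> base_of ` cls t" using cls_self[OF assms] by simp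
  qed
  then show ?thesis by (simp add: Omega_def)
qed

lemma Omega_neg:
  assumes "wf_term t"
  shows "bneg (Omega X Y p) (cls t) = cls (BNeg t)"
proof -
  have "(\<Union>u\<in>cls t. cls (BNeg u)) = cls (BNeg t)"
    by (rule UN_cls[OF assms]) (rule cls_eqI[OF beck_cong.sym[OF beck_cong.Neg_cong]])
  then show ?thesis by (simp add: Omega_def)
qed

lemma Omega_lact:
  assumes "wf_term s" "wf_term t"
  shows "cls s \<rhd>\<^bsub>Omega X Y p\<^esub> cls t = cls (BOp s t)"
proof -
  have "(\<Union>u\<in>cls s. \<Union>v\<in>cls t. cls (BOp u v)) = (\<Union>v\<in>cls t. cls (BOp s v))"
  proof (rule UN_cls[OF assms(1)])
    fix u assume u: "s \<simeq> u"
    have "cls (BOp u v) = cls (BOp s v)" if "v \<in> cls t" for v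
    proof -
      have "wf_term v" using that cong_wf_base[of t v] unfolding in_cls by simp
      from cls_eqI[OF beck_cong.Op_cong[OF beck_cong.sym[OF u] beck_cong.refl[OF this]]]
      show ?thesis .
    qed
    then show "(\<Union>v\<in>cls t. cls (BOp u v)) = (\<Union>v\<in>cls t. cls (BOp s v))"
      by (rule SUP_cong[OF HOL.refl])
  qed
  also have "\<dots> = cls (BOp s t)"
  proof (rule UN_cls[OF assms(2)])
    fix u assume "t \<simeq> u"
    from cls_eqI[OF beck_cong.Op_cong[OF beck_cong.refl[OF assms(1)] beck_cong.sym[OF this]]]
    show "cls (BOp s u) = cls (BOp s t)" .
  qed
  finally show ?thesis by (simp add: Omega_def)
qed

lemma Omega_add:
  assumes "wf_term s" "wf_term t" "base_of s = base_of t"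
  shows "badd (Omega X Y p) (cls s) (cls t) = cls (BAdd s t)"
proof -
  have "(\<Union>u\<in>cls s. \<Union>v\<in>cls t. cls (BAdd u v)) = (\<Union>v\<in>cls t. cls (BAdd s v))"
  proof (rule UN_cls[OF assms(1)])
    fix u assume u: "s \<simeq> u"
    have "cls (BAdd u v) = cls (BAdd s v)" if "v \<in> cls t" for v
    proof -
      have v: "t \<simeq> v" using that unfolding in_cls .
      have "base_of u = base_of v" using cong_wf_base[OF u] cong_wf_base[OF v] assms(3) by metis
      moreover have "wf_term v" using cong_wf_base[OF v] by simp
      ultimately show ?thesis
        using cls_eqI[OF beck_cong.Add_cong[OF beck_cong.sym[OF u] beck_cong.refl]] by simp
    qed
    then show "(\<Union>v\<in>cls t. cls (BAdd u v)) = (\<Union>v\<in>cls t. cls (BAdd s v))"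
      by (rule SUP_cong[OF HOL.refl])
  qed
  also have "\<dots> = cls (BAdd s t)"
  proof (rule UN_cls[OF assms(2)])
    fix u assume "t \<simeq> u"
    from cls_eqI[OF beck_cong.Add_cong[OF beck_cong.refl[OF assms(1)] this assms(3)]]
    show "cls (BAdd s u) = cls (BAdd s t)" by (rule HOL.sym)
  qed
  finally show ?thesis by (simp add: Omega_def)
qed

lemma quandle_Omega: "quandle (Omega X Y p)"
proof
  let ?O = "Omega X Y p"
  show "bij_betw (\<lambda>y. x \<rhd>\<^bsub>?O\<^esub> y) (carrier ?O) (carrier ?O)" if x: "x \<in> carrier ?O" for x
  proof -
    obtain s where s: "wf_term s" "x = cls s" using x by (rule Omega_cases)
    have D: "(\<Union>t\<in>cls t. cls (BDiv s t)) = cls (BDiv s t)" if "wf_term t" for t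
    proof (rule UN_cls[OF that])
      fix u assume "t \<simeq> u"
      from cls_eqI[OF beck_cong.Div_cong[OF beck_cong.refl[OF s(1)] beck_cong.sym[OF this]]]
      show "cls (BDiv s u) = cls (BDiv s t)" .
    qed
    have S: "wf_term (BDiv s t)" "wf_term (BOp s t)" if "wf_term t" for t
      using s(1) that by simp_all
    have A: "x \<rhd>\<^bsub>?O\<^esub> cls t = cls (BOp s t)" if "wf_term t" for t
      unfolding s(2) by (rule Omega_lact[OF s(1) that])
    show ?thesis
    proof (rule bij_betw_byWitness[where f' = "\<lambda>y. \<Union>t\<in>y. cls (BDiv s t)"])
      show "\<forall>y\<in>carrier ?O. (\<Union>t\<in>x \<rhd>\<^bsub>?O\<^esub> y. cls (BDiv s t)) = y"
      proof
        fix y assume "y \<in> carrier ?O"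
        then obtain t where t: "wf_term t" "y = cls t" by (rule Omega_cases)
        show "(\<Union>t\<in>x \<rhd>\<^bsub>?O\<^esub> y. cls (BDiv s t)) = y"
          unfolding t(2) A[OF t(1)] D[OF S(2)[OF t(1)]]
          by (rule cls_eqI[OF beck_cong.Div_Op[OF s(1) t(1)]])
      qed
      show "\<forall>y\<in>carrier ?O. x \<rhd>\<^bsub>?O\<^esub> (\<Union>t\<in>y. cls (BDiv s t)) = y"
      proof
        fix y assume "y \<in> carrier ?O"
        then obtain t where t: "wf_term t" "y = cls t" by (rule Omega_cases)
        show "x \<rhd>\<^bsub>?O\<^esub> (\<Union>t\<in>y. cls (BDiv s t)) = y"
          unfolding t(2) D[OF t(1)] A[OF S(1)[OF t(1)]]
          by (rule cls_eqI[OF beck_cong.Op_Div[OF s(1) t(1)]])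
      qed
      show "(\<lambda>y. x \<rhd>\<^bsub>?O\<^esub> y) ` carrier ?O \<subseteq> carrier ?O"
      proof (rule image_subsetI)
        fix y assume "y \<in> carrier ?O"
        then obtain t where t: "wf_term t" "y = cls t" by (rule Omega_cases)
        show "x \<rhd>\<^bsub>?O\<^esub> y \<in> carrier ?O"
          unfolding t(2) A[OF t(1)] by (rule cls_mem[OF S(2)[OF t(1)]])
      qed
      show "(\<lambda>y. \<Union>t\<in>y. cls (BDiv s t)) ` carrier ?O \<subseteq> carrier ?O"
      proof (rule image_subsetI)
        fix y assume "y \<in> carrier ?O"
        then obtain t where t: "wf_term t" "y = cls t" by (rule Omega_cases)
        show "(\<Union>t\<in>y. cls (BDiv s t)) \<in> carrier ?O"
          unfolding t(2) D[OF t(1)] by (rule cls_mem[OF S(1)[OF t(1)]])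
      qed
    qed
  qed
  show "x \<rhd>\<^bsub>?O\<^esub> x = x" if x: "x \<in> carrier ?O" for x
  proof -
    obtain s where s: "wf_term s" "x = cls s" using x by (rule Omega_cases)
    show ?thesis unfolding s(2) Omega_lact[OF s(1) s(1)]
      by (rule cls_eqI[OF beck_cong.idem[OF s(1)]])
  qed
  show "x \<rhd>\<^bsub>?O\<^esub> (y \<rhd>\<^bsub>?O\<^esub> z) = (x \<rhd>\<^bsub>?O\<^esub> y) \<rhd>\<^bsub>?O\<^esub> (x \<rhd>\<^bsub>?O\<^esub> z)"
    if x: "x \<in> carrier ?O" and y: "y \<in> carrier ?O" and z: "z \<in> carrier ?O" for x y z
  proof -
    obtain s where s: "wf_term s" "x = cls s" using x by (rule Omega_cases)
    obtain t where t: "wf_term t" "y = cls t" using y by (rule Omega_cases)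
    obtain u where u: "wf_term u" "z = cls u" using z by (rule Omega_cases)
    have S: "wf_term (BOp t u)" "wf_term (BOp s t)" "wf_term (BOp s u)"
      using s(1) t(1) u(1) by simp_all
    show ?thesis
      unfolding s(2) t(2) u(2) Omega_lact[OF t(1) u(1)] Omega_lact[OF s(1) S(1)]
        Omega_lact[OF s(1) t(1)] Omega_lact[OF s(1) u(1)] Omega_lact[OF S(2,3)]
      by (rule cls_eqI[OF beck_cong.distrib[OF s(1) t(1) u(1)]])
  qed
qed

lemma beck_module_Omega: "beck_module X (Omega X Y p)"
proof (rule beck_module.intro)
  let ?O = "Omega X Y p"
  interpret O: quandle ?O by (rule quandle_Omega)
  have proj_closed: "proj ?O C \<in> carrier X" if C: "C \<in> carrier ?O" for C
  proof -
    obtain t where t: "wf_term t" "C = cls t" using C by (rule Omega_cases)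
    show ?thesis unfolding t(2) Omega_proj[OF t(1)] by (rule base_of_closed[OF t(1)])
  qed
  have proj_lact: "proj ?O (C \<rhd>\<^bsub>?O\<^esub> D) = proj ?O C \<rhd>\<^bsub>X\<^esub> proj ?O D"
    if C: "C \<in> carrier ?O" and D: "D \<in> carrier ?O" for C D
  proof -
    obtain s where s: "wf_term s" "C = cls s" using C by (rule Omega_cases)
    obtain t where t: "wf_term t" "D = cls t" using D by (rule Omega_cases)
    have st: "wf_term (BOp s t)" using s(1) t(1) by simp
    show ?thesis
      unfolding s(2) t(2) Omega_lact[OF s(1) t(1)] Omega_proj[OF st] Omega_proj[OF s(1)] Omega_proj[OF t(1)]
      by simp
  qed
  have add_pairs: thesis
    if CD: "C \<in> carrier ?O" "D \<in> carrier ?O" "proj ?O C = proj ?O D"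
      and hyp: "\<And>s t. \<lbrakk>wf_term s; wf_term t; base_of s = base_of t; wf_term (BAdd s t); C = cls s; D = cls t\<rbrakk> \<Longrightarrow> thesis"
    for C D thesis
  proof -
    obtain s where s: "wf_term s" "C = cls s" using CD(1) by (rule Omega_cases)
    obtain t where t: "wf_term t" "D = cls t" using CD(2) by (rule Omega_cases)
    have b: "base_of s = base_of t"
      using CD(3) unfolding s(2) t(2) Omega_proj[OF s(1)] Omega_proj[OF t(1)] .
    have "wf_term (BAdd s t)" using s(1) t(1) b by simp
    from hyp[OF s(1) t(1) b this s(2) t(2)] show ?thesis .
  qed
  show "quandle X" by (rule base.quandle_axioms)
  show "quandle ?O" by (rule quandle_Omega)
  show "proj ?O \<in> quandle_hom ?O X"
    using proj_closed proj_lact by (simp add: quandle_hom_def)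
  show "bzero ?O \<in> slice_hom X id ?O (proj ?O)"
    unfolding slice_hom_def quandle_hom_def
  proof (intro CollectI conjI ballI funcsetI)
    fix x assume x: "x \<in> carrier X"
    then have wx: "wf_term (BZero x)" by simp
    show "bzero ?O x \<in> carrier ?O" unfolding Omega_zero by (rule cls_mem[OF wx])
    show "proj ?O (bzero ?O x) = id x" unfolding Omega_zero Omega_proj[OF wx] by simp
    fix y assume y: "y \<in> carrier X"
    then have wy: "wf_term (BZero y)" by simp
    show "bzero ?O (x \<rhd>\<^bsub>X\<^esub> y) = bzero ?O x \<rhd>\<^bsub>?O\<^esub> bzero ?O y"
      unfolding Omega_zero Omega_lact[OF wx wy] by (rule cls_eqI[OF beck_cong.zero_hom[OF x y]])
  qed
  show "(\<lambda>(a, b). badd ?O a b)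
      \<in> slice_hom (fibre_product ?O (proj ?O) ?O (proj ?O)) (\<lambda>(a, b). proj ?O a) ?O (proj ?O)"
    unfolding slice_hom_def quandle_hom_def
  proof (intro CollectI conjI ballI funcsetI)
    fix P assume P: "P \<in> carrier (fibre_product ?O (proj ?O) ?O (proj ?O))"
    obtain C D where CD: "P = (C, D)" "C \<in> carrier ?O" "D \<in> carrier ?O" "proj ?O C = proj ?O D"
      using P by (auto simp: fibre_product_def)
    obtain s t where st: "wf_term s" "wf_term t" "base_of s = base_of t" "wf_term (BAdd s t)"
        "C = cls s" "D = cls t"
      using CD(2-4) by (rule add_pairs)
    have P_eq: "(case P of (a, b) \<Rightarrow> badd ?O a b) = cls (BAdd s t)"
      unfolding CD(1) prod.case st(5,6) by (rule Omega_add[OF st(1-3)])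
    show "(case P of (a, b) \<Rightarrow> badd ?O a b) \<in> carrier ?O"
      unfolding P_eq by (rule cls_mem[OF st(4)])
    have "proj ?O (case P of (a, b) \<Rightarrow> badd ?O a b) = base_of s"
      unfolding P_eq Omega_proj[OF st(4)] by simp
    also have "\<dots> = (case P of (a, b) \<Rightarrow> proj ?O a)"
      unfolding CD(1) prod.case st(5) Omega_proj[OF st(1)] ..
    finally show "proj ?O (case P of (a, b) \<Rightarrow> badd ?O a b) = (case P of (a, b) \<Rightarrow> proj ?O a)" .
    fix P' assume P': "P' \<in> carrier (fibre_product ?O (proj ?O) ?O (proj ?O))"
    obtain C' D' where CD': "P' = (C', D')" "C' \<in> carrier ?O" "D' \<in> carrier ?O" "proj ?O C' = proj ?O D'"
      using P' by (auto simp: fibre_product_def)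
    obtain s' t' where st': "wf_term s'" "wf_term t'" "base_of s' = base_of t'" "wf_term (BAdd s' t')"
        "C' = cls s'" "D' = cls t'"
      using CD'(2-4) by (rule add_pairs)
    have P'_eq: "(case P' of (a, b) \<Rightarrow> badd ?O a b) = cls (BAdd s' t')"
      unfolding CD'(1) prod.case st'(5,6) by (rule Omega_add[OF st'(1-3)])
    have PP': "P \<rhd>\<^bsub>fibre_product ?O (proj ?O) ?O (proj ?O)\<^esub> P' = (cls (BOp s s'), cls (BOp t t'))"
      unfolding CD(1) CD'(1) st(5,6) st'(5,6)
      by (simp add: fibre_product_def Omega_lact[OF st(1) st'(1)] Omega_lact[OF st(2) st'(2)])
    have w: "wf_term (BOp s s')" "wf_term (BOp t t')" "base_of (BOp s s') = base_of (BOp t t')"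
      using st(1-3) st'(1-3) by simp_all
    show "(case P \<rhd>\<^bsub>fibre_product ?O (proj ?O) ?O (proj ?O)\<^esub> P' of (a, b) \<Rightarrow> badd ?O a b)
        = (case P of (a, b) \<Rightarrow> badd ?O a b) \<rhd>\<^bsub>?O\<^esub> (case P' of (a, b) \<Rightarrow> badd ?O a b)"
      unfolding PP' P_eq P'_eq prod.case Omega_add[OF w] Omega_lact[OF st(4) st'(4)]
      by (rule cls_eqI[OF beck_cong.add_hom[OF st(4) st'(4)]])
  qed
  show "bneg ?O \<in> slice_hom ?O (proj ?O) ?O (proj ?O)"
    unfolding slice_hom_def quandle_hom_def
  proof (intro CollectI conjI ballI funcsetI)
    fix C assume C: "C \<in> carrier ?O"
    obtain s where s: "wf_term s" "C = cls s" using C by (rule Omega_cases)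
    have ns: "wf_term (BNeg s)" using s(1) by simp
    show "bneg ?O C \<in> carrier ?O" unfolding s(2) Omega_neg[OF s(1)] by (rule cls_mem[OF ns])
    show "proj ?O (bneg ?O C) = proj ?O C"
      unfolding s(2) Omega_neg[OF s(1)] Omega_proj[OF ns] Omega_proj[OF s(1)] by simp
    fix D assume D: "D \<in> carrier ?O"
    obtain t where t: "wf_term t" "D = cls t" using D by (rule Omega_cases)
    have nt: "wf_term (BNeg t)" and st: "wf_term (BOp s t)" using s(1) t(1) by simp_all
    show "bneg ?O (C \<rhd>\<^bsub>?O\<^esub> D) = bneg ?O C \<rhd>\<^bsub>?O\<^esub> bneg ?O D"
      unfolding s(2) t(2) Omega_lact[OF s(1) t(1)] Omega_neg[OF st] Omega_neg[OF s(1)] Omega_neg[OF t(1)]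
        Omega_lact[OF ns nt]
      by (rule cls_eqI[OF beck_cong.neg_hom[OF s(1) t(1)]])
  qed
  show "badd ?O (badd ?O C D) E = badd ?O C (badd ?O D E)"
    if C: "C \<in> carrier ?O" and D: "D \<in> carrier ?O" and E: "E \<in> carrier ?O"
      and CD: "proj ?O C = proj ?O D" and DE: "proj ?O D = proj ?O E" for C D E
  proof -
    obtain s where s: "wf_term s" "C = cls s" using C by (rule Omega_cases)
    obtain t where t: "wf_term t" "D = cls t" using D by (rule Omega_cases)
    obtain u where u: "wf_term u" "E = cls u" using E by (rule Omega_cases)
    have b: "base_of s = base_of t" "base_of t = base_of u"
      using CD DE unfolding s(2) t(2) u(2) Omega_proj[OF s(1)] Omega_proj[OF t(1)] Omega_proj[OF u(1)] .
    have w: "wf_term (BAdd s t)" "wf_term (BAdd t u)"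
      and b': "base_of (BAdd s t) = base_of u" "base_of s = base_of (BAdd t u)"
      using s(1) t(1) u(1) b by simp_all
    have w': "wf_term (BAdd (BAdd s t) u)" "wf_term (BAdd s (BAdd t u))"
      using s(1) t(1) u(1) b by simp_all
    show ?thesis
      unfolding s(2) t(2) u(2) Omega_add[OF s(1) t(1) b(1)] Omega_add[OF t(1) u(1) b(2)]
        Omega_add[OF w(1) u(1) b'(1)] Omega_add[OF s(1) w(2) b'(2)]
      by (rule cls_eqI[OF beck_cong.add_assoc[OF w']])
  qed
  show "badd ?O C D = badd ?O D C"
    if CD: "C \<in> carrier ?O" "D \<in> carrier ?O" "proj ?O C = proj ?O D" for C D
  proof -
    obtain s t where st: "wf_term s" "wf_term t" "base_of s = base_of t" "wf_term (BAdd s t)"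
        "C = cls s" "D = cls t"
      using CD by (rule add_pairs)
    show ?thesis
      unfolding st(5,6) Omega_add[OF st(1-3)] Omega_add[OF st(2,1) st(3)[symmetric]]
      by (rule cls_eqI[OF beck_cong.add_comm[OF st(4)]])
  qed
  show "badd ?O (bzero ?O (proj ?O C)) C = C" if C: "C \<in> carrier ?O" for C
  proof -
    obtain s where s: "wf_term s" "C = cls s" using C by (rule Omega_cases)
    have w: "wf_term (BZero (base_of s))" "base_of (BZero (base_of s)) = base_of s"
      using base_of_closed[OF s(1)] by simp_all
    show ?thesis
      unfolding s(2) Omega_proj[OF s(1)] Omega_zero Omega_add[OF w(1) s(1) w(2)]
      by (rule cls_eqI[OF beck_cong.add_zero[OF s(1)]])
  qed
  show "badd ?O (bneg ?O C) C = bzero ?O (proj ?O C)" if C: "C \<in> carrier ?O" for C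
  proof -
    obtain s where s: "wf_term s" "C = cls s" using C by (rule Omega_cases)
    have w: "wf_term (BNeg s)" "base_of (BNeg s) = base_of s" using s(1) by simp_all
    show ?thesis
      unfolding s(2) Omega_proj[OF s(1)] Omega_zero Omega_neg[OF s(1)] Omega_add[OF w(1) s(1) w(2)]
      by (rule cls_eqI[OF beck_cong.add_neg[OF s(1)]])
  qed
qed

lemma Omega_unit_slice_hom: "Omega_unit X Y p \<in> slice_hom Y p (Omega X Y p) (proj (Omega X Y p))"
  unfolding slice_hom_def quandle_hom_def
proof (intro CollectI conjI ballI funcsetI)
  fix y assume y: "y \<in> carrier Y"
  then have wy: "wf_term (BGen y)" by simp
  show "Omega_unit X Y p y \<in> carrier (Omega X Y p)"
    unfolding Omega_unit_def by (rule cls_mem[OF wy])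
  show "proj (Omega X Y p) (Omega_unit X Y p y) = p y"
    unfolding Omega_unit_def Omega_proj[OF wy] by simp
  fix z assume z: "z \<in> carrier Y"
  then have wz: "wf_term (BGen z)" by simp
  show "Omega_unit X Y p (y \<rhd>\<^bsub>Y\<^esub> z) = Omega_unit X Y p y \<rhd>\<^bsub>Omega X Y p\<^esub> Omega_unit X Y p z"
    unfolding Omega_unit_def Omega_lact[OF wy wz] by (rule cls_eqI[OF beck_cong.gen_hom[OF y z]])
qed

end

locale quandle_over_to_beck = quandle_over X Y p + target: beck_module X N
  for X :: "('x, 'm) magma_scheme" and Y :: "('y, 'n) magma_scheme" and p :: "'y \<Rightarrow> 'x"
    and N :: "('b, 'x, 'k) beck_scheme" +
  fixes g :: "'y \<Rightarrow> 'b"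
  assumes g: "g \<in> slice_hom Y p N (proj N)"
begin

abbreviation ev where "ev \<equiv> beck_eval N g"

lemma rack_N: "rack N" and quandle_N: "quandle N"
  using target.total_quandle by (auto simp: quandle_def)

lemma g_hom: "g \<in> quandle_hom Y N"
  using g by (simp add: slice_hom_def)

lemma ev_closed: "wf_term t \<Longrightarrow> ev t \<in> carrier N \<and> proj N (ev t) = base_of t"
proof (induction t)
  case (BGen y)
  then show ?case using g quandle_hom_closed[OF g_hom] by (simp add: slice_hom_def)
next
  case (BZero x)
  then show ?case using target.fibre_closed(2) by simp
next
  case (BAdd s t)
  then show ?case using target.fibre_closed(4)[of "ev s" "ev t"] by simp
next
  case (BNeg t)
  then show ?case using target.fibre_closed(3)[of "ev t"] by simp
next
  case (BOp s t)
  then show ?case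
    using target.fibre_lact(1)[of "ev s" "ev t"] rack.lact_closed[OF rack_N, of "ev s" "ev t"] by simp
next
  case (BDiv s t)
  then show ?case
    using quandle_hom_ldiv[OF rack_N base.rack_axioms target.proj_hom, of "ev s" "ev t"]
      rack.ldiv_closed[OF rack_N, of "ev s" "ev t"] by simp
qed

lemma ev_cong: "s \<simeq> t \<Longrightarrow> ev s = ev t"
proof (induction rule: beck_cong.induct)
  case (gen_hom y y')
  then show ?case using quandle_hom_lact[OF g_hom] by simp
next
  case (distrib s t u)
  then show ?case
    unfolding beck_eval.simps by (intro rack.lact_distrib[OF rack_N] conjunct1[OF ev_closed])
next
  case (idem t)
  then show ?case
    unfolding beck_eval.simps by (intro quandle.lact_idem[OF quandle_N] conjunct1[OF ev_closed])
next
  case (Op_Div s t)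
  then show ?case
    unfolding beck_eval.simps by (intro rack.lact_ldiv[OF rack_N] conjunct1[OF ev_closed])
next
  case (Div_Op s t)
  then show ?case
    unfolding beck_eval.simps by (intro rack.ldiv_lact[OF rack_N] conjunct1[OF ev_closed])
next
  case (zero_hom x x')
  then show ?case unfolding beck_eval.simps by (intro target.fibre_lact(2))
next
  case (neg_hom s t)
  then show ?case
    unfolding beck_eval.simps by (intro target.fibre_lact(3) conjunct1[OF ev_closed])
next
  case (add_hom s t s' t')
  then have "wf_term s" "wf_term t" "wf_term s'" "wf_term t'"
    "base_of s = base_of t" "base_of s' = base_of t'" by simp_all
  then show ?case
    unfolding beck_eval.simps by (intro target.fibre_lact(4)) (simp_all add: ev_closed)
next
  case (add_assoc s t u)
  then have "wf_term s" "wf_term t" "wf_term u" "base_of s = base_of t" "base_of t = base_of u" by simp_all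
  then show ?case
    unfolding beck_eval.simps by (intro target.add_assoc) (simp_all add: ev_closed)
next
  case (add_comm s t)
  then have "wf_term s" "wf_term t" "base_of s = base_of t" by simp_all
  then show ?case
    unfolding beck_eval.simps by (intro target.add_comm) (simp_all add: ev_closed)
next
  case (add_zero t)
  then show ?case using ev_closed[of t] target.add_zero[of "ev t"] by simp
next
  case (add_neg t)
  then show ?case using ev_closed[of t] target.add_neg[of "ev t"] by simp
qed simp_all

lemma Omega_lift_cls:
  assumes "wf_term t"
  shows "Omega_lift N g (cls t) = ev t"
proof -
  have "t \<in> cls t" by (rule cls_self[OF assms])
  moreover have "ev u = ev t" if "u \<in> cls t" for u
    using that ev_cong[of t u] unfolding in_cls by simp
  ultimately have "ev ` cls t = {ev t}" by blast
  then show ?thesis by (simp add: Omega_lift_def)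
qed

text \<open>Universal property: \<^const>\<open>Omega\<close> is left adjoint to the forgetful functor from
  Beck modules over \<open>X\<close> to quandles over \<open>X\<close>.\<close>

theorem Omega_lift_hom: "Omega_lift N g \<in> beck_hom (Omega X Y p) N"
  unfolding beck_hom_def slice_hom_def quandle_hom_def
proof (intro CollectI conjI ballI funcsetI impI)
  let ?O = "Omega X Y p"
  fix C assume C: "C \<in> carrier ?O"
  obtain s where s: "wf_term s" "C = cls s" using C by (rule Omega_cases)
  show "Omega_lift N g C \<in> carrier N"
    unfolding s(2) Omega_lift_cls[OF s(1)] by (rule conjunct1[OF ev_closed[OF s(1)]])
  show "proj N (Omega_lift N g C) = proj ?O C"
    unfolding s(2) Omega_lift_cls[OF s(1)] Omega_proj[OF s(1)] by (rule conjunct2[OF ev_closed[OF s(1)]])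
  fix D assume D: "D \<in> carrier ?O"
  obtain t where t: "wf_term t" "D = cls t" using D by (rule Omega_cases)
  have w: "wf_term (BOp s t)" using s(1) t(1) by simp
  show "Omega_lift N g (C \<rhd>\<^bsub>?O\<^esub> D) = Omega_lift N g C \<rhd>\<^bsub>N\<^esub> Omega_lift N g D"
    unfolding s(2) t(2) Omega_lact[OF s(1) t(1)] Omega_lift_cls[OF w]
      Omega_lift_cls[OF s(1)] Omega_lift_cls[OF t(1)] by simp
  assume CD: "proj ?O C = proj ?O D"
  then have b: "base_of s = base_of t"
    unfolding s(2) t(2) Omega_proj[OF s(1)] Omega_proj[OF t(1)] .
  then have w': "wf_term (BAdd s t)" using s(1) t(1) by simp
  show "Omega_lift N g (badd ?O C D) = badd N (Omega_lift N g C) (Omega_lift N g D)"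
    unfolding s(2) t(2) Omega_add[OF s(1) t(1) b] Omega_lift_cls[OF w']
      Omega_lift_cls[OF s(1)] Omega_lift_cls[OF t(1)] by simp
qed

theorem Omega_lift_unit: "y \<in> carrier Y \<Longrightarrow> Omega_lift N g (Omega_unit X Y p y) = g y"
  unfolding Omega_unit_def by (subst Omega_lift_cls) simp_all

theorem Omega_lift_unique:
  assumes h: "h \<in> beck_hom (Omega X Y p) N"
    and hg: "\<And>y. y \<in> carrier Y \<Longrightarrow> h (Omega_unit X Y p y) = g y"
    and C: "C \<in> carrier (Omega X Y p)"
  shows "h C = Omega_lift N g C"
proof -
  note om = beck_module_Omega
  note bN = target.beck_module_axioms
  have "h (cls t) = ev t" if "wf_term t" for t
    using that
  proof (induction t)
    case (BGen y)
    then show ?case using hg[of y] by (simp add: Omega_unit_def)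
  next
    case (BZero x)
    then show ?case using beck_hom_zero[OF om bN h, of x] by (simp add: Omega_zero)
  next
    case (BAdd s t)
    then have st: "wf_term s" "wf_term t" "base_of s = base_of t"
      and IH: "h (cls s) = ev s" "h (cls t) = ev t" by simp_all
    have "proj (Omega X Y p) (cls s) = proj (Omega X Y p) (cls t)"
      unfolding Omega_proj[OF st(1)] Omega_proj[OF st(2)] by (rule st(3))
    from beck_homD(4)[OF h cls_mem[OF st(1)] cls_mem[OF st(2)] this]
    show ?case unfolding Omega_add[OF st] IH by simp
  next
    case (BNeg t)
    then have t: "wf_term t" and IH: "h (cls t) = ev t" by simp_all
    from beck_hom_neg[OF om bN h cls_mem[OF t]]
    show ?case unfolding Omega_neg[OF t] IH by simp
  next
    case (BOp s t)
    then have st: "wf_term s" "wf_term t"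
      and IH: "h (cls s) = ev s" "h (cls t) = ev t" by simp_all
    from beck_homD(3)[OF h cls_mem[OF st(1)] cls_mem[OF st(2)]]
    show ?case unfolding Omega_lact[OF st] IH by simp
  next
    case (BDiv s t)
    then have st: "wf_term s" "wf_term t" "wf_term (BDiv s t)"
      and IH: "h (cls s) = ev s" "h (cls t) = ev t" by simp_all
    interpret O: quandle "Omega X Y p" by (rule quandle_Omega)
    have "cls s \<rhd>\<^bsub>Omega X Y p\<^esub> cls (BDiv s t) = cls t"
      unfolding Omega_lact[OF st(1,3)] by (rule cls_eqI[OF beck_cong.Op_Div[OF st(1,2)]])
    then have "ldiv (Omega X Y p) (cls s) (cls t) = cls (BDiv s t)"
      by (rule O.ldiv_unique[OF cls_mem cls_mem cls_mem, OF st])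
    then show ?case
      using quandle_hom_ldiv[OF O.rack_axioms rack_N beck_homD(1)[OF h] cls_mem[OF st(1)] cls_mem[OF st(2)]]
      unfolding beck_eval.simps IH by simp
  qed
  moreover obtain t where "wf_term t" "C = cls t" using C by (rule Omega_cases)
  ultimately show ?thesis using Omega_lift_cls by simp
qed

end


section \<open>Simplicial sets and simplicial quandles\<close>

text \<open>In a simplicial set \<open>K\<close> the face map \<open>d\<^sub>i: K\<^sub>n\<^sub>+\<^sub>1 \<rightarrow> K\<^sub>n\<close> is \<open>face K n i\<close>, for \<open>i \<le> n + 1\<close>, and
  the degeneracy map \<open>s\<^sub>i: K\<^sub>n \<rightarrow> K\<^sub>n\<^sub>+\<^sub>1\<close> is \<open>degen K n i\<close>, for \<open>i \<le> n\<close>.\<close>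

record 'a sset =
  simplices :: "nat \<Rightarrow> 'a set"
  face :: "nat \<Rightarrow> nat \<Rightarrow> 'a \<Rightarrow> 'a"
  degen :: "nat \<Rightarrow> nat \<Rightarrow> 'a \<Rightarrow> 'a"

locale simplicial_set =
  fixes K :: "('a, 'm) sset_scheme"
  assumes face_closed: "\<lbrakk>x \<in> simplices K (Suc n); i \<le> Suc n\<rbrakk> \<Longrightarrow> face K n i x \<in> simplices K n"
    and degen_closed: "\<lbrakk>x \<in> simplices K n; i \<le> n\<rbrakk> \<Longrightarrow> degen K n i x \<in> simplices K (Suc n)"
    and face_face: "\<lbrakk>x \<in> simplices K (Suc (Suc n)); i < j; j \<le> Suc (Suc n)\<rbrakk>
      \<Longrightarrow> face K n i (face K (Suc n) j x) = face K n (j - 1) (face K (Suc n) i x)"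
    and face_degen_less: "\<lbrakk>x \<in> simplices K (Suc n); i < j; j \<le> Suc n\<rbrakk>
      \<Longrightarrow> face K (Suc n) i (degen K (Suc n) j x) = degen K n (j - 1) (face K n i x)"
    and face_degen_eq: "\<lbrakk>x \<in> simplices K n; j \<le> n; i = j \<or> i = Suc j\<rbrakk> \<Longrightarrow> face K n i (degen K n j x) = x"
    and face_degen_greater: "\<lbrakk>x \<in> simplices K (Suc n); Suc j < i; i \<le> Suc (Suc n)\<rbrakk>
      \<Longrightarrow> face K (Suc n) i (degen K (Suc n) j x) = degen K n j (face K n (i - 1) x)"
    and degen_degen: "\<lbrakk>x \<in> simplices K n; i \<le> j; j \<le> n\<rbrakk>
      \<Longrightarrow> degen K (Suc n) i (degen K n j x) = degen K (Suc n) (Suc j) (degen K n i x)"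

definition simplicial_map ::
  "('a, 'm) sset_scheme \<Rightarrow> ('b, 'n) sset_scheme \<Rightarrow> (nat \<Rightarrow> 'a \<Rightarrow> 'b) \<Rightarrow> bool" where
  "simplicial_map K L f \<longleftrightarrow>
     (\<forall>n. \<forall>x\<in>simplices K n. f n x \<in> simplices L n) \<and>
     (\<forall>n. \<forall>i\<le>Suc n. \<forall>x\<in>simplices K (Suc n). f n (face K n i x) = face L n i (f (Suc n) x)) \<and>
     (\<forall>n. \<forall>i\<le>n. \<forall>x\<in>simplices K n. f (Suc n) (degen K n i x) = degen L n i (f n x))"

text \<open>A simplicial quandle extends its underlying simplicial set.\<close>

record 'a squandle = "'a sset" +
  level_lact :: "nat \<Rightarrow> 'a \<Rightarrow> 'a \<Rightarrow> 'a"

definition level :: "('a, 'm) squandle_scheme \<Rightarrow> nat \<Rightarrow> 'a magma" where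
  "level F n = \<lparr>carrier = simplices F n, lact = level_lact F n\<rparr>"

locale simplicial_quandle = simplicial_set F for F :: "('a, 'm) squandle_scheme" +
  assumes quandle_level: "quandle (level F n)"
    and face_hom: "i \<le> Suc n \<Longrightarrow> face F n i \<in> quandle_hom (level F (Suc n)) (level F n)"
    and degen_hom: "i \<le> n \<Longrightarrow> degen F n i \<in> quandle_hom (level F n) (level F (Suc n))"

definition simplicial_quandle_map ::
  "('a, 'm) squandle_scheme \<Rightarrow> ('b, 'n) squandle_scheme \<Rightarrow> (nat \<Rightarrow> 'a \<Rightarrow> 'b) \<Rightarrow> bool" where
  "simplicial_quandle_map F G f \<longleftrightarrow>
     simplicial_map F G f \<and> (\<forall>n. f n \<in> quandle_hom (level F n) (level G n))"

definition constant_squandle :: "('x, 'm) magma_scheme \<Rightarrow> 'x squandle" where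
  "constant_squandle X = \<lparr>simplices = (\<lambda>n. carrier X), face = (\<lambda>n i x. x), degen = (\<lambda>n i x. x),
     level_lact = (\<lambda>n. lact X)\<rparr>"

subsection \<open>Geometric realization and weak equivalences\<close>

definition quotient_topology :: "'a topology \<Rightarrow> ('a \<Rightarrow> 'b) \<Rightarrow> 'b topology" where
  "quotient_topology Z q = topology (\<lambda>U. U \<subseteq> q ` topspace Z \<and> openin Z {z \<in> topspace Z. q z \<in> U})"

lemma openin_quotient_topology:
  "openin (quotient_topology Z q) U \<longleftrightarrow> U \<subseteq> q ` topspace Z \<and> openin Z {z \<in> topspace Z. q z \<in> U}"
proof -
  have "istopology (\<lambda>U. U \<subseteq> q ` topspace Z \<and> openin Z {z \<in> topspace Z. q z \<in> U})"
    unfolding istopology_def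
  proof (intro conjI allI impI)
    fix S T
    assume S: "S \<subseteq> q ` topspace Z \<and> openin Z {z \<in> topspace Z. q z \<in> S}"
      and T: "T \<subseteq> q ` topspace Z \<and> openin Z {z \<in> topspace Z. q z \<in> T}"
    show "S \<inter> T \<subseteq> q ` topspace Z" using S by blast
    have "{z \<in> topspace Z. q z \<in> S \<inter> T} = {z \<in> topspace Z. q z \<in> S} \<inter> {z \<in> topspace Z. q z \<in> T}" by blast
    then show "openin Z {z \<in> topspace Z. q z \<in> S \<inter> T}" using S T by (simp add: openin_Int)
  next
    fix \<K> assume K: "\<forall>K\<in>\<K>. K \<subseteq> q ` topspace Z \<and> openin Z {z \<in> topspace Z. q z \<in> K}"
    show "\<Union>\<K> \<subseteq> q ` topspace Z" using K by blast
    have "{z \<in> topspace Z. q z \<in> \<Union>\<K>} = (\<Union>K\<in>\<K>. {z \<in> topspace Z. q z \<in> K})" by blast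
    moreover have "openin Z (\<Union>K\<in>\<K>. {z \<in> topspace Z. q z \<in> K})" using K by (intro openin_Union) blast
    ultimately show "openin Z {z \<in> topspace Z. q z \<in> \<Union>\<K>}" by simp
  qed
  then show ?thesis by (simp add: quotient_topology_def)
qed

lemma quotient_map_quotient_topology: "quotient_map Z (quotient_topology Z q) q"
proof -
  have "topspace (quotient_topology Z q) = q ` topspace Z"
  proof
    show "topspace (quotient_topology Z q) \<subseteq> q ` topspace Z"
      unfolding topspace_def openin_quotient_topology by blast
    have "{z \<in> topspace Z. q z \<in> q ` topspace Z} = topspace Z" by blast
    then have "openin (quotient_topology Z q) (q ` topspace Z)"
      unfolding openin_quotient_topology by simp
    then show "q ` topspace Z \<subseteq> topspace (quotient_topology Z q)" by (rule openin_subset)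
  qed
  then show ?thesis by (simp add: quotient_map_def openin_quotient_topology)
qed

text \<open>The map of standard simplices which collapses the vertices \<open>i\<close> and \<open>i + 1\<close>, in barycentric
  coordinates; the inclusion of the \<open>i\<close>-th face is \<^const>\<open>simplical_face\<close>.\<close>

definition simplex_collapse :: "nat \<Rightarrow> (nat \<Rightarrow> real) \<Rightarrow> nat \<Rightarrow> real" where
  "simplex_collapse i t = (\<lambda>k. if k < i then t k else if k = i then t i + t (Suc i) else t (Suc k))"

definition cell_topology :: "('a, 'm) sset_scheme \<Rightarrow> (nat \<times> 'a \<times> (nat \<Rightarrow> real)) topology" where
  "cell_topology K = sum_topology (\<lambda>n. prod_topology (discrete_topology (simplices K n))
     (subtopology (powertop_real UNIV) (standard_simplex n))) UNIV"

definition gluing ::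
  "('a, 'm) sset_scheme \<Rightarrow> ((nat \<times> 'a \<times> (nat \<Rightarrow> real)) \<times> (nat \<times> 'a \<times> (nat \<Rightarrow> real))) set" where
  "gluing K =
     {((n, face K n i x, t), (Suc n, x, simplical_face i t)) | n i x t.
        x \<in> simplices K (Suc n) \<and> t \<in> standard_simplex n \<and> i \<le> Suc n} \<union>
     {((Suc n, degen K n i x, t), (n, x, simplex_collapse i t)) | n i x t.
        x \<in> simplices K n \<and> t \<in> standard_simplex (Suc n) \<and> i \<le> n}"

definition gluing_equiv ::
  "('a, 'm) sset_scheme \<Rightarrow> ((nat \<times> 'a \<times> (nat \<Rightarrow> real)) \<times> (nat \<times> 'a \<times> (nat \<Rightarrow> real))) set" where
  "gluing_equiv K = (gluing K \<union> (gluing K)\<inverse>)\<^sup>*"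

definition realization :: "('a, 'm) sset_scheme \<Rightarrow> (nat \<times> 'a \<times> (nat \<Rightarrow> real)) set topology" where
  "realization K = quotient_topology (cell_topology K) (\<lambda>c. gluing_equiv K `` {c})"

definition realization_map :: "('b, 'm) sset_scheme \<Rightarrow> (nat \<Rightarrow> 'a \<Rightarrow> 'b) \<Rightarrow>
    (nat \<times> 'a \<times> (nat \<Rightarrow> real)) set \<Rightarrow> (nat \<times> 'b \<times> (nat \<Rightarrow> real)) set" where
  "realization_map L f C = (\<Union>(n, x, t)\<in>C. gluing_equiv L `` {(n, f n x, t)})"

definition homotopy_equivalence_map :: "'a topology \<Rightarrow> 'b topology \<Rightarrow> ('a \<Rightarrow> 'b) \<Rightarrow> bool" where
  "homotopy_equivalence_map Y Z f \<longleftrightarrow> continuous_map Y Z f \<and>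
     (\<exists>g. continuous_map Z Y g \<and> homotopic_with (\<lambda>h. True) Y Y (g \<circ> f) id \<and>
          homotopic_with (\<lambda>h. True) Z Z (f \<circ> g) id)"

text \<open>The weak equivalences of the Kan--Quillen model structure are the maps whose geometric
  realization is a homotopy equivalence. Since realizations are CW complexes, it makes no
  difference whether one asks for a homotopy equivalence or for a weak one.\<close>

definition weak_equivalence ::
  "('a, 'm) sset_scheme \<Rightarrow> ('b, 'n) sset_scheme \<Rightarrow> (nat \<Rightarrow> 'a \<Rightarrow> 'b) \<Rightarrow> bool" where
  "weak_equivalence K L f \<longleftrightarrow>
     homotopy_equivalence_map (realization K) (realization L) (realization_map L f)"

subsection \<open>Cofibrant replacements\<close>

definition free_squandle :: "('a, 'm) squandle_scheme \<Rightarrow> bool" where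
  "free_squandle G \<longleftrightarrow> simplicial_quandle G \<and>
     (\<exists>B. (\<forall>q. B q \<subseteq> simplices G q) \<and>
          (\<forall>q. \<forall>i\<le>q. degen G q i ` B q \<subseteq> B (Suc q)) \<and>
          (\<forall>q. bij_betw (free_quandle_lift (level G q) id)
                 (carrier (free_quandle (B q))) (carrier (level G q))))"

definition retract_of_squandle :: "('a, 'm) squandle_scheme \<Rightarrow> ('b, 'n) squandle_scheme \<Rightarrow> bool" where
  "retract_of_squandle F G \<longleftrightarrow>
     (\<exists>i r. simplicial_quandle_map F G i \<and> simplicial_quandle_map G F r \<and>
            (\<forall>q. \<forall>x\<in>simplices F q. r q (i q x) = x))"

text \<open>The type argument is the type of the simplices of the ambient free simplicial quandle. Being
  a variable type in a hypothesis, it imposes no restriction on that quandle.\<close>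

definition cofibrant :: "'g itself \<Rightarrow> ('a, 'm) squandle_scheme \<Rightarrow> bool" where
  "cofibrant TG F \<longleftrightarrow> simplicial_quandle F \<and>
     (\<exists>G :: 'g squandle. free_squandle G \<and> retract_of_squandle F G)"

definition cofibrant_replacement ::
  "'g itself \<Rightarrow> ('x, 'm) magma_scheme \<Rightarrow> ('a, 'n) squandle_scheme \<Rightarrow> (nat \<Rightarrow> 'a \<Rightarrow> 'x) \<Rightarrow> bool" where
  "cofibrant_replacement TG X F \<epsilon> \<longleftrightarrow> cofibrant TG F \<and>
     simplicial_quandle_map F (constant_squandle X) \<epsilon> \<and>
     weak_equivalence F (constant_squandle X) \<epsilon>"


section \<open>Quillen cohomology\<close>

text \<open>The cotangent complex of \<open>X\<close>, computed from \<open>\<epsilon>: F \<rightarrow> X\<close>: the Beck modules \<open>\<Omega>\<^sub>X(F\<^sub>q)\<close> and the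
  face maps between them.\<close>

definition cotangent :: "('x, 'm) magma_scheme \<Rightarrow> ('f, 'n) squandle_scheme \<Rightarrow> (nat \<Rightarrow> 'f \<Rightarrow> 'x) \<Rightarrow>
    nat \<Rightarrow> (('f, 'x) beck_term set, 'x) beck" where
  "cotangent X F \<epsilon> q = Omega X (level F q) (\<epsilon> q)"

definition cotangent_face :: "('x, 'm) magma_scheme \<Rightarrow> ('f, 'n) squandle_scheme \<Rightarrow> (nat \<Rightarrow> 'f \<Rightarrow> 'x) \<Rightarrow>
    nat \<Rightarrow> nat \<Rightarrow> ('f, 'x) beck_term set \<Rightarrow> ('f, 'x) beck_term set" where
  "cotangent_face X F \<epsilon> q i = Omega_map X (level F q) (\<epsilon> q) (face F q i)"

definition quillen_cochains :: "('x, 'm) magma_scheme \<Rightarrow> ('f, 'n) squandle_scheme \<Rightarrow> (nat \<Rightarrow> 'f \<Rightarrow> 'x) \<Rightarrow>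
    ('b, 'x, 'k) beck_scheme \<Rightarrow> nat \<Rightarrow> (('f, 'x) beck_term set \<Rightarrow> 'b) monoid" where
  "quillen_cochains X F \<epsilon> M q = beck_hom_group (cotangent X F \<epsilon> q) M"

text \<open>The alternating sum \<open>\<Sum>\<^sub>i (-1)\<^sup>i d\<^sub>i\<^sup>*\<close>, written with the multiplicative notation for groups.\<close>

definition quillen_coboundary :: "('x, 'm) magma_scheme \<Rightarrow> ('f, 'n) squandle_scheme \<Rightarrow> (nat \<Rightarrow> 'f \<Rightarrow> 'x) \<Rightarrow>
    ('b, 'x, 'k) beck_scheme \<Rightarrow> nat \<Rightarrow> (('f, 'x) beck_term set \<Rightarrow> 'b) \<Rightarrow> (('f, 'x) beck_term set \<Rightarrow> 'b)" where
  "quillen_coboundary X F \<epsilon> M q h =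
     (\<Otimes>\<^bsub>quillen_cochains X F \<epsilon> M (Suc q)\<^esub>i\<in>{..Suc q}.
        (\<lambda>\<omega>\<in>carrier (cotangent X F \<epsilon> (Suc q)). h (cotangent_face X F \<epsilon> q i \<omega>))
          [^]\<^bsub>quillen_cochains X F \<epsilon> M (Suc q)\<^esub> ((-1) ^ i :: int))"

definition quillen_cohomology :: "('x, 'm) magma_scheme \<Rightarrow> ('f, 'n) squandle_scheme \<Rightarrow> (nat \<Rightarrow> 'f \<Rightarrow> 'x) \<Rightarrow>
    ('b, 'x, 'k) beck_scheme \<Rightarrow> nat \<Rightarrow> (('f, 'x) beck_term set \<Rightarrow> 'b) set monoid" where
  "quillen_cohomology X F \<epsilon> M n =
     cohomology (quillen_cochains X F \<epsilon> M) (quillen_coboundary X F \<epsilon> M) n"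

end

theory Submission
 imports Defs "HOL-Analysis.Abstract_Topological_Spaces"
begin

text \<open>
 Both sides are cohomologies of cochains on complexes of free abelian groups. Dividing by the
 degenerate tuples amounts to using only the tuples without equal neighbours: the quandle cohomology
 of \<open>X\<close> in degree \<open>n + 1\<close> is the cohomology in degree \<open>n\<close> of the complex \<open>P\<close> with the normalized
 \<open>(n + 1)\<close>-tuples of \<open>X\<close> as basis in degree \<open>n\<close> (\<open>HQ_normalized\<close>). On the other side, by the universal
 property of \<open>\<Omega>\<close>, a morphism of Beck modules from the cotangent module of \<open>F\<^sub>n\<close> to \<open>A \<times> X\<close> is a
 function on \<open>F\<^sub>n\<close> with values in \<open>A\<close> that is invariant under left multiplications. Hence Quillen
 cochains are the cochains of the complex \<open>Q\<close> with the orbits of \<open>F\<^sub>n\<close> as basis in degree \<open>n\<close>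
 (\<open>orbit_cochain_iso\<close>).

 The two complexes are connected by the double complex of normalized \<open>(p + 1)\<close>-tuples of \<open>F\<^sub>q\<close>, with
 the quandle boundary in the direction of \<open>p\<close> and the alternating sum of simplicial faces in the
 direction of \<open>q\<close>. It is augmented to \<open>Q\<close> and to \<open>P\<close>, and both augmentations of its total complex are
 surjective with acyclic kernel (\<open>orbit_fibration\<close>, \<open>tuple_fibration\<close>). As all groups are free, such
 chain maps have a section that is a homotopy inverse, so that \<open>P\<close> and \<open>Q\<close> are chain
 homotopy equivalent and have isomorphic cohomology with every coefficient group
 (\<open>cohomology_span\<close>).

 The augmentation to \<open>Q\<close> is a resolution because the quandle homology of a free quandle
 is concentrated in the lowest degree, where it is free on the orbits (\<open>row_exact_free_quandle\<close>), and because this property passes to retracts. For the vanishing,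
 the quandle is lifted to a quandle of pairs of homotopies on its chain complex; by freeness the
 projection from the lifted quandle has a section, and the section is a contraction.

 The augmentation to \<open>P\<close> is a resolution because \<open>F\<close> is weakly equivalent to \<open>X\<close>. First, a weak
 equivalence to a discrete simplicial set makes the simplicial chains acyclic
 (\<open>weak_equivalence_acyclic\<close>). Weak equivalences are detected on geometric realizations, so this
 requires the comparison of simplicial with singular chains: the realization is filtered by skeleta,
 each of which arises from the previous one by attaching the nondegenerate simplices
 (\<open>skeleton_attachment\<close>), and the relative homology of attached cells is computed by excision
 (\<open>attach_iso\<close>). Then the acyclic simplicial group of chains of \<open>F\<close> has an extra degeneracy, which
 extends to all tensor powers and to their natural summands spanned by the normalized tuples
 (\<open>columns_exact_Suc\<close>).
\<close>

section \<open>Chain complexes of free abelian groups\<close>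

definition frees :: "'a set => ('a \<Rightarrow>\<^sub>0 int) set" where
 "frees S = {c. Poly_Mapping.keys c \<subseteq> S}"

definition additive_map :: "(('a \<Rightarrow>\<^sub>0 int) => ('b \<Rightarrow>\<^sub>0 int)) => bool" where
 "additive_map f \<longleftrightarrow> (\<forall>x y. f (x - y) = f x - f y)"

lemma additive_map_diff: "additive_map f ==> f (x - y) = f x - f y"
 by (simp add: additive_map_def)

lemma additive_map_zero: "additive_map f ==> f 0 = 0"
 using additive_map_diff[of f 0 0] by simp

lemma additive_map_minus: "additive_map f ==> f (- x) = - f x"
 using additive_map_diff[of f 0 x] by (simp add: additive_map_zero)

lemma additive_map_add: "additive_map f ==> f (x + y) = f x + f y"
 using additive_map_diff[of f x "- y"] by (simp add: additive_map_minus)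

lemma additive_map_sum: "additive_map f ==> f (\<Sum>i\<in>I. g i) = (\<Sum>i\<in>I. f (g i))"
 by (induction I rule: infinite_finite_induct) (simp_all add: additive_map_zero additive_map_add)

lemma additive_map_cmul:
 assumes "additive_map f"
 shows "f (frag_cmul k x) = frag_cmul k (f x)"
proof (induction k rule: int_induct[where k = 0])
 case (step1 i)
 then show ?case using assms by (simp add: frag_cmul_distrib additive_map_add)
next
 case (step2 i)
 then show ?case using assms by (simp add: frag_cmul_diff_distrib additive_map_diff)
qed (simp add: assms additive_map_zero)

lemma additive_map_frag_extend [intro, simp]: "additive_map (frag_extend f)"
 by (simp add: additive_map_def frag_extend_diff)

lemma additive_map_id [intro, simp]: "additive_map (%x. x)"
 by (simp add: additive_map_def)

lemma additive_map_zero_map [intro, simp]: "additive_map (%x. 0)"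
 by (simp add: additive_map_def)

lemma additive_map_comp [intro]:
 "additive_map f ==> additive_map g ==> additive_map (%x. f (g x))"
 by (simp add: additive_map_def)

lemma additive_map_plus [intro]:
 "additive_map f ==> additive_map g ==> additive_map (%x. f x + g x)"
 by (simp add: additive_map_def)

lemma additive_map_minus_map [intro]:
 "additive_map f ==> additive_map g ==> additive_map (%x. f x - g x)"
 by (simp add: additive_map_def)

lemma additive_map_uminus_map [intro]:
 "additive_map f ==> additive_map (%x. - f x)"
 by (simp add: additive_map_def)

lemma additive_map_cmul_map [intro]:
 "additive_map f ==> additive_map (%x. frag_cmul k (f x))"
 using frag_cmul_distrib2[of k _ "- _"]
 by (simp add: additive_map_def frag_cmul_distrib2 diff_conv_add_uminus del: add_uminus_conv_diff minus_frag_cmul)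
  (metis frag_cmul_cmul frag_cmul_minus_one mult.commute)

lemma additive_map_sum_map [intro]:
 "(\<And>i. i \<in> I ==> additive_map (f i)) ==> additive_map (%x. \<Sum>i\<in>I. f i x)"
 by (simp add: additive_map_def sum_subtractf)

lemma frees_zero [simp, intro]: "0 \<in> frees S"
 by (simp add: frees_def)

lemma frees_add [intro]: "x \<in> frees S ==> y \<in> frees S ==> x + y \<in> frees S"
 unfolding frees_def using keys_add[of x y] by blast

lemma frees_diff [intro]: "x \<in> frees S ==> y \<in> frees S ==> x - y \<in> frees S"
 unfolding frees_def using keys_diff[of x y] by blast

lemma frees_minus [intro]: "x \<in> frees S ==> - x \<in> frees S"
 using frees_diff[of 0 S x] by simp

lemma frees_cmul [intro]: "x \<in> frees S ==> frag_cmul k x \<in> frees S"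
 unfolding frees_def using keys_cmul[of k x] by blast

lemma frees_sum [intro]: "(\<And>i. i \<in> I ==> g i \<in> frees S) ==> (\<Sum>i\<in>I. g i) \<in> frees S"
 by (induction I rule: infinite_finite_induct) auto

lemma frees_of [simp]: "frag_of x \<in> frees S \<longleftrightarrow> x \<in> S"
 by (simp add: frees_def)

lemma frees_mono: "c \<in> frees S ==> S \<subseteq> T ==> c \<in> frees T"
 by (auto simp: frees_def)

lemma frees_empty: "c \<in> frees {} ==> c = 0"
 by (simp add: frees_def)

lemma frees_induct [consumes 1, case_names zero of diff]:
 assumes "c \<in> frees S" "P 0" "\<And>x. x \<in> S ==> P (frag_of x)"
  "\<And>a b. P a ==> P b ==> P (a - b)"
 shows "P c"
 using assms(1) unfolding frees_def
 by (intro frag_induction[of c S P]) (use assms in auto)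

lemma additive_map_eqI:
 assumes "c \<in> frees S" "additive_map f" "additive_map g" "\<And>x. x \<in> S ==> f (frag_of x) = g (frag_of x)"
 shows "f c = g c"
 using assms(1)
 by (induction rule: frees_induct) (simp_all add: assms additive_map_zero additive_map_diff)

lemma additive_map_closedI:
 assumes "c \<in> frees S" "additive_map f" "\<And>x. x \<in> S ==> f (frag_of x) \<in> frees T"
 shows "f c \<in> frees T"
 using assms(1)
 by (induction rule: frees_induct) (auto simp: assms additive_map_zero additive_map_diff)

lemma additive_map_zeroI:
 assumes "c \<in> frees S" "additive_map f" "\<And>x. x \<in> S ==> f (frag_of x) = 0"
 shows "f c = 0"
 using additive_map_eqI[OF assms(1,2), of "%x. 0"] assms(3) by simp

lemma frees_split:
 assumes "c \<in> frees (S \<union> T)"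
 obtains a b where "a \<in> frees S" "b \<in> frees T" "c = a + b"
 using frag_split[of c S T] assms unfolding frees_def by (metis mem_Collect_eq)

lemma frees_disjoint_zero:
 assumes "a \<in> frees S" "b \<in> frees T" "S \<inter> T = {}" "a + b = 0"
 shows "a = 0"
proof -
 have "a = - b" using assms(4) by (simp add: eq_neg_iff_add_eq_0)
 then have "Poly_Mapping.keys a = Poly_Mapping.keys b" by simp
 then have "Poly_Mapping.keys a = {}" using assms(1-3) unfolding frees_def by blast
 then show ?thesis by simp
qed

locale chain_complex =
 fixes S :: "nat => 'a set" and D :: "('a \<Rightarrow>\<^sub>0 int) => ('a \<Rightarrow>\<^sub>0 int)"
 assumes D_additive: "additive_map D"
  and D_closed: "c \<in> frees (S (Suc n)) ==> D c \<in> frees (S n)"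
  and D_bottom: "c \<in> frees (S 0) ==> D c = 0"
  and D_D: "c \<in> frees (S n) ==> D (D c) = 0"

locale complex_map = S: chain_complex S D + T: chain_complex T E
 for S :: "nat => 'a set" and D and T :: "nat => 'b set" and E +
 fixes f :: "('a \<Rightarrow>\<^sub>0 int) => ('b \<Rightarrow>\<^sub>0 int)"
 assumes f_additive: "additive_map f"
  and f_closed: "c \<in> frees (S n) ==> f c \<in> frees (T n)"
  and f_commutes: "c \<in> frees (S n) ==> f (D c) = E (f c)"

text \<open>The surjective chain maps with acyclic kernel. The condition says that a chain with
 prescribed boundary and prescribed image exists as soon as the prescriptions are compatible.\<close>

locale trivial_fibration = complex_map +
 assumes lift_bottom: "r \<in> frees (T 0) ==> \<exists>z\<in>frees (S 0). f z = r"
  and lift: "[|z \<in> frees (S n); r \<in> frees (T (Suc n)); D z = 0; E r = f z|]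
   ==> \<exists>z'\<in>frees (S (Suc n)). D z' = z & f z' = r"
begin

primrec sect :: "nat => ('b \<Rightarrow>\<^sub>0 int) => ('a \<Rightarrow>\<^sub>0 int)" where
 "sect 0 = frag_extend (%b. SOME z. z \<in> frees (S 0) & f z = frag_of b)"
| "sect (Suc n) = frag_extend (%b. SOME z. z \<in> frees (S (Suc n)) \<and>
   D z = sect n (E (frag_of b)) & f z = frag_of b)"

lemma sect_additive: "additive_map (sect n)"
 by (cases n) simp_all

lemma sect_zero:
 assumes "c \<in> frees (T 0)"
 shows "sect 0 c \<in> frees (S 0)" "f (sect 0 c) = c"
proof -
 have *: "sect 0 (frag_of b) \<in> frees (S 0) & f (sect 0 (frag_of b)) = frag_of b" if "b \<in> T 0" for b
 proof -
  have "\<exists>z. z \<in> frees (S 0) & f z = frag_of b"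
   using lift_bottom[of "frag_of b"] that by auto
  from someI_ex[OF this] show ?thesis by simp
 qed
 show "sect 0 c \<in> frees (S 0)"
  using additive_map_closedI[OF assms sect_additive] * by blast
 show "f (sect 0 c) = c"
  using additive_map_eqI[OF assms additive_map_comp[OF f_additive sect_additive] additive_map_id] * by blast
qed

lemma sect_Suc:
 assumes "c \<in> frees (T (Suc n))"
  "\<And>c. c \<in> frees (T n) ==> sect n c \<in> frees (S n) & f (sect n c) = c"
  "\<And>c. c \<in> frees (T (Suc n)) ==> D (sect n (E c)) = 0"
 shows "sect (Suc n) c \<in> frees (S (Suc n))" "f (sect (Suc n) c) = c" "D (sect (Suc n) c) = sect n (E c)"
proof -
 have *: "sect (Suc n) (frag_of b) \<in> frees (S (Suc n)) \<and>
  D (sect (Suc n) (frag_of b)) = sect n (E (frag_of b)) & f (sect (Suc n) (frag_of b)) = frag_of b"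
  if "b \<in> T (Suc n)" for b
 proof -
  have b: "frag_of b \<in> frees (T (Suc n))" using that by simp
  have "\<exists>z\<in>frees (S (Suc n)). D z = sect n (E (frag_of b)) & f z = frag_of b"
   using assms(2)[OF T.D_closed[OF b]] assms(3)[OF b] b by (intro lift) auto
  then have "\<exists>z. z \<in> frees (S (Suc n)) & D z = sect n (E (frag_of b)) & f z = frag_of b" by blast
  from someI_ex[OF this] show ?thesis by simp
 qed
 show "sect (Suc n) c \<in> frees (S (Suc n))"
  using additive_map_closedI[OF assms(1) sect_additive] * by blast
 show "f (sect (Suc n) c) = c"
  using additive_map_eqI[OF assms(1) additive_map_comp[OF f_additive sect_additive] additive_map_id] * by blast
 show "D (sect (Suc n) c) = sect n (E c)"
  using additive_map_eqI[OF assms(1) additive_map_comp[OF S.D_additive sect_additive]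
    additive_map_comp[OF sect_additive T.D_additive]] * by blast
qed

lemma sect_props:
 "(\<forall>c\<in>frees (T n). sect n c \<in> frees (S n) & f (sect n c) = c) \<and>
 (\<forall>c\<in>frees (T (Suc n)). D (sect n (E c)) = 0)"
proof (induction n)
 case 0
 then show ?case using sect_zero T.D_closed S.D_bottom by blast
next
 case (Suc n)
 have "D (sect (Suc n) (E c)) = 0" if "c \<in> frees (T (Suc (Suc n)))" for c
  using sect_Suc(3)[OF T.D_closed[OF that]] Suc T.D_D[OF that] additive_map_zero[OF sect_additive]
  by metis
 then show ?case using sect_Suc(1,2)[of _ n] Suc by blast
qed

lemma sect_closed: "c \<in> frees (T n) ==> sect n c \<in> frees (S n)"
 and f_sect: "c \<in> frees (T n) ==> f (sect n c) = c"
 and D_sect: "c \<in> frees (T (Suc n)) ==> D (sect (Suc n) c) = sect n (E c)"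
 using sect_props sect_Suc(3)[of c n] by blast+

primrec homotopy :: "nat => ('a \<Rightarrow>\<^sub>0 int) => ('a \<Rightarrow>\<^sub>0 int)" where
 "homotopy 0 = frag_extend (%b. SOME z. z \<in> frees (S 1) \<and>
   D z = sect 0 (f (frag_of b)) - frag_of b & f z = 0)"
| "homotopy (Suc n) = frag_extend (%b. SOME z. z \<in> frees (S (Suc (Suc n))) \<and>
   D z = sect (Suc n) (f (frag_of b)) - frag_of b - homotopy n (D (frag_of b)) & f z = 0)"

lemma homotopy_additive: "additive_map (homotopy n)"
 by (cases n) simp_all

lemma lift_kernel:
 assumes "z \<in> frees (S n)" "D z = 0" "f z = 0"
 shows "\<exists>z'. z' \<in> frees (S (Suc n)) & D z' = z & f z' = 0"
 using lift[of z n 0] assms additive_map_zero[OF T.D_additive] by auto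

lemma homotopy_zero:
 assumes "c \<in> frees (S 0)"
 shows "homotopy 0 c \<in> frees (S 1)" "f (homotopy 0 c) = 0" "D (homotopy 0 c) = sect 0 (f c) - c"
proof -
 have *: "homotopy 0 (frag_of b) \<in> frees (S 1) \<and>
  D (homotopy 0 (frag_of b)) = sect 0 (f (frag_of b)) - frag_of b & f (homotopy 0 (frag_of b)) = 0"
  if "b \<in> S 0" for b
 proof -
  have b: "frag_of b \<in> frees (S 0)" using that by simp
  let ?z = "sect 0 (f (frag_of b)) - frag_of b"
  have z: "?z \<in> frees (S 0)" using sect_closed f_closed b by blast
  have "f ?z = 0" using f_sect[OF f_closed[OF b]] by (simp add: additive_map_diff[OF f_additive])
  from lift_kernel[OF z S.D_bottom[OF z] this] have
   "\<exists>z'. z' \<in> frees (S 1) & D z' = ?z & f z' = 0" by simp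
  from someI_ex[OF this] show ?thesis by simp
 qed
 show "homotopy 0 c \<in> frees (S 1)"
  using additive_map_closedI[OF assms homotopy_additive] * by blast
 show "f (homotopy 0 c) = 0"
  using additive_map_zeroI[OF assms additive_map_comp[OF f_additive homotopy_additive]] * by blast
 show "D (homotopy 0 c) = sect 0 (f c) - c"
  by (rule additive_map_eqI[OF assms additive_map_comp[OF S.D_additive homotopy_additive]
    additive_map_minus_map[OF additive_map_comp[OF sect_additive f_additive] additive_map_id]])
  (use * in blast)
qed

lemma homotopy_Suc:
 assumes "c \<in> frees (S (Suc n))"
  "\<And>c. c \<in> frees (S n) ==> homotopy n c \<in> frees (S (Suc n)) & f (homotopy n c) = 0"
  "\<And>c. c \<in> frees (S (Suc n)) ==> D (homotopy n (D c)) = sect n (f (D c)) - D c"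
 shows "homotopy (Suc n) c \<in> frees (S (Suc (Suc n)))" "f (homotopy (Suc n) c) = 0"
  "D (homotopy (Suc n) c) = sect (Suc n) (f c) - c - homotopy n (D c)"
proof -
 have *: "homotopy (Suc n) (frag_of b) \<in> frees (S (Suc (Suc n))) \<and>
  D (homotopy (Suc n) (frag_of b)) = sect (Suc n) (f (frag_of b)) - frag_of b - homotopy n (D (frag_of b)) \<and>
  f (homotopy (Suc n) (frag_of b)) = 0"
  if "b \<in> S (Suc n)" for b
 proof -
  have b: "frag_of b \<in> frees (S (Suc n))" using that by simp
  let ?z = "sect (Suc n) (f (frag_of b)) - frag_of b - homotopy n (D (frag_of b))"
  have z: "?z \<in> frees (S (Suc n))"
   using sect_closed[OF f_closed[OF b]] b assms(2)[OF S.D_closed[OF b]] by blast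
  have fz: "f ?z = 0"
   using f_sect[OF f_closed[OF b]] assms(2)[OF S.D_closed[OF b]]
   by (simp add: additive_map_diff[OF f_additive])
  have "D ?z = 0"
   using assms(3)[OF b] D_sect[OF f_closed[OF b]] f_commutes[OF b]
   by (simp add: additive_map_diff[OF S.D_additive])
  from lift_kernel[OF z this fz] have
   "\<exists>z'. z' \<in> frees (S (Suc (Suc n))) & D z' = ?z & f z' = 0" by simp
  from someI_ex[OF this] show ?thesis by simp
 qed
 show "homotopy (Suc n) c \<in> frees (S (Suc (Suc n)))"
  using additive_map_closedI[OF assms(1) homotopy_additive] * by blast
 show "f (homotopy (Suc n) c) = 0"
  using additive_map_zeroI[OF assms(1) additive_map_comp[OF f_additive homotopy_additive]] * by blast
 show "D (homotopy (Suc n) c) = sect (Suc n) (f c) - c - homotopy n (D c)"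
  by (rule additive_map_eqI[OF assms(1) additive_map_comp[OF S.D_additive homotopy_additive]
    additive_map_minus_map[OF additive_map_minus_map[OF additive_map_comp[OF sect_additive f_additive] additive_map_id]
     additive_map_comp[OF homotopy_additive S.D_additive]]])
  (use * in blast)
qed

lemma homotopy_props:
 "(\<forall>c\<in>frees (S n). homotopy n c \<in> frees (S (Suc n)) & f (homotopy n c) = 0) \<and>
 (\<forall>c\<in>frees (S (Suc n)). D (homotopy n (D c)) = sect n (f (D c)) - D c)"
proof (induction n)
 case 0
 then show ?case using homotopy_zero S.D_closed by simp
next
 case (Suc n)
 have "D (homotopy (Suc n) (D c)) = sect (Suc n) (f (D c)) - D c" if "c \<in> frees (S (Suc (Suc n)))" for c
  using homotopy_Suc(3)[OF S.D_closed[OF that]] Suc S.D_D[OF that] additive_map_zero[OF homotopy_additive]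
  by (metis diff_zero)
 then show ?case using homotopy_Suc(1,2)[of _ n] Suc by blast
qed

lemma homotopy_closed: "c \<in> frees (S n) ==> homotopy n c \<in> frees (S (Suc n))"
 and D_homotopy: "c \<in> frees (S (Suc n)) ==>
  D (homotopy (Suc n) c) = sect (Suc n) (f c) - c - homotopy n (D c)"
 using homotopy_props homotopy_Suc(3)[of c n] by blast+

end

locale trivial_fibration_span =
 f: trivial_fibration S D P E f + g: trivial_fibration S D Q G g for S D P E f Q G g
begin

text \<open>A span of trivial fibrations makes its two ends chain homotopy equivalent; the map and the
 homotopy for one direction are given here, the other direction being symmetric.\<close>

definition across where "across n c = g (f.sect n c)"
definition across_homotopy where "across_homotopy n c = f (g.homotopy n (f.sect n c))"

end

subsection \<open>Double complexes\<close>

locale double_complex =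
 fixes \<beta> :: "nat => nat => 'b set" and dh dv :: "('b \<Rightarrow>\<^sub>0 int) => ('b \<Rightarrow>\<^sub>0 int)"
 assumes disjoint: "\<beta> p q \<inter> \<beta> p' q' \<noteq> {} ==> p = p' & q = q'"
  and dh_additive: "additive_map dh" and dv_additive: "additive_map dv"
  and dh_closed: "b \<in> \<beta> (Suc p) q ==> dh (frag_of b) \<in> frees (\<beta> p q)"
  and dh_bottom: "b \<in> \<beta> 0 q ==> dh (frag_of b) = 0"
  and dv_closed: "b \<in> \<beta> p (Suc q) ==> dv (frag_of b) \<in> frees (\<beta> p q)"
  and dv_bottom: "b \<in> \<beta> p 0 ==> dv (frag_of b) = 0"
  and dh_dh: "b \<in> \<beta> p q ==> dh (dh (frag_of b)) = 0"
  and dv_dv: "b \<in> \<beta> p q ==> dv (dv (frag_of b)) = 0"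
  and dh_dv: "b \<in> \<beta> p q ==> dh (dv (frag_of b)) = - dv (dh (frag_of b))"
begin

definition strip :: "nat => nat => 'b set" where
 "strip m n = (\<Union>p\<in>{m..n}. \<beta> p (n - p))"

definition tot :: "nat => 'b set" where "tot n = strip 0 n"

definition D :: "('b \<Rightarrow>\<^sub>0 int) => ('b \<Rightarrow>\<^sub>0 int)" where "D c = dh c + dv c"

lemma D_additive: "additive_map D"
 unfolding D_def[abs_def] using dh_additive dv_additive by blast

lemma D_strip:
 assumes "c \<in> frees (strip (Suc m) n)"
 shows "D c \<in> frees (strip m (n - 1))"
proof (rule additive_map_closedI[OF assms D_additive])
 fix b assume "b \<in> strip (Suc m) n"
 then obtain p where p: "p \<in> {Suc m..n}" "b \<in> \<beta> p (n - p)" by (auto simp: strip_def)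
 then obtain p' where p': "p = Suc p'" by (cases p) auto
 have "dh (frag_of b) \<in> frees (\<beta> p' (n - p))" using p p' dh_closed by blast
 moreover have "n - p = (n - 1) - p'" "p' \<in> {m..n - 1}" using p p' by auto
 ultimately have 1: "dh (frag_of b) \<in> frees (strip m (n - 1))"
  by (auto simp: strip_def elim!: frees_mono)
 have 2: "dv (frag_of b) \<in> frees (strip m (n - 1))"
 proof (cases "n = p")
  case True
  then show ?thesis using dv_bottom p by simp
 next
  case False
  then have "dv (frag_of b) \<in> frees (\<beta> p (n - 1 - p))" "p \<in> {m..n - 1}"
   using p dv_closed[of b p "n - 1 - p"] by (auto simp: Suc_diff_Suc)
  then show ?thesis by (auto simp: strip_def elim!: frees_mono)
 qed
 show "D (frag_of b) \<in> frees (strip m (n - 1))" unfolding D_def using 1 2 by blast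
qed

lemma dh_closed': "c \<in> frees (\<beta> (Suc p) q) ==> dh c \<in> frees (\<beta> p q)"
 and dv_closed': "c \<in> frees (\<beta> p (Suc q)) ==> dv c \<in> frees (\<beta> p q)"
 and dh_bottom': "c \<in> frees (\<beta> 0 q) ==> dh c = 0"
 and dv_bottom': "c \<in> frees (\<beta> p 0) ==> dv c = 0"
 by (auto intro: additive_map_closedI dh_additive dv_additive dh_closed dv_closed
   additive_map_zeroI dh_bottom dv_bottom)

lemma chain_complex_tot: "chain_complex tot D"
proof
 show "additive_map D" by (rule D_additive)
 fix c n
 show "D c \<in> frees (tot n)" if c: "c \<in> frees (tot (Suc n))"
 proof (rule additive_map_closedI[OF c D_additive])
  fix b assume "b \<in> tot (Suc n)"
  then obtain p where p: "p \<le> Suc n" "b \<in> \<beta> p (Suc n - p)" by (auto simp: strip_def tot_def)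
  show "D (frag_of b) \<in> frees (tot n)"
  proof (cases p)
   case 0
   then have "dh (frag_of b) = 0" "dv (frag_of b) \<in> frees (\<beta> 0 n)"
    using p dh_bottom dv_closed by auto
   then show ?thesis by (auto simp: D_def tot_def strip_def elim!: frees_mono)
  next
   case (Suc m)
   then have "p \<in> {Suc 0..Suc n}" using p by auto
   then have "frag_of b \<in> frees (strip (Suc 0) (Suc n))" using p unfolding strip_def by auto
   from D_strip[OF this] show ?thesis by (simp add: tot_def)
  qed
 qed
 show "D c = 0" if c: "c \<in> frees (tot 0)"
  by (rule additive_map_zeroI[OF c D_additive])
   (auto simp: tot_def strip_def D_def dh_bottom dv_bottom)
 show "D (D c) = 0" if c: "c \<in> frees (tot n)"
 proof (rule additive_map_zeroI[OF c additive_map_comp[OF D_additive D_additive]])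
  fix b assume "b \<in> tot n"
  then obtain p where "b \<in> \<beta> p (n - p)" by (auto simp: strip_def tot_def)
  then show "D (D (frag_of b)) = 0"
   by (simp add: D_def additive_map_add[OF dh_additive] additive_map_add[OF dv_additive]
     dh_dh dv_dv dh_dv)
 qed
qed

end

text \<open>If the augmented rows of a double complex are exact, then the total complex resolves the
 augmentation: a lift is built one column at a time, the exactness of the rows taking care of
 the remaining error.\<close>

locale augmented_double_complex = double_complex \<beta> dh dv + R: chain_complex R E
 for \<beta> :: "nat => nat => 'b set" and dh dv and R :: "nat => 'r set" and E +
 fixes \<epsilon> :: "('b \<Rightarrow>\<^sub>0 int) => ('r \<Rightarrow>\<^sub>0 int)"
 assumes \<epsilon>_additive: "additive_map \<epsilon>"
  and \<epsilon>_closed: "b \<in> \<beta> 0 q ==> \<epsilon> (frag_of b) \<in> frees (R q)"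
  and \<epsilon>_zero: "b \<in> \<beta> (Suc p) q ==> \<epsilon> (frag_of b) = 0"
  and \<epsilon>_dv: "b \<in> \<beta> 0 q ==> \<epsilon> (dv (frag_of b)) = E (\<epsilon> (frag_of b))"
  and \<epsilon>_dh: "b \<in> \<beta> 1 q ==> \<epsilon> (dh (frag_of b)) = 0"
  and exact: "c \<in> frees (\<beta> (Suc p) q) ==> dh c = 0 ==> \<exists>c'\<in>frees (\<beta> (Suc (Suc p)) q). dh c' = c"
  and exact_0: "c \<in> frees (\<beta> 0 q) ==> \<epsilon> c = 0 ==> \<exists>c'\<in>frees (\<beta> 1 q). dh c' = c"
  and \<epsilon>_surj: "r \<in> frees (R q) ==> \<exists>c\<in>frees (\<beta> 0 q). \<epsilon> c = r"
begin

lemma \<epsilon>_zero_strip: "c \<in> frees (strip (Suc m) n) ==> \<epsilon> c = 0"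
proof (erule additive_map_zeroI[OF _ \<epsilon>_additive])
 fix b assume "b \<in> strip (Suc m) n"
 then obtain p where p: "p \<in> {Suc m..n}" "b \<in> \<beta> p (n - p)" by (auto simp: strip_def)
 then obtain p' where "p = Suc p'" by (cases p) auto
 then show "\<epsilon> (frag_of b) = 0" using p \<epsilon>_zero by blast
qed

sublocale tot: chain_complex tot D by (rule chain_complex_tot)

lemma complex_map_\<epsilon>: "complex_map tot D R E \<epsilon>"
proof
 show "additive_map \<epsilon>" by (rule \<epsilon>_additive)
 show "\<epsilon> c \<in> frees (R n)" if c: "c \<in> frees (tot n)" for c n
 proof (rule additive_map_closedI[OF c \<epsilon>_additive])
  fix b assume "b \<in> tot n"
  then obtain p where p: "p \<le> n" "b \<in> \<beta> p (n - p)" by (auto simp: strip_def tot_def)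
  then show "\<epsilon> (frag_of b) \<in> frees (R n)"
   using \<epsilon>_closed \<epsilon>_zero by (cases p) auto
 qed
 show "\<epsilon> (D c) = E (\<epsilon> c)" if c: "c \<in> frees (tot n)" for c n
 proof (rule additive_map_eqI[OF c additive_map_comp[OF \<epsilon>_additive D_additive]
    additive_map_comp[OF R.D_additive \<epsilon>_additive]])
  fix b assume "b \<in> tot n"
  then obtain p where p: "p \<le> n" "b \<in> \<beta> p (n - p)" by (auto simp: strip_def tot_def)
  show "\<epsilon> (D (frag_of b)) = E (\<epsilon> (frag_of b))"
  proof (cases p)
   case 0
   then show ?thesis
    using p dh_bottom \<epsilon>_dv by (simp add: D_def)
  next
   case (Suc m)
   have "\<epsilon> (dv (frag_of b)) = 0"
   proof (cases "n = p")
    case True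
    then show ?thesis using dv_bottom p by (simp add: additive_map_zero[OF \<epsilon>_additive])
   next
    case False
    then have "dv (frag_of b) \<in> frees (\<beta> p (n - 1 - p))"
     using p dv_closed[of b p "n - 1 - p"] by (auto simp: Suc_diff_Suc)
    then show ?thesis unfolding Suc by (rule additive_map_zeroI[OF _ \<epsilon>_additive]) (rule \<epsilon>_zero)
   qed
   moreover have "\<epsilon> (dh (frag_of b)) = 0"
   proof (cases m)
    case 0
    then show ?thesis using \<epsilon>_dh p Suc by simp
   next
    case (Suc m')
    then have "dh (frag_of b) \<in> frees (\<beta> (Suc m') (n - p))" using p \<open>p = Suc m\<close> dh_closed by simp
    then show ?thesis by (rule additive_map_zeroI[OF _ \<epsilon>_additive]) (rule \<epsilon>_zero)
   qed
   ultimately show ?thesis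
    using p Suc \<epsilon>_zero
    by (simp add: D_def additive_map_add[OF \<epsilon>_additive] additive_map_zero[OF R.D_additive])
  qed
 qed
qed

lemma lift_step:
 assumes w: "w \<in> frees (strip m n)" "D w = 0" "m = 0 ==> \<epsilon> w = 0" and m: "m \<le> n"
 shows "\<exists>v\<in>frees (\<beta> (Suc m) (n - m)). w - D v \<in> frees (strip (Suc m) n)"
proof -
 have "strip m n = \<beta> m (n - m) \<union> strip (Suc m) n"
 proof -
  have "{m..n} = insert m {Suc m..n}" using m by auto
  then show ?thesis by (simp add: strip_def)
 qed
 then obtain a b where ab: "a \<in> frees (\<beta> m (n - m))" "b \<in> frees (strip (Suc m) n)" "w = a + b"
  using w(1) frees_split by metis
 have "\<exists>v\<in>frees (\<beta> (Suc m) (n - m)). dh v = a"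
 proof (cases m)
  case 0
  have "\<epsilon> a = 0"
   using w(3)[OF 0] \<epsilon>_zero_strip[OF ab(2)] ab(3) by (simp add: additive_map_add[OF \<epsilon>_additive])
  then show ?thesis using exact_0 ab(1) 0 by simp
 next
  case (Suc m')
  have "dh a = 0"
  proof (rule frees_disjoint_zero)
   show "dh a \<in> frees (\<beta> m' (n - m))" using dh_closed' ab(1) Suc by simp
   have "dv a \<in> frees (strip m (n - 1))"
   proof (cases "n = m")
    case True
    then show ?thesis using dv_bottom'[of a m] ab(1) by simp
   next
    case False
    then have "dv a \<in> frees (\<beta> m (n - 1 - m))" "m \<in> {m..n - 1}"
     using m dv_closed'[of a m "n - 1 - m"] ab(1) by (auto simp: Suc_diff_Suc)
    then show ?thesis unfolding strip_def frees_def by blast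
   qed
   then show "dv a + D b \<in> frees (strip m (n - 1))" using D_strip[OF ab(2)] by blast
   show "\<beta> m' (n - m) \<inter> strip m (n - 1) = {}"
    using disjoint[of m' "n - m"] Suc by (fastforce simp: strip_def)
   show "dh a + (dv a + D b) = 0"
    using w(2) ab(3) by (simp add: additive_map_add[OF D_additive]) (simp add: D_def add.assoc)
  qed
  then show ?thesis using exact ab(1) Suc by simp
 qed
 then obtain v where v: "v \<in> frees (\<beta> (Suc m) (n - m))" "dh v = a" by blast
 have "dv v \<in> frees (strip (Suc m) n)"
 proof (cases "n = m")
  case True
  then show ?thesis using dv_bottom'[of v "Suc m"] v(1) by simp
 next
  case False
  then have "dv v \<in> frees (\<beta> (Suc m) (n - Suc m))" "Suc m \<in> {Suc m..n}"
   using m dv_closed'[of v "Suc m" "n - Suc m"] v(1) by (auto simp: Suc_diff_Suc)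
  then show ?thesis unfolding strip_def frees_def by blast
 qed
 moreover have "w - D v = b - dv v" using ab(3) v(2) by (simp add: D_def)
 ultimately show ?thesis using frees_diff[OF ab(2)] v(1) by metis
qed

theorem trivial_fibration_\<epsilon>: "trivial_fibration tot D R E \<epsilon>"
proof (rule trivial_fibration.intro[OF complex_map_\<epsilon>], unfold_locales)
 interpret complex_map tot D R E \<epsilon> by (rule complex_map_\<epsilon>)
 show "\<exists>z\<in>frees (tot 0). \<epsilon> z = r" if "r \<in> frees (R 0)" for r
  using \<epsilon>_surj[OF that] by (simp add: tot_def strip_def)
 fix z r n
 assume z: "z \<in> frees (tot n)" and r: "r \<in> frees (R (Suc n))" and "D z = 0" and Er: "E r = \<epsilon> z"
 have "\<exists>z'\<in>frees (tot (Suc n)). \<epsilon> z' = r & z - D z' \<in> frees (strip m n)" if "m \<le> Suc n" for m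
  using that
 proof (induction m)
  case 0
  obtain c where c: "c \<in> frees (\<beta> 0 (Suc n))" "\<epsilon> c = r" using \<epsilon>_surj[OF r] by blast
  then have c': "c \<in> frees (tot (Suc n))" by (auto simp: tot_def strip_def elim!: frees_mono)
  have "z - D c \<in> frees (strip 0 n)" using z tot.D_closed[OF c'] by (auto simp: tot_def)
  then show ?case using c c' by blast
 next
  case (Suc m)
  then obtain z' where z': "z' \<in> frees (tot (Suc n))" "\<epsilon> z' = r" "z - D z' \<in> frees (strip m n)"
   by auto
  have "\<epsilon> (z - D z') = 0"
   using f_commutes[OF z'(1)] z'(2) Er by (simp add: additive_map_diff[OF \<epsilon>_additive])
  moreover have "D (z - D z') = 0"
   using tot.D_D[OF z'(1)] \<open>D z = 0\<close> by (simp add: additive_map_diff[OF D_additive])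
  ultimately obtain v where v: "v \<in> frees (\<beta> (Suc m) (n - m))"
   "z - D z' - D v \<in> frees (strip (Suc m) n)"
   using lift_step[OF z'(3)] Suc.prems by auto
  have "Suc m \<in> {0..Suc n}" "Suc n - Suc m = n - m" using Suc.prems by auto
  then have "v \<in> frees (tot (Suc n))"
   using v(1) unfolding tot_def strip_def frees_def by fastforce
  moreover have "\<epsilon> v = 0" using v(1) by (rule additive_map_zeroI[OF _ \<epsilon>_additive]) (rule \<epsilon>_zero)
  ultimately show ?case
   using v(2) z'(1,2)
   by (intro bexI[of _ "z' + v"])
    (auto simp: additive_map_add[OF \<epsilon>_additive] additive_map_add[OF D_additive] algebra_simps)
 qed
 from this[of "Suc n"] obtain z' where "z' \<in> frees (tot (Suc n))" "\<epsilon> z' = r"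
  "z - D z' \<in> frees (strip (Suc n) n)" by blast
 moreover have "strip (Suc n) n = {}" by (simp add: strip_def)
 ultimately show "\<exists>z'\<in>frees (tot (Suc n)). D z' = z & \<epsilon> z' = r"
  using frees_empty by fastforce
qed

end

section \<open>Normalized quandle chains\<close>

text \<open>The degenerate tuples are set to zero by working with the tuples without equal neighbours;
 prepending an entry then gives zero whenever it would create equal neighbours.\<close>

definition ncons :: "'a => 'a list => ('a list \<Rightarrow>\<^sub>0 int)" where
 "ncons x ys = (if ys \<noteq> [] & hd ys = x then 0 else frag_of (x # ys))"

abbreviation Ncons :: "'a => ('a list \<Rightarrow>\<^sub>0 int) => ('a list \<Rightarrow>\<^sub>0 int)" where
 "Ncons x \<equiv> frag_extend (ncons x)"

definition nmap :: "('a => 'b) => 'a list => ('b list \<Rightarrow>\<^sub>0 int)" where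
 "nmap f xs = (if distinct_adj (map f xs) then frag_of (map f xs) else 0)"

abbreviation Nmap :: "('a => 'b) => ('a list \<Rightarrow>\<^sub>0 int) => ('b list \<Rightarrow>\<^sub>0 int)" where
 "Nmap f \<equiv> frag_extend (nmap f)"

primrec nbd :: "('a, 'm) magma_scheme => 'a list => ('a list \<Rightarrow>\<^sub>0 int)" where
 "nbd X [] = 0"
| "nbd X (x # xs) = frag_of (map (lact X x) xs) - frag_of xs - Ncons x (nbd X xs)"

abbreviation Nbd :: "('a, 'm) magma_scheme => ('a list \<Rightarrow>\<^sub>0 int) => ('a list \<Rightarrow>\<^sub>0 int)" where
 "Nbd X \<equiv> frag_extend (nbd X)"

definition ntuples :: "('a, 'm) magma_scheme => 'a list set" where
 "ntuples X = {xs. set xs \<subseteq> carrier X & distinct_adj xs}"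

definition ntuples_of :: "('a, 'm) magma_scheme => nat => 'a list set" where
 "ntuples_of X n = {xs \<in> ntuples X. length xs = n}"

lemma ntuples_of_sub: "ntuples_of X n \<subseteq> ntuples X"
 by (auto simp: ntuples_of_def)

lemma frees_ntuples_of: "c \<in> frees (ntuples_of X n) ==> c \<in> frees (ntuples X)"
 by (erule frees_mono[OF _ ntuples_of_sub])

lemma ntuples_Nil [simp]: "[] \<in> ntuples X"
 by (simp add: ntuples_def)

lemma ntuples_ConsD: "x # xs \<in> ntuples X ==> x \<in> carrier X & xs \<in> ntuples X"
 by (auto simp: ntuples_def dest: distinct_adj_ConsD)

lemma ncons_closed:
 "[|x \<in> carrier X; xs \<in> ntuples_of X n|] ==> ncons x xs \<in> frees (ntuples_of X (Suc n))"
 by (auto simp: ncons_def ntuples_of_def ntuples_def distinct_adj_Cons)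

lemma ncons_closed': "[|x \<in> carrier X; xs \<in> ntuples X|] ==> ncons x xs \<in> frees (ntuples X)"
 by (auto simp: ncons_def ntuples_def distinct_adj_Cons)

lemma Ncons_closed:
 "[|x \<in> carrier X; c \<in> frees (ntuples_of X n)|] ==> Ncons x c \<in> frees (ntuples_of X (Suc n))"
 by (rule additive_map_closedI) (auto intro: ncons_closed)

lemma Ncons_ncons [simp]: "Ncons x (ncons x xs) = 0"
 by (simp add: ncons_def)

lemma Ncons_Ncons: "Ncons x (Ncons x c) = 0"
 by (rule additive_map_zeroI[where S = UNIV and f = "%c. Ncons x (Ncons x c)"])
  (auto simp: frees_def)

lemma ncons_ntuple: "x # xs \<in> ntuples X ==> ncons x xs = frag_of (x # xs)"
 by (auto simp: ncons_def ntuples_def distinct_adj_Cons)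

lemma nmap_Nil [simp]: "nmap f [] = frag_of []"
 by (simp add: nmap_def)

lemma nmap_Cons: "nmap f (x # xs) = Ncons (f x) (nmap f xs)"
 by (cases xs) (auto simp: nmap_def ncons_def distinct_adj_Cons)

lemma Nmap_ncons: "Nmap f (ncons x xs) = Ncons (f x) (nmap f xs)"
 by (cases xs) (auto simp: nmap_def ncons_def distinct_adj_Cons)

lemma Nmap_Ncons: "Nmap f (Ncons x c) = Ncons (f x) (Nmap f c)"
 by (rule additive_map_eqI[where S = UNIV and f = "%c. Nmap f (Ncons x c)" and g = "%c. Ncons (f x) (Nmap f c)"])
  (auto simp: frees_def Nmap_ncons)

lemma Nmap_nmap: "Nmap g (nmap f xs) = nmap (g \<circ> f) xs"
 by (auto simp: nmap_def distinct_adj_conv_nth)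

lemma Nmap_Nmap: "Nmap g (Nmap f c) = Nmap (g \<circ> f) c"
 by (rule additive_map_eqI[where S = UNIV and f = "%c. Nmap g (Nmap f c)"])
  (auto simp: frees_def Nmap_nmap comp_def)

lemma nmap_cong: "(\<And>x. x \<in> set xs ==> f x = g x) ==> nmap f xs = nmap g xs"
 by (simp add: nmap_def cong: map_cong)

lemma Nmap_cong:
 assumes "c \<in> frees S" "\<And>xs x. xs \<in> S ==> x \<in> set xs ==> f x = g x"
 shows "Nmap f c = Nmap g c"
 by (rule additive_map_eqI[OF assms(1)]) (auto intro!: nmap_cong assms(2))

lemma nmap_closed:
 assumes "f \<in> carrier X \<rightarrow> carrier Y" "xs \<in> ntuples_of X n"
 shows "nmap f xs \<in> frees (ntuples_of Y n)"
 using assms by (auto simp: nmap_def ntuples_of_def ntuples_def)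

lemma Nmap_closed:
 assumes "f \<in> carrier X \<rightarrow> carrier Y" "c \<in> frees (ntuples_of X n)"
 shows "Nmap f c \<in> frees (ntuples_of Y n)"
 by (rule additive_map_closedI[OF assms(2)]) (auto intro: nmap_closed[OF assms(1)])

lemma Nmap_closed':
 assumes "f \<in> carrier X \<rightarrow> carrier Y" "c \<in> frees (ntuples X)"
 shows "Nmap f c \<in> frees (ntuples Y)"
 by (rule additive_map_closedI[OF assms(2)]) (use assms(1) in \<open>auto simp: nmap_def ntuples_def\<close>)

lemma Nmap_id: "c \<in> frees (ntuples X) ==> (\<And>x. x \<in> carrier X ==> f x = x) ==> Nmap f c = c"
proof (rule additive_map_eqI[where g = "%c. c" and S = "ntuples X"])
 fix xs assume "xs \<in> ntuples X" and f: "\<And>x. x \<in> carrier X ==> f x = x"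
 then have "map f xs = xs" "distinct_adj xs" by (auto simp: ntuples_def intro!: map_idI)
 then show "Nmap f (frag_of xs) = frag_of xs" by (simp add: nmap_def)
qed auto

context quandle
begin

lemma lact_hom: "x \<in> carrier X ==> lact X x \<in> quandle_hom X X"
 by (auto simp: quandle_hom_def intro: lact_distrib)

lemma lact_inj: "[|x \<in> carrier X; y \<in> carrier X; z \<in> carrier X|] ==> x \<rhd> y = x \<rhd> z \<longleftrightarrow> y = z"
 using lact_bij[of x] by (auto simp: bij_betw_def inj_on_def)

lemma map_lact_ntuples:
 assumes "x \<in> carrier X"
 shows "xs \<in> ntuples X ==> map (lact X x) xs \<in> ntuples X"
  and "xs \<in> ntuples_of X n ==> map (lact X x) xs \<in> ntuples_of X n"
proof -
 have "distinct_adj (map (lact X x) xs)" if "xs \<in> ntuples X"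
  using that assms unfolding ntuples_def distinct_adj_conv_nth
  by (auto simp: lact_inj subset_iff)
 then show *: "xs \<in> ntuples X ==> map (lact X x) xs \<in> ntuples X"
  using assms by (auto simp: ntuples_def)
 then show "xs \<in> ntuples_of X n ==> map (lact X x) xs \<in> ntuples_of X n"
  by (auto simp: ntuples_of_def)
qed

lemma nmap_lact: "[|x \<in> carrier X; xs \<in> ntuples X|] ==> nmap (lact X x) xs = frag_of (map (lact X x) xs)"
 using map_lact_ntuples(1) by (auto simp: nmap_def ntuples_def)

lemma nbd_closed: "xs \<in> ntuples_of X (Suc n) ==> nbd X xs \<in> frees (ntuples_of X n)"
proof (induction xs arbitrary: n)
 case (Cons x xs)
 then have x: "x \<in> carrier X" "xs \<in> ntuples_of X n"
  using ntuples_ConsD[of x xs X] by (simp_all add: ntuples_of_def)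
 then have "Ncons x (nbd X xs) \<in> frees (ntuples_of X n)"
 proof (cases n)
  case (Suc m)
  then show ?thesis using Ncons_closed[OF x(1) Cons.IH[of m]] x(2) by simp
 qed (use x in \<open>simp add: ntuples_of_def\<close>)
 then show ?case
  unfolding nbd.simps using map_lact_ntuples(2)[OF x] x by (intro frees_diff) simp_all
qed simp

lemma Nbd_closed: "c \<in> frees (ntuples_of X (Suc n)) ==> Nbd X c \<in> frees (ntuples_of X n)"
 by (rule additive_map_closedI) (auto intro: nbd_closed)

lemma nbd_closed': "xs \<in> ntuples X ==> nbd X xs \<in> frees (ntuples X)"
 using nbd_closed[of xs "length xs - 1"] by (cases xs) (auto simp: ntuples_of_def elim!: frees_mono)

text \<open>The recursion for the boundary survives normalization, because \<open>x \<rhd> x = x\<close>.\<close>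

lemma Nbd_ncons:
 assumes "x \<in> carrier X" "xs \<in> ntuples X"
 shows "Nbd X (ncons x xs) = frag_of (map (lact X x) xs) - frag_of xs - Ncons x (nbd X xs)"
proof (cases "xs \<noteq> [] & hd xs = x")
 case True
 then obtain zs where zs: "xs = x # zs" by (cases xs) auto
 then have z: "zs \<in> ntuples X" using assms zs ntuples_ConsD by metis
 have d: "zs = [] \<or> hd zs \<noteq> x" using assms zs by (auto simp: ntuples_def distinct_adj_Cons)
 have "ncons x zs = frag_of (x # zs)" using d by (auto simp: ncons_def)
 moreover have "ncons x (map (lact X x) zs) = frag_of (x # map (lact X x) zs)"
 proof (cases zs)
  case (Cons z ws)
  then have "z \<in> carrier X" "z \<noteq> x" using z d by (auto simp: ntuples_def)
  then have "x \<rhd> z \<noteq> x" using lact_inj[of x z x] assms(1) lact_idem by metis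
  then show ?thesis using Cons by (simp add: ncons_def)
 qed (simp add: ncons_def)
 ultimately have "Ncons x (nbd X xs) = frag_of (map (lact X x) xs) - frag_of xs"
  unfolding zs using lact_idem[OF assms(1)]
  by (simp add: frag_extend_diff Ncons_Ncons)
 then show ?thesis using True by (simp add: ncons_def)
next
 case False
 then have "ncons x xs = frag_of (x # xs)" by (auto simp: ncons_def)
 then show ?thesis by simp
qed

lemma Nbd_Ncons:
 assumes "x \<in> carrier X" "c \<in> frees (ntuples X)"
 shows "Nbd X (Ncons x c) = Nmap (lact X x) c - c - Ncons x (Nbd X c)"
proof (rule additive_map_eqI[OF assms(2)])
 show "additive_map (%c. Nbd X (Ncons x c))" by (rule additive_map_comp[OF additive_map_frag_extend additive_map_frag_extend])
 show "additive_map (%c. Nmap (lact X x) c - c - Ncons x (Nbd X c))"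
  by (intro additive_map_minus_map additive_map_comp[OF additive_map_frag_extend additive_map_frag_extend]
    additive_map_frag_extend additive_map_id)
qed (simp add: Nbd_ncons assms nmap_lact)

end

lemma nbd_natural:
 assumes "quandle X" "quandle Y" and f: "f \<in> quandle_hom X Y"
 shows "xs \<in> ntuples X ==> Nmap f (nbd X xs) = Nbd Y (nmap f xs)"
proof (induction xs)
 interpret X: quandle X by fact
 interpret Y: quandle Y by fact
 case (Cons x xs)
 then have x: "x \<in> carrier X" "xs \<in> ntuples X" using ntuples_ConsD[of x xs X] by simp_all
 have fx: "f x \<in> carrier Y" using f x quandle_hom_closed by metis
 have fxs: "nmap f xs \<in> frees (ntuples Y)"
  using Nmap_closed'[of f X Y "frag_of xs"] f x by (auto simp: quandle_hom_def)
 have "f (x \<rhd>\<^bsub>X\<^esub> y) = f x \<rhd>\<^bsub>Y\<^esub> f y" if "y \<in> set xs" for y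
  using that x(2) quandle_hom_lact[OF f x(1)] by (auto simp: ntuples_def)
 then have "map f (map (lact X x) xs) = map (lact Y (f x) \<circ> f) xs" by simp
 then have "nmap f (map (lact X x) xs) = nmap (lact Y (f x) \<circ> f) xs"
  by (simp only: nmap_def)
 also have "\<dots> = Nmap (lact Y (f x)) (nmap f xs)" by (simp add: Nmap_nmap)
 finally show ?case
  using Cons.IH[OF x(2)] Y.Nbd_Ncons[OF fx fxs]
  by (simp add: frag_extend_diff nmap_Cons Nmap_Ncons)
qed simp

lemma Nbd_natural:
 assumes "quandle X" "quandle Y" "f \<in> quandle_hom X Y" "c \<in> frees (ntuples X)"
 shows "Nmap f (Nbd X c) = Nbd Y (Nmap f c)"
 by (rule additive_map_eqI[OF assms(4) additive_map_comp[OF additive_map_frag_extend additive_map_frag_extend]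
    additive_map_comp[OF additive_map_frag_extend additive_map_frag_extend]])
  (simp_all add: nbd_natural[OF assms(1-3)])

context quandle
begin

lemma Nbd_nbd: "xs \<in> ntuples X ==> Nbd X (nbd X xs) = 0"
proof (induction xs)
 case (Cons x xs)
 then have x: "x \<in> carrier X" "xs \<in> ntuples X" using ntuples_ConsD[of x xs X] by simp_all
 have "nbd X (map (lact X x) xs) = Nmap (lact X x) (nbd X xs)"
  using nbd_natural[OF quandle_axioms quandle_axioms lact_hom[OF x(1)] x(2)] nmap_lact[OF x] by simp
 then show ?case
  using Cons.IH[OF x(2)] Nbd_Ncons[OF x(1) nbd_closed'[OF x(2)]] by (simp add: frag_extend_diff)
qed simp

lemma Nbd_Nbd: "c \<in> frees (ntuples X) ==> Nbd X (Nbd X c) = 0"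
 by (erule additive_map_zeroI[OF _ additive_map_comp[OF additive_map_frag_extend additive_map_frag_extend]]) (simp add: Nbd_nbd)

end

subsection \<open>Orbits\<close>

definition orbit :: "('a, 'm) magma_scheme => 'a => 'a set" where
 "orbit X y = {z. (y, z) \<in> ({(u, v). u \<in> carrier X & (\<exists>x\<in>carrier X. v = x \<rhd>\<^bsub>X\<^esub> u)} \<union> {(v, u). u \<in> carrier X & (\<exists>x\<in>carrier X. v = x \<rhd>\<^bsub>X\<^esub> u)})\<^sup>*}"

definition orbits :: "('a, 'm) magma_scheme => 'a set set" where
 "orbits X = orbit X ` carrier X"

lemma orbit_self: "y \<in> orbit X y"
 by (simp add: orbit_def)

lemma orbit_invariant:
 assumes "\<And>x y. [|x \<in> carrier X; y \<in> carrier X|] ==> f (x \<rhd>\<^bsub>X\<^esub> y) = f y" "z \<in> orbit X y"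
 shows "f z = f y"
 using assms(2) unfolding orbit_def mem_Collect_eq
 by (induction rule: rtrancl_induct) (auto simp: assms(1))

lemma orbit_eqI:
 assumes "z \<in> orbit X y"
 shows "orbit X z = orbit X y"
proof -
 let ?r = "{(u, v). u \<in> carrier X & (\<exists>x\<in>carrier X. v = x \<rhd>\<^bsub>X\<^esub> u)} \<union> {(v, u). u \<in> carrier X & (\<exists>x\<in>carrier X. v = x \<rhd>\<^bsub>X\<^esub> u)}"
 have "sym (?r\<^sup>*)" by (rule sym_rtrancl) (auto simp: sym_def)
 then show ?thesis
  using assms by (auto simp: orbit_def dest: symD intro: rtrancl_trans)
qed

lemma orbit_lact: "[|x \<in> carrier X; y \<in> carrier X|] ==> orbit X (x \<rhd>\<^bsub>X\<^esub> y) = orbit X y"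
 by (rule orbit_eqI) (auto simp: orbit_def)

section \<open>Quandle homology of free quandles\<close>

definition row_exact :: "('a, 'm) magma_scheme => bool" where
 "row_exact X \<longleftrightarrow>
  (\<forall>n. \<forall>c\<in>frees (ntuples_of X (Suc (Suc n))). Nbd X c = 0 -->
    (\<exists>c'\<in>frees (ntuples_of X (Suc (Suc (Suc n)))). Nbd X c' = c)) \<and>
  (\<forall>c\<in>frees (ntuples_of X 1). frag_extend (%xs. frag_of (orbit X (hd xs))) c = 0 -->
    (\<exists>c'\<in>frees (ntuples_of X 2). Nbd X c' = c))"

type_synonym 'a lifted = "'a \<times> ('a list => ('a list \<Rightarrow>\<^sub>0 int)) \<times> ('a list => ('a list \<Rightarrow>\<^sub>0 int))"

context quandle
begin

text \<open>A point of the lifted quandle is an element \<open>x\<close> with a chain homotopy \<open>T\<close> between the translation by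
 \<open>x\<close> and the identity (\<open>P1\<close>) and a homotopy \<open>\<sigma>\<close> between \<open>T\<close> and the particular such homotopy that
 prepends \<open>x\<close> (\<open>P3\<close>). The condition \<open>P2\<close> describes how \<open>\<sigma>\<close> changes under the translation by \<open>x\<close>; it is
 what makes the operation below idempotent. Along a section of the projection to \<open>x\<close>, that operation
 makes \<open>T\<close> a derivation in \<open>x\<close>.\<close>

definition P1 where
 "P1 x T ys = Nbd X (T ys) + frag_extend T (nbd X ys) - (frag_of (map (lact X x) ys) - frag_of ys)"

definition P2 where
 "P2 x T \<sigma> ys = \<sigma> (map (lact X x) ys) - \<sigma> ys - frag_extend T (ncons x ys)"

definition P3 where
 "P3 x T \<sigma> ys = Nbd X (\<sigma> ys) - frag_extend \<sigma> (nbd X ys) - ncons x ys + T ys"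

definition shape where
 "shape x T \<sigma> n ys \<longleftrightarrow> T ys \<in> frees (ntuples_of X (Suc n)) & \<sigma> ys \<in> frees (ntuples_of X (Suc (Suc n))) \<and>
  (ys \<noteq> [] & hd ys = x --> \<sigma> ys = 0)"

definition lifted :: "'a lifted set" where
 "lifted = {(x, T, \<sigma>). x \<in> carrier X & (\<forall>ys. ys \<notin> ntuples X --> T ys = 0 & \<sigma> ys = 0) \<and>
  (\<forall>n. \<forall>ys\<in>ntuples_of X n. shape x T \<sigma> n ys) \<and>
  (\<forall>ys\<in>ntuples X. P1 x T ys = 0 & P2 x T \<sigma> ys = 0 & P3 x T \<sigma> ys = 0)}"

definition related :: "'a lifted => 'a lifted => 'a lifted => bool" where
 "related = (%(x, T, \<sigma>) (y, T', \<sigma>') (z, T'', \<sigma>''). z = x \<rhd> y \<and>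
  (\<forall>ys\<in>ntuples X. T'' (map (lact X x) ys) = T (map (lact X y) ys) - T ys + T' ys \<and>
    \<sigma>'' (map (lact X x) ys) = \<sigma>' ys + frag_extend T (ncons y ys)))"

lemma map_lact_lact:
 assumes "x \<in> carrier X" "y \<in> carrier X" "ys \<in> ntuples X"
 shows "map (lact X (x \<rhd> y)) (map (lact X x) ys) = map (lact X x) (map (lact X y) ys)"
 using assms lact_distrib[OF assms(1,2)] by (auto simp: ntuples_def)

lemma Nmap_ncons_lact:
 assumes "x \<in> carrier X" "y \<in> carrier X" "ys \<in> ntuples X"
 shows "Nmap (lact X x) (ncons y ys) = ncons (x \<rhd> y) (map (lact X x) ys)"
 using nmap_lact[OF assms(1,3)] by (simp add: Nmap_ncons)

lemma nbd_map_lact: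
 assumes "x \<in> carrier X" "ys \<in> ntuples X"
 shows "nbd X (map (lact X x) ys) = Nmap (lact X x) (nbd X ys)"
 using nbd_natural[OF quandle_axioms quandle_axioms lact_hom[OF assms(1)] assms(2)] nmap_lact[OF assms]
 by simp

lemma related_extend:
 assumes r: "related (x, T, \<sigma>) (y, T', \<sigma>') (z, T'', \<sigma>'')" and "x \<in> carrier X" "y \<in> carrier X"
  and c: "c \<in> frees (ntuples X)"
 shows "frag_extend T'' (Nmap (lact X x) c)
   = frag_extend T (Nmap (lact X y) c) - frag_extend T c + frag_extend T' c"
  and "frag_extend \<sigma>'' (Nmap (lact X x) c) = frag_extend \<sigma>' c + frag_extend T (Ncons y c)"
proof -
 show "frag_extend T'' (Nmap (lact X x) c)
   = frag_extend T (Nmap (lact X y) c) - frag_extend T c + frag_extend T' c"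
  using c
  by (induction rule: frees_induct)
   (use r assms(2,3) in \<open>simp_all add: frag_extend_diff nmap_lact related_def\<close>)
 show "frag_extend \<sigma>'' (Nmap (lact X x) c) = frag_extend \<sigma>' c + frag_extend T (Ncons y c)"
  using c
  by (induction rule: frees_induct)
   (use r assms(2,3) in \<open>simp_all add: frag_extend_diff nmap_lact related_def\<close>)
qed

lemma P1_extend:
 assumes "\<And>ys. ys \<in> ntuples X ==> P1 x T ys = 0" "x \<in> carrier X" "c \<in> frees (ntuples X)"
 shows "Nbd X (frag_extend T c) = Nmap (lact X x) c - c - frag_extend T (Nbd X c)"
 using assms(3)
proof (induction rule: frees_induct)
 case (of ys)
 then show ?case using assms(1)[OF of] nmap_lact[OF assms(2) of] by (simp add: P1_def algebra_simps)
qed (simp_all add: frag_extend_diff)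

lemma P_transfer:
 assumes r: "related (x, T, \<sigma>) (y, T', \<sigma>') (z, T'', \<sigma>'')" and x: "x \<in> carrier X" "y \<in> carrier X"
  and P1: "\<And>ys. ys \<in> ntuples X ==> P1 x T ys = 0" and ys: "ys \<in> ntuples X"
 shows "P1 z T'' (map (lact X x) ys) = P1 y T' ys"
  and "P2 z T'' \<sigma>'' (map (lact X x) ys) = P2 y T' \<sigma>' ys"
  and "P3 z T'' \<sigma>'' (map (lact X x) ys) = P3 y T' \<sigma>' ys"
proof -
 have z: "z = x \<rhd> y" using r by (simp add: related_def)
 have T'': "T'' (map (lact X x) ys) = T (map (lact X y) ys) - T ys + T' ys"
  and \<sigma>'': "\<sigma>'' (map (lact X x) ys) = \<sigma>' ys + frag_extend T (ncons y ys)"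
  if "ys \<in> ntuples X" for ys
  using r that by (simp_all add: related_def)
 have yys: "map (lact X y) ys \<in> ntuples X" using map_lact_ntuples(1)[OF x(2) ys] .
 have nc: "ncons y ys \<in> frees (ntuples X)" by (rule ncons_closed'[OF x(2) ys])
 have zx: "map (lact X z) (map (lact X x) ys) = map (lact X x) (map (lact X y) ys)"
  unfolding z by (rule map_lact_lact[OF x ys])
 have nb: "nbd X (map (lact X x) ys) = Nmap (lact X x) (nbd X ys)"
  "nbd X (map (lact X y) ys) = Nmap (lact X y) (nbd X ys)"
  by (rule nbd_map_lact[OF x(1) ys], rule nbd_map_lact[OF x(2) ys])
 have ncz: "ncons z (map (lact X x) ys) = Nmap (lact X x) (ncons y ys)"
  unfolding z using Nmap_ncons_lact[OF x ys] by simp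
 have ncy: "ncons y (map (lact X y) ys) = Nmap (lact X y) (ncons y ys)"
  using Nmap_ncons_lact[OF x(2,2) ys] lact_idem[OF x(2)] by simp
 note ext = related_extend[OF r x]
 note extn = ext[OF nbd_closed'[OF ys]] and extc = ext[OF nc]
 show "P1 z T'' (map (lact X x) ys) = P1 y T' ys"
  using P1[OF ys] P1[OF yys]
  unfolding P1_def zx T''[OF ys] nb extn(1) by (simp add: frag_extend_diff frag_extend_add algebra_simps)
 show "P2 z T'' \<sigma>'' (map (lact X x) ys) = P2 y T' \<sigma>' ys"
  unfolding P2_def zx \<sigma>''[OF ys] \<sigma>''[OF yys] ncz extc(1) ncy by (simp add: algebra_simps)
 have "Nbd X (frag_extend T (ncons y ys))
   = Nmap (lact X x) (ncons y ys) - ncons y ys - frag_extend T (Nbd X (ncons y ys))"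
  by (rule P1_extend[OF P1 x(1) nc])
 then show "P3 z T'' \<sigma>'' (map (lact X x) ys) = P3 y T' \<sigma>' ys"
  unfolding P3_def \<sigma>''[OF ys] T''[OF ys] nb extn(2) ncz Nbd_ncons[OF x(2) ys]
  by (simp add: frag_extend_diff frag_extend_add algebra_simps)
qed

lemma ntuples_image:
 assumes "x \<in> carrier X"
 shows "map (lact X x) ` ntuples X = ntuples X" "map (lact X x) ` ntuples_of X n = ntuples_of X n"
proof -
 have 1: "\<exists>ys. ys \<in> ntuples X & length ys = length zs & zs = map (lact X x) ys" if "zs \<in> ntuples X" for zs
 proof (intro exI conjI)
  let ?ys = "map (ldiv X x) zs"
  have 1: "map (lact X x) ?ys = zs" using assms that by (auto simp: ntuples_def intro!: map_idI)
  have "distinct_adj (map (lact X x) ?ys)" using 1 that by (simp add: ntuples_def)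
  then have "distinct_adj ?ys" by (auto simp: distinct_adj_conv_nth)
  then show "?ys \<in> ntuples X" using assms that by (auto simp: ntuples_def)
  show "zs = map (lact X x) ?ys" by (rule 1[symmetric])
  show "length ?ys = length zs" by (rule length_map)
 qed
 show "map (lact X x) ` ntuples X = ntuples X"
  using 1 map_lact_ntuples(1)[OF assms] by (intro equalityI subsetI) (auto simp: image_iff)
 show "map (lact X x) ` ntuples_of X n = ntuples_of X n"
  using 1 map_lact_ntuples(2)[OF assms, of _ n]
  by (intro equalityI subsetI) (auto simp: image_iff ntuples_of_def)
qed

lemma shape_transfer:
 assumes r: "related (x, T, \<sigma>) (y, T', \<sigma>') (z, T'', \<sigma>'')" and x: "x \<in> carrier X" "y \<in> carrier X"
  and ys: "ys \<in> ntuples_of X n" and sh: "\<And>n ys. ys \<in> ntuples_of X n ==> shape x T \<sigma> n ys"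
 shows "shape z T'' \<sigma>'' n (map (lact X x) ys) \<longleftrightarrow> shape y T' \<sigma>' n ys"
proof -
 have z: "z = x \<rhd> y" using r by (simp add: related_def)
 have ys': "ys \<in> ntuples X" using ys by (simp add: ntuples_of_def)
 have T'': "T'' (map (lact X x) ys) = T (map (lact X y) ys) - T ys + T' ys"
  and \<sigma>'': "\<sigma>'' (map (lact X x) ys) = \<sigma>' ys + frag_extend T (ncons y ys)"
  using r ys' by (simp_all add: related_def)
 have 1: "T (map (lact X y) ys) - T ys \<in> frees (ntuples_of X (Suc n))" (is "?a \<in> _")
  using sh[OF ys] sh[OF map_lact_ntuples(2)[OF x(2) ys]] by (auto simp: shape_def)
 have 2: "frag_extend T (ncons y ys) \<in> frees (ntuples_of X (Suc (Suc n)))"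
  by (rule additive_map_closedI[OF ncons_closed[OF x(2) ys]]) (use sh in \<open>auto simp: shape_def\<close>)
 have 3: "?a + T' ys \<in> frees (ntuples_of X (Suc n)) \<longleftrightarrow> T' ys \<in> frees (ntuples_of X (Suc n))"
  using frees_diff[OF _ 1, of "?a + T' ys"] frees_add[OF 1, of "T' ys"] by auto
 have 4: "\<sigma>' ys + frag_extend T (ncons y ys) \<in> frees (ntuples_of X (Suc (Suc n)))
   \<longleftrightarrow> \<sigma>' ys \<in> frees (ntuples_of X (Suc (Suc n)))"
  using frees_diff[OF _ 2, of "\<sigma>' ys + frag_extend T (ncons y ys)"] frees_add[OF _ 2, of "\<sigma>' ys"] by auto
 have 5: "map (lact X x) ys \<noteq> [] & hd (map (lact X x) ys) = z \<longleftrightarrow> ys \<noteq> [] & hd ys = y"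
  unfolding z using ys' x by (cases ys) (auto simp: ntuples_def lact_inj)
 have 6: "ys \<noteq> [] & hd ys = y ==> frag_extend T (ncons y ys) = 0" by (simp add: ncons_def)
 show ?thesis unfolding shape_def T'' \<sigma>'' 3 4 5 using 6 by auto
qed

lemma lifted_transfer:
 assumes r: "related (x, T, \<sigma>) (y, T', \<sigma>') (z, T'', \<sigma>'')" and x: "(x, T, \<sigma>) \<in> lifted" and y: "y \<in> carrier X"
  and out: "\<forall>ys. ys \<notin> ntuples X --> T' ys = 0 & \<sigma>' ys = 0" "\<forall>ys. ys \<notin> ntuples X --> T'' ys = 0 & \<sigma>'' ys = 0"
 shows "(z, T'', \<sigma>'') \<in> lifted \<longleftrightarrow> (y, T', \<sigma>') \<in> lifted"
proof -
 have xc: "x \<in> carrier X" and P1: "\<And>ys. ys \<in> ntuples X ==> P1 x T ys = 0"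
  and sh: "\<And>n ys. ys \<in> ntuples_of X n ==> shape x T \<sigma> n ys"
  using x by (auto simp: lifted_def)
 have z: "z \<in> carrier X" using r xc y by (simp add: related_def)
 have A: "(\<forall>ys\<in>ntuples X. Q ys) \<longleftrightarrow> (\<forall>ys\<in>ntuples X. Q (map (lact X x) ys))" for Q
 proof -
  have "(\<forall>ys\<in>map (lact X x) ` ntuples X. Q ys) \<longleftrightarrow> (\<forall>ys\<in>ntuples X. Q (map (lact X x) ys))"
   by (rule ball_simps)
  then show ?thesis unfolding ntuples_image(1)[OF xc] .
 qed
 have B: "(\<forall>n. \<forall>ys\<in>ntuples_of X n. Q n ys) \<longleftrightarrow> (\<forall>n. \<forall>ys\<in>ntuples_of X n. Q n (map (lact X x) ys))" for Q
 proof -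
  have "(\<forall>ys\<in>map (lact X x) ` ntuples_of X n. Q n ys) \<longleftrightarrow> (\<forall>ys\<in>ntuples_of X n. Q n (map (lact X x) ys))" for n
   by (rule ball_simps)
  then show ?thesis unfolding ntuples_image(2)[OF xc] by simp
 qed
 have 1: "(\<forall>n. \<forall>ys\<in>ntuples_of X n. shape z T'' \<sigma>'' n ys) \<longleftrightarrow> (\<forall>n. \<forall>ys\<in>ntuples_of X n. shape y T' \<sigma>' n ys)"
  by (subst B) (intro all_cong1 ball_cong HOL.refl shape_transfer[OF r xc y _ sh])
 have 2: "(\<forall>ys\<in>ntuples X. P1 z T'' ys = 0 & P2 z T'' \<sigma>'' ys = 0 & P3 z T'' \<sigma>'' ys = 0) \<longleftrightarrow>
  (\<forall>ys\<in>ntuples X. P1 y T' ys = 0 & P2 y T' \<sigma>' ys = 0 & P3 y T' \<sigma>' ys = 0)"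
  by (subst A) (intro ball_cong HOL.refl, simp only: P_transfer[OF r xc y P1])
 show ?thesis unfolding lifted_def using 1 2 z y out by simp
qed

definition lifted_quandle :: "'a lifted magma" where
 "lifted_quandle = \<lparr>carrier = lifted, lact = (%(x, T, \<sigma>) (y, T', \<sigma>').
  (x \<rhd> y,
   %zs. if zs \<in> ntuples X
    then let ys = map (ldiv X x) zs in T (map (lact X y) ys) - T ys + T' ys else 0,
   %zs. if zs \<in> ntuples X
    then let ys = map (ldiv X x) zs in \<sigma>' ys + frag_extend T (ncons y ys) else 0))\<rparr>"

lemma map_ldiv_lact: "x \<in> carrier X ==> ys \<in> ntuples X ==> map (ldiv X x) (map (lact X x) ys) = ys"
 by (auto simp: ntuples_def intro!: map_idI)

lemma lifted_quandle_related:
 assumes "a \<in> lifted" "b \<in> lifted"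
 shows "related a b (a \<rhd>\<^bsub>lifted_quandle\<^esub> b)"
 using assms map_lact_ntuples(1) map_ldiv_lact
 by (auto simp: lifted_quandle_def related_def lifted_def Let_def simp del: map_map split: prod.split)

lemma related_lifted_eqI:
 assumes "related a b c" "related a b c'" "fst a \<in> carrier X"
  "\<forall>ys. ys \<notin> ntuples X --> fst (snd c) ys = 0 & snd (snd c) ys = 0"
  "\<forall>ys. ys \<notin> ntuples X --> fst (snd c') ys = 0 & snd (snd c') ys = 0"
 shows "c = c'"
proof -
 obtain x T \<sigma> y T' \<sigma>' where ab: "a = (x, T, \<sigma>)" "b = (y, T', \<sigma>')" by (metis prod_cases3)
 obtain z T1 \<sigma>1 z' T2 \<sigma>2 where c: "c = (z, T1, \<sigma>1)" "c' = (z', T2, \<sigma>2)" by (metis prod_cases3)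
 have "T1 zs = T2 zs & \<sigma>1 zs = \<sigma>2 zs" for zs
 proof (cases "zs \<in> ntuples X")
  case True
  then obtain ys where "ys \<in> ntuples X" "zs = map (lact X x) ys"
   using ntuples_image(1)[of x] assms(3) unfolding ab fst_conv by (metis imageE)
  then show ?thesis using assms(1,2) unfolding ab c related_def by simp
 qed (use assms(4,5) c in simp)
 then show ?thesis using assms(1,2) unfolding ab c related_def by auto
qed

lemma lifted_out: "c \<in> lifted ==> \<forall>ys. ys \<notin> ntuples X --> fst (snd c) ys = 0 & snd (snd c) ys = 0"
 by (auto simp: lifted_def)

lemma lifted_out': "\<forall>ys. ys \<notin> ntuples X -->
  fst (snd (a \<rhd>\<^bsub>lifted_quandle\<^esub> b)) ys = 0 & snd (snd (a \<rhd>\<^bsub>lifted_quandle\<^esub> b)) ys = 0"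
 by (auto simp: lifted_quandle_def split: prod.split)

lemma lifted_fst: "a \<in> lifted ==> fst a \<in> carrier X"
 by (auto simp: lifted_def)

lemma lifted_closed:
 assumes "a \<in> lifted" "b \<in> lifted"
 shows "a \<rhd>\<^bsub>lifted_quandle\<^esub> b \<in> lifted"
proof -
 obtain x T \<sigma> where a: "a = (x, T, \<sigma>)" by (metis prod_cases3)
 obtain y T' \<sigma>' where b: "b = (y, T', \<sigma>')" by (metis prod_cases3)
 obtain z T'' \<sigma>'' where c: "a \<rhd>\<^bsub>lifted_quandle\<^esub> b = (z, T'', \<sigma>'')" by (metis prod_cases3)
 have "related (x, T, \<sigma>) (y, T', \<sigma>') (z, T'', \<sigma>'')"
  using lifted_quandle_related[OF assms] unfolding c unfolding a b .
 from lifted_transfer[OF this] show ?thesis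
  using lifted_out[OF assms(2)] lifted_out'[of a b] lifted_fst[OF assms(2)] assms
  unfolding c unfolding a b by simp
qed

lemma lifted_distrib:
 assumes a: "a \<in> lifted" and b: "b \<in> lifted" and c: "c \<in> lifted"
 shows "a \<rhd>\<^bsub>lifted_quandle\<^esub> (b \<rhd>\<^bsub>lifted_quandle\<^esub> c)
   = (a \<rhd>\<^bsub>lifted_quandle\<^esub> b) \<rhd>\<^bsub>lifted_quandle\<^esub> (a \<rhd>\<^bsub>lifted_quandle\<^esub> c)"
proof -
 let ?m = "%a b. a \<rhd>\<^bsub>lifted_quandle\<^esub> b"
 note cl = lifted_closed
 have ab: "?m a b \<in> lifted" and bc: "?m b c \<in> lifted" and ac: "?m a c \<in> lifted"
  by (rule cl[OF a b], rule cl[OF b c], rule cl[OF a c])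
 obtain x T \<sigma> where a': "a = (x, T, \<sigma>)" by (metis prod_cases3)
 obtain y T' \<sigma>' where b': "b = (y, T', \<sigma>')" by (metis prod_cases3)
 obtain z U \<tau> where c': "c = (z, U, \<tau>)" by (metis prod_cases3)
 obtain xy Tab \<sigma>ab where ab': "?m a b = (xy, Tab, \<sigma>ab)" by (metis prod_cases3)
 obtain yz Tbc \<sigma>bc where bc': "?m b c = (yz, Tbc, \<sigma>bc)" by (metis prod_cases3)
 obtain xz Tac \<sigma>ac where ac': "?m a c = (xz, Tac, \<sigma>ac)" by (metis prod_cases3)
 obtain l Tl \<sigma>l where l': "?m a (?m b c) = (l, Tl, \<sigma>l)" by (metis prod_cases3)
 obtain r Tr \<sigma>r where r': "?m (?m a b) (?m a c) = (r, Tr, \<sigma>r)" by (metis prod_cases3)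
 have xc: "x \<in> carrier X" "y \<in> carrier X" "z \<in> carrier X"
  using lifted_fst[OF a] lifted_fst[OF b] lifted_fst[OF c] by (simp_all add: a' b' c')
 have Rab: "related (x, T, \<sigma>) (y, T', \<sigma>') (xy, Tab, \<sigma>ab)"
  using lifted_quandle_related[OF a b] by (simp add: a' b' ab'[unfolded a' b'])
 have Rbc: "related (y, T', \<sigma>') (z, U, \<tau>) (yz, Tbc, \<sigma>bc)"
  using lifted_quandle_related[OF b c] by (simp add: b' c' bc'[unfolded b' c'])
 have Rac: "related (x, T, \<sigma>) (z, U, \<tau>) (xz, Tac, \<sigma>ac)"
  using lifted_quandle_related[OF a c] by (simp add: a' c' ac'[unfolded a' c'])
 have Rl: "related (x, T, \<sigma>) (yz, Tbc, \<sigma>bc) (l, Tl, \<sigma>l)"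
  using lifted_quandle_related[OF a bc] unfolding l' unfolding bc' a' .
 have Rr: "related (xy, Tab, \<sigma>ab) (xz, Tac, \<sigma>ac) (r, Tr, \<sigma>r)"
  using lifted_quandle_related[OF ab ac] unfolding r' unfolding ab' ac' .
 have e: "xy = x \<rhd> y" "yz = y \<rhd> z" "xz = x \<rhd> z" "l = x \<rhd> yz" "r = xy \<rhd> xz"
  using Rab Rbc Rac Rl Rr by (simp_all add: related_def)
 have m: "xy \<in> carrier X" "yz \<in> carrier X" "xz \<in> carrier X" using e xc by simp_all
 have "Tl zs = Tr zs & \<sigma>l zs = \<sigma>r zs" for zs
 proof (cases "zs \<in> ntuples X")
  case True
  then obtain vs where vs: "vs \<in> ntuples X" "zs = map (lact X x) vs"
   using ntuples_image(1)[OF xc(1)] by (metis imageE)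
  then obtain ws where ws: "ws \<in> ntuples X" "vs = map (lact X y) ws"
   using ntuples_image(1)[OF xc(2)] by (metis imageE)
  let ?L = "%x. map (lact X x)"
  have xws: "?L x ws \<in> ntuples X" "?L z ws \<in> ntuples X"
   by (rule map_lact_ntuples(1)[OF xc(1) ws(1)], rule map_lact_ntuples(1)[OF xc(3) ws(1)])
  have zs: "zs = ?L xy (?L x ws)" unfolding e vs ws using map_lact_lact[OF xc(1,2) ws(1)] by simp
  have yz: "?L yz (?L y ws) = ?L y (?L z ws)" unfolding e by (rule map_lact_lact[OF xc(2,3) ws(1)])
  have xz: "?L xz (?L x ws) = ?L x (?L z ws)" unfolding e by (rule map_lact_lact[OF xc(1,3) ws(1)])
  have nc: "ncons z ws \<in> frees (ntuples X)" by (rule ncons_closed'[OF xc(3) ws(1)])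
  have TL: "Tl zs = T (?L y (?L z ws)) - T (?L y ws) + (T' (?L z ws) - T' ws + U ws)"
   using Rl Rbc ws vs yz by (simp add: related_def del: map_map)
  have TR: "Tr zs = (T (?L y (?L z ws)) - T (?L z ws) + T' (?L z ws)) - (T (?L y ws) - T ws + T' ws)
    + (T (?L z ws) - T ws + U ws)"
   unfolding zs using Rr Rab Rac ws xws xz by (simp add: related_def del: map_map)
  have SL: "\<sigma>l zs = \<tau> ws + frag_extend T' (ncons z ws) + frag_extend T (Nmap (lact X y) (ncons z ws))"
   using Rl Rbc ws vs Nmap_ncons_lact[OF xc(2,3) ws(1)] e by (simp add: related_def del: map_map)
  have SR: "\<sigma>r zs = \<tau> ws + frag_extend T (ncons z ws) + frag_extend Tab (Nmap (lact X x) (ncons z ws))"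
   unfolding zs using Rr Rac ws xws(1) Nmap_ncons_lact[OF xc(1,3) ws(1)] e by (simp add: related_def del: map_map)
  show ?thesis
   unfolding TL TR SL SR related_extend(1)[OF Rab xc(1,2) nc] by (simp add: algebra_simps del: map_map)
 next
  case False
  then show ?thesis using lifted_out'[of a "?m b c"] lifted_out'[of "?m a b" "?m a c"] l' r' by simp
 qed
 moreover have "l = r" unfolding e by (rule lact_distrib[OF xc])
 ultimately show ?thesis unfolding l' r' by auto
qed

lemma quandle_lifted: "quandle lifted_quandle"
proof
 have carr: "carrier lifted_quandle = lifted" by (simp add: lifted_quandle_def)
 show "a \<rhd>\<^bsub>lifted_quandle\<^esub> (b \<rhd>\<^bsub>lifted_quandle\<^esub> c)
   = (a \<rhd>\<^bsub>lifted_quandle\<^esub> b) \<rhd>\<^bsub>lifted_quandle\<^esub> (a \<rhd>\<^bsub>lifted_quandle\<^esub> c)"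
  if "a \<in> carrier lifted_quandle" "b \<in> carrier lifted_quandle" "c \<in> carrier lifted_quandle" for a b c
  using that lifted_distrib by (simp add: carr)
 show "a \<rhd>\<^bsub>lifted_quandle\<^esub> a = a" if "a \<in> carrier lifted_quandle" for a
 proof (rule related_lifted_eqI)
  have a: "a \<in> lifted" using that by (simp add: carr)
  show "related a a (a \<rhd>\<^bsub>lifted_quandle\<^esub> a)" by (rule lifted_quandle_related[OF a a])
  show "related a a a"
   using a lact_idem by (auto simp: related_def lifted_def P2_def algebra_simps)
 qed (use that carr lifted_out lifted_out' lifted_fst in \<open>simp_all\<close>)
 show "bij_betw (%b. a \<rhd>\<^bsub>lifted_quandle\<^esub> b) (carrier lifted_quandle) (carrier lifted_quandle)"
  if "a \<in> carrier lifted_quandle" for a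
  unfolding bij_betw_def carr
 proof
  have a: "a \<in> lifted" using that by (simp add: carr)
  obtain x T \<sigma> where a': "a = (x, T, \<sigma>)" by (metis prod_cases3)
  have x: "x \<in> carrier X" using lifted_fst[OF a] a' by simp
  show "inj_on (%b. a \<rhd>\<^bsub>lifted_quandle\<^esub> b) lifted"
  proof (rule inj_onI)
   fix b c assume b: "b \<in> lifted" and c: "c \<in> lifted" and eq: "a \<rhd>\<^bsub>lifted_quandle\<^esub> b = a \<rhd>\<^bsub>lifted_quandle\<^esub> c"
   obtain y T' \<sigma>' where b': "b = (y, T', \<sigma>')" by (metis prod_cases3)
   obtain z U \<tau> where c': "c = (z, U, \<tau>)" by (metis prod_cases3)
   obtain w V \<rho> where w: "a \<rhd>\<^bsub>lifted_quandle\<^esub> c = (w, V, \<rho>)" by (metis prod_cases3)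
   have R: "related (x, T, \<sigma>) (y, T', \<sigma>') (w, V, \<rho>)" "related (x, T, \<sigma>) (z, U, \<tau>) (w, V, \<rho>)"
    using lifted_quandle_related[OF a b] lifted_quandle_related[OF a c]
    unfolding eq w unfolding a' b' c' .
   have "y \<in> carrier X" "z \<in> carrier X" using lifted_fst[OF b] lifted_fst[OF c] by (simp_all add: b' c')
   then have yz: "y = z" using R x lact_inj by (simp add: related_def)
   have "T' ys = U ys & \<sigma>' ys = \<tau> ys" for ys
   proof (cases "ys \<in> ntuples X")
    case True
    then have "T (map (lact X y) ys) - T ys + T' ys = T (map (lact X y) ys) - T ys + U ys"
     "\<sigma>' ys + frag_extend T (ncons y ys) = \<tau> ys + frag_extend T (ncons y ys)"
     using R yz unfolding related_def by (auto simp del: add_right_cancel add_left_cancel)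
    then show ?thesis by simp
   qed (use lifted_out[OF b] lifted_out[OF c] b' c' in simp)
   then show "b = c" unfolding b' c' using yz by auto
  qed
  show "(%b. a \<rhd>\<^bsub>lifted_quandle\<^esub> b) ` lifted = lifted"
  proof
   show "(%b. a \<rhd>\<^bsub>lifted_quandle\<^esub> b) ` lifted \<subseteq> lifted" using lifted_closed[OF a] by blast
   show "lifted \<subseteq> (%b. a \<rhd>\<^bsub>lifted_quandle\<^esub> b) ` lifted"
   proof
    fix c assume c: "c \<in> lifted"
    obtain z U \<tau> where c': "c = (z, U, \<tau>)" by (metis prod_cases3)
    have z: "z \<in> carrier X" using lifted_fst[OF c] c' by simp
    define y where "y = ldiv X x z"
    have y: "y \<in> carrier X" "x \<rhd> y = z" using x z by (simp_all add: y_def)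
    define T' where "T' ys = (if ys \<in> ntuples X
     then U (map (lact X x) ys) - T (map (lact X y) ys) + T ys else 0)" for ys
    define \<sigma>' where "\<sigma>' ys = (if ys \<in> ntuples X
     then \<tau> (map (lact X x) ys) - frag_extend T (ncons y ys) else 0)" for ys
    have R: "related (x, T, \<sigma>) (y, T', \<sigma>') (z, U, \<tau>)"
     using y by (simp add: related_def T'_def \<sigma>'_def)
    have b: "(y, T', \<sigma>') \<in> lifted"
     using lifted_transfer[OF R _ y(1)] a a' c c' lifted_out[OF c] by (simp add: T'_def \<sigma>'_def)
    have "c = a \<rhd>\<^bsub>lifted_quandle\<^esub> (y, T', \<sigma>')"
     by (rule related_lifted_eqI[OF R[folded a' c'] lifted_quandle_related[OF a b]
       lifted_fst[OF a] lifted_out[OF c] lifted_out'])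
    then show "c \<in> (%b. a \<rhd>\<^bsub>lifted_quandle\<^esub> b) ` lifted" using b by blast
   qed
  qed
 qed
qed

lemma fst_lifted_hom: "fst \<in> quandle_hom lifted_quandle X"
 using lifted_fst by (auto simp: quandle_hom_def lifted_quandle_def)

text \<open>Over every element there is a tautological point, for which \<open>T\<close> is prepending itself; a free quandle
 therefore maps to its lifted quandle by sending each generator to its tautological point.\<close>

lemma generator_lifted:
 assumes "b \<in> carrier X"
 shows "(b, %ys. if ys \<in> ntuples X then ncons b ys else 0, %ys. 0) \<in> lifted"
proof -
 let ?T = "%ys. if ys \<in> ntuples X then ncons b ys else 0"
 have ext: "frag_extend ?T c = Ncons b c" if "c \<in> frees (ntuples X)" for c
  by (rule additive_map_eqI[OF that]) simp_all
 have [simp]: "ys \<in> ntuples_of X n ==> ys \<in> ntuples X" for ys n by (simp add: ntuples_of_def)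
 show ?thesis
  unfolding lifted_def shape_def P1_def P2_def P3_def
  using assms ncons_closed[OF assms] ncons_closed'[OF assms] ext Nbd_ncons nbd_closed'
  by (simp add: frag_extend_eq_0)
qed

text \<open>A section of the projection from the lifted quandle contracts the complex.\<close>

lemma row_exact_of_section:
 assumes L: "L \<in> quandle_hom X lifted_quandle" and fst_L: "\<And>x. x \<in> carrier X ==> fst (L x) = x"
 shows "row_exact X"
proof -
 define T where "T x = fst (snd (L x))" for x
 define \<sigma> where "\<sigma> x = snd (snd (L x))" for x
 have Lx: "L x = (x, T x, \<sigma> x)" if "x \<in> carrier X" for x
  using fst_L[OF that] by (simp add: T_def \<sigma>_def prod_eq_iff)
 have L_lifted: "(x, T x, \<sigma> x) \<in> lifted" if "x \<in> carrier X" for x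
  using quandle_hom_closed[OF L that] Lx[OF that] by (simp add: lifted_quandle_def)
 have R: "related (x, T x, \<sigma> x) (y, T y, \<sigma> y) (x \<rhd> y, T (x \<rhd> y), \<sigma> (x \<rhd> y))"
  if "x \<in> carrier X" "y \<in> carrier X" for x y
  using lifted_quandle_related[OF L_lifted[OF that(1)] L_lifted[OF that(2)]]
   quandle_hom_lact[OF L that] Lx that by simp
 define s where "s xs = (case xs of [] => 0 | x # w => \<sigma> x w)" for xs
 have s_closed: "frag_extend s c \<in> frees (ntuples_of X (Suc (Suc n)))" if "c \<in> frees (ntuples_of X (Suc n))" for c n
 proof (rule additive_map_closedI[OF that additive_map_frag_extend])
  fix xs assume xs: "xs \<in> ntuples_of X (Suc n)"
  then obtain x w where w: "xs = x # w" by (cases xs) (auto simp: ntuples_of_def)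
  then have "x \<in> carrier X" "w \<in> ntuples_of X n"
   using xs ntuples_ConsD[of x w X] by (auto simp: ntuples_of_def)
  then show "frag_extend s (frag_of xs) \<in> frees (ntuples_of X (Suc (Suc n)))"
   using L_lifted[of x] by (auto simp: s_def w lifted_def shape_def)
 qed
 have s_Ncons: "frag_extend s (Ncons x c) = frag_extend (\<sigma> x) c" if "x \<in> carrier X" "c \<in> frees (ntuples X)" for x c
 proof (rule additive_map_eqI[OF that(2) additive_map_comp[OF additive_map_frag_extend additive_map_frag_extend]])
  fix ys assume ys: "ys \<in> ntuples X"
  then have "shape x (T x) (\<sigma> x) (length ys) ys"
   using L_lifted[OF that(1)] by (auto simp: lifted_def ntuples_of_def)
  then show "frag_extend s (Ncons x (frag_of ys)) = frag_extend (\<sigma> x) (frag_of ys)"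
   by (simp add: ncons_def s_def shape_def)
 qed simp
 have s_lact: "s (map (lact X x) w) = s w + T x w" if x: "x \<in> carrier X" and w: "w \<in> ntuples X" "w \<noteq> []" for x w
 proof -
  obtain y u where y: "w = y # u" using w by (cases w) auto
  then have yu: "y \<in> carrier X" "u \<in> ntuples X" using w ntuples_ConsD by metis+
  have "\<sigma> (x \<rhd> y) (map (lact X x) u) = \<sigma> y u + frag_extend (T x) (ncons y u)"
   using R[OF x yu(1)] yu(2) by (simp add: related_def)
  moreover have "ncons y u = frag_of (y # u)" using ncons_ntuple w(1) y by metis
  ultimately show ?thesis using y by (simp add: s_def)
 qed
 have P3: "Nbd X (\<sigma> x w) - frag_extend (\<sigma> x) (nbd X w) - ncons x w + T x w = 0"
  if "x \<in> carrier X" "w \<in> ntuples X" for x w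
  using L_lifted[OF that(1)] that(2) by (simp add: lifted_def P3_def)
 have contraction: "Nbd X (s xs) + frag_extend s (nbd X xs) = frag_of xs"
  if xs: "xs \<in> ntuples_of X (Suc (Suc n))" for xs n
 proof -
  obtain x w where w: "xs = x # w" "w \<noteq> []" using xs by (cases xs; cases "tl xs") (auto simp: ntuples_of_def)
  then have xw: "x \<in> carrier X" "w \<in> ntuples X" "x # w \<in> ntuples X"
   using xs ntuples_ConsD[of x w X] by (auto simp: ntuples_of_def)
  have "s (x # w) = \<sigma> x w" by (simp add: s_def)
  then show ?thesis
   using P3[OF xw(1,2)]
   unfolding w(1) nbd.simps frag_extend_diff frag_extend_of s_lact[OF xw(1,2) w(2)]
    s_Ncons[OF xw(1) nbd_closed'[OF xw(2)]] ncons_ntuple[OF xw(3)]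
   by (simp add: algebra_simps)
 qed
 have "\<exists>c'\<in>frees (ntuples_of X (Suc (Suc (Suc n)))). Nbd X c' = c"
  if c: "c \<in> frees (ntuples_of X (Suc (Suc n)))" and "Nbd X c = 0" for c n
 proof -
  have "Nbd X (frag_extend s c) + frag_extend s (Nbd X c) = c"
   by (rule additive_map_eqI[OF c additive_map_plus additive_map_id])
    (simp_all add: contraction additive_map_comp[OF additive_map_frag_extend additive_map_frag_extend])
  then show ?thesis using s_closed[OF c] that(2) by auto
 qed
 moreover have "\<exists>c'\<in>frees (ntuples_of X 2). Nbd X c' = c"
  if c: "c \<in> frees (ntuples_of X 1)" and 0: "frag_extend (%xs. frag_of (orbit X (hd xs))) c = 0" for c
 proof -
  define u where "u = frag_extend (%C. T (SOME x. x \<in> C) [])"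
  have T_orbit: "T z [] = T y []" if "z \<in> orbit X y" for y z
  proof (rule orbit_invariant[where f = "%x. T x []", OF _ that])
   show "T (x \<rhd> y) [] = T y []" if "x \<in> carrier X" "y \<in> carrier X" for x y
    using R[OF that] by (simp add: related_def) (metis list.map_disc_iff ntuples_Nil diff_self add_0)
  qed
  have "Nbd X (frag_extend s c) + u (frag_extend (%xs. frag_of (orbit X (hd xs))) c) = c"
   unfolding u_def
  proof (rule additive_map_eqI[OF c additive_map_plus additive_map_id])
   fix xs assume "xs \<in> ntuples_of X 1"
   then obtain x where x: "xs = [x]" "x \<in> carrier X"
    by (cases xs) (auto simp: ntuples_of_def ntuples_def)
   have "T (SOME z. z \<in> orbit X x) [] = T x []"
    by (rule T_orbit) (rule someI[of _ x], rule orbit_self)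
   then show "Nbd X (frag_extend s (frag_of xs)) +
     frag_extend (%C. T (SOME x. x \<in> C) []) (frag_extend (%xs. frag_of (orbit X (hd xs))) (frag_of xs)) = frag_of xs"
    using P3[OF x(2), of "[]"] x by (simp add: s_def ncons_def algebra_simps)
  qed (simp_all add: additive_map_comp[OF additive_map_frag_extend additive_map_frag_extend])
  then show ?thesis using s_closed[of c 0] c 0 by (auto simp: u_def numeral_2_eq_2)
 qed
 ultimately show ?thesis unfolding row_exact_def by blast
qed

end

text \<open>The homomorphism given by the generators is a section of the projection because the two agree on
 generators.\<close>

lemma row_exact_free_quandle: "row_exact (free_quandle B)"
proof -
 interpret L: quandle "free_quandle B" by (rule quandle_free_quandle)
 let ?u = "free_quandle_unit B"
 let ?g = "%b. (?u b, %ys. if ys \<in> ntuples (free_quandle B) then ncons (?u b) ys else 0, %ys. 0)"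
 have u: "?u b \<in> carrier (free_quandle B)" if "b \<in> B" for b
  using that by (auto simp: free_quandle_unit_def carrier_free_quandle)
 have g: "?g \<in> B \<rightarrow> carrier L.lifted_quandle"
  using L.generator_lifted[OF u] by (auto simp: L.lifted_quandle_def)
 note up = free_quandle_universal[OF L.quandle_lifted g]
 let ?L = "free_quandle_lift L.lifted_quandle ?g"
 have h: "(%x. fst (?L x)) \<in> quandle_hom (free_quandle B) (free_quandle B)"
  using up(1) L.fst_lifted_hom by (auto simp: quandle_hom_def Pi_iff)
 have i: "(%x. x) \<in> quandle_hom (free_quandle B) (free_quandle B)"
  by (auto simp: quandle_hom_def)
 have "fst (?L x) = x" if x: "x \<in> carrier (free_quandle B)" for x
  using free_quandle_universal(3)[OF L.quandle_axioms _ h _ x, of ?u]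
   free_quandle_universal(3)[OF L.quandle_axioms _ i _ x, of ?u] up(2) u by auto
 then show ?thesis by (rule L.row_exact_of_section[OF up(1)])
qed

lemma hom_orbit:
 assumes f: "f \<in> quandle_hom X Y" and "z \<in> orbit X y" "y \<in> carrier X"
 shows "orbit Y (f z) = orbit Y (f y)"
 by (rule orbit_invariant[where f = "%x. orbit Y (f x)", OF _ assms(2)])
  (use f in \<open>simp add: quandle_hom_lact orbit_lact quandle_hom_closed\<close>)

text \<open>A chain on the retract is carried to the larger quandle, bounded there, and carried back.\<close>

lemma row_exact_retract:
 assumes X: "quandle X" and Y: "quandle Y"
  and i: "i \<in> quandle_hom X Y" and r: "r \<in> quandle_hom Y X"
  and ri: "\<And>x. x \<in> carrier X ==> r (i x) = x" and ex: "row_exact Y"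
 shows "row_exact X"
proof -
 have ic: "i \<in> carrier X \<rightarrow> carrier Y" and rc: "r \<in> carrier Y \<rightarrow> carrier X"
  using i r by (simp_all add: quandle_hom_def)
 have ret: "Nmap r (Nmap i c) = c" if "c \<in> frees (ntuples X)" for c
  using Nmap_id[OF that] ri by (simp add: Nmap_Nmap)
 have down: "\<exists>c'\<in>frees (ntuples_of X n). Nbd X c' = c"
  if "c \<in> frees (ntuples X)" "c' \<in> frees (ntuples_of Y n)" "Nbd Y c' = Nmap i c" for c c' n
 proof
  show "Nmap r c' \<in> frees (ntuples_of X n)" by (rule Nmap_closed[OF rc that(2)])
  show "Nbd X (Nmap r c') = c"
   using Nbd_natural[OF Y X r frees_ntuples_of[OF that(2)]] that(3) ret[OF that(1)] by simp
 qed
 have "\<exists>c'\<in>frees (ntuples_of X (Suc (Suc (Suc n)))). Nbd X c' = c"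
  if c: "c \<in> frees (ntuples_of X (Suc (Suc n)))" and 0: "Nbd X c = 0" for c n
 proof -
  have "Nbd Y (Nmap i c) = 0" using Nbd_natural[OF X Y i frees_ntuples_of[OF c]] 0 by simp
  then obtain c' where "c' \<in> frees (ntuples_of Y (Suc (Suc (Suc n))))" "Nbd Y c' = Nmap i c"
   using ex Nmap_closed[OF ic c] unfolding row_exact_def by blast
  then show ?thesis using down[OF frees_ntuples_of[OF c]] by blast
 qed
 moreover have "\<exists>c'\<in>frees (ntuples_of X 2). Nbd X c' = c"
  if c: "c \<in> frees (ntuples_of X 1)" and 0: "frag_extend (%xs. frag_of (orbit X (hd xs))) c = 0" for c
 proof -
  have "frag_extend (%xs. frag_of (orbit Y (hd xs))) (Nmap i c)
    = frag_extend (%C. frag_of (orbit Y (i (SOME x. x \<in> C)))) (frag_extend (%xs. frag_of (orbit X (hd xs))) c)"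
  proof (rule additive_map_eqI[OF c additive_map_comp[OF additive_map_frag_extend additive_map_frag_extend]
     additive_map_comp[OF additive_map_frag_extend additive_map_frag_extend]])
   fix xs assume "xs \<in> ntuples_of X 1"
   then obtain x where x: "xs = [x]" "x \<in> carrier X"
    by (cases xs) (auto simp: ntuples_of_def ntuples_def)
   have "orbit Y (i (SOME z. z \<in> orbit X x)) = orbit Y (i x)"
    by (rule hom_orbit[OF i _ x(2)]) (rule someI[of _ x], rule orbit_self)
   then show "frag_extend (%xs. frag_of (orbit Y (hd xs))) (Nmap i (frag_of xs))
    = frag_extend (%C. frag_of (orbit Y (i (SOME x. x \<in> C)))) (frag_extend (%xs. frag_of (orbit X (hd xs))) (frag_of xs))"
    by (simp add: x nmap_def)
  qed
  then have "frag_extend (%xs. frag_of (orbit Y (hd xs))) (Nmap i c) = 0" using 0 by simp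
  then obtain c' where "c' \<in> frees (ntuples_of Y 2)" "Nbd Y c' = Nmap i c"
   using ex Nmap_closed[OF ic c] unfolding row_exact_def by blast
  then show ?thesis using down[OF frees_ntuples_of[OF c]] by blast
 qed
 ultimately show ?thesis unfolding row_exact_def by blast
qed

section \<open>Extra degeneracies\<close>

abbreviation flin :: "('a => 'b) => ('a \<Rightarrow>\<^sub>0 int) => ('b \<Rightarrow>\<^sub>0 int)" where
 "flin f \<equiv> frag_extend (%x. frag_of (f x))"

lemma additive_ff: "additive_map (%c. frag_extend f (frag_extend g c))"
 by (rule additive_map_comp[OF additive_map_frag_extend additive_map_frag_extend])

lemma flin_flin: "flin f (flin g c) = flin (%x. f (g x)) c"
 by (rule additive_map_eqI[where S = UNIV, OF _ additive_ff])
  (simp_all add: frees_def)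

lemma flin_cong: "c \<in> frees S ==> (\<And>x. x \<in> S ==> f x = g x) ==> flin f c = flin g c"
 by (rule additive_map_eqI[where S = S]) simp_all

lemma flin_closed: "c \<in> frees S ==> (\<And>x. x \<in> S ==> f x \<in> T) ==> flin f c \<in> frees T"
 by (erule additive_map_closedI) simp_all

lemma flin_id: "c \<in> frees S ==> (\<And>x. x \<in> S ==> f x = x) ==> flin f c = c"
 by (rule additive_map_eqI[where S = S and g = "%c. c"]) simp_all

lemma frag_cmul_uminus: "frag_cmul k (- x) = - frag_cmul k x"
 by (metis frag_cmul_cmul frag_cmul_minus_one mult.commute)

definition degenerates :: "('a, 'm) sset_scheme => nat => 'a set" where
 "degenerates K n = (case n of 0 => {} | Suc m => {degen K m i x |i x. i \<le> m & x \<in> simplices K m})"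

definition sbd :: "('a, 'm) sset_scheme => nat => ('a \<Rightarrow>\<^sub>0 int) => ('a \<Rightarrow>\<^sub>0 int)" where
 "sbd K n c = (\<Sum>i\<le>Suc n. frag_cmul ((-1) ^ i) (flin (face K n i) c))"

lemma sbd_additive: "additive_map (sbd K n)"
 unfolding sbd_def by (intro additive_map_sum_map additive_map_cmul_map additive_map_frag_extend)

text \<open>A simplicial set over a discrete set whose cycles, as far as they have vanishing faces, are
 boundaries up to degenerate chains.\<close>

locale acyclic_over = simplicial_set K for K :: "('a, 'm) sset_scheme" +
 fixes X :: "'x set" and \<epsilon> :: "'a => 'x"
 assumes eps_surj: "\<epsilon> ` simplices K 0 = X"
  and eps_face: "x \<in> simplices K (Suc 0) ==> \<epsilon> (face K 0 0 x) = \<epsilon> (face K 0 (Suc 0) x)"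
  and acyclic_0: "[|e \<in> frees (simplices K 0); flin \<epsilon> e = 0|]
   ==> \<exists>v\<in>frees (simplices K (Suc 0)). sbd K 0 v = e"
  and acyclic_Suc: "[|e \<in> frees (simplices K (Suc n)); \<And>i. i \<le> Suc n ==> flin (face K n i) e = 0|]
   ==> \<exists>v\<in>frees (simplices K (Suc (Suc n))). e - sbd K (Suc n) v \<in> frees (degenerates K (Suc n))"

context simplicial_set
begin

abbreviation fm where "fm n i \<equiv> flin (face K n i)"
abbreviation sm where "sm n i \<equiv> flin (degen K n i)"

lemma fm_closed: "c \<in> frees (simplices K (Suc n)) ==> i \<le> Suc n ==> fm n i c \<in> frees (simplices K n)"
 by (erule flin_closed) (rule face_closed)

lemma sm_closed: "c \<in> frees (simplices K n) ==> i \<le> n ==> sm n i c \<in> frees (simplices K (Suc n))"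
 by (erule flin_closed) (rule degen_closed)

lemma fm_fm: "[|c \<in> frees (simplices K (Suc (Suc n))); i < j; j \<le> Suc (Suc n)|]
  ==> fm n i (fm (Suc n) j c) = fm n (j - 1) (fm (Suc n) i c)"
 unfolding flin_flin by (erule flin_cong) (rule face_face)

lemma fm_sm_less: "[|c \<in> frees (simplices K (Suc n)); i < j; j \<le> Suc n|]
  ==> fm (Suc n) i (sm (Suc n) j c) = sm n (j - 1) (fm n i c)"
 unfolding flin_flin by (erule flin_cong) (rule face_degen_less)

lemma fm_sm_eq: "[|c \<in> frees (simplices K n); j \<le> n; i = j \<or> i = Suc j|] ==> fm n i (sm n j c) = c"
 unfolding flin_flin by (erule flin_id) (rule face_degen_eq)

lemma fm_sm_greater: "[|c \<in> frees (simplices K (Suc n)); Suc j < i; i \<le> Suc (Suc n)|]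
  ==> fm (Suc n) i (sm (Suc n) j c) = sm n j (fm n (i - 1) c)"
 unfolding flin_flin by (erule flin_cong) (rule face_degen_greater)

lemma sm_sm: "[|c \<in> frees (simplices K n); i \<le> j; j \<le> n|]
  ==> sm (Suc n) i (sm n j c) = sm (Suc n) (Suc j) (sm n i c)"
 unfolding flin_flin by (erule flin_cong) (rule degen_degen)

lemma sbd_closed: "c \<in> frees (simplices K (Suc n)) ==> sbd K n c \<in> frees (simplices K n)"
 unfolding sbd_def by (intro frees_sum frees_cmul fm_closed) auto

text \<open>The projection \<open>1 - s\<^sub>k d\<^sub>k\<close> removes the \<open>k\<close>-th face; composing these projections gives the
 projection to the Moore complex.\<close>

definition prk :: "nat => nat => ('a \<Rightarrow>\<^sub>0 int) => ('a \<Rightarrow>\<^sub>0 int)" where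
 "prk n k c = c - sm n k (fm n k c)"

primrec moore :: "nat => nat => ('a \<Rightarrow>\<^sub>0 int) => ('a \<Rightarrow>\<^sub>0 int)" where
 "moore n 0 c = c"
| "moore n (Suc k) c = prk n k (moore n k c)"

lemma prk_additive: "additive_map (prk n k)"
 unfolding prk_def
 by (intro additive_map_minus_map additive_map_id additive_ff)

lemma moore_additive: "additive_map (moore n k)"
proof (induction k)
 case (Suc k)
 then show ?case using additive_map_comp[OF prk_additive] by simp
qed simp

lemma prk_closed: "[|c \<in> frees (simplices K (Suc n)); k \<le> n|] ==> prk n k c \<in> frees (simplices K (Suc n))"
 unfolding prk_def by (intro frees_diff sm_closed fm_closed) auto

lemma moore_closed: "[|c \<in> frees (simplices K (Suc n)); k \<le> Suc n|] ==> moore n k c \<in> frees (simplices K (Suc n))"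
 by (induction k) (auto intro: prk_closed)

lemma fm_prk:
 assumes c: "c \<in> frees (simplices K (Suc n))" "k \<le> n" and z: "\<And>i. i < k ==> fm n i c = 0" and "i \<le> k"
 shows "fm n i (prk n k c) = 0"
proof (cases "i = k")
 case True
 then show ?thesis
  using fm_sm_eq[OF fm_closed[OF c(1)] c(2)] c(2) by (simp add: prk_def frag_extend_diff)
next
 case False
 then obtain m where m: "n = Suc m" "i < k" using assms by (cases n) auto
 have "fm n k c \<in> frees (simplices K (Suc m))" using fm_closed[OF c(1), of k] c(2) m by simp
 from fm_sm_less[OF this m(2)] have "fm n i (sm n k (fm n k c)) = sm m (k - 1) (fm m i (fm n k c))"
  using c m by simp
 also have "fm m i (fm n k c) = fm m (k - 1) (fm n i c)"
  using fm_fm[of c m i k] c m by simp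
 finally show ?thesis using z m by (simp add: prk_def frag_extend_diff)
qed

lemma fm_moore:
 "[|c \<in> frees (simplices K (Suc n)); k \<le> Suc n; i < k|] ==> fm n i (moore n k c) = 0"
proof (induction k arbitrary: i)
 case (Suc k)
 then show ?case using fm_prk[of "moore n k c" n k i] moore_closed[of c n k] by simp
qed simp

lemma moore_id:
 assumes "\<And>i. i \<le> n ==> fm n i e = 0" "k \<le> Suc n"
 shows "moore n k e = e"
 using assms(2) by (induction k) (simp_all add: prk_def assms(1))

lemma moore_degen:
 assumes "z \<in> frees (simplices K n)" "j \<le> n" "k \<le> j"
 shows "\<exists>z'\<in>frees (simplices K n). moore n k (sm n j z) = sm n j z'"
 using assms(3)
proof (induction k)
 case (Suc k)
 then obtain z' where z': "z' \<in> frees (simplices K n)" "moore n k (sm n j z) = sm n j z'" by auto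
 obtain m where m: "n = Suc m" using assms(2) Suc.prems by (cases n) auto
 obtain j' where j': "j = Suc j'" using Suc.prems by (cases j) auto
 have kj: "k \<le> j'" "j' \<le> m" "k < j" "j \<le> Suc m" using Suc.prems assms(2) m j' by auto
 let ?u = "fm m k z'"
 have u: "?u \<in> frees (simplices K m)" using z'(1) m kj by (intro fm_closed) auto
 have "fm n k (sm n j z') = sm m j' ?u"
  using fm_sm_less[of z' m k j] z'(1) m kj j' by simp
 then have "sm n k (fm n k (sm n j z')) = sm n j (sm m k ?u)"
  using sm_sm[OF u kj(1,2)] m j' by simp
 then have "moore n (Suc k) (sm n j z) = sm n j (z' - sm m k ?u)"
  by (simp add: z'(2) prk_def frag_extend_diff)
 moreover have "z' - sm m k ?u \<in> frees (simplices K n)"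
  using z'(1) sm_closed[OF u, of k] m kj by auto
 ultimately show ?case by blast
qed (use assms(1) in auto)

lemma moore_kills_degen:
 assumes "z \<in> frees (simplices K n)" "j \<le> n" "j < k"
 shows "moore n k (sm n j z) = 0"
 using assms(3)
proof (induction k)
 case (Suc k)
 show ?case
 proof (cases "j = k")
  case True
  then obtain z' where z': "z' \<in> frees (simplices K n)" "moore n k (sm n j z) = sm n j z'"
   using moore_degen[OF assms(1,2), of k] by auto
  then show ?thesis using fm_sm_eq[OF z'(1), of j j] assms(2) True by (simp add: prk_def)
 next
  case False
  then show ?thesis using Suc by (simp add: prk_def)
 qed
qed simp

lemma moore_degenerates:
 assumes "c \<in> frees (degenerates K (Suc n))"
 shows "moore n (Suc n) c = 0"
proof (rule additive_map_zeroI[OF assms moore_additive])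
 fix x assume "x \<in> degenerates K (Suc n)"
 then obtain j y where "x = degen K n j y" "j \<le> n" "y \<in> simplices K n" by (auto simp: degenerates_def)
 then show "moore n (Suc n) (frag_of x) = 0"
  using moore_kills_degen[of "frag_of y" n j "Suc n"] by simp
qed

lemma sbd_prk:
 assumes c: "c \<in> frees (simplices K (Suc (Suc n)))" and k: "k \<le> n" and z: "\<And>i. i < k ==> fm (Suc n) i c = 0"
 shows "sbd K (Suc n) (prk (Suc n) k c) = prk n k (sbd K (Suc n) c)"
proof -
 let ?A = "%i. fm (Suc n) i (sm (Suc n) k (fm (Suc n) k c))"
 let ?B = "%i. sm n k (fm n k (fm (Suc n) i c))"
 let ?s = "%i. frag_cmul ((-1) ^ i) (?A i - ?B i)"
 have u: "fm (Suc n) k c \<in> frees (simplices K (Suc n))" using c k by (intro fm_closed) auto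
 have "?s i = 0" if "i \<le> Suc (Suc n)" "i \<noteq> k" "i \<noteq> Suc k" for i
 proof (cases "i < k")
  case True
  have "?A i = sm n (k - 1) (fm n i (fm (Suc n) k c))"
   using fm_sm_less[OF u True] k by simp
  also have "fm n i (fm (Suc n) k c) = fm n (k - 1) (fm (Suc n) i c)"
   using fm_fm[OF c True] k by simp
  finally show ?thesis using z[OF True] by simp
 next
  case False
  then have i: "Suc k < i" using that by simp
  have "?A i = sm n k (fm n (i - 1) (fm (Suc n) k c))"
   using fm_sm_greater[OF u i] that by simp
  also have "fm n (i - 1) (fm (Suc n) k c) = fm n k (fm (Suc n) i c)"
   using fm_fm[OF c, of k i] i that by simp
  finally show ?thesis by simp
 qed
 then have "(\<Sum>i\<le>Suc (Suc n). ?s i) = (\<Sum>i\<in>{k, Suc k}. ?s i)"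
  using k by (intro sum.mono_neutral_right) auto
 also have "\<dots> = 0"
 proof -
  have "?A k = fm (Suc n) k c" "?A (Suc k) = fm (Suc n) k c"
   using fm_sm_eq[OF u] k by simp_all
  moreover have "?B (Suc k) = ?B k" using fm_fm[OF c, of k "Suc k"] k by simp
  ultimately show ?thesis by (simp add: frag_cmul_distrib[symmetric] del: minus_frag_cmul)
 qed
 finally have "(\<Sum>i\<le>Suc (Suc n). frag_cmul ((-1) ^ i) (?A i)) = (\<Sum>i\<le>Suc (Suc n). frag_cmul ((-1) ^ i) (?B i))"
  unfolding additive_map_diff[OF additive_map_cmul_map[OF additive_map_id]] sum_subtractf by simp
 moreover have "sm n k (fm n k (sbd K (Suc n) c)) = (\<Sum>i\<le>Suc (Suc n). frag_cmul ((-1) ^ i) (?B i))"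
  unfolding sbd_def by (simp add: frag_extend_sum frag_extend_cmul o_def del: sum.atMost_Suc)
 moreover have "sbd K (Suc n) (sm (Suc n) k (fm (Suc n) k c)) = (\<Sum>i\<le>Suc (Suc n). frag_cmul ((-1) ^ i) (?A i))"
  by (simp add: sbd_def)
 ultimately show ?thesis
  unfolding prk_def additive_map_diff[OF sbd_additive] by simp
qed

lemma sbd_moore:
 assumes c: "c \<in> frees (simplices K (Suc (Suc n)))" and "k \<le> Suc n"
 shows "sbd K (Suc n) (moore (Suc n) k c) = moore n k (sbd K (Suc n) c)"
 using assms(2)
proof (induction k)
 case (Suc k)
 then show ?case
  using sbd_prk[OF moore_closed[OF c, of k], of k] fm_moore[OF c, of k] by simp
qed simp

text \<open>The linear form of the Kan condition: the group of chains is a simplicial abelian group, so all faces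
 but one can be prescribed.\<close>

lemma horn_filler:
 assumes y: "\<And>i. i \<le> Suc m ==> y i \<in> frees (simplices K m)"
  and compat: "\<And>m' i j. m = Suc m' ==> i < j ==> j \<le> Suc m ==> fm m' i (y j) = fm m' (j - 1) (y i)"
  and "k \<le> Suc m"
 shows "\<exists>w\<in>frees (simplices K (Suc m)). \<forall>i<k. fm m i w = y i"
 using assms(3)
proof (induction k)
 case (Suc k)
 then obtain w where w: "w \<in> frees (simplices K (Suc m))" "\<forall>i<k. fm m i w = y i" by auto
 have k: "k \<le> m" using Suc.prems by simp
 let ?u = "fm m k w - y k"
 have u: "?u \<in> frees (simplices K m)"
  by (intro frees_diff fm_closed w(1) y) (use k in auto)
 have "fm m i (w - sm m k ?u) = y i" if "i < Suc k" for i
 proof (cases "i = k")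
  case True
  then show ?thesis using fm_sm_eq[OF u k] by (simp add: frag_extend_diff)
 next
  case False
  then have i: "i < k" using that by simp
  then obtain m' where m': "m = Suc m'" using k by (cases m) auto
  have "fm m' i ?u = fm m' (k - 1) (fm m i w) - fm m' (k - 1) (y i)"
   using fm_fm[of w m' i k] compat[OF m' i] w(1) k i m' by (simp add: frag_extend_diff)
  then have "fm m' i ?u = 0" using w(2) i by simp
  then have "fm m i (sm m k ?u) = 0"
   using fm_sm_less[of ?u m' i k] u i k m' by simp
  then show ?thesis using w(2) i by (simp add: frag_extend_diff)
 qed
 moreover have "w - sm m k ?u \<in> frees (simplices K (Suc m))"
  by (intro frees_diff sm_closed w(1) u k)
 ultimately show ?case by blast
qed auto

end

context acyclic_over
begin

text \<open>Boundedness modulo degenerate chains gives boundedness on the nose for Moore cycles, because the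
 projection to the Moore complex annihilates degenerate chains.\<close>

lemma normalized_filler:
 assumes e: "e \<in> frees (simplices K m)" and "m = 0 ==> flin \<epsilon> e = 0"
  and "\<And>m' i. m = Suc m' ==> i \<le> m ==> fm m' i e = 0"
 shows "\<exists>v\<in>frees (simplices K (Suc m)). (\<forall>i\<le>m. fm m i v = 0) & fm m (Suc m) v = e"
proof -
 have "\<exists>v\<in>frees (simplices K (Suc m)). sbd K m v = e & (\<forall>i<m. fm m i v = 0)"
 proof (cases m)
  case 0
  then show ?thesis using acyclic_0 e assms(2) by auto
 next
  case (Suc n)
  obtain v where v: "v \<in> frees (simplices K (Suc m))" "e - sbd K m v \<in> frees (degenerates K m)"
   using acyclic_Suc[of e n] e assms(3) Suc by auto
  have "moore n m (e - sbd K m v) = 0" using moore_degenerates v(2) Suc by simp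
  then have "moore n m (sbd K m v) = moore n m e" by (simp add: additive_map_diff[OF moore_additive])
  also have "\<dots> = e" using moore_id[of n e m] assms(3) Suc by simp
  finally have "sbd K m (moore m m v) = e" using sbd_moore[of v n m] v(1) Suc by simp
  moreover have "\<forall>i<m. fm m i (moore m m v) = 0" using fm_moore[OF v(1)] by simp
  ultimately show ?thesis using moore_closed[OF v(1), of m] by auto
 qed
 then obtain v where v: "v \<in> frees (simplices K (Suc m))" "sbd K m v = e" "\<forall>i<m. fm m i v = 0" by blast
 let ?w = "prk m m v"
 have w: "?w \<in> frees (simplices K (Suc m))" by (rule prk_closed[OF v(1)]) simp
 have 0: "fm m i ?w = 0" if "i \<le> m" for i using fm_prk[OF v(1) _ _ that] v(3) by simp
 have "sbd K m v = (\<Sum>i\<in>{m, Suc m}. frag_cmul ((-1) ^ i) (fm m i v))"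
  unfolding sbd_def using v(3) by (intro sum.mono_neutral_right) auto
 then have "e = frag_cmul ((-1) ^ m) (fm m m v - fm m (Suc m) v)"
  using v(2) by (simp add: additive_map_diff[OF additive_map_cmul_map[OF additive_map_id]])
 moreover have "fm m (Suc m) ?w = fm m (Suc m) v - fm m m v"
  using fm_sm_eq[OF fm_closed[OF v(1)], of m m "Suc m"] by (simp add: prk_def frag_extend_diff)
 ultimately have "e = frag_cmul ((-1) ^ m) (- fm m (Suc m) ?w)" by simp
 then have "e = fm m (Suc m) (frag_cmul ((-1) ^ Suc m) ?w)" by (simp add: frag_extend_cmul frag_cmul_uminus)
 moreover have "fm m i (frag_cmul ((-1) ^ Suc m) ?w) = 0" if "i \<le> m" for i
  using 0[OF that] by (simp add: frag_extend_cmul del: power_Suc)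
 ultimately show ?thesis using frees_cmul[OF w] by metis
qed

text \<open>Compatible prescriptions of all faces can be filled: a horn filler takes care of all faces but one,
 and the difference in the remaining face is a Moore cycle.\<close>

lemma sphere_filler:
 assumes y: "\<And>i. i \<le> Suc m ==> y i \<in> frees (simplices K m)"
  and compat: "\<And>m' i j. m = Suc m' ==> i < j ==> j \<le> Suc m ==> fm m' i (y j) = fm m' (j - 1) (y i)"
  and compat0: "m = 0 ==> flin \<epsilon> (y 0) = flin \<epsilon> (y 1)"
 shows "\<exists>w\<in>frees (simplices K (Suc m)). \<forall>i\<le>Suc m. fm m i w = y i"
proof -
 obtain w where w: "w \<in> frees (simplices K (Suc m))" "\<forall>i<Suc m. fm m i w = y i"
  using horn_filler[OF y compat, of "Suc m"] by auto
 let ?e = "y (Suc m) - fm m (Suc m) w"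
 have "\<exists>v\<in>frees (simplices K (Suc m)). (\<forall>i\<le>m. fm m i v = 0) & fm m (Suc m) v = ?e"
 proof (rule normalized_filler)
  show "?e \<in> frees (simplices K m)" by (intro frees_diff fm_closed w(1) y) auto
  show "flin \<epsilon> ?e = 0" if "m = 0"
  proof -
   have "flin \<epsilon> (fm 0 0 w) = flin \<epsilon> (fm 0 (Suc 0) w)"
    unfolding flin_flin using w(1) that by (intro flin_cong[of w "simplices K (Suc 0)"] eps_face) auto
   then show ?thesis using w(2) that compat0 by (simp add: frag_extend_diff)
  qed
  show "fm m' i ?e = 0" if m': "m = Suc m'" and i: "i \<le> m" for m' i
  proof -
   have "fm m' i (fm m (Suc m) w) = fm m' m (fm m i w)"
    using fm_fm[of w m' i "Suc m"] w(1) i m' by simp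
   then show ?thesis
    using compat[OF m', of i "Suc m"] i w(2) by (simp add: frag_extend_diff)
  qed
 qed
 then obtain v where v: "v \<in> frees (simplices K (Suc m))" "\<forall>i\<le>m. fm m i v = 0" "fm m (Suc m) v = ?e" by blast
 have "fm m i (w + v) = y i" if "i \<le> Suc m" for i
  using w(2) v(2,3) that by (cases "i = Suc m") (simp_all add: frag_extend_add)
 then show ?thesis using w(1) v(1) by blast
qed

definition base_pt :: "'x => 'a" where
 "base_pt y = (SOME x. x \<in> simplices K 0 & \<epsilon> x = y)"

lemma base_pt: "y \<in> X ==> base_pt y \<in> simplices K 0 & \<epsilon> (base_pt y) = y"
 unfolding base_pt_def using eps_surj by (intro someI_ex[of "%x. x \<in> simplices K 0 & \<epsilon> x = y"]) auto

primrec extra :: "nat => 'a => ('a \<Rightarrow>\<^sub>0 int)" where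
 "extra 0 x = (SOME w. w \<in> frees (simplices K 1) & fm 0 0 w = frag_of x & fm 0 1 w = frag_of (base_pt (\<epsilon> x)))"
| "extra (Suc n) x = (SOME w. w \<in> frees (simplices K (Suc (Suc n))) & fm (Suc n) 0 w = frag_of x \<and>
   (\<forall>i\<le>Suc n. fm (Suc n) (Suc i) w = extra n (face K n i x)))"

text \<open>The extra degeneracy contracts the augmented simplicial group. In general it does not exist on the
 simplicial set itself; it is chosen on basis elements by filling spheres of chains, in ascending dimensions.\<close>

lemma extra_0:
 assumes "x \<in> simplices K 0"
 shows "extra 0 x \<in> frees (simplices K 1) & fm 0 0 (extra 0 x) = frag_of x \<and>
  fm 0 1 (extra 0 x) = frag_of (base_pt (\<epsilon> x))"
proof -
 have ex: "\<epsilon> x \<in> X" using assms eps_surj by blast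
 note bp = base_pt[OF ex]
 have "\<exists>w\<in>frees (simplices K (Suc 0)). \<forall>i\<le>Suc 0. fm 0 i w = (if i = 0 then frag_of x else frag_of (base_pt (\<epsilon> x)))"
  by (rule sphere_filler) (use assms bp in auto)
 then obtain w where "w \<in> frees (simplices K (Suc 0))" "\<forall>i\<le>Suc 0. fm 0 i w = (if i = 0 then frag_of x else frag_of (base_pt (\<epsilon> x)))"
  by blast
 then have "w \<in> frees (simplices K 1) & fm 0 0 w = frag_of x & fm 0 1 w = frag_of (base_pt (\<epsilon> x))"
  by simp
 then show ?thesis unfolding extra.simps by (rule someI)
qed

lemma extra_Suc:
 "x \<in> simplices K (Suc n) ==> extra (Suc n) x \<in> frees (simplices K (Suc (Suc n))) \<and>
  fm (Suc n) 0 (extra (Suc n) x) = frag_of x \<and>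
  (\<forall>i\<le>Suc n. fm (Suc n) (Suc i) (extra (Suc n) x) = extra n (face K n i x))"
proof (induction n arbitrary: x)
 case (0 x)
 define y where "y i = (case i of 0 => frag_of x | Suc i => extra 0 (face K 0 i x))" for i
 have f: "face K 0 i x \<in> simplices K 0" if "i \<le> Suc 0" for i by (rule face_closed[OF 0 that])
 have "\<exists>w\<in>frees (simplices K (Suc (Suc 0))). \<forall>i\<le>Suc (Suc 0). fm (Suc 0) i w = y i"
 proof (rule sphere_filler)
  show "y i \<in> frees (simplices K (Suc 0))" if "i \<le> Suc (Suc 0)" for i
   using that 0 f extra_0 by (cases i) (auto simp: y_def)
  fix m' i j assume m': "Suc 0 = Suc m'" and ij: "i < j" "j \<le> Suc (Suc 0)"
  then obtain j' where j': "j = Suc j'" "j' \<le> Suc 0" by (cases j) auto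
  show "fm m' i (y j) = fm m' (j - 1) (y i)"
  proof (cases i)
   case 0
   then show ?thesis using extra_0[OF f[OF j'(2)]] j' m' by (simp add: y_def)
  next
   case (Suc i')
   then have "i' = 0" "j' = Suc 0" using ij j' by auto
   then show ?thesis
    using extra_0[OF f[of 0]] extra_0[OF f[of "Suc 0"]] eps_face[OF 0] Suc j' m' by (simp add: y_def)
  qed
 qed simp
 then obtain w where w: "w \<in> frees (simplices K (Suc (Suc 0)))" "\<forall>i\<le>Suc (Suc 0). fm (Suc 0) i w = y i" by blast
 then have "w \<in> frees (simplices K (Suc (Suc 0))) & fm (Suc 0) 0 w = frag_of x \<and>
   (\<forall>i\<le>Suc 0. fm (Suc 0) (Suc i) w = extra 0 (face K 0 i x))"
  by (auto simp: y_def)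
 then show ?case unfolding extra.simps(2) by (rule someI)
next
 case (Suc n x)
 define y where "y i = (case i of 0 => frag_of x | Suc i => extra (Suc n) (face K (Suc n) i x))" for i
 have f: "face K (Suc n) i x \<in> simplices K (Suc n)" if "i \<le> Suc (Suc n)" for i
  by (rule face_closed[OF Suc.prems that])
 have "\<exists>w\<in>frees (simplices K (Suc (Suc (Suc n)))). \<forall>i\<le>Suc (Suc (Suc n)). fm (Suc (Suc n)) i w = y i"
 proof (rule sphere_filler)
  show "y i \<in> frees (simplices K (Suc (Suc n)))" if "i \<le> Suc (Suc (Suc n))" for i
   using that Suc.prems Suc.IH[OF f] by (cases i) (auto simp: y_def simp del: extra.simps)
  fix m' i j assume m': "Suc (Suc n) = Suc m'" and ij: "i < j" "j \<le> Suc (Suc (Suc n))"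
  then obtain j' where j': "j = Suc j'" "j' \<le> Suc (Suc n)" by (cases j) auto
  have m'': "m' = Suc n" using m' by simp
  show "fm m' i (y j) = fm m' (j - 1) (y i)"
  proof (cases i)
   case 0
   then show ?thesis using Suc.IH[OF f[OF j'(2)]] j' by (simp add: y_def m'' del: extra.simps)
  next
   case (Suc i')
   then obtain j'' where j'': "j' = Suc j''" using ij j' by (cases j') auto
   have "i' < j'" "i' \<le> Suc n" "j'' \<le> Suc n" "i' \<le> Suc (Suc n)" using Suc ij j' j'' by auto
   moreover from this have "face K n i' (face K (Suc n) j' x) = face K n j'' (face K (Suc n) i' x)"
    using face_face[OF Suc.prems, of i' j'] j' j'' by simp
   ultimately show ?thesis
    using Suc.IH[OF f[OF j'(2)]] Suc.IH[OF f[of i']] Suc j' j'' by (simp add: y_def m'' del: extra.simps)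
  qed
 qed simp
 then obtain w where w: "w \<in> frees (simplices K (Suc (Suc (Suc n))))"
  "\<forall>i\<le>Suc (Suc (Suc n)). fm (Suc (Suc n)) i w = y i" by blast
 then have "w \<in> frees (simplices K (Suc (Suc (Suc n)))) & fm (Suc (Suc n)) 0 w = frag_of x \<and>
   (\<forall>i\<le>Suc (Suc n). fm (Suc (Suc n)) (Suc i) w = extra (Suc n) (face K (Suc n) i x))"
  by (auto simp: y_def simp del: extra.simps)
 then show ?case unfolding extra.simps(2)[of "Suc n"] by (rule someI)
qed

end

subsection \<open>Tensor powers\<close>

abbreviation ucons :: "'a => ('a list \<Rightarrow>\<^sub>0 int) => ('a list \<Rightarrow>\<^sub>0 int)" where
 "ucons x \<equiv> flin (%ys. x # ys)"

primrec tens :: "('a \<Rightarrow>\<^sub>0 int) list => ('a list \<Rightarrow>\<^sub>0 int)" where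
 "tens [] = frag_of []"
| "tens (c # cs) = frag_extend (%x. ucons x (tens cs)) c"

definition lists_of :: "'a set => nat => 'a list set" where
 "lists_of A p = {xs. set xs \<subseteq> A & length xs = p}"

lemma tens_closed: "set cs \<subseteq> frees A ==> tens cs \<in> frees (lists_of A (length cs))"
proof (induction cs)
 case (Cons c cs)
 then have "tens cs \<in> frees (lists_of A (length cs))" by simp
 then have "ucons x (tens cs) \<in> frees (lists_of A (length (c # cs)))" if "x \<in> A" for x
  by (rule flin_closed) (use that in \<open>simp add: lists_of_def\<close>)
 moreover have "c \<in> frees A" using Cons.prems by simp
 ultimately show ?case
  unfolding tens.simps by (elim additive_map_closedI[OF _ additive_map_frag_extend]) simp_all
qed (simp add: lists_of_def)

lemma flin_map_tens: "flin (map f) (tens cs) = tens (map (flin f) cs)"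
proof (induction cs)
 case (Cons c cs)
 have *: "flin (map f) (ucons x (tens cs)) = ucons (f x) (flin (map f) (tens cs))" for x
  by (simp add: flin_flin)
 show ?case
  unfolding tens.simps list.map
  by (rule additive_map_eqI[where S = UNIV and c = c, OF _ additive_ff additive_ff])
   (simp_all add: frees_def Cons.IH *)
qed simp

lemma tens_of: "tens (map (%x. frag_of (g x)) xs) = frag_of (map g xs)"
 by (induction xs) simp_all

text \<open>The tuples without equal neighbours span a natural direct summand of all tuples: the
 complement of the degenerate tuples is given by the expansion of
 \<open>x\<^sub>1 \<otimes> (x\<^sub>2 - x\<^sub>1) \<otimes> (x\<^sub>3 - x\<^sub>2) \<otimes> \<dots>\<close>.\<close>

primrec split_tail :: "'a => 'a list => ('a list \<Rightarrow>\<^sub>0 int)" where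
 "split_tail a [] = frag_of []"
| "split_tail a (y # ys) = ucons y (split_tail y ys) - ucons a (split_tail y ys)"

primrec split :: "'a list => ('a list \<Rightarrow>\<^sub>0 int)" where
 "split [] = frag_of []"
| "split (x # xs) = ucons x (split_tail x xs)"

lemma split_degenerate: "\<not> distinct_adj xs ==> split xs = 0"
proof -
 have "\<not> distinct_adj (a # ys) ==> split_tail a ys = 0" for a :: 'a and ys
  by (induction ys arbitrary: a) auto
 then show "\<not> distinct_adj xs ==> split xs = 0" by (cases xs) auto
qed

lemma flin_map_split: "flin (map f) (split xs) = split (map f xs)"
proof -
 have *: "flin (map f) (ucons x c) = ucons (f x) (flin (map f) c)" for x c by (simp add: flin_flin)
 have "flin (map f) (split_tail a ys) = split_tail (f a) (map f ys)" for a ys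
  by (induction ys arbitrary: a) (simp_all add: frag_extend_diff *)
 then show ?thesis by (cases xs) (simp_all add: *)
qed

lemma split_closed: "xs \<in> lists_of A p ==> split xs \<in> frees (lists_of A p)"
proof -
 have "a \<in> A ==> set ys \<subseteq> A ==> split_tail a ys \<in> frees (lists_of A (length ys))" for a ys
 proof (induction ys arbitrary: a)
  case (Cons y ys)
  then have "split_tail y ys \<in> frees (lists_of A (length ys))" by simp
  then have "ucons x (split_tail y ys) \<in> frees (lists_of A (length (y # ys)))" if "x \<in> A" for x
   by (rule flin_closed) (use that in \<open>simp add: lists_of_def\<close>)
  then show ?case unfolding split_tail.simps using Cons.prems by (intro frees_diff) simp_all
 qed (simp add: lists_of_def)
 then have *: "split_tail a ys \<in> frees (lists_of A (length ys))" if "a \<in> A" "set ys \<subseteq> A" for a ys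
  using that by simp
 assume xs: "xs \<in> lists_of A p"
 show "split xs \<in> frees (lists_of A p)"
 proof (cases xs)
  case (Cons y ys)
  have "split_tail y ys \<in> frees (lists_of A (length ys))"
   using * xs Cons by (simp add: lists_of_def)
  then show ?thesis
   unfolding Cons split.simps
   by (rule flin_closed) (use xs Cons in \<open>auto simp: lists_of_def\<close>)
 qed (use xs in \<open>simp add: lists_of_def\<close>)
qed

lemma Nmap_ucons: "Nmap f (ucons x c) = Ncons (f x) (Nmap f c)"
 by (rule additive_map_eqI[where S = UNIV and c = c, OF _ additive_ff additive_ff])
  (simp_all add: frees_def nmap_Cons)

lemma normalize_split:
 assumes "distinct_adj xs"
 shows "Nmap (%x. x) (split xs) = frag_of xs"
proof -
 have "distinct_adj (a # ys) ==> Ncons a (Nmap (%x. x) (split_tail a ys)) = frag_of (a # ys)" for a :: 'a and ys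
 proof (induction ys arbitrary: a)
  case Nil
  then show ?case by (simp add: ncons_def)
 next
  case (Cons y ys)
  then have "Ncons y (Nmap (%x. x) (split_tail y ys)) = frag_of (y # ys)" "a \<noteq> y" by auto
  then show ?case by (simp add: frag_extend_diff Nmap_ucons Ncons_Ncons) (simp add: ncons_def)
 qed
 then show ?thesis using assms by (cases xs) (simp_all add: Nmap_ucons)
qed

lemma Nmap_flin: "Nmap g (flin (map f) c) = Nmap (g \<circ> f) c"
 by (rule additive_map_eqI[where S = UNIV, OF _ additive_ff])
  (simp_all add: frees_def nmap_def comp_def)

lemma split_Nmap: "frag_extend split (Nmap f c) = flin (map f) (frag_extend split c)"
proof -
 have *: "frag_extend split (nmap f xs) = split (map f xs)" for xs
  using split_degenerate by (auto simp: nmap_def)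
 show ?thesis
  by (rule additive_map_eqI[where S = UNIV and c = c, OF _ additive_ff additive_ff])
   (simp_all add: frees_def flin_map_split *)
qed

definition nlists :: "'a set => nat => 'a list set" where
 "nlists A p = {xs \<in> lists_of A p. distinct_adj xs}"

definition nsbd :: "('a, 'm) sset_scheme => nat => ('a list \<Rightarrow>\<^sub>0 int) => ('a list \<Rightarrow>\<^sub>0 int)" where
 "nsbd K n c = (\<Sum>i\<le>Suc n. frag_cmul ((-1) ^ i) (Nmap (face K n i) c))"

lemma nsbd_additive: "additive_map (nsbd K n)"
 unfolding nsbd_def by (intro additive_map_sum_map additive_map_cmul_map additive_map_frag_extend)

context acyclic_over
begin

definition list_extra :: "nat => ('a list \<Rightarrow>\<^sub>0 int) => ('a list \<Rightarrow>\<^sub>0 int)" where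
 "list_extra n = frag_extend (%xs. tens (map (extra n) xs))"

lemma extra_closed: "x \<in> simplices K n ==> extra n x \<in> frees (simplices K (Suc n))"
 using extra_0 extra_Suc by (cases n) auto

lemma list_extra_closed:
 assumes "c \<in> frees (lists_of (simplices K n) p)"
 shows "list_extra n c \<in> frees (lists_of (simplices K (Suc n)) p)"
 unfolding list_extra_def
proof (rule additive_map_closedI[OF assms additive_map_frag_extend])
 fix xs assume xs: "xs \<in> lists_of (simplices K n) p"
 then have "set (map (extra n) xs) \<subseteq> frees (simplices K (Suc n))"
  using extra_closed by (auto simp: lists_of_def)
 from tens_closed[OF this] show "frag_extend (%xs. tens (map (extra n) xs)) (frag_of xs)
   \<in> frees (lists_of (simplices K (Suc n)) p)"
  using xs by (simp add: lists_of_def)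
qed

lemma face_list_extra:
 assumes c: "c \<in> frees (lists_of (simplices K n) p)"
 shows "flin (map (face K n 0)) (list_extra n c) = c"
  and "n = 0 ==> flin (map (face K 0 1)) (list_extra 0 c) = flin (map base_pt) (flin (map \<epsilon>) c)"
  and "n = Suc m ==> i \<le> n ==> flin (map (face K n (Suc i))) (list_extra n c) = list_extra m (flin (map (face K m i)) c)"
proof -
 have *: "flin (map f) (tens (map (extra n) xs)) = tens (map (%x. g x) xs)"
  if "\<And>x. x \<in> simplices K n ==> flin f (extra n x) = g x" "xs \<in> lists_of (simplices K n) p" for f and g :: "'a => ('a \<Rightarrow>\<^sub>0 int)" and xs
  using that by (auto simp: flin_map_tens lists_of_def subset_iff intro!: arg_cong[of _ _ tens])
 show "flin (map (face K n 0)) (list_extra n c) = c"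
  unfolding list_extra_def
 proof (rule additive_map_eqI[OF c additive_ff additive_map_id])
  fix xs assume "xs \<in> lists_of (simplices K n) p"
  then show "flin (map (face K n 0)) (frag_extend (%xs. tens (map (extra n) xs)) (frag_of xs)) = frag_of xs"
   using *[of "face K n 0" "%x. frag_of x" xs] extra_0 extra_Suc tens_of[of "%x. x" xs] by (cases n) auto
 qed
 show "flin (map (face K 0 1)) (list_extra 0 c) = flin (map base_pt) (flin (map \<epsilon>) c)" if "n = 0"
  unfolding list_extra_def flin_flin
 proof (rule additive_map_eqI[OF c additive_ff additive_map_frag_extend])
  fix xs assume "xs \<in> lists_of (simplices K n) p"
  then show "flin (map (face K 0 1)) (frag_extend (%xs. tens (map (extra 0) xs)) (frag_of xs))
    = flin (%x. map base_pt (map \<epsilon> x)) (frag_of xs)"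
   using *[of "face K 0 1" "%x. frag_of (base_pt (\<epsilon> x))" xs] extra_0 that tens_of[of "%x. base_pt (\<epsilon> x)" xs]
   by (simp add: o_def)
 qed
 show "flin (map (face K n (Suc i))) (list_extra n c) = list_extra m (flin (map (face K m i)) c)"
  if n: "n = Suc m" and i: "i \<le> n"
  unfolding list_extra_def
 proof (rule additive_map_eqI[OF c additive_ff
    additive_ff])
  fix xs assume "xs \<in> lists_of (simplices K n) p"
  then show "flin (map (face K n (Suc i))) (frag_extend (%xs. tens (map (extra n) xs)) (frag_of xs))
    = frag_extend (%xs. tens (map (extra m) xs)) (flin (map (face K m i)) (frag_of xs))"
   using *[of "face K n (Suc i)" "%x. extra m (face K m i x)" xs] extra_Suc n i by (simp add: o_def)
 qed
qed

lemma nsbd_normalize: "nsbd K n (Nmap (%x. x) c) = (\<Sum>i\<le>Suc n. frag_cmul ((-1) ^ i) (Nmap (%x. x) (flin (map (face K n i)) c)))"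
 unfolding nsbd_def by (simp add: Nmap_Nmap Nmap_flin comp_def)

lemma normalize_closed: "c \<in> frees (lists_of A p) ==> Nmap (%x. x) c \<in> frees (nlists A p)"
 by (rule additive_map_closedI) (auto simp: nlists_def nmap_def)

lemma
 assumes c: "c \<in> frees (nlists (simplices K n) p)"
 shows split_closed': "frag_extend split c \<in> frees (lists_of (simplices K n) p)"
  and normalize_split': "Nmap (%x. x) (frag_extend split c) = c"
proof -
 show "frag_extend split c \<in> frees (lists_of (simplices K n) p)"
  by (rule additive_map_closedI[OF c additive_map_frag_extend]) (use split_closed in \<open>auto simp: nlists_def\<close>)
 show "Nmap (%x. x) (frag_extend split c) = c"
  by (rule additive_map_eqI[OF c additive_ff additive_map_id])
   (simp add: nlists_def normalize_split)
qed

text \<open>An extra degeneracy of the simplicial abelian group of chains induces one on its tensor powers, which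
 are the chains on tuples. The normalized tuples are a natural direct summand of all tuples and inherit
 the exactness.\<close>

theorem columns_exact_Suc:
 assumes c: "c \<in> frees (nlists (simplices K (Suc n)) p)" and 0: "nsbd K n c = 0"
 shows "\<exists>c'\<in>frees (nlists (simplices K (Suc (Suc n))) p). nsbd K (Suc n) c' = c"
proof -
 let ?u = "frag_extend split c"
 note u = split_closed'[OF c] and Nu = normalize_split'[OF c]
 let ?w = "list_extra (Suc n) ?u"
 have faces: "(\<Sum>i\<le>Suc n. frag_cmul ((-1) ^ i) (flin (map (face K n i)) ?u)) = frag_extend split (nsbd K n c)"
  unfolding nsbd_def by (simp add: frag_extend_sum frag_extend_cmul o_def split_Nmap del: sum.atMost_Suc)
 have "(\<Sum>i\<le>Suc (Suc n). frag_cmul ((-1) ^ i) (flin (map (face K (Suc n) i)) ?w))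
   = ?u + (\<Sum>i\<le>Suc n. frag_cmul ((-1) ^ Suc i) (list_extra n (flin (map (face K n i)) ?u)))"
  unfolding sum.atMost_Suc_shift
  using face_list_extra(1)[OF u] face_list_extra(3)[OF u HOL.refl] by (simp del: sum.atMost_Suc)
 also have "(\<Sum>i\<le>Suc n. frag_cmul ((-1) ^ Suc i) (list_extra n (flin (map (face K n i)) ?u)))
   = - list_extra n (\<Sum>i\<le>Suc n. frag_cmul ((-1) ^ i) (flin (map (face K n i)) ?u))"
  unfolding list_extra_def
  by (simp add: frag_extend_sum frag_extend_cmul o_def sum_negf[symmetric] del: sum.atMost_Suc)
 also have "\<dots> = 0" unfolding faces 0 by (simp add: list_extra_def)
 finally have *: "(\<Sum>i\<le>Suc (Suc n). frag_cmul ((-1) ^ i) (flin (map (face K (Suc n) i)) ?w)) = ?u" by simp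
 have "nsbd K (Suc n) (Nmap (%x. x) ?w)
   = Nmap (%x. x) (\<Sum>i\<le>Suc (Suc n). frag_cmul ((-1) ^ i) (flin (map (face K (Suc n) i)) ?w))"
  unfolding nsbd_normalize
  by (simp add: frag_extend_sum frag_extend_cmul o_def del: sum.atMost_Suc)
 then have "nsbd K (Suc n) (Nmap (%x. x) ?w) = Nmap (%x. x) ?u" unfolding * .
 then show ?thesis using Nu normalize_closed[OF list_extra_closed[OF u]] by metis
qed

theorem columns_exact_0:
 assumes c: "c \<in> frees (nlists (simplices K 0) p)" and 0: "Nmap \<epsilon> c = 0"
 shows "\<exists>c'\<in>frees (nlists (simplices K (Suc 0)) p). nsbd K 0 c' = c"
proof -
 let ?u = "frag_extend split c"
 note u = split_closed'[OF c] and Nu = normalize_split'[OF c]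
 let ?w = "list_extra 0 ?u"
 have "flin (map \<epsilon>) ?u = 0" using split_Nmap[of \<epsilon> c] 0 by simp
 then have "nsbd K 0 (Nmap (%x. x) ?w) = Nmap (%x. x) ?u"
  unfolding nsbd_normalize using face_list_extra(1,2)[OF u] by simp
 then show ?thesis using Nu normalize_closed[OF list_extra_closed[OF u]] by metis
qed

theorem columns_surjective:
 assumes "r \<in> frees (nlists X p)"
 shows "\<exists>c\<in>frees (nlists (simplices K 0) p). Nmap \<epsilon> c = r"
proof
 have *: "map \<epsilon> (map base_pt ys) = ys" if "ys \<in> nlists X p" for ys
  using that base_pt by (auto simp: nlists_def lists_of_def intro!: map_idI)
 have "map base_pt ys \<in> nlists (simplices K 0) p" if "ys \<in> nlists X p" for ys
 proof -
  have "distinct_adj (map \<epsilon> (map base_pt ys))" unfolding *[OF that] using that by (simp add: nlists_def)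
  then have "distinct_adj (map base_pt ys)" by (auto simp: distinct_adj_conv_nth)
  then show ?thesis using that base_pt by (auto simp: nlists_def lists_of_def)
 qed
 then show "flin (map base_pt) r \<in> frees (nlists (simplices K 0) p)" by (rule flin_closed[OF assms])
 show "Nmap \<epsilon> (flin (map base_pt) r) = r"
 proof (rule additive_map_eqI[OF assms additive_ff additive_map_id])
  fix ys assume ys: "ys \<in> nlists X p"
  then show "Nmap \<epsilon> (flin (map base_pt) (frag_of ys)) = frag_of ys"
   using *[OF ys] by (simp add: nmap_def nlists_def del: map_map)
 qed
qed

end

section \<open>Attaching cells in singular homology\<close>

abbreviation simplex_top :: "nat => (nat => real) topology" where
 "simplex_top n \<equiv> subtopology (powertop_real UNIV) (standard_simplex n)"

lemma relative_iso_push: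
 assumes hom: "homotopic_with (%h. h \<in> S \<rightarrow> S & h \<in> U \<rightarrow> U) Y Y id f" and f: "f \<in> U \<rightarrow> S" and "S \<subseteq> U"
 shows "hom_induced p Y S Y U id \<in> iso (relative_homology_group p Y S) (relative_homology_group p Y U)"
proof (rule homotopy_equivalence_relative_homology_group_isomorphism)
 show "continuous_map Y Y id" "continuous_map Y Y f"
  using homotopic_with_imp_continuous_maps[OF hom] by auto
 show "id \<in> S \<rightarrow> U" using assms(3) by auto
 show "f \<in> U \<rightarrow> S" by (rule f)
 have *: "homotopic_with (%h. h \<in> S \<rightarrow> S & h \<in> U \<rightarrow> U) Y Y f id" using hom by (rule homotopic_with_symD)
 show "homotopic_with (%h. h \<in> S \<rightarrow> S) Y Y (f \<circ> id) id"
  using homotopic_with_mono[OF *, of "%h. h \<in> S \<rightarrow> S"] by simp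
 show "homotopic_with (%h. h \<in> U \<rightarrow> U) Y Y (id \<circ> f) id"
  using homotopic_with_mono[OF *, of "%h. h \<in> U \<rightarrow> U"] by simp
qed

lemma iso_comp_cancel_right:
 assumes "a \<in> iso G H" "d \<in> hom H K" "b \<in> iso G K" "\<And>x. x \<in> carrier G ==> d (a x) = b x"
 shows "d \<in> iso H K"
proof -
 have "bij_betw a (carrier G) (carrier H)" "bij_betw b (carrier G) (carrier K)"
  using assms by (auto simp: iso_def)
 moreover from this have "bij_betw (d \<circ> a) (carrier G) (carrier K)"
  using assms(4) by (subst bij_betw_cong[where g = b]) auto
 ultimately show ?thesis using assms(2) bij_betw_comp_iff[of a "carrier G" "carrier H" d "carrier K"] by (auto simp: iso_def)
qed

lemma iso_comp_cancel_left:
 assumes "i \<in> iso H K" "d \<in> hom G H" "b \<in> iso G K" "\<And>x. x \<in> carrier G ==> i (d x) = b x"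
 shows "d \<in> iso G H"
proof -
 have i: "bij_betw i (carrier H) (carrier K)" and "bij_betw b (carrier G) (carrier K)"
  using assms by (auto simp: iso_def)
 moreover from this have "bij_betw (i \<circ> d) (carrier G) (carrier K)"
  using assms(4) by (subst bij_betw_cong[where g = b]) auto
 moreover have "d ` carrier G \<subseteq> carrier H" using assms(2) by (auto simp: hom_def)
 ultimately show ?thesis using assms(2) bij_betw_comp_iff2[OF i] by (auto simp: iso_def)
qed

text \<open>The excision principle for attaching cells: if a neighbourhood of a closed subspace can be
 pushed into it, and a map is a homeomorphism away from the subspaces, then it induces an
 isomorphism of relative homology groups.\<close>

lemma attach_iso:
 fixes g :: "'b => real" and c :: real
 assumes e: "continuous_map Z Y e" and g: "continuous_map Y euclideanreal g" and c: "c > 0"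
  and S: "S = {y \<in> topspace Y. g y \<le> 0}" and T: "T = {z \<in> topspace Z. g (e z) \<le> 0}"
  and U: "U = {y \<in> topspace Y. g y < c}" and V: "V = {z \<in> topspace Z. g (e z) < c}"
  and homeo: "homeomorphic_map (subtopology Z {z \<in> topspace Z. g (e z) > 0})
   (subtopology Y {y \<in> topspace Y. g y > 0}) e"
  and Y: "homotopic_with (%h. h \<in> S \<rightarrow> S & h \<in> U \<rightarrow> U) Y Y id f" "f \<in> U \<rightarrow> S"
  and Z: "homotopic_with (%h. h \<in> T \<rightarrow> T & h \<in> V \<rightarrow> V) Z Z id k" "k \<in> V \<rightarrow> T"
 shows "hom_induced p Z T Y S e \<in> iso (relative_homology_group p Z T) (relative_homology_group p Y S)"
proof -
 have ge: "continuous_map Z euclideanreal (%z. g (e z))"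
  using continuous_map_compose[OF e g] by (simp add: o_def)
 have eZ: "e z \<in> topspace Y" if "z \<in> topspace Z" for z
  using continuous_map_image_subset_topspace[OF e] that by blast
 define A where "A = {y \<in> topspace Y. g y \<le> c / 2}"
 define B where "B = {z \<in> topspace Z. g (e z) \<le> c / 2}"
 have SU: "S \<subseteq> U" and TV: "T \<subseteq> V" using c by (auto simp: S U T V)
 have sets: "closedin Y A" "openin Y U" "closedin Z B" "openin Z V"
 proof -
  have "A = {y \<in> topspace Y. g y \<in> {..c / 2}}" "U = {y \<in> topspace Y. g y \<in> {..<c}}"
   "B = {z \<in> topspace Z. g (e z) \<in> {..c / 2}}" "V = {z \<in> topspace Z. g (e z) \<in> {..<c}}"
   by (auto simp: A_def U B_def V)
  then show "closedin Y A" "openin Y U" "closedin Z B" "openin Z V"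
   using closedin_continuous_map_preimage[OF g, of "{..c / 2}"] openin_continuous_map_preimage[OF g, of "{..<c}"]
    closedin_continuous_map_preimage[OF ge, of "{..c / 2}"] openin_continuous_map_preimage[OF ge, of "{..<c}"]
   by (auto simp: o_def)
 qed
 have AU: "A \<subseteq> U" "B \<subseteq> V" using c by (auto simp: A_def U B_def V)
 have exY: "hom_induced p (subtopology Y (topspace Y - A)) (U - A) Y U id
   \<in> iso (relative_homology_group p (subtopology Y (topspace Y - A)) (U - A)) (relative_homology_group p Y U)"
  using homology_excision_axiom[of Y A U "topspace Y" p] sets AU
  by (simp add: closure_of_closedin interior_of_openin U subtopology_topspace)
 have exZ: "hom_induced p (subtopology Z (topspace Z - B)) (V - B) Z V id
   \<in> iso (relative_homology_group p (subtopology Z (topspace Z - B)) (V - B)) (relative_homology_group p Z V)"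
  using homology_excision_axiom[of Z B V "topspace Z" p] sets AU
  by (simp add: closure_of_closedin interior_of_openin V subtopology_topspace)
 let ?ZB = "subtopology Z (topspace Z - B)" and ?YA = "subtopology Y (topspace Y - A)"
 have im: "e ` {z \<in> topspace Z. g (e z) > 0} = {y \<in> topspace Y. g y > 0}"
  using homeomorphic_imp_surjective_map[OF homeo] by (auto simp: topspace_subtopology Int_def)
 have imB: "e ` (topspace Z - B) = topspace Y - A"
 proof
  show "e ` (topspace Z - B) \<subseteq> topspace Y - A" using eZ by (auto simp: A_def B_def)
  show "topspace Y - A \<subseteq> e ` (topspace Z - B)"
  proof
   fix y assume y: "y \<in> topspace Y - A"
   then have "y \<in> e ` {z \<in> topspace Z. g (e z) > 0}" unfolding im using c by (auto simp: A_def)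
   then show "y \<in> e ` (topspace Z - B)" using y by (auto simp: A_def B_def)
  qed
 qed
 have homeoB: "homeomorphic_map ?ZB ?YA e"
 proof -
  have "homeomorphic_map (subtopology (subtopology Z {z \<in> topspace Z. g (e z) > 0}) (topspace Z - B))
    (subtopology (subtopology Y {y \<in> topspace Y. g y > 0}) (topspace Y - A)) e"
  proof (rule homeomorphic_map_subtopologies[OF homeo])
   have "topspace Z - B \<subseteq> {z \<in> topspace Z. g (e z) > 0}" "topspace Y - A \<subseteq> {y \<in> topspace Y. g y > 0}"
    using c by (auto simp: A_def B_def)
   then have "topspace (subtopology Z {z \<in> topspace Z. g (e z) > 0}) \<inter> (topspace Z - B) = topspace Z - B"
    "topspace (subtopology Y {y \<in> topspace Y. g y > 0}) \<inter> (topspace Y - A) = topspace Y - A"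
    by auto
   then show "e ` (topspace (subtopology Z {z \<in> topspace Z. g (e z) > 0}) \<inter> (topspace Z - B))
     = topspace (subtopology Y {y \<in> topspace Y. g y > 0}) \<inter> (topspace Y - A)"
    using imB by simp
  qed
  moreover have "{z \<in> topspace Z. g (e z) > 0} \<inter> (topspace Z - B) = topspace Z - B"
   "{y \<in> topspace Y. g y > 0} \<inter> (topspace Y - A) = topspace Y - A"
   using c by (auto simp: A_def B_def)
  ultimately show ?thesis by (simp add: subtopology_subtopology)
 qed
 have imV: "e ` (V - B) = U - A"
 proof -
  have "V - B = {z \<in> topspace Z - B. g (e z) < c}" "U - A = {y \<in> topspace Y - A. g y < c}"
   by (auto simp: U V A_def B_def)
  then show ?thesis using imB by auto
 qed
 have hB: "hom_induced p ?ZB (V - B) ?YA (U - A) e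
   \<in> iso (relative_homology_group p ?ZB (V - B)) (relative_homology_group p ?YA (U - A))"
  by (rule homeomorphic_map_relative_homology_iso[OF homeoB _ imV]) (auto simp: V)
 have eV: "e \<in> V \<rightarrow> U" and eT: "e \<in> T \<rightarrow> S" using eZ by (auto simp: U V S T)
 have cB: "continuous_map ?ZB Z id" "continuous_map ?YA Y id" "continuous_map ?ZB ?YA e"
  using homeomorphic_imp_continuous_map[OF homeoB] by (auto intro: continuous_map_from_subtopology)
 have mid: "hom_induced p Z V Y U e \<in> iso (relative_homology_group p Z V) (relative_homology_group p Y U)"
 proof (rule iso_comp_cancel_right[OF exZ hom_induced_hom iso_set_trans[OF hB exY]])
  fix x
  show "hom_induced p Z V Y U e (hom_induced p ?ZB (V - B) Z V id x)
    = (hom_induced p ?YA (U - A) Y U id \<circ> hom_induced p ?ZB (V - B) ?YA (U - A) e) x"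
   using hom_induced_compose'[OF cB(1) _ e eV, of "V - B" p x]
    hom_induced_compose'[OF cB(3) _ cB(2), of "V - B" "U - A" U p x] imV by auto
 qed
 show ?thesis
 proof (rule iso_comp_cancel_left[OF relative_iso_push[OF Y SU] hom_induced_hom
    iso_set_trans[OF relative_iso_push[OF Z TV] mid]])
  fix x
  show "hom_induced p Y S Y U id (hom_induced p Z T Y S e x)
    = (hom_induced p Z V Y U e \<circ> hom_induced p Z T Z V id) x"
  proof -
   have "hom_induced p Y S Y U id (hom_induced p Z T Y S e x) = hom_induced p Z T Y U (id \<circ> e) x"
    by (rule hom_induced_compose'[OF e eT]) (use SU in auto)
   moreover have "hom_induced p Z V Y U e (hom_induced p Z T Z V id x) = hom_induced p Z T Y U (e \<circ> id) x"
    by (rule hom_induced_compose'[OF _ _ e eV]) (use TV in auto)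
   ultimately show ?thesis by simp
  qed
 qed
qed

text \<open>An isomorphism of relative homology groups lifts relative cycles and reflects relative boundaries;
 this is how homology isomorphisms are used at the level of chains.\<close>

lemma relcycle_lift:
 assumes iso: "hom_induced (int p) Z T Y S e \<in> iso (relative_homology_group (int p) Z T) (relative_homology_group (int p) Y S)"
  and e: "continuous_map Z Y e" "e \<in> T \<rightarrow> S" and c: "singular_relcycle p Y S c"
 shows "\<exists>b. singular_relcycle p Z T b & homologous_rel p Y S c (chain_map p e b)"
proof -
 have "homologous_rel_set p Y S c \<in> carrier (relative_homology_group (int p) Y S)"
  using c by (auto simp: carrier_relative_homology_group)
 moreover have "hom_induced (int p) Z T Y S e ` carrier (relative_homology_group (int p) Z T)
   = carrier (relative_homology_group (int p) Y S)"
  using iso by (simp add: iso_def bij_betw_def)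
 ultimately have "homologous_rel_set p Y S c
   \<in> hom_induced (int p) Z T Y S e ` carrier (relative_homology_group (int p) Z T)" by metis
 then obtain x where x: "x \<in> carrier (relative_homology_group (int p) Z T)"
  "hom_induced (int p) Z T Y S e x = homologous_rel_set p Y S c"
  by (metis imageE)
 then obtain b where b: "singular_relcycle p Z T b" "x = homologous_rel_set p Z T b"
  by (auto simp: carrier_relative_homology_group)
 then have "homologous_rel_set p Y S (chain_map p e b) = homologous_rel_set p Y S c"
  using x(2) hom_induced_chain_map[OF e b(1)] by simp
 then have "homologous_rel p Y S c (chain_map p e b)" by (metis homologous_rel_set_eq)
 then show ?thesis using b(1) by blast
qed

lemma relboundary_reflect:
 assumes iso: "hom_induced (int p) Z T Y S e \<in> iso (relative_homology_group (int p) Z T) (relative_homology_group (int p) Y S)"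
  and e: "continuous_map Z Y e" "e \<in> T \<rightarrow> S" and b: "singular_relcycle p Z T b"
  and bd: "singular_relboundary p Y S (chain_map p e b)"
 shows "singular_relboundary p Z T b"
proof -
 have "homologous_rel_set p Y S (chain_map p e b) = singular_relboundary_set p Y S"
  using bd by (simp add: homologous_rel_set_eq_relboundary)
 also have "\<dots> = homologous_rel_set p Y S (chain_map p e 0)"
  using homologous_rel_set_eq_relboundary[of p Y S 0] by simp
 finally have "hom_induced (int p) Z T Y S e (homologous_rel_set p Z T b)
   = hom_induced (int p) Z T Y S e (homologous_rel_set p Z T 0)"
  using hom_induced_chain_map[OF e b] hom_induced_chain_map[OF e singular_relcycle_0] by simp
 then have "homologous_rel_set p Z T b = homologous_rel_set p Z T 0"
  using iso b singular_relcycle_0 unfolding iso_def bij_betw_def inj_on_def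
  by (auto simp: carrier_relative_homology_group)
 then have "homologous_rel p Z T b 0" by (metis homologous_rel_set_eq)
 then show ?thesis by (simp add: homologous_rel_def)
qed

lemma chain_boundary_additive: "additive_map (chain_boundary p)"
 by (simp add: additive_map_def chain_boundary_diff)

lemma chain_map_additive: "additive_map (chain_map p f)"
 by (simp add: additive_map_def chain_map_diff)

text \<open>A space that can be deformed so that all singular simplices become constant is acyclic.\<close>

definition const_simplex :: "nat => 'a => (nat => real) => 'a" where
 "const_simplex p y = restrict (%_. y) (standard_simplex p)"

lemma const_simplex_vertex [simp]: "const_simplex p y (%j. if j = 0 then 1 else 0) = y"
 by (simp add: const_simplex_def)

lemma singular_simplex_const: "y \<in> topspace Y ==> singular_simplex p Y (const_simplex p y)"
 by (simp add: singular_simplex_def const_simplex_def)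

lemma sum_frag_cmul: "(\<Sum>k\<in>I. frag_cmul (f k) x) = frag_cmul (\<Sum>k\<in>I. f k) x"
 by (induction I rule: infinite_finite_induct) (simp_all add: frag_cmul_distrib)

lemma boundary_const_simplex:
 assumes "p > 0"
 shows "chain_boundary p (frag_of (const_simplex p y))
  = (if even p then frag_of (const_simplex (p - 1) y) else 0)"
proof -
 have "singular_face p k (const_simplex p y) = const_simplex (p - 1) y" if "k \<le> p" for k
  using simplical_face_in_standard_simplex[of p k] assms that
  by (auto simp: singular_face_def fun_eq_iff const_simplex_def)
 then have "chain_boundary p (frag_of (const_simplex p y))
   = (\<Sum>k\<le>p. frag_cmul ((-1) ^ k) (frag_of (const_simplex (p - 1) y)))"
  using assms by (simp add: chain_boundary_of)
 also have "\<dots> = frag_cmul (\<Sum>k\<le>p. (-1) ^ k) (frag_of (const_simplex (p - 1) y))"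
  by (rule sum_frag_cmul)
 also have "(\<Sum>k\<le>p. (-1 :: int) ^ k) = (if even p then 1 else 0)"
  by (induction p) auto
 finally show ?thesis by simp
qed

text \<open>A homotopy to a map with discrete image turns a cycle into a cycle of constant simplices. Such cycles
 bound in positive degrees: the boundary of a constant simplex is a constant simplex or zero,
 depending on the parity of the dimension.\<close>

lemma acyclic_if_constant:
 assumes hom: "homotopic_with (%h. True) Y Y id r"
  and const: "\<And>f. singular_simplex p Y f ==> \<exists>y\<in>topspace Y. simplex_map p r f = const_simplex p y"
  and c: "singular_relcycle p Y {} c"
 shows "p = 0 ==> chain_map 0 r c = 0 ==> singular_relboundary p Y {} c"
  and "p > 0 ==> singular_relboundary p Y {} c"
proof -
 have hr: "homologous_rel p Y {} c (chain_map p r c)"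
 proof -
  have "homotopic_with (%h. h \<in> {} \<rightarrow> {}) Y Y id r" using hom by simp
  from homotopic_imp_homologous_rel_chain_maps[OF this c] show ?thesis
   using chain_map_id_gen[of p Y c id] c by (simp add: singular_relcycle_def)
 qed
 show "singular_relboundary p Y {} c" if "p = 0" "chain_map 0 r c = 0"
  using hr that by (simp add: homologous_rel_def)
 assume p: "p > 0"
 let ?C = "%p. {const_simplex p y |y. y \<in> topspace Y}"
 have cC: "chain_map p r c \<in> frees (?C p)"
 proof (rule additive_map_closedI[OF _ chain_map_additive])
  show "c \<in> frees (singular_simplex_set p Y)"
   using c by (auto simp: singular_relcycle_def singular_chain_def frees_def)
 qed (use const in auto)
 have cyc: "chain_boundary p (chain_map p r c) = 0"
  using hr c homologous_rel_singular_relcycle[of p Y "{}" c "chain_map p r c"]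
  by (simp add: singular_cycle)
 have cs: "singular_chain q Y (frag_of (const_simplex q y))" if "y \<in> topspace Y" for q y
  using that by (simp add: singular_chain_of singular_simplex_const)
 have "singular_relboundary p Y {} (chain_map p r c)"
 proof (cases "even p")
  case False
  let ?d = "flin (%f. const_simplex (Suc p) (f (%j. if j = 0 then 1 else 0))) (chain_map p r c)"
  have "?d \<in> frees (?C (Suc p))" by (rule flin_closed[OF cC]) auto
  then have "singular_chain (Suc p) Y ?d"
   using cs[of _ "Suc p"] by (auto simp: singular_chain_def frees_def singular_chain_of)
  moreover have "chain_boundary (Suc p) ?d = chain_map p r c"
   by (rule additive_map_eqI[OF cC additive_map_comp[OF chain_boundary_additive additive_map_frag_extend] additive_map_id])
    (use False in \<open>auto simp: boundary_const_simplex\<close>)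
  ultimately show ?thesis by (auto simp: singular_boundary)
 next
  case True
  let ?u = "flin (%f. const_simplex p (f (%j. if j = 0 then 1 else 0)))"
  have "?u (chain_boundary p (chain_map p r c)) = chain_map p r c"
   by (rule additive_map_eqI[OF cC additive_map_comp[OF additive_map_frag_extend chain_boundary_additive] additive_map_id])
    (use True in \<open>auto simp: boundary_const_simplex[OF p]\<close>)
  then have "chain_map p r c = 0" using cyc by simp
  then show ?thesis by simp
 qed
 then show "singular_relboundary p Y {} c"
  using hr singular_relboundary_add[of p Y "{}" "c - chain_map p r c" "chain_map p r c"]
  by (simp add: homologous_rel_def)
qed

section \<open>Relative homology of simplices\<close>

lemma continuous_map_into_simplex:
 "continuous_map X (simplex_top n) f \<longleftrightarrow>
  (\<forall>k. continuous_map X euclideanreal (%x. f x k)) & (\<forall>x\<in>topspace X. f x \<in> standard_simplex n)"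
 by (auto simp: continuous_map_in_subtopology continuous_map_componentwise_UNIV)

lemma continuous_map_coordinate: "continuous_map (simplex_top n) euclideanreal (%t. t k)"
 by (intro continuous_map_from_subtopology continuous_map_product_projection) simp

definition lo :: "nat set => (nat => real) => real" where
 "lo I t = Min (t ` I)"

lemma lo_le: "finite I ==> i \<in> I ==> lo I t \<le> t i"
 by (simp add: lo_def)

lemma lo_attained:
 assumes "finite I" "I \<noteq> {}"
 obtains i where "i \<in> I" "lo I t = t i"
proof -
 have "lo I t \<in> t ` I" unfolding lo_def by (rule Min_in) (use assms in auto)
 then show ?thesis using that by blast
qed

lemma lo_le_iff: "finite I ==> I \<noteq> {} ==> lo I t \<le> a \<longleftrightarrow> (\<exists>i\<in>I. t i \<le> a)"
 unfolding lo_def by (simp add: Min_le_iff)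

lemma lo_gr_iff: "finite I ==> I \<noteq> {} ==> a < lo I t \<longleftrightarrow> (\<forall>i\<in>I. a < t i)"
 unfolding lo_def by simp

lemma continuous_map_lo:
 assumes "finite I" "I \<noteq> {}" "\<And>i. i \<in> I ==> continuous_map X euclideanreal (%x. f x i)"
 shows "continuous_map X euclideanreal (%x. lo I (f x))"
 using assms unfolding lo_def
proof (induction I rule: finite_ne_induct)
 case (insert i I)
 then show ?case by (simp add: continuous_map_real_min)
qed simp

text \<open>The radial deformation of a simplex which stretches the simplex away from the barycentre of the face
 spanned by \<open>I\<close>, so that a neighbourhood of the boundary of this face is pushed into it.\<close>

definition stretch :: "nat set => real => (nat => real) => nat => real" where
 "stretch I s t = (let m = min (lo I t) (1 / (2 * real (card I))) in
  (%i. (t i - (if i \<in> I then s * m else 0)) / (1 - real (card I) * s * m)))"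

context
 fixes I :: "nat set" and N :: nat
 assumes I: "I \<subseteq> {..N}" "I \<noteq> {}"
begin

lemma fin_I: "finite I" and card_I: "card I > 0"
 using I finite_subset[of I "{..N}"] by (auto simp: card_gt_0_iff)

lemma stretch_denominator:
 assumes "s \<in> {0..1}" "0 \<le> a"
 shows "1 - real (card I) * s * min a (1 / (2 * real (card I))) \<ge> 1 / 2"
proof -
 have "real (card I) * min a (1 / (2 * real (card I))) \<le> 1 / 2"
  using card_I by (simp add: min_def field_simps)
 moreover have "0 \<le> real (card I) * min a (1 / (2 * real (card I)))" using assms card_I by simp
 ultimately have "s * (real (card I) * min a (1 / (2 * real (card I)))) \<le> 1 * (1 / 2)"
  using assms by (intro mult_mono) auto
 then show ?thesis unfolding mult.commute[of "real (card I)" s] mult.assoc by linarith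
qed

lemma lo_nonneg: "t \<in> standard_simplex N ==> 0 \<le> lo I t"
 by (rule lo_attained[OF fin_I I(2), of t]) (simp add: standard_simplex_def)

lemma stretch_closed:
 assumes s: "s \<in> {0..1}" and t: "t \<in> standard_simplex N"
 shows "stretch I s t \<in> standard_simplex N"
proof -
 let ?m = "min (lo I t) (1 / (2 * real (card I)))"
 let ?D = "1 - real (card I) * s * ?m"
 have D: "?D \<ge> 1 / 2" by (rule stretch_denominator[OF s lo_nonneg[OF t]])
 have m: "0 \<le> ?m" using lo_nonneg[OF t] by simp
 have e: "stretch I s t i = (t i - (if i \<in> I then s * ?m else 0)) / ?D" for i
  by (simp add: stretch_def Let_def)
 have nn: "0 \<le> stretch I s t i" for i
 proof -
  have "s * ?m \<le> 1 * t i" if "i \<in> I"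
   using s m lo_le[OF fin_I that, of t] by (intro mult_mono) auto
  then show ?thesis
   unfolding e using D t by (auto simp: standard_simplex_def intro!: divide_nonneg_nonneg)
 qed
 have out: "stretch I s t i = 0" if "i > N" for i
  using that I t unfolding e by (auto simp: standard_simplex_def)
 have "(\<Sum>i\<le>N. stretch I s t i) = ((\<Sum>i\<le>N. t i) - (\<Sum>i\<le>N. if i \<in> I then s * ?m else 0)) / ?D"
  unfolding e by (simp add: sum_subtractf flip: sum_divide_distrib)
 also have "(\<Sum>i\<le>N. if i \<in> I then s * ?m else 0) = real (card I) * s * ?m"
  using I by (simp add: sum.If_cases Int_absorb1)
 also have "(\<Sum>i\<le>N. t i) = 1" using t by (simp add: standard_simplex_def)
 finally have sum: "(\<Sum>i\<le>N. stretch I s t i) = 1" using D by simp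
 have "stretch I s t i \<le> 1" for i
 proof (cases "i \<le> N")
  case True
  then show ?thesis using member_le_sum[of i "{..N}" "stretch I s t"] nn sum by simp
 qed (use out in auto)
 then show ?thesis using nn out sum by (simp add: standard_simplex_def)
qed

lemma lo_stretch:
 assumes s: "s \<in> {0..1}" and t: "t \<in> standard_simplex N"
 shows "lo I (stretch I s t) = (lo I t - s * min (lo I t) (1 / (2 * real (card I))))
   / (1 - real (card I) * s * min (lo I t) (1 / (2 * real (card I))))"
proof -
 let ?m = "min (lo I t) (1 / (2 * real (card I)))"
 let ?D = "1 - real (card I) * s * ?m"
 have D: "?D > 0" using stretch_denominator[OF s lo_nonneg[OF t]] by linarith
 have e: "stretch I s t i = (t i - s * ?m) / ?D" if "i \<in> I" for i
  using that by (simp add: stretch_def Let_def)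
 obtain i where i: "i \<in> I" "lo I t = t i" by (rule lo_attained[OF fin_I I(2)])
 obtain j where j: "j \<in> I" "lo I (stretch I s t) = stretch I s t j" by (rule lo_attained[OF fin_I I(2)])
 have "lo I (stretch I s t) \<le> stretch I s t i" by (rule lo_le[OF fin_I i(1)])
 also have "\<dots> = (lo I t - s * ?m) / ?D" unfolding e[OF i(1)] i(2)[symmetric] ..
 finally have "lo I (stretch I s t) \<le> (lo I t - s * ?m) / ?D" .
 moreover have "(lo I t - s * ?m) / ?D \<le> lo I (stretch I s t)"
  unfolding j(2) e[OF j(1)] using lo_le[OF fin_I j(1), of t] D by (intro divide_right_mono) auto
 ultimately show ?thesis by (rule antisym)
qed

lemma stretch_0: "stretch I 0 t = t"
 by (simp add: stretch_def Let_def fun_eq_iff)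

lemma stretch_boundary:
 assumes "lo I t = 0"
 shows "stretch I s t = t"
 using assms by (simp add: stretch_def Let_def fun_eq_iff)

lemma lo_stretch_less:
 assumes s: "s \<in> {0..1}" and t: "t \<in> standard_simplex N" and l: "lo I t < 1 / (2 * real (card I))"
 shows "lo I (stretch I s t) < 1 / (2 * real (card I))"
proof -
 let ?a = "lo I t"
 have a: "0 \<le> ?a" by (rule lo_nonneg[OF t])
 have m: "min ?a (1 / (2 * real (card I))) = ?a" using l by simp
 have D: "1 - real (card I) * s * ?a > 0" using stretch_denominator[OF s a] unfolding m by linarith
 have "real (card I) * ?a \<le> 1" using l card_I by (simp add: field_simps)
 then have "s * (real (card I) * ?a) \<le> s * 1" using s by (intro mult_left_mono) auto
 then have "1 - s \<le> 1 - real (card I) * s * ?a"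
  unfolding mult.commute[of "real (card I)" s] mult.assoc by linarith
 then have "?a * (1 - s) \<le> ?a * (1 - real (card I) * s * ?a)" using a by (intro mult_left_mono)
 then have "(?a - s * ?a) / (1 - real (card I) * s * ?a) \<le> ?a"
  using D by (simp add: divide_le_eq algebra_simps)
 then show ?thesis using lo_stretch[OF s t] l unfolding m by linarith
qed

lemma lo_stretch_1:
 assumes t: "t \<in> standard_simplex N" and l: "lo I t < 1 / (2 * real (card I))"
 shows "lo I (stretch I 1 t) = 0"
 using lo_stretch[of 1, OF _ t] l by simp

lemma continuous_map_stretch:
 assumes p: "continuous_map X euclideanreal p" and q: "\<And>k. continuous_map X euclideanreal (%x. q x k)"
  and range: "\<And>x. x \<in> topspace X ==> p x \<in> {0..1} & q x \<in> standard_simplex N"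
 shows "continuous_map X euclideanreal (%x. stretch I (p x) (q x) k)"
proof -
 let ?m = "%x. min (lo I (q x)) (1 / (2 * real (card I)))"
 have m: "continuous_map X euclideanreal ?m"
  by (intro continuous_map_real_min continuous_map_lo fin_I I(2) q) simp
 have pm: "continuous_map X euclideanreal (%x. p x * ?m x)" by (rule continuous_map_real_mult[OF p m])
 have D: "1 - real (card I) * (p x * ?m x) \<noteq> 0" if "x \<in> topspace X" for x
  using stretch_denominator[of "p x" "lo I (q x)"] range[OF that] lo_nonneg[of "q x"]
  by (simp add: mult.assoc)
 have "continuous_map X euclideanreal
   (%x. (q x k - (if k \<in> I then p x * ?m x else 0)) / (1 - real (card I) * (p x * ?m x)))"
 proof (intro continuous_map_real_divide continuous_map_diff continuous_map_real_mult_left q D pm)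
  show "continuous_map X euclideanreal (%x. if k \<in> I then p x * ?m x else 0)"
   using pm by (cases "k \<in> I") simp_all
 qed simp_all
 then show ?thesis by (simp add: stretch_def Let_def mult.assoc)
qed

end

lemma homotopic_pairI:
 assumes h: "continuous_map (prod_topology (top_of_set {0..1::real}) Y) Y h"
  and "\<And>y. y \<in> topspace Y ==> h (0, y) = y" and sub: "S \<subseteq> topspace Y" "U \<subseteq> topspace Y"
  and "\<And>s y. s \<in> {0..1} ==> y \<in> S ==> h (s, y) \<in> S" "\<And>s y. s \<in> {0..1} ==> y \<in> U ==> h (s, y) \<in> U"
 shows "homotopic_with (%h. h \<in> S \<rightarrow> S & h \<in> U \<rightarrow> U) Y Y id (%y. h (1::real, y))"
proof (subst homotopic_with)
 have "\<forall>t\<in>{0..1}. (%x. h (t, x)) \<in> S \<rightarrow> S & (%x. h (t, x)) \<in> U \<rightarrow> U" using assms(5,6) by auto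
 then show "(\<exists>h'. continuous_map (prod_topology (top_of_set {0..1::real}) Y) Y h' \<and>
   (\<forall>x\<in>topspace Y. h' (0, x) = id x) & (\<forall>x\<in>topspace Y. h' (1, x) = h (1, x)) \<and>
   (\<forall>t\<in>{0..1}. (%x. h' (t, x)) \<in> S \<rightarrow> S & (%x. h' (t, x)) \<in> U \<rightarrow> U))"
  using assms(1,2) by (intro exI[of _ h] conjI) auto
qed (use sub in \<open>auto simp: Pi_iff subset_iff\<close>)

definition bdry_simplex :: "nat => (nat => real) set" where
 "bdry_simplex n = {t \<in> standard_simplex n. lo {..n} t \<le> 0}"

definition fund :: "nat => (nat => real) => nat => real" where
 "fund n = restrict (%t. t) (standard_simplex n)"

text \<open>The relative homology of a simplex modulo its boundary is infinite cyclic in the top degree,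
 generated by the identity, and zero below.\<close>

definition pair_homology :: "nat => bool" where
 "pair_homology n \<longleftrightarrow>
  (\<forall>m<n. \<forall>c. singular_relcycle m (simplex_top n) (bdry_simplex n) c
   --> singular_relboundary m (simplex_top n) (bdry_simplex n) c) \<and>
  (\<forall>c. singular_relcycle n (simplex_top n) (bdry_simplex n) c
   --> (\<exists>k. homologous_rel n (simplex_top n) (bdry_simplex n) c (frag_cmul k (frag_of (fund n))))) \<and>
  (\<forall>k. singular_relboundary n (simplex_top n) (bdry_simplex n) (frag_cmul k (frag_of (fund n))) --> k = 0)"

lemma fund_simplex: "singular_simplex n (simplex_top n) (fund n)"
 unfolding singular_simplex_def fund_def
 by (auto intro: continuous_map_eq[of _ _ id])

lemma fund_relcycle: "singular_relcycle n (simplex_top n) (bdry_simplex n) (frag_of (fund n))"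
proof -
 have "singular_chain (n - 1) (subtopology (simplex_top n) (bdry_simplex n)) (chain_boundary n (frag_of (fund n)))"
 proof (cases "n = 0")
  case False
  have "singular_simplex (n - 1) (subtopology (simplex_top n) (bdry_simplex n)) (singular_face n k (fund n))"
   if "k \<le> n" for k
  proof -
   have "simplical_face k t \<in> bdry_simplex n" if t: "t \<in> standard_simplex (n - 1)" for t
   proof -
    have "simplical_face k t k = 0" by (simp add: simplical_face_def)
    then have "lo {..n} (simplical_face k t) \<le> 0" using lo_le[of "{..n}" k "simplical_face k t"] \<open>k \<le> n\<close> by simp
    moreover have "simplical_face k t \<in> standard_simplex n"
     using simplical_face_in_standard_simplex[of n k t] False \<open>k \<le> n\<close> t by simp
    ultimately show ?thesis by (simp add: bdry_simplex_def)
   qed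
   then have "(singular_face n k (fund n)) ` standard_simplex (n - 1) \<subseteq> bdry_simplex n"
    by (auto simp: singular_face_def fund_def bdry_simplex_def)
   then show ?thesis
    using singular_simplex_singular_face[OF fund_simplex, of n k] False that
    by (simp add: singular_simplex_subtopology[of _ _ "bdry_simplex n"])
  qed
  then show ?thesis using False
   by (auto simp: chain_boundary_of singular_chain_of intro!: singular_chain_sum singular_chain_cmul)
 qed (simp add: chain_boundary_def)
 then show ?thesis using fund_simplex by (simp add: singular_relcycle singular_chain_of)
qed

subsection \<open>Disjoint unions of simplices\<close>

abbreviation cells :: "'j set => nat => ('j \<times> (nat => real)) topology" where
 "cells J n \<equiv> prod_topology (discrete_topology J) (simplex_top n)"

definition cell_incl :: "nat => 'j => (nat => real) => 'j \<times> (nat => real)" where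
 "cell_incl n j = restrict (%t. (j, t)) (standard_simplex n)"

definition on_cell :: "'j => (((nat => real) => 'j \<times> (nat => real)) \<Rightarrow>\<^sub>0 int) => (((nat => real) => 'j \<times> (nat => real)) \<Rightarrow>\<^sub>0 int)" where
 "on_cell j = frag_extend (%f. if fst (f (%i. if i = 0 then 1 else 0)) = j then frag_of f else 0)"

lemma simplex_in_cell:
 assumes "singular_simplex p (cells J n) f"
 obtains j where "j \<in> J" "\<And>t. t \<in> standard_simplex p ==> fst (f t) = j & snd (f t) \<in> standard_simplex n"
proof -
 have f: "continuous_map (simplex_top p) (cells J n) f" using assms by (simp add: singular_simplex_def)
 have "continuous_map (simplex_top p) (discrete_topology J) (fst \<circ> f)"
  by (rule continuous_map_compose[OF f continuous_map_fst])
 from connectedin_continuous_map_image[OF this, of "standard_simplex p"]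
 have "connectedin (discrete_topology J) ((fst \<circ> f) ` standard_simplex p)"
  using connectedin_standard_simplex by (simp add: connectedin_subtopology)
 then have "(fst \<circ> f) ` standard_simplex p \<subseteq> J" "\<exists>j. (fst \<circ> f) ` standard_simplex p \<subseteq> {j}"
  by (auto simp: connectedin_discrete_topology)
 then obtain j where "j \<in> J" "(fst \<circ> f) ` standard_simplex p \<subseteq> {j}"
  using nonempty_standard_simplex[of p] by (metis equals0I image_subset_iff singletonD)
 moreover have "snd (f t) \<in> standard_simplex n" if "t \<in> standard_simplex p" for t
  using continuous_map_image_subset_topspace[OF f] that by (auto simp: image_subset_iff mem_Times_iff)
 ultimately show ?thesis using that by (auto simp: image_subset_iff)
qed

lemma on_cell_closed:
 assumes "singular_chain p Y c"
 shows "singular_chain p Y (on_cell j c)"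
proof -
 have "c \<in> frees (singular_simplex_set p Y)" using assms by (simp add: singular_chain_def frees_def)
 then have "on_cell j c \<in> frees (singular_simplex_set p Y)"
  unfolding on_cell_def by (rule additive_map_closedI) auto
 then show ?thesis by (simp add: singular_chain_def frees_def)
qed

lemma on_cell_boundary:
 assumes "singular_chain p (cells J n) c" "p > 0"
 shows "on_cell j (chain_boundary p c) = chain_boundary p (on_cell j c)"
proof (rule additive_map_eqI[where f = "%c. on_cell j (chain_boundary p c)" and g = "%c. chain_boundary p (on_cell j c)"])
 show "c \<in> frees (singular_simplex_set p (cells J n))" using assms by (simp add: singular_chain_def frees_def)
 show "additive_map (%c. on_cell j (chain_boundary p c))"
  unfolding on_cell_def by (rule additive_map_comp[OF additive_map_frag_extend chain_boundary_additive])
 show "additive_map (%c. chain_boundary p (on_cell j c))"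
  unfolding on_cell_def by (rule additive_map_comp[OF chain_boundary_additive additive_map_frag_extend])
 fix f assume "f \<in> singular_simplex_set p (cells J n)"
 then obtain j' where j': "\<And>t. t \<in> standard_simplex p ==> fst (f t) = j'"
  by (auto elim: simplex_in_cell)
 have v: "(%i. if i = 0 then 1 else 0) \<in> standard_simplex q" for q by simp
 have "fst (singular_face p k f (%i. if i = 0 then 1 else 0)) = j'" if "k \<le> p" for k
  using simplical_face_in_standard_simplex[of p k "%i. if i = 0 then 1 else 0"] assms(2) that j' v
  by (simp add: singular_face_def)
 then show "on_cell j (chain_boundary p (frag_of f)) = chain_boundary p (on_cell j (frag_of f))"
  using j'[OF v] by (simp add: on_cell_def chain_boundary_of frag_extend_sum frag_extend_cmul o_def)
qed

lemma on_cell_sum: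
 assumes "singular_chain p (cells J n) c"
 obtains J' where "finite J'" "J' \<subseteq> J" "c = (\<Sum>j\<in>J'. on_cell j c)"
proof
 let ?v = "%i::nat. if i = 0 then 1 else 0 :: real"
 let ?J = "(%f. fst (f ?v)) ` Poly_Mapping.keys c"
 show "finite ?J" by simp
 have v: "?v \<in> standard_simplex p" by simp
 show "?J \<subseteq> J"
 proof
  fix j assume "j \<in> ?J"
  then obtain f where f: "f \<in> Poly_Mapping.keys c" "j = fst (f ?v)" by auto
  then have "singular_simplex p (cells J n) f" using assms by (auto simp: singular_chain_def)
  then show "j \<in> J" using f(2) v by (auto elim: simplex_in_cell)
 qed
 show "c = (\<Sum>j\<in>?J. on_cell j c)"
 proof (rule additive_map_eqI[OF _ additive_map_id, where c = c and S = "Poly_Mapping.keys c" and g = "%c'. \<Sum>j\<in>?J. on_cell j c'"])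
  show "additive_map (%c'. \<Sum>j\<in>?J. on_cell j c')"
   unfolding on_cell_def by (intro additive_map_sum_map additive_map_frag_extend)
  fix f assume f: "f \<in> Poly_Mapping.keys c"
  then have "fst (f ?v) \<in> ?J" by blast
  moreover have "(\<Sum>j\<in>?J. on_cell j (frag_of f)) = (\<Sum>j\<in>?J. if fst (f ?v) = j then frag_of f else 0)"
   by (simp add: on_cell_def)
  ultimately show "frag_of f = (\<Sum>j\<in>?J. on_cell j (frag_of f))" by (simp only: sum.delta' finite_imageI finite_keys if_True)
 qed (simp add: frees_def)
qed

lemma cell_incl_snd:
 assumes "singular_chain p (cells J n) c"
 shows "chain_map p (Pair j) (chain_map p snd (on_cell j c)) = on_cell j c"
proof (rule additive_map_eqI[where f = "%c. chain_map p (Pair j) (chain_map p snd (on_cell j c))" and g = "on_cell j"])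
 show "c \<in> frees (singular_simplex_set p (cells J n))" using assms by (simp add: singular_chain_def frees_def)
 show "additive_map (%c. chain_map p (Pair j) (chain_map p snd (on_cell j c)))"
  unfolding on_cell_def
  by (rule additive_map_comp[OF additive_map_comp[OF chain_map_additive chain_map_additive] additive_map_frag_extend])
 show "additive_map (on_cell j)" by (simp add: on_cell_def)
 fix f assume f: "f \<in> singular_simplex_set p (cells J n)"
 then obtain j' where j': "\<And>t. t \<in> standard_simplex p ==> fst (f t) = j'"
  by (auto elim: simplex_in_cell)
 have v: "(%i. if i = 0 then 1 else 0) \<in> standard_simplex p" by simp
 have "simplex_map p (Pair j') (simplex_map p snd f) = f"
 proof
  fix t
  show "simplex_map p (Pair j') (simplex_map p snd f) t = f t"
   using j'[of t] f by (cases "f t") (auto simp: simplex_map_def singular_simplex_def extensional_def)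
 qed
 then show "chain_map p (Pair j) (chain_map p snd (on_cell j (frag_of f))) = on_cell j (frag_of f)"
  using j'[OF v] by (auto simp: on_cell_def)
qed

lemma cells_continuous:
 "continuous_map (cells J n) (simplex_top n) snd"
 "j \<in> J ==> continuous_map (simplex_top n) (cells J n) (Pair j)"
 by (auto simp: continuous_map_snd continuous_map_pairwise o_def)

lemma on_cell_relcycle:
 assumes "singular_relcycle p (cells J n) (J \<times> bdry_simplex n) c"
 shows "singular_relcycle p (simplex_top n) (bdry_simplex n) (chain_map p snd (on_cell j c))"
proof (rule singular_relcycle_chain_map[OF _ cells_continuous(1)])
 have c: "singular_chain p (cells J n) c"
  "singular_chain (p - 1) (subtopology (cells J n) (J \<times> bdry_simplex n)) (chain_boundary p c)"
  using assms by (auto simp: singular_relcycle)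
 have "chain_boundary p (on_cell j c) = on_cell j (chain_boundary p c)"
  using on_cell_boundary[OF c(1)] by (cases "p = 0") (auto simp: chain_boundary_def on_cell_def)
 then show "singular_relcycle p (cells J n) (J \<times> bdry_simplex n) (on_cell j c)"
  using on_cell_closed[OF c(1)] on_cell_closed[OF c(2)] by (simp add: singular_relcycle)
qed auto

lemma singular_relboundary_sum:
 "(\<And>i. i \<in> I ==> singular_relboundary p Y S (f i)) ==> singular_relboundary p Y S (\<Sum>i\<in>I. f i)"
 by (induction I rule: infinite_finite_induct) (auto intro: singular_relboundary_add)

lemma cell_incl_relcycle:
 assumes "\<kappa> \<in> frees J"
 shows "singular_relcycle n (cells J n) (J \<times> bdry_simplex n) (flin (cell_incl n) \<kappa>)"
 using assms
proof (induction rule: frees_induct)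
 case (of j)
 have "simplex_map n (Pair j) (fund n) = cell_incl n j"
  by (simp add: simplex_map_def fund_def cell_incl_def fun_eq_iff)
 then show ?case
  using singular_relcycle_chain_map[OF fund_relcycle cells_continuous(2)[OF of], of n "J \<times> bdry_simplex n"] of
  by auto
qed (auto simp: frag_extend_diff intro: singular_relcycle_diff)

context
 fixes n :: nat and J :: "'j set"
 assumes n: "pair_homology n"
begin

lemma cells_below:
 assumes "m < n" and c: "singular_relcycle m (cells J n) (J \<times> bdry_simplex n) c"
 shows "singular_relboundary m (cells J n) (J \<times> bdry_simplex n) c"
proof -
 have c': "singular_chain m (cells J n) c" using c by (simp add: singular_relcycle)
 obtain J' where J': "finite J'" "J' \<subseteq> J" "c = (\<Sum>j\<in>J'. on_cell j c)" by (rule on_cell_sum[OF c'])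
 have "singular_relboundary m (cells J n) (J \<times> bdry_simplex n) (on_cell j c)" if "j \<in> J'" for j
 proof -
  have "singular_relboundary m (simplex_top n) (bdry_simplex n) (chain_map m snd (on_cell j c))"
   using n assms(1) on_cell_relcycle[OF c] by (simp add: pair_homology_def)
  from singular_relboundary_chain_map[OF this cells_continuous(2), of j J "J \<times> bdry_simplex n"]
  show ?thesis using cell_incl_snd[OF c'] that J'(2) by auto
 qed
 then have "singular_relboundary m (cells J n) (J \<times> bdry_simplex n) (\<Sum>j\<in>J'. on_cell j c)"
  by (rule singular_relboundary_sum)
 then show ?thesis using J'(3) by simp
qed

text \<open>A singular chain meets only finitely many of the disjoint cells and splits accordingly; this reduces
 the computation to a single cell.\<close>

lemma cells_generated:
 assumes c: "singular_relcycle n (cells J n) (J \<times> bdry_simplex n) c"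
 shows "\<exists>\<kappa>\<in>frees J. homologous_rel n (cells J n) (J \<times> bdry_simplex n) c (flin (cell_incl n) \<kappa>)"
proof -
 have c': "singular_chain n (cells J n) c" using c by (simp add: singular_relcycle)
 obtain J' where J': "finite J'" "J' \<subseteq> J" "c = (\<Sum>j\<in>J'. on_cell j c)" by (rule on_cell_sum[OF c'])
 have "\<exists>k. homologous_rel n (simplex_top n) (bdry_simplex n) (chain_map n snd (on_cell j c)) (frag_cmul k (frag_of (fund n)))" for j
  using n on_cell_relcycle[OF c] by (simp add: pair_homology_def)
 then obtain k where k: "\<And>j. homologous_rel n (simplex_top n) (bdry_simplex n) (chain_map n snd (on_cell j c)) (frag_cmul (k j) (frag_of (fund n)))"
  by metis
 let ?\<kappa> = "\<Sum>j\<in>J'. frag_cmul (k j) (frag_of j)"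
 have fund: "simplex_map n (Pair j) (fund n) = cell_incl n j" for j :: 'j
  by (simp add: simplex_map_def fund_def cell_incl_def fun_eq_iff)
 have "singular_relboundary n (cells J n) (J \<times> bdry_simplex n) (on_cell j c - frag_cmul (k j) (frag_of (cell_incl n j)))"
  if "j \<in> J'" for j
 proof -
  have "singular_relboundary n (simplex_top n) (bdry_simplex n)
    (chain_map n snd (on_cell j c) - frag_cmul (k j) (frag_of (fund n)))"
   using k[of j] by (simp add: homologous_rel_def)
  from singular_relboundary_chain_map[OF this cells_continuous(2), of j J "J \<times> bdry_simplex n"]
  show ?thesis using cell_incl_snd[OF c'] that J'(2) by (auto simp: chain_map_diff fund)
 qed
 then have "singular_relboundary n (cells J n) (J \<times> bdry_simplex n)
   (\<Sum>j\<in>J'. on_cell j c - frag_cmul (k j) (frag_of (cell_incl n j)))"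
  by (rule singular_relboundary_sum)
 also have "(\<Sum>j\<in>J'. on_cell j c - frag_cmul (k j) (frag_of (cell_incl n j))) = c - flin (cell_incl n) ?\<kappa>"
  using J'(1,3) by (simp add: sum_subtractf frag_extend_sum frag_extend_cmul o_def)
 finally have "homologous_rel n (cells J n) (J \<times> bdry_simplex n) c (flin (cell_incl n) ?\<kappa>)"
  by (simp add: homologous_rel_def)
 moreover have "?\<kappa> \<in> frees J" using J'(2) by (intro frees_sum frees_cmul) auto
 ultimately show ?thesis by blast
qed

lemma cells_independent:
 assumes \<kappa>: "\<kappa> \<in> frees J" and bd: "singular_relboundary n (cells J n) (J \<times> bdry_simplex n) (flin (cell_incl n) \<kappa>)"
 shows "\<kappa> = 0"
proof (rule poly_mapping_eqI)
 fix j
 obtain d e where d: "singular_chain (Suc n) (cells J n) d" and e: "singular_chain n (subtopology (cells J n) (J \<times> bdry_simplex n)) e"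
  and de: "chain_boundary (Suc n) d + e = flin (cell_incl n) \<kappa>"
  using bd unfolding singular_relboundary by blast
 have oc: "additive_map (on_cell j :: ((((nat => real) => 'j \<times> (nat => real)) \<Rightarrow>\<^sub>0 int) => _))"
  by (simp add: on_cell_def)
 have "on_cell j (flin (cell_incl n) \<kappa>) = frag_cmul (Poly_Mapping.lookup \<kappa> j) (frag_of (cell_incl n j))"
  using \<kappa>
 proof (induction rule: frees_induct)
  case (of x)
  have "fst (cell_incl n x (%i. if i = 0 then 1 else 0)) = x" by (simp add: cell_incl_def)
  then show ?case by (auto simp: on_cell_def)
 next
  case (diff a b)
  then show ?case
   by (simp add: frag_extend_diff additive_map_diff[OF oc] lookup_minus frag_cmul_diff_distrib)
 qed (simp add: on_cell_def)
 then have "chain_boundary (Suc n) (on_cell j d) + on_cell j e = frag_cmul (Poly_Mapping.lookup \<kappa> j) (frag_of (cell_incl n j))"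
  using on_cell_boundary[OF d, of j] de by (metis additive_map_add[OF oc] zero_less_Suc)
 then have "singular_relboundary n (cells J n) (J \<times> bdry_simplex n) (frag_cmul (Poly_Mapping.lookup \<kappa> j) (frag_of (cell_incl n j)))"
  unfolding singular_relboundary using on_cell_closed[OF d] on_cell_closed[OF e] by blast
 moreover have "snd \<in> J \<times> bdry_simplex n \<rightarrow> bdry_simplex n" by auto
 ultimately have "singular_relboundary n (simplex_top n) (bdry_simplex n)
   (chain_map n snd (frag_cmul (Poly_Mapping.lookup \<kappa> j) (frag_of (cell_incl n j))))"
  using singular_relboundary_chain_map cells_continuous(1) by blast
 then
 have "singular_relboundary n (simplex_top n) (bdry_simplex n) (frag_cmul (Poly_Mapping.lookup \<kappa> j) (frag_of (simplex_map n snd (cell_incl n j))))"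
  by auto
 moreover have "simplex_map n snd (cell_incl n j) = fund n"
  by (simp add: simplex_map_def fund_def cell_incl_def fun_eq_iff)
 ultimately show "Poly_Mapping.lookup \<kappa> j = Poly_Mapping.lookup 0 j"
  using n by (simp add: pair_homology_def)
qed

end

text \<open>The homology of a pair obtained by attaching \<open>n\<close>-cells.\<close>

locale cell_attachment =
 fixes Y :: "'b topology" and S :: "'b set" and J :: "'j set" and n :: nat and e :: "'j \<times> (nat => real) => 'b"
  and g :: "'b => real" and h :: "real \<times> 'b => 'b"
 assumes pair: "pair_homology n"
  and e: "continuous_map (cells J n) Y e"
  and g: "continuous_map Y euclideanreal g"
  and S: "S = {y \<in> topspace Y. g y \<le> 0}"
  and ge: "[|j \<in> J; t \<in> standard_simplex n|] ==> g (e (j, t)) = lo {..n} t"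
  and homeo: "homeomorphic_map (subtopology (cells J n) {z \<in> topspace (cells J n). g (e z) > 0})
   (subtopology Y {y \<in> topspace Y. g y > 0}) e"
  and h: "continuous_map (prod_topology (top_of_set {0..1::real}) Y) Y h"
  and h0: "y \<in> topspace Y ==> h (0, y) = y"
  and h_S: "[|s \<in> {0..1}; y \<in> S|] ==> h (s, y) \<in> S"
  and h_U: "[|s \<in> {0..1}; y \<in> topspace Y; g y < 1 / (2 * real (Suc n))|] ==> g (h (s, y)) < 1 / (2 * real (Suc n))"
  and h1: "[|y \<in> topspace Y; g y < 1 / (2 * real (Suc n))|] ==> h (1, y) \<in> S"
begin

lemma attach: "hom_induced p (cells J n) (J \<times> bdry_simplex n) Y S e
  \<in> iso (relative_homology_group p (cells J n) (J \<times> bdry_simplex n)) (relative_homology_group p Y S)"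
proof (rule attach_iso[where c = "1 / (2 * real (Suc n))", OF e g _ S _ HOL.refl HOL.refl homeo])
 let ?c = "1 / (2 * real (Suc n))"
 show T: "J \<times> bdry_simplex n = {z \<in> topspace (cells J n). g (e z) \<le> 0}"
  by (auto simp: bdry_simplex_def ge)
 show "?c > 0" by simp
 have hY: "h (s, y) \<in> topspace Y" if "s \<in> {0..1}" "y \<in> topspace Y" for s y
  using continuous_map_image_subset_topspace[OF h] that by (auto simp: image_subset_iff)
 let ?U = "{y \<in> topspace Y. g y < ?c}"
 show "homotopic_with (%h. h \<in> S \<rightarrow> S & h \<in> ?U \<rightarrow> ?U) Y Y id (%y. h (1, y))"
  by (rule homotopic_pairI[OF h]) (use h0 S h_S h_U hY in auto)
 show "(%y. h (1, y)) \<in> ?U \<rightarrow> S" using h1 by auto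
 have I: "{..n} \<subseteq> {..n}" "{..n} \<noteq> {}" by auto
 have c: "1 / (2 * real (card {..n})) = ?c" by simp
 let ?k = "%(s, j, t). (j :: 'j, stretch {..n} s t)"
 have k: "continuous_map (prod_topology (top_of_set {0..1::real}) (cells J n)) (cells J n) ?k"
 proof -
  have 1: "continuous_map (prod_topology (top_of_set {0..1::real}) (cells J n)) (top_of_set {0..1::real}) fst"
   and 2: "continuous_map (prod_topology (top_of_set {0..1::real}) (cells J n)) (discrete_topology J) (fst \<circ> snd)"
   and 3: "continuous_map (prod_topology (top_of_set {0..1::real}) (cells J n)) (simplex_top n) (snd \<circ> snd)"
   by (auto intro: continuous_map_fst continuous_map_compose[OF continuous_map_snd continuous_map_fst]
     continuous_map_compose[OF continuous_map_snd continuous_map_snd])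
  have 4: "continuous_map (prod_topology (top_of_set {0..1::real}) (cells J n)) euclideanreal (%x. (snd \<circ> snd) x k)" for k
   using 3 by (simp add: continuous_map_into_simplex)
  have "continuous_map (prod_topology (top_of_set {0..1::real}) (cells J n)) (simplex_top n)
    (%x. stretch {..n} (fst x) ((snd \<circ> snd) x))"
   unfolding continuous_map_into_simplex
  proof (intro conjI allI ballI)
   fix k
   show "continuous_map (prod_topology (top_of_set {0..1::real}) (cells J n)) euclideanreal
     (%x. stretch {..n} (fst x) ((snd \<circ> snd) x) k)"
    by (rule continuous_map_stretch[OF I continuous_map_into_fulltopology[OF 1] 4]) auto
  qed (auto intro!: stretch_closed[OF I])
  from continuous_map_pairedI[OF 2 this] show ?thesis by (simp add: case_prod_unfold)
 qed
 let ?V = "{z \<in> topspace (cells J n). g (e z) < ?c}"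
 have kc: "stretch {..n} s t \<in> standard_simplex n" if "s \<in> {0..1}" "t \<in> standard_simplex n" for s t
  by (rule stretch_closed[OF I that])
 have kb: "stretch {..n} s t \<in> bdry_simplex n" if "s \<in> {0..1}" "t \<in> bdry_simplex n" for s t
 proof -
  have "lo {..n} t = 0" using that lo_nonneg[OF I, of t] by (auto simp: bdry_simplex_def)
  then show ?thesis using stretch_boundary[OF I] that by simp
 qed
 show "homotopic_with (%h. h \<in> (J \<times> bdry_simplex n) \<rightarrow> (J \<times> bdry_simplex n) & h \<in> ?V \<rightarrow> ?V) (cells J n) (cells J n) id (%z. ?k (1, z))"
 proof (rule homotopic_pairI[OF k])
  show "?k (0, z) = z" for z by (cases z) (simp add: stretch_0[OF I])
  show "J \<times> bdry_simplex n \<subseteq> topspace (cells J n)" by (auto simp: bdry_simplex_def)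
  show "?k (s, z) \<in> J \<times> bdry_simplex n" if "s \<in> {0..1}" "z \<in> J \<times> bdry_simplex n" for s z
   using kb that by auto
  show "?k (s, z) \<in> ?V" if s: "s \<in> {0..1}" and z: "z \<in> ?V" for s z
  proof -
   obtain j t where jt: "z = (j, t)" "j \<in> J" "t \<in> standard_simplex n" using z by auto
   have "lo {..n} (stretch {..n} s t) < ?c"
    using lo_stretch_less[OF I s jt(3)] z unfolding c jt by (simp add: ge jt)
   then show ?thesis using jt kc[OF s jt(3)] by (simp add: ge)
  qed
 qed auto
 show "(%z. ?k (1, z)) \<in> ?V \<rightarrow> J \<times> bdry_simplex n"
 proof
  fix z assume z: "z \<in> ?V"
  obtain j t where jt: "z = (j, t)" "j \<in> J" "t \<in> standard_simplex n" using z by auto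
  have "lo {..n} (stretch {..n} 1 t) = 0"
   using lo_stretch_1[OF I jt(3)] z unfolding c jt by (simp add: ge jt)
  then show "?k (1, z) \<in> J \<times> bdry_simplex n" using jt kc[of 1 t] by (simp add: bdry_simplex_def)
 qed
qed

lemma eT: "e \<in> (J \<times> bdry_simplex n) \<rightarrow> S"
proof
 fix z assume "z \<in> J \<times> bdry_simplex n"
 then obtain j t where z: "z = (j, t)" "j \<in> J" "t \<in> standard_simplex n" "lo {..n} t \<le> 0"
  by (auto simp: bdry_simplex_def)
 then have "e z \<in> topspace Y" using continuous_map_image_subset_topspace[OF e] by (auto simp: image_subset_iff)
 then show "e z \<in> S" using z ge by (simp add: S)
qed

lemma attached_below:
 assumes "m < n" "singular_relcycle m Y S c"
 shows "singular_relboundary m Y S c"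
proof -
 obtain b where b: "singular_relcycle m (cells J n) (J \<times> bdry_simplex n) b" "homologous_rel m Y S c (chain_map m e b)"
  using relcycle_lift[OF attach e eT assms(2)] by blast
 have "singular_relboundary m Y S (chain_map m e b)"
  by (rule singular_relboundary_chain_map[OF cells_below[OF pair assms(1) b(1)] e eT])
 then show ?thesis
  using b(2) singular_relboundary_add[of m Y S "c - chain_map m e b" "chain_map m e b"]
  by (simp add: homologous_rel_def)
qed

abbreviation attached :: "'j => (nat => real) => 'b" where
 "attached j \<equiv> restrict (%t. e (j, t)) (standard_simplex n)"

lemma chain_map_cell_incl: "chain_map n e (flin (cell_incl n) \<kappa>) = flin attached \<kappa>"
proof -
 have "simplex_map n e (cell_incl n j) = attached j" for j
  by (auto simp: simplex_map_def cell_incl_def)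
 then show ?thesis by (simp add: chain_map_def flin_flin o_def)
qed

lemma attached_generate:
 assumes "singular_relcycle n Y S c"
 shows "\<exists>\<kappa>\<in>frees J. homologous_rel n Y S c (flin attached \<kappa>)"
proof -
 obtain b where b: "singular_relcycle n (cells J n) (J \<times> bdry_simplex n) b" "homologous_rel n Y S c (chain_map n e b)"
  using relcycle_lift[OF attach e eT assms] by blast
 obtain \<kappa> where \<kappa>: "\<kappa> \<in> frees J" "homologous_rel n (cells J n) (J \<times> bdry_simplex n) b (flin (cell_incl n) \<kappa>)"
  using cells_generated[OF pair b(1)] by blast
 have "singular_relboundary n Y S (chain_map n e (b - flin (cell_incl n) \<kappa>))"
  by (rule singular_relboundary_chain_map[OF _ e eT]) (use \<kappa>(2) in \<open>simp add: homologous_rel_def\<close>)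
 then have "homologous_rel n Y S (chain_map n e b) (flin attached \<kappa>)"
  by (simp add: homologous_rel_def chain_map_diff chain_map_cell_incl)
 then show ?thesis using b(2) \<kappa>(1) homologous_rel_trans by blast
qed

lemma attached_independent:
 assumes \<kappa>: "\<kappa> \<in> frees J" and bd: "singular_relboundary n Y S (flin attached \<kappa>)"
 shows "\<kappa> = 0"
proof (rule cells_independent[OF pair \<kappa> relboundary_reflect[OF attach e eT]])
 show "singular_relcycle n (cells J n) (J \<times> bdry_simplex n) (flin (cell_incl n) \<kappa>)"
  by (rule cell_incl_relcycle[OF \<kappa>])
 show "singular_relboundary n Y S (chain_map n e (flin (cell_incl n) \<kappa>))"
  using bd by (simp add: chain_map_cell_incl)
qed

end

subsection \<open>The relative homology of a simplex modulo its boundary\<close>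

lemma frees_singleton: "c \<in> frees {a} ==> \<exists>k. c = frag_cmul k (frag_of a)"
proof (induction rule: frees_induct)
 case zero
 then show ?case by (intro exI[of _ 0]) simp
next
 case (of x)
 then show ?case by (intro exI[of _ 1]) simp
next
 case (diff a' b')
 then show ?case by (metis frag_cmul_diff_distrib)
qed

lemma chain_frees: "singular_chain p Y c \<longleftrightarrow> c \<in> frees (singular_simplex_set p Y)"
 by (simp add: singular_chain_def frees_def)

lemma chain_relboundary: "singular_chain p (subtopology Y S) c ==> singular_relboundary p Y S c"
 unfolding singular_relboundary by (intro exI[of _ 0] exI[of _ c]) simp

lemma contracted_relboundary:
 assumes hom: "homotopic_with (%h. h \<in> S \<rightarrow> S) Y Y id r" and r: "r \<in> topspace Y \<rightarrow> S"
  and c: "singular_relcycle p Y S c"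
 shows "singular_relboundary p Y S c"
proof -
 have rc: "continuous_map Y Y r" using homotopic_with_imp_continuous_maps[OF hom] by simp
 have "homologous_rel p Y S c (chain_map p r c)"
  using homotopic_imp_homologous_rel_chain_maps[OF hom c] chain_map_id_gen[of p Y c id] c
  by (simp add: singular_relcycle_def)
 moreover have "continuous_map Y (subtopology Y S) r"
  using rc r by (auto simp: continuous_map_in_subtopology)
 then have "singular_relboundary p Y S (chain_map p r c)"
  using c by (intro chain_relboundary) (auto simp: singular_relcycle intro: singular_chain_chain_map)
 ultimately show ?thesis
  using singular_relboundary_add[of p Y S "c - chain_map p r c" "chain_map p r c"]
  by (simp add: homologous_rel_def)
qed

lemma bdry_simplex_0: "bdry_simplex 0 = {}"
 by (auto simp: bdry_simplex_def standard_simplex_0 lo_def)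

lemma pair_homology_0: "pair_homology 0"
proof -
 have one: "f = fund 0" if "singular_simplex 0 (simplex_top 0) f" for f
 proof -
  have "f t = fund 0 t" for t
  proof (cases "t \<in> standard_simplex 0")
   case True
   moreover have "f t \<in> standard_simplex 0"
    using that True continuous_map_image_subset_topspace by (fastforce simp: singular_simplex_def)
   ultimately show ?thesis by (simp add: standard_simplex_0 fund_def)
  qed (use that in \<open>simp add: singular_simplex_def fund_def extensional_def\<close>)
  then show ?thesis by blast
 qed
 have gen: "\<exists>k. c = frag_cmul k (frag_of (fund 0))" if "singular_chain 0 (simplex_top 0) c" for c
  by (rule frees_singleton) (use that one in \<open>auto simp: chain_frees intro: frees_mono\<close>)
 have indep: "k = 0" if bd: "singular_relboundary 0 (simplex_top 0) {} (frag_cmul k (frag_of (fund 0)))" for k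
 proof -
  obtain d where d: "singular_chain (Suc 0) (simplex_top 0) d" "chain_boundary (Suc 0) d = frag_cmul k (frag_of (fund 0))"
   using bd by (auto simp: singular_boundary)
  let ?aug = "flin (%f :: (nat => real) => nat => real. ())"
  have "?aug (chain_boundary (Suc 0) d) = 0"
  proof (rule additive_map_zeroI[where f = "%d. ?aug (chain_boundary (Suc 0) d)"])
   show "d \<in> frees (singular_simplex_set (Suc 0) (simplex_top 0))" using d(1) by (simp add: chain_frees)
   show "additive_map (%d. ?aug (chain_boundary (Suc 0) d))"
    by (rule additive_map_comp[OF additive_map_frag_extend chain_boundary_additive])
  qed (simp add: chain_boundary_of frag_extend_diff)
  then have "frag_cmul k (frag_of ()) = 0" by (simp add: d(2) frag_extend_cmul)
  then show "k = 0" by simp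
 qed
 show ?thesis
  unfolding pair_homology_def bdry_simplex_0
 proof (intro conjI allI impI)
  fix c assume "singular_relcycle 0 (simplex_top 0) {} c"
  then obtain k where "c = frag_cmul k (frag_of (fund 0))" using gen by (auto simp: singular_relcycle)
  then show "\<exists>k. homologous_rel 0 (simplex_top 0) {} c (frag_cmul k (frag_of (fund 0)))"
   by (intro exI[of _ k]) (simp add: homologous_rel_def)
 qed (use indep in auto)
qed

context
 fixes n :: nat
begin

abbreviation "hI \<equiv> {1..Suc n}"

lemma hI: "hI \<subseteq> {..Suc n}" "hI \<noteq> {}" and card_hI: "real (card hI) = real (Suc n)"
 by auto

definition "horn = {t \<in> bdry_simplex (Suc n). lo hI t \<le> 0}"

abbreviation "rim \<equiv> subtopology (simplex_top (Suc n)) (bdry_simplex (Suc n))"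

lemma bdry_subset: "bdry_simplex k \<subseteq> standard_simplex k"
 by (auto simp: bdry_simplex_def)

lemma topspace_rim: "topspace rim = bdry_simplex (Suc n)"
 using bdry_subset by auto

lemma bdry_iff: "t \<in> bdry_simplex k \<longleftrightarrow> t \<in> standard_simplex k & (\<exists>i\<le>k. t i = 0)"
proof -
 have "lo {..k} t \<le> 0 \<longleftrightarrow> (\<exists>i\<le>k. t i \<le> 0)" by (subst lo_le_iff) auto
 moreover have "t i \<le> 0 \<longleftrightarrow> t i = 0" if "t \<in> standard_simplex k" for i
  using that by (auto simp: standard_simplex_def order_antisym_conv)
 ultimately show ?thesis by (auto simp: bdry_simplex_def)
qed

lemma horn_iff: "t \<in> horn \<longleftrightarrow> t \<in> standard_simplex (Suc n) & (\<exists>i\<in>hI. t i = 0)"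
proof -
 have "lo hI t \<le> 0 \<longleftrightarrow> (\<exists>i\<in>hI. t i \<le> 0)" by (rule lo_le_iff) auto
 moreover have "t i \<le> 0 \<longleftrightarrow> t i = 0" if "t \<in> standard_simplex (Suc n)" for i
  using that by (auto simp: standard_simplex_def order_antisym_conv)
 ultimately show ?thesis by (auto simp: horn_def bdry_iff)
qed

lemma cone_closed:
 assumes s: "s \<in> {0..1}" and t: "t \<in> standard_simplex (Suc n)"
 shows "(%i. (1 - s) * t i + s * (if i = 0 then 1 else 0)) \<in> standard_simplex (Suc n)"
 using convex_standard_simplex[of t "Suc n" "%i. if i = 0 then 1 else 0" s] s t by simp

text \<open>The cone deformation towards the vertex \<open>0\<close> contracts the simplex and preserves the horn of all faces
 that contain this vertex.\<close>

lemma simplex_mod_horn: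
 assumes "singular_relcycle p (simplex_top (Suc n)) horn c"
 shows "singular_relboundary p (simplex_top (Suc n)) horn c"
proof (rule contracted_relboundary[OF _ _ assms])
 let ?h = "%(s, t) i. (1 - s) * t i + s * (if i = (0::nat) then 1 else 0 :: real)"
 let ?P = "prod_topology (top_of_set {0..1::real}) (simplex_top (Suc n))"
 have 1: "continuous_map ?P euclideanreal fst"
  by (rule continuous_map_into_fulltopology[OF continuous_map_fst])
 have 2: "continuous_map ?P euclideanreal (%x. snd x k)" for k
  using continuous_map_snd[of "top_of_set {0..1::real}" "simplex_top (Suc n)"] by (simp add: continuous_map_into_simplex)
 have h: "continuous_map ?P (simplex_top (Suc n)) ?h"
  unfolding continuous_map_into_simplex
 proof (intro conjI allI ballI)
  fix k
  have "continuous_map ?P euclideanreal (%x. (1 - fst x) * snd x k + fst x * (if k = 0 then 1 else 0))"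
   by (intro continuous_map_add continuous_map_real_mult continuous_map_diff 1 2) simp_all
  then show "continuous_map ?P euclideanreal (%x. ?h x k)" by (simp add: case_prod_unfold)
 qed (use cone_closed in auto)
 have K: "?h (s, y) \<in> horn" if "s \<in> {0..1}" "y \<in> horn" for s y
 proof -
  have "y \<in> standard_simplex (Suc n)" "\<exists>i\<in>hI. y i = 0" using that(2) by (auto simp: horn_iff)
  then show ?thesis using cone_closed[OF that(1), of y] by (fastforce simp: horn_iff)
 qed
 have "homotopic_with (%h. h \<in> horn \<rightarrow> horn & h \<in> horn \<rightarrow> horn) (simplex_top (Suc n)) (simplex_top (Suc n)) id (%y. ?h (1, y))"
  by (rule homotopic_pairI[OF h _ _ _ K K]) (auto simp: horn_iff)
 then show "homotopic_with (%h. h \<in> horn \<rightarrow> horn) (simplex_top (Suc n)) (simplex_top (Suc n)) id (%y. ?h (1, y))"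
  by simp
 show "(%y. ?h (1, y)) \<in> topspace (simplex_top (Suc n)) \<rightarrow> horn"
 proof
  fix y assume "y \<in> topspace (simplex_top (Suc n))"
  then show "?h (1, y) \<in> horn" using cone_closed[of 1 y] by (auto simp: horn_iff intro: bexI[of _ "Suc 0"])
 qed
qed

text \<open>The boundary of a simplex arises from the horn by attaching the face opposite to the vertex \<open>0\<close>.\<close>

lemma horn_attachment:
 assumes n: "pair_homology n"
 shows "cell_attachment rim horn (UNIV :: unit set) n (%(j, t). simplical_face 0 t) (lo hI) (%(s, t). stretch hI s t)"
proof
 let ?c = "1 / (2 * real (Suc n))"
 note I = hI
 have cI: "1 / (2 * real (card hI)) = ?c" by simp
 let ?C = "cells (UNIV :: unit set) n"
 show "pair_homology n" by (rule n)
 have face: "simplical_face 0 t \<in> bdry_simplex (Suc n)" if "t \<in> standard_simplex n" for t :: "nat => real"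
  using that simplical_face_in_standard_simplex[of "Suc n" 0 t] by (auto simp: bdry_iff simplical_face_def)
 have coord: "continuous_map ?C euclideanreal (%x. snd x k)" for k
  using continuous_map_snd[of "discrete_topology (UNIV :: unit set)" "simplex_top n"] by (simp add: continuous_map_into_simplex)
 show e: "continuous_map ?C rim (%(j, t). simplical_face 0 t)"
  unfolding continuous_map_in_subtopology[of _ _ "bdry_simplex (Suc n)"] continuous_map_into_simplex
 proof (intro conjI allI ballI)
  fix k
  show "continuous_map ?C euclideanreal (%x. (case x of (j, t) => simplical_face 0 t) k)"
   using coord[of "k - 1"] by (cases "k = 0") (simp_all add: simplical_face_def case_prod_unfold)
 qed (use face bdry_subset in auto)
 show g: "continuous_map rim euclideanreal (lo hI)"
  using continuous_map_lo[of hI rim "%t. t"] continuous_map_from_subtopology[OF continuous_map_coordinate]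
  by simp
 show "horn = {y \<in> topspace rim. lo hI y \<le> 0}" unfolding topspace_rim horn_def ..
 show ge: "lo hI (case (j, t) of (j, t) => simplical_face 0 t) = lo {..n} t" for j :: unit and t :: "nat => real"
 proof -
  have "simplical_face 0 t ` hI = t ` {..n}"
  proof -
   have "hI = Suc ` {..n}" by (simp add: image_Suc_atMost)
   then show ?thesis by (simp only: image_image) (simp add: simplical_face_def)
  qed
  then show ?thesis by (simp add: lo_def)
 qed
 show "homeomorphic_map (subtopology ?C {z \<in> topspace ?C. lo hI (case z of (j, t) => simplical_face 0 t) > 0})
   (subtopology rim {y \<in> topspace rim. lo hI y > 0}) (%(j, t). simplical_face 0 t)"
  (is "homeomorphic_map (subtopology ?C ?A) (subtopology rim ?B) ?e")
 proof (rule homeomorphic_maps_imp_map)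
  let ?i = "%t. ((), %i. t (Suc i) :: real)"
  have B: "(%i. y (Suc i)) \<in> standard_simplex n & simplical_face 0 (%i. y (Suc i)) = y" if y: "y \<in> ?B" for y
  proof -
   have yb: "y \<in> bdry_simplex (Suc n)" and lo: "lo hI y > 0" using y topspace_rim by auto
   have "\<forall>i\<in>hI. 0 < y i" using lo by (subst (asm) lo_gr_iff) auto
   then have y0: "y 0 = 0" using yb by (auto simp: bdry_iff) (metis One_nat_def Suc_leI atLeastAtMost_iff less_irrefl neq0_conv)
   have ys: "y \<in> standard_simplex (Suc n)" using yb bdry_subset by auto
   have "sum y {..Suc n} = y 0 + (\<Sum>i\<le>n. y (Suc i))" by (rule sum.atMost_Suc_shift)
   then have "(%i. y (Suc i)) \<in> standard_simplex n" using ys y0 by (auto simp: standard_simplex_def)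
   moreover have "simplical_face 0 (%i. y (Suc i)) = y" using y0 by (auto simp: simplical_face_def)
   ultimately show ?thesis by simp
  qed
  show "homeomorphic_maps (subtopology ?C ?A) (subtopology rim ?B) ?e ?i"
   unfolding homeomorphic_maps_def
  proof (intro conjI ballI)
   show "continuous_map (subtopology ?C ?A) (subtopology rim ?B) ?e"
    using continuous_map_from_subtopology[OF e, of ?A] face
    by (auto simp: continuous_map_in_subtopology bdry_subset[THEN subsetD])
   have "continuous_map (subtopology rim ?B) (simplex_top n) (%t i. t (Suc i))"
    unfolding continuous_map_into_simplex
   proof (intro conjI allI ballI)
    fix k
    show "continuous_map (subtopology rim ?B) euclideanreal (%x. x (Suc k))"
     by (intro continuous_map_from_subtopology continuous_map_coordinate)
   next
    fix x assume "x \<in> topspace (subtopology rim ?B)"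
    then show "(%i. x (Suc i)) \<in> standard_simplex n" using B[of x] by simp
   qed
   then have "continuous_map (subtopology rim ?B) ?C ?i"
    by (intro continuous_map_pairedI) auto
   moreover have "?i y \<in> ?A" if "y \<in> ?B" for y
    using B[OF that] that by auto
   ultimately show "continuous_map (subtopology rim ?B) (subtopology ?C ?A) ?i"
    by (auto simp: continuous_map_in_subtopology)
   show "?e (?i y) = y" if "y \<in> topspace (subtopology rim ?B)" for y
    using B[of y] that by simp
   show "?i (?e x) = x" if "x \<in> topspace (subtopology ?C ?A)" for x
    by (cases x) (simp add: simplical_face_def)
  qed
 qed
 let ?P = "prod_topology (top_of_set {0..1::real}) rim"
 have keep: "stretch hI s t \<in> bdry_simplex (Suc n)" if s: "s \<in> {0..1}" and t: "t \<in> bdry_simplex (Suc n)" for s t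
 proof (cases "t 0 = 0")
  case True
  then have "stretch hI s t 0 = 0" by (simp add: stretch_def Let_def)
  then show ?thesis using stretch_closed[OF I s] t by (auto simp: bdry_iff)
 next
  case False
  then have "t \<in> horn" using t by (auto simp: bdry_iff horn_iff) (metis One_nat_def Suc_leI atLeastAtMost_iff gr0I)
  then have "lo hI t = 0" using lo_nonneg[OF I, of t] bdry_subset by (force simp: horn_def)
  then show ?thesis using stretch_boundary[OF I] t by simp
 qed
 show "continuous_map ?P rim (%(s, t). stretch hI s t)"
  unfolding continuous_map_in_subtopology[of _ _ "bdry_simplex (Suc n)"] continuous_map_into_simplex
 proof (intro conjI allI ballI)
  have 1: "continuous_map ?P euclideanreal fst"
   by (rule continuous_map_into_fulltopology[OF continuous_map_fst])
  have 2: "continuous_map ?P euclideanreal (%x. snd x k)" for k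
   using continuous_map_snd[of "top_of_set {0..1::real}" rim]
   by (simp add: continuous_map_in_subtopology continuous_map_componentwise_UNIV)
  fix k
  have "continuous_map ?P euclideanreal (%x. stretch hI (fst x) (snd x) k)"
   by (rule continuous_map_stretch[OF I 1 2]) auto
  then show "continuous_map ?P euclideanreal (%x. (case x of (s, t) => stretch hI s t) k)"
   by (simp add: case_prod_unfold)
 qed (use keep bdry_subset stretch_closed[OF I] in auto)
 show "(case (0::real, y) of (s, t) => stretch hI s t) = y" for y by (simp only: prod.case stretch_0[OF I])
 have lo0: "lo hI y = 0" if "y \<in> horn" for y
  using that lo_nonneg[OF I, of y] bdry_subset by (force simp: horn_def)
 show "(case (s, y) of (s, t) => stretch hI s t) \<in> horn" if "s \<in> {0..1}" "y \<in> horn" for s y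
  using that lo0 stretch_boundary[OF I] by simp
 show "lo hI (case (s, y) of (s, t) => stretch hI s t) < ?c" if "s \<in> {0..1}" "y \<in> topspace rim" "lo hI y < ?c" for s y
  using lo_stretch_less[OF I, of s y] that bdry_subset unfolding topspace_rim cI by auto
 show "(case (1::real, y) of (s, t) => stretch hI s t) \<in> horn" if "y \<in> topspace rim" "lo hI y < ?c" for y
  using lo_stretch_1[OF I, of y] keep[of 1 y] that bdry_subset[of "Suc n", THEN subsetD, of y]
  unfolding topspace_rim cI by (auto simp: horn_def)
qed

lemma boundary_of_relcycle:
 assumes c: "singular_relcycle (Suc q) (simplex_top (Suc n)) (bdry_simplex (Suc n)) c"
  and z: "singular_relboundary q rim horn (chain_boundary (Suc q) c)"
 shows "singular_relboundary (Suc q) (simplex_top (Suc n)) (bdry_simplex (Suc n)) c"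
proof -
 let ?T = "simplex_top (Suc n)"
 have hb: "horn \<subseteq> bdry_simplex (Suc n)" by (auto simp: horn_def)
 obtain d l where d: "singular_chain (Suc q) rim d" and l: "singular_chain q (subtopology rim horn) l"
  and dl: "chain_boundary (Suc q) d + l = chain_boundary (Suc q) c"
  using z unfolding singular_relboundary by blast
 have l': "singular_chain q (subtopology ?T horn) l"
  using l hb by (simp add: subtopology_subtopology Int_absorb1 Int_assoc)
 have "singular_relcycle (Suc q) ?T horn (c - d)"
 proof -
  have "chain_boundary (Suc q) (c - d) = l" using dl by (simp add: chain_boundary_diff algebra_simps)
  moreover have "singular_chain (Suc q) ?T c" "singular_chain (Suc q) ?T d"
   using c d singular_chain_subtopology by (auto simp: singular_relcycle)
  ultimately show ?thesis using l' by (simp add: singular_relcycle singular_chain_diff)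
 qed
 then obtain w m where w: "singular_chain (Suc (Suc q)) ?T w" and m: "singular_chain (Suc q) (subtopology ?T horn) m"
  and wm: "chain_boundary (Suc (Suc q)) w + m = c - d"
  using simplex_mod_horn unfolding singular_relboundary by blast
 have "singular_chain (Suc q) rim m" using m hb by (rule singular_chain_mono)
 then have "singular_chain (Suc q) rim (m + d)" using d by (rule singular_chain_add)
 moreover have "chain_boundary (Suc (Suc q)) w + (m + d) = c" using wm by (simp add: algebra_simps)
 ultimately show ?thesis unfolding singular_relboundary using w by blast
qed

lemma boundary_relcycle:
 assumes c: "singular_relcycle (Suc q) (simplex_top (Suc n)) (bdry_simplex (Suc n)) c"
 shows "singular_relcycle q rim horn (chain_boundary (Suc q) c)"
 using c chain_boundary_boundary_alt[of q "simplex_top (Suc n)" c] by (simp add: singular_relcycle)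

lemma boundary_fund:
 "\<exists>r. singular_chain n (subtopology rim horn) r \<and>
  chain_boundary (Suc n) (frag_of (fund (Suc n)))
   = frag_of (restrict (%t. simplical_face 0 t) (standard_simplex n)) + r"
proof -
 let ?T = "simplex_top (Suc n)"
 let ?r = "\<Sum>k=1..Suc n. frag_cmul ((-1) ^ k) (frag_of (singular_face (Suc n) k (fund (Suc n))))"
 have "{..Suc n} = insert 0 {1..Suc n}" by auto
 then have 1: "chain_boundary (Suc n) (frag_of (fund (Suc n))) = frag_of (singular_face (Suc n) 0 (fund (Suc n))) + ?r"
  by (simp add: chain_boundary_of)
 have 2: "singular_face (Suc n) 0 (fund (Suc n)) = restrict (%t. simplical_face 0 t) (standard_simplex n)"
  using simplical_face_in_standard_simplex[of "Suc n" 0]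
  by (auto simp: singular_face_def fund_def fun_eq_iff)
 have "singular_chain n (subtopology rim horn) ?r"
 proof (intro singular_chain_sum singular_chain_cmul)
  fix k assume k: "k \<in> {1..Suc n}"
  have "singular_simplex n (subtopology ?T horn) (singular_face (Suc n) k (fund (Suc n)))"
  proof -
   have "simplical_face k t \<in> horn" if "t \<in> standard_simplex n" for t :: "nat => real"
    using simplical_face_in_standard_simplex[of "Suc n" k t] k that
    by (auto simp: horn_iff simplical_face_def intro!: bexI[of _ k])
   then have "singular_face (Suc n) k (fund (Suc n)) ` standard_simplex n \<subseteq> horn"
    by (auto simp: singular_face_def fund_def horn_iff)
   then show ?thesis
    using singular_simplex_singular_face[OF fund_simplex, of "Suc n" k] k
    by (simp add: singular_simplex_subtopology[of _ _ horn])
  qed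
  moreover have "subtopology rim horn = subtopology ?T horn"
   by (auto simp: subtopology_subtopology horn_def intro!: arg_cong2[where f = subtopology])
  ultimately show "singular_chain n (subtopology rim horn) (frag_of (singular_face (Suc n) k (fund (Suc n))))"
   by (simp add: singular_chain_of)
 qed
 then show ?thesis using 1[unfolded 2] by blast
qed

text \<open>The boundary operator identifies the relative homology of the simplex modulo its boundary with that of
 the boundary modulo the horn, since the simplex and the horn are both contractible. Attaching the
 missing face to the horn expresses the latter by the previous dimension.\<close>

lemma pair_homology_Suc:
 assumes n: "pair_homology n"
 shows "pair_homology (Suc n)"
proof -
 let ?T = "simplex_top (Suc n)" and ?B = "bdry_simplex (Suc n)" and ?f = "frag_of (fund (Suc n))"
 interpret A: cell_attachment rim horn "UNIV :: unit set" n "%(j, t). simplical_face 0 t" "lo hI" "%(s, t). stretch hI s t"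
  by (rule horn_attachment[OF n])
 obtain r where r: "singular_chain n (subtopology rim horn) r"
  "chain_boundary (Suc n) ?f = frag_of (A.attached ()) + r"
  using boundary_fund by auto
 have below: "singular_relboundary m ?T ?B c" if m: "m < Suc n" and c: "singular_relcycle m ?T ?B c" for m c
 proof (cases m)
  case 0
  then have "singular_relcycle m ?T horn c" using c by (simp add: singular_relcycle chain_boundary_def)
  then obtain w e where "singular_chain (Suc m) ?T w" "singular_chain m (subtopology ?T horn) e" "chain_boundary (Suc m) w + e = c"
   using simplex_mod_horn unfolding singular_relboundary by blast
  moreover have "horn \<subseteq> ?B" by (auto simp: horn_def)
  ultimately show ?thesis unfolding singular_relboundary using singular_chain_mono by blast
 next
  case (Suc q)
  then have c': "singular_relcycle (Suc q) ?T ?B c" using c by simp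
  have "singular_relboundary q rim horn (chain_boundary (Suc q) c)"
   by (rule A.attached_below[OF _ boundary_relcycle[OF c']]) (use m Suc in simp)
  then show ?thesis using boundary_of_relcycle[OF c'] Suc by simp
 qed
 have gen: "\<exists>k. homologous_rel (Suc n) ?T ?B c (frag_cmul k ?f)" if c: "singular_relcycle (Suc n) ?T ?B c" for c
 proof -
  obtain \<kappa> where \<kappa>: "\<kappa> \<in> frees (UNIV :: unit set)" "homologous_rel n rim horn (chain_boundary (Suc n) c) (flin A.attached \<kappa>)"
   using A.attached_generate[OF boundary_relcycle[OF c]] by blast
  have "UNIV = {()}" by auto
  then obtain k where k: "\<kappa> = frag_cmul k (frag_of ())" using \<kappa>(1) frees_singleton[of \<kappa> "()"] by metis
  let ?c = "c - frag_cmul k ?f"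
  have c': "singular_relcycle (Suc n) ?T ?B ?c"
   by (intro singular_relcycle_diff singular_relcycle_cmul c fund_relcycle)
  have "singular_relboundary n rim horn (chain_boundary (Suc n) c - frag_cmul k (frag_of (A.attached ())))"
   using \<kappa>(2) by (simp add: k homologous_rel_def frag_extend_cmul)
  from singular_relboundary_diff[OF this singular_relboundary_cmul[OF chain_relboundary[OF r(1)], of k]]
  have "singular_relboundary n rim horn (chain_boundary (Suc n) ?c)"
   by (simp only: chain_boundary_diff chain_boundary_cmul r(2) frag_cmul_distrib2 diff_diff_eq)
  then show ?thesis using boundary_of_relcycle[OF c'] by (auto simp: homologous_rel_def)
 qed
 have indep: "k = 0" if bd: "singular_relboundary (Suc n) ?T ?B (frag_cmul k ?f)" for k
 proof -
  obtain d s where d: "singular_chain (Suc (Suc n)) ?T d" and s: "singular_chain (Suc n) rim s"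
   and ds: "chain_boundary (Suc (Suc n)) d + s = frag_cmul k ?f"
   using bd unfolding singular_relboundary by blast
  have "chain_boundary (Suc n) (frag_cmul k ?f) = chain_boundary (Suc n) s"
   using chain_boundary_boundary_alt[OF d] by (simp flip: ds add: chain_boundary_add)
  then have "chain_boundary (Suc n) s = frag_cmul k (frag_of (A.attached ())) + frag_cmul k r"
   by (simp add: chain_boundary_cmul r(2) frag_cmul_distrib2)
  then have "chain_boundary (Suc n) s + - frag_cmul k r = frag_cmul k (frag_of (A.attached ()))"
   by (simp only: add.assoc right_minus add_0_right)
  then have "chain_boundary (Suc n) s + - frag_cmul k r = flin A.attached (frag_cmul k (frag_of ()))"
   by (simp add: frag_extend_cmul)
  moreover have "singular_chain n (subtopology rim horn) (- frag_cmul k r)"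
   using r(1) by (simp add: singular_chain_cmul singular_chain_minus)
  ultimately have "singular_relboundary n rim horn (flin A.attached (frag_cmul k (frag_of ())))"
   unfolding singular_relboundary using s by blast
  then have "frag_cmul k (frag_of ()) = 0" by (intro A.attached_independent) auto
  then show "k = 0" by simp
 qed
 show ?thesis unfolding pair_homology_def using below gen indep by blast
qed

end

theorem pair_homology: "pair_homology n"
 by (induction n) (auto intro: pair_homology_0 pair_homology_Suc)

section \<open>Normal forms of points of the realization\<close>

lemma standard_simplexI:
 assumes "\<And>i. 0 \<le> t i" "\<And>i. i > n ==> t i = 0" "(\<Sum>i\<le>n. t i) = 1"
 shows "t \<in> standard_simplex n"
proof -
 have "t i \<le> 1" for i
 proof (cases "i \<le> n")
  case True
  then show ?thesis using member_le_sum[of i "{..n}" t] assms by simp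
 qed (use assms(2) in simp)
 then show ?thesis using assms by (simp add: standard_simplex_def)
qed

lemma sum_simplex_collapse:
 "i \<le> n ==> (\<Sum>k\<le>n. simplex_collapse i t k) = (\<Sum>k\<le>Suc n. t k)"
proof (induction n rule: dec_induct)
 case base
 have "(\<Sum>k<i. simplex_collapse i t k) = (\<Sum>k<i. t k)" by (rule sum.cong) (auto simp: simplex_collapse_def)
 then have "(\<Sum>k\<le>i. simplex_collapse i t k) = (\<Sum>k<i. t k) + (t i + t (Suc i))"
  by (simp add: simplex_collapse_def flip: lessThan_Suc_atMost)
 then show ?case by (simp flip: lessThan_Suc_atMost)
next
 case (step n)
 then show ?case by (simp add: simplex_collapse_def)
qed

lemma simplex_collapse_closed:
 assumes t: "t \<in> standard_simplex (Suc n)" and i: "i \<le> n"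
 shows "simplex_collapse i t \<in> standard_simplex n"
proof (rule standard_simplexI)
 show "(\<Sum>k\<le>n. simplex_collapse i t k) = 1"
  using sum_simplex_collapse[OF i] t by (simp add: standard_simplex_def)
qed (use t i in \<open>auto simp: simplex_collapse_def standard_simplex_def\<close>)

lemma simplical_face_closed:
 "t \<in> standard_simplex n ==> i \<le> Suc n ==> simplical_face i t \<in> standard_simplex (Suc n)"
 using simplical_face_in_standard_simplex[of "Suc n" i t] by simp

lemma standard_simplex_face:
 fixes t :: "nat => real"
 assumes t: "t \<in> standard_simplex n" and i: "i \<le> n" "t i = 0"
 obtains m t' where "n = Suc m" "t' \<in> standard_simplex m" "t = simplical_face i t'"
proof -
 obtain m where m: "n = Suc m" using t i by (cases n) (auto simp: standard_simplex_0)
 let ?t = "%k. if k < i then t k else t (Suc k)"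
 have "?t = simplex_collapse (min i m) t"
 proof
  fix k
  have "t (Suc (Suc m)) = 0" using t m by (simp add: standard_simplex_def)
  moreover have "k > m ==> t (Suc k) = 0" using t m by (simp add: standard_simplex_def)
  ultimately show "?t k = simplex_collapse (min i m) t k"
   using i m by (cases "i \<le> m") (auto simp: simplex_collapse_def min_def le_Suc_eq not_less_eq)
 qed
 then have "?t \<in> standard_simplex m" using simplex_collapse_closed[of t m "min i m"] t m by simp
 moreover have "t = simplical_face i ?t"
  using i by (auto simp: simplical_face_def fun_eq_iff)
 ultimately show ?thesis using that m by blast
qed

lemma simplical_face_inject: "simplical_face i s = simplical_face i t \<longleftrightarrow> s = (t :: nat => real)"
proof
 assume eq: "simplical_face i s = simplical_face i t"
 show "s = t"
 proof
  fix k
  show "s k = t k"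
   using fun_cong[OF eq, of k] fun_cong[OF eq, of "Suc k"] by (cases "k < i") (auto simp: simplical_face_def)
 qed
qed simp

lemma simplical_face_swap:
 fixes s t :: "nat => real"
 assumes "i < j" "j \<le> Suc n" "s \<in> standard_simplex n" "t \<in> standard_simplex n"
  and eq: "simplical_face i s = simplical_face j t"
 obtains m u where "n = Suc m" "u \<in> standard_simplex m" "s = simplical_face (j - 1) u" "t = simplical_face i u"
proof -
 have s0: "s (j - 1) = 0" using fun_cong[OF eq, of j] assms(1) by (auto simp: simplical_face_def)
 have j1: "j - 1 \<le> n" using assms by simp
 obtain m u where u: "n = Suc m" "u \<in> standard_simplex m" "s = simplical_face (j - 1) u"
  by (rule standard_simplex_face[OF assms(3) j1 s0])
 moreover have "t = simplical_face i u"
 proof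
  fix k
  show "t k = simplical_face i u k"
   using fun_cong[OF eq, of k] fun_cong[OF eq, of "Suc k"] assms(1) unfolding u(3)
   by (auto simp: simplical_face_def split: if_splits)
 qed
 ultimately show ?thesis using that by blast
qed

lemma collapse_face_eq: "i = j \<or> i = Suc j ==> simplex_collapse j (simplical_face i t) = (t :: nat => real)"
 by (auto simp: simplex_collapse_def simplical_face_def fun_eq_iff)

lemma collapse_face_less: "i < j ==> simplex_collapse j (simplical_face i t) = simplical_face i (simplex_collapse (j - 1) (t :: nat => real))"
 by (auto simp: simplex_collapse_def simplical_face_def fun_eq_iff)

lemma collapse_face_greater: "Suc j < i ==> simplex_collapse j (simplical_face i t) = simplical_face (i - 1) (simplex_collapse j (t :: nat => real))"
 by (auto simp: simplex_collapse_def simplical_face_def fun_eq_iff)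

lemma collapse_collapse: "i < j ==> simplex_collapse (j - 1) (simplex_collapse i t) = simplex_collapse i (simplex_collapse j t)"
 by (auto simp: simplex_collapse_def fun_eq_iff)

context simplicial_set
begin

definition cell_pts :: "(nat \<times> 'a \<times> (nat => real)) set" where
 "cell_pts = {(n, x, t). x \<in> simplices K n & t \<in> standard_simplex n}"

inductive red :: "nat \<times> 'a \<times> (nat => real) => nat \<times> 'a \<times> (nat => real) => bool" where
 red_face: "[|x \<in> simplices K (Suc n); t \<in> standard_simplex n; i \<le> Suc n|]
  ==> red (Suc n, x, simplical_face i t) (n, face K n i x, t)"
| red_degen: "[|x \<in> simplices K n; t \<in> standard_simplex (Suc n); i \<le> n|]
  ==> red (Suc n, degen K n i x, t) (n, x, simplex_collapse i t)"

lemma red_fst: "red a b ==> fst a = Suc (fst b)"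
 by (induction rule: red.induct) auto

lemma red_cell: "red a b ==> a \<in> cell_pts & b \<in> cell_pts"
 by (induction rule: red.induct)
  (auto simp: cell_pts_def face_closed degen_closed simplex_collapse_closed simplical_face_closed)

lemma gluing_red: "gluing K \<union> (gluing K)\<inverse> = {(a, b). red a b \<or> red b a}"
 unfolding gluing_def by (auto simp: red.simps)

lemma degen_degen_common:
 assumes y: "y \<in> simplices K n" and z: "z \<in> simplices K n" and eq: "degen K n i y = degen K n j z"
  and ij: "i < j" "j \<le> n"
 obtains m u where "n = Suc m" "u \<in> simplices K m" "y = degen K m (j - 1) u" "z = degen K m i u"
proof -
 obtain m where m: "n = Suc m" using ij by (cases n) auto
 let ?u = "face K m j y"
 have u: "?u \<in> simplices K m" using y ij m by (simp add: face_closed)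
 have "z = face K n (Suc j) (degen K n j z)" using z ij by (simp add: face_degen_eq)
 also have "\<dots> = face K (Suc m) (Suc j) (degen K (Suc m) i y)" using eq m by simp
 also have "\<dots> = degen K m i ?u" using face_degen_greater[of y m i "Suc j"] y ij m by simp
 finally have zu: "z = degen K m i ?u" .
 have "y = face K n i (degen K n i y)" using y ij by (simp add: face_degen_eq)
 also have "\<dots> = face K (Suc m) i (degen K (Suc m) j z)" using eq m by simp
 also have "\<dots> = degen K m (j - 1) (face K m i z)" using face_degen_less[of z m i j] z ij m by simp
 also have "face K m i z = ?u" using zu u ij m face_degen_eq[of ?u m i i] by simp
 finally show ?thesis using that m u zu by blast
qed

text \<open>Critical pairs of the reduction: a face of a degenerate simplex can be collapsed instead, and the two
 results agree or have a common reduct by the simplicial identities.\<close>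

lemma red_face_degen:
 assumes "x \<in> simplices K (Suc n)" "t \<in> standard_simplex n" "i \<le> Suc n"
  and "y \<in> simplices K n" "j \<le> n" and x: "x = degen K n j y"
 shows "(n, face K n i x, t) = (n, y, simplex_collapse j (simplical_face i t))
  \<or> (\<exists>d. red (n, face K n i x, t) d & red (n, y, simplex_collapse j (simplical_face i t)) d)"
proof -
 consider "i = j \<or> i = Suc j" | "i < j" | "Suc j < i" by linarith
 then show ?thesis
 proof cases
  case 1
  then show ?thesis using assms face_degen_eq[of y n j i] collapse_face_eq[OF 1] by simp
 next
  case 2
  then obtain m where m: "n = Suc m" using assms by (cases n) auto
  have "red (n, degen K m (j - 1) (face K m i y), t) (m, face K m i y, simplex_collapse (j - 1) t)"
   unfolding m by (rule red_degen) (use assms 2 m in \<open>auto simp: face_closed\<close>)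
  moreover have "red (n, y, simplical_face i (simplex_collapse (j - 1) t)) (m, face K m i y, simplex_collapse (j - 1) t)"
   unfolding m by (rule red_face) (use assms 2 m in \<open>auto simp: simplex_collapse_closed\<close>)
  moreover have "face K n i x = degen K m (j - 1) (face K m i y)"
   unfolding x using face_degen_less[of y m i j] assms 2 m by simp
  ultimately show ?thesis by (metis collapse_face_less[OF 2])
 next
  case 3
  then obtain m where m: "n = Suc m" using assms by (cases n) auto
  have "red (n, degen K m j (face K m (i - 1) y), t) (m, face K m (i - 1) y, simplex_collapse j t)"
   unfolding m by (rule red_degen) (use assms 3 m in \<open>auto simp: face_closed\<close>)
  moreover have "red (n, y, simplical_face (i - 1) (simplex_collapse j t)) (m, face K m (i - 1) y, simplex_collapse j t)"
   unfolding m by (rule red_face) (use assms 3 m in \<open>auto simp: simplex_collapse_closed\<close>)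
  moreover have "face K n i x = degen K m j (face K m (i - 1) y)"
   unfolding x using face_degen_greater[of y m j i] assms 3 m by simp
  ultimately show ?thesis by (metis collapse_face_greater[OF 3])
 qed
qed

lemma red_face_face:
 assumes x: "x \<in> simplices K (Suc n)" and "s \<in> standard_simplex n" "t \<in> standard_simplex n" "i < j" "j \<le> Suc n"
  and eq: "simplical_face i s = simplical_face j t"
 shows "\<exists>d. red (n, face K n i x, s) d & red (n, face K n j x, t) d"
proof -
 obtain m u where u: "n = Suc m" "u \<in> standard_simplex m" "s = simplical_face (j - 1) u" "t = simplical_face i u"
  using simplical_face_swap[OF assms(4,5,2,3) eq] by blast
 have "red (n, face K n i x, s) (m, face K m (j - 1) (face K n i x), u)"
  unfolding u(1,3) by (rule red_face) (use assms u in \<open>auto simp: face_closed\<close>)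
 moreover have "red (n, face K n j x, t) (m, face K m i (face K n j x), u)"
  unfolding u(1,4) by (rule red_face) (use assms u in \<open>auto simp: face_closed\<close>)
 moreover have "face K m i (face K n j x) = face K m (j - 1) (face K n i x)"
  using face_face[of x m i j] assms u(1) by simp
 ultimately show ?thesis by metis
qed

lemma red_degen_degen:
 assumes "y \<in> simplices K n" "z \<in> simplices K n" "degen K n i y = degen K n j z" "i < j" "j \<le> n"
  and t: "t \<in> standard_simplex (Suc n)"
 shows "\<exists>d. red (n, y, simplex_collapse i t) d & red (n, z, simplex_collapse j t) d"
proof -
 obtain m u where u: "n = Suc m" "u \<in> simplices K m" "y = degen K m (j - 1) u" "z = degen K m i u"
  using degen_degen_common[OF assms(1-5)] by blast
 have "red (n, y, simplex_collapse i t) (m, u, simplex_collapse (j - 1) (simplex_collapse i t))"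
  unfolding u(1,3) by (rule red_degen) (use assms u in \<open>auto intro!: simplex_collapse_closed\<close>)
 moreover have "red (n, z, simplex_collapse j t) (m, u, simplex_collapse i (simplex_collapse j t))"
  unfolding u(1,4) by (rule red_degen) (use assms u in \<open>auto intro!: simplex_collapse_closed\<close>)
 ultimately show ?thesis by (metis collapse_collapse[OF assms(4)])
qed

lemma red_diamond:
 assumes "red a b" "red a c"
 shows "b = c \<or> (\<exists>d. red b d & red c d)"
 using assms(1)
proof cases
 case (red_face x n s i)
 note 1 = this
 from assms(2) show ?thesis
 proof cases
  case (red_face x' n' t j)
  then have e: "n' = n" "x' = x" "simplical_face i s = simplical_face j t" using 1 by auto
  consider "i = j" | "i < j" | "j < i" by linarith
  then show ?thesis
  proof cases
   case 1
   then show ?thesis using e red_face \<open>b = _\<close> by (simp add: simplical_face_inject)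
  next
   case 2
   then show ?thesis using red_face_face[of x n s t i j] e red_face 1 by auto
  next
   case 3
   then show ?thesis using red_face_face[of x n t s j i] e red_face 1 by auto
  qed
 next
  case (red_degen y n' t j)
  then show ?thesis using red_face_degen[of x n s i y j] 1 by auto
 qed
next
 case (red_degen y n t i)
 note 1 = this
 from assms(2) show ?thesis
 proof cases
  case (red_face x n' s j)
  then show ?thesis using red_face_degen[of x n s j y i] 1 by auto
 next
  case (red_degen z n' t' j)
  then have e: "n' = n" "t' = t" "degen K n i y = degen K n j z" using 1 by auto
  consider "i = j" | "i < j" | "j < i" by linarith
  then show ?thesis
  proof cases
   case 1
   then have "y = z"
    using e red_degen \<open>y \<in> simplices K n\<close> \<open>i \<le> n\<close> face_degen_eq[of y n i i] face_degen_eq[of z n i i] by simp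
   then show ?thesis using 1 e red_degen \<open>b = _\<close> by simp
  next
   case 2
   then show ?thesis using red_degen_degen[of y n z i j t] e red_degen 1 by auto
  next
   case 3
   then show ?thesis using red_degen_degen[of z n y j i t] e red_degen 1 by auto
  qed
 qed
qed

definition irred :: "nat \<times> 'a \<times> (nat => real) => bool" where "irred a \<longleftrightarrow> (\<forall>b. \<not> red a b)"

lemma reduces_exists: "\<exists>b. red\<^sup>*\<^sup>* a b & irred b"
proof (induction "fst a" arbitrary: a rule: less_induct)
 case less
 show ?case
 proof (cases "irred a")
  case False
  then obtain b where b: "red a b" by (auto simp: irred_def)
  then obtain c where "red\<^sup>*\<^sup>* b c" "irred c" using less[of b] red_fst[OF b] by auto
  then show ?thesis using b converse_rtranclp_into_rtranclp[of red a b c] by blast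
 next
  case True
  then show ?thesis by (intro exI[of _ a]) simp
 qed
qed

lemma reduces_unique: "[|red\<^sup>*\<^sup>* a b; irred b; red\<^sup>*\<^sup>* a c; irred c|] ==> b = c"
proof (induction "fst a" arbitrary: a b c rule: less_induct)
 case less
 show ?case
 proof (cases "a = b \<or> a = c")
  case True
  then show ?thesis using less.prems by (auto simp: irred_def elim: converse_rtranclpE)
 next
  case False
  obtain b' where b': "red a b'" "red\<^sup>*\<^sup>* b' b" using less.prems(1) False by (metis converse_rtranclpE)
  obtain c' where c': "red a c'" "red\<^sup>*\<^sup>* c' c" using less.prems(3) False by (metis converse_rtranclpE)
  have lt: "fst b' < fst a" "fst c' < fst a" using red_fst[OF b'(1)] red_fst[OF c'(1)] by auto
  show ?thesis
  proof (cases "b' = c'")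
   case True
   then show ?thesis using less.hyps[OF lt(1)] b' c' less.prems by blast
  next
   case False
   then obtain d where d: "red b' d" "red c' d" using red_diamond[OF b'(1) c'(1)] by blast
   obtain e where e: "red\<^sup>*\<^sup>* d e" "irred e" using reduces_exists by blast
   have "red\<^sup>*\<^sup>* b' e" "red\<^sup>*\<^sup>* c' e" using d e(1) by (auto intro: converse_rtranclp_into_rtranclp)
   then show ?thesis using less.hyps[OF lt(1), of b e] less.hyps[OF lt(2), of c e] b' c' e less.prems by simp
  qed
 qed
qed

definition nf :: "nat \<times> 'a \<times> (nat => real) => nat \<times> 'a \<times> (nat => real)" where
 "nf a = (SOME b. red\<^sup>*\<^sup>* a b & irred b)"

lemma nf: "red\<^sup>*\<^sup>* a (nf a)" "irred (nf a)"
 using someI_ex[OF reduces_exists[of a]] by (auto simp: nf_def)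

lemma nf_irred: "irred a ==> nf a = a"
 using reduces_unique[OF nf(1,2), of a a] by simp

text \<open>The reduction decreases the dimension and is locally confluent, so each point has a unique normal form:
 an interior point of a nondegenerate simplex. Points of the realization are thus the normal forms.\<close>

lemma nf_red: "red a b ==> nf a = nf b"
 using reduces_unique[OF nf(1,2), of a "nf b"] nf[of b] converse_rtranclp_into_rtranclp[of red a b "nf b"] by simp

lemma reduces_cell: "red\<^sup>*\<^sup>* a b ==> a \<in> cell_pts ==> b \<in> cell_pts & fst b \<le> fst a"
proof (induction rule: rtranclp_induct)
 case (step b c)
 then show ?case using red_cell[OF step(2)] red_fst[OF step(2)] by simp
qed simp

lemma nf_cell: "a \<in> cell_pts ==> nf a \<in> cell_pts" and nf_fst: "a \<in> cell_pts ==> fst (nf a) \<le> fst a"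
 using reduces_cell[OF nf(1)] by auto

definition pt :: "nat \<times> 'a \<times> (nat => real) => (nat \<times> 'a \<times> (nat => real)) set" where
 "pt a = gluing_equiv K `` {a}"

lemma gluing_equiv_refl: "refl (gluing_equiv K)" and gluing_equiv_sym: "sym (gluing_equiv K)"
 and gluing_equiv_trans: "trans (gluing_equiv K)"
 unfolding gluing_equiv_def
 by (simp_all add: refl_rtrancl trans_rtrancl sym_rtrancl sym_Un_converse)

lemma gluing_equiv_nf: "(a, b) \<in> gluing_equiv K \<longleftrightarrow> nf a = nf b"
proof
 assume "(a, b) \<in> gluing_equiv K"
 then have "(a, b) \<in> {(a, b). red a b \<or> red b a}\<^sup>*" by (simp add: gluing_equiv_def gluing_red)
 then show "nf a = nf b"
  by (induction rule: rtrancl_induct) (auto dest: nf_red)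
next
 have 1: "(a, b) \<in> gluing_equiv K" if "red\<^sup>*\<^sup>* a b" for a b
  using that unfolding gluing_equiv_def gluing_red
  by (induction rule: rtranclp_induct) (auto intro: rtrancl_into_rtrancl)
 assume "nf a = nf b"
 then have "(a, nf a) \<in> gluing_equiv K" "(nf a, b) \<in> gluing_equiv K"
  using 1[OF nf(1)[of a]] 1[OF nf(1)[of b]] gluing_equiv_sym by (auto dest: symD)
 then show "(a, b) \<in> gluing_equiv K" using gluing_equiv_trans by (meson transD)
qed

lemma pt_eq_iff: "pt a = pt b \<longleftrightarrow> nf a = nf b"
proof -
 have "equiv UNIV (gluing_equiv K)"
  using gluing_equiv_refl gluing_equiv_sym gluing_equiv_trans by (intro equivI) auto
 then show ?thesis using eq_equiv_class_iff[of UNIV "gluing_equiv K" a b] by (simp add: pt_def gluing_equiv_nf)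
qed

lemma pt_nf: "pt (nf a) = pt a"
 by (simp add: pt_eq_iff nf_irred[OF nf(2)])

lemma pt_red: "red a b ==> pt a = pt b"
 by (simp add: pt_eq_iff nf_red)

definition rep :: "(nat \<times> 'a \<times> (nat => real)) set => nat \<times> 'a \<times> (nat => real)" where
 "rep p = nf (SOME a. pt a = p)"

lemma rep_pt: "rep (pt a) = nf a"
proof -
 have "pt (SOME b. pt b = pt a) = pt a" by (rule someI_ex) blast
 then show ?thesis by (simp add: rep_def pt_eq_iff)
qed

definition nondeg :: "nat => 'a set" where "nondeg n = simplices K n - degenerates K n"

lemma irred_cell_iff:
 assumes x: "x \<in> simplices K n" and t: "t \<in> standard_simplex n"
 shows "irred (n, x, t) \<longleftrightarrow> x \<in> nondeg n & lo {..n} t > 0"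
proof -
 have lo: "lo {..n} t > 0 \<longleftrightarrow> (\<forall>i\<le>n. t i > 0)" by (subst lo_gr_iff) auto
 have pos: "t i > 0 \<longleftrightarrow> t i \<noteq> 0" for i
 proof -
  have "t i \<ge> 0" using t by (simp add: standard_simplex_def)
  then show ?thesis by linarith
 qed
 have 1: "\<not> irred (n, x, t)" if deg: "x \<in> degenerates K n"
 proof -
  obtain m i y where m: "n = Suc m" "x = degen K m i y" "i \<le> m" "y \<in> simplices K m"
   using deg by (cases n) (auto simp: degenerates_def)
  then show ?thesis using red_degen[of y m t i] t by (auto simp: irred_def)
 qed
 have 2: "\<not> irred (n, x, t)" if z: "i \<le> n" "t i = 0" for i
 proof -
  obtain m t' where "n = Suc m" "t' \<in> standard_simplex m" "t = simplical_face i t'"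
   using standard_simplex_face[OF t z] by blast
  then show ?thesis using red_face[of x m t' i] x z by (auto simp: irred_def)
 qed
 have 3: "irred (n, x, t)" if "x \<notin> degenerates K n" "\<forall>i\<le>n. t i \<noteq> 0"
  unfolding irred_def
 proof (intro allI notI)
  fix b assume "red (n, x, t) b"
  then consider (face) i t' where "i \<le> n" "t = simplical_face i t'"
   | (degen) m y i where "n = Suc m" "x = degen K m i y" "i \<le> m" "y \<in> simplices K m"
   by (auto elim!: red.cases)
  then show False
  proof cases
   case face
   then have "t i = 0" by (simp add: simplical_face_def)
   then show False using that(2) face by blast
  next
   case degen
   then show False using that(1) by (auto simp: degenerates_def)
  qed
 qed
 show ?thesis unfolding lo pos using 1 2 3 x by (auto simp: nondeg_def)
qed

definition skeleton :: "nat => (nat \<times> 'a \<times> (nat => real)) set set" where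
 "skeleton n = pt ` {c \<in> cell_pts. fst c < n}"

lemma skeleton_iff: "c \<in> cell_pts ==> pt c \<in> skeleton n \<longleftrightarrow> fst (nf c) < n"
proof
 assume "pt c \<in> skeleton n"
 then obtain d where d: "d \<in> cell_pts" "fst d < n" "pt c = pt d" by (auto simp: skeleton_def)
 then show "fst (nf c) < n" using nf_fst[of d] by (simp add: pt_eq_iff)
next
 assume "c \<in> cell_pts" "fst (nf c) < n"
 then show "pt c \<in> skeleton n"
  unfolding skeleton_def using nf_cell[of c] pt_nf[of c] by (metis (mono_tags, lifting) image_eqI mem_Collect_eq)
qed

lemma skeleton_mono: "m \<le> n ==> skeleton m \<subseteq> skeleton n"
 by (auto simp: skeleton_def)

end

section \<open>The topology of the realization\<close>

lemma Hausdorff_simplex: "Hausdorff_space (simplex_top n)"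
 by (rule Hausdorff_space_subtopology) (simp add: Hausdorff_space_product_topology)

lemma compact_simplex: "compact_space (simplex_top n)"
 using compactin_standard_simplex by (simp add: compact_space_subtopology)

lemma continuous_simplical_face:
 "i \<le> Suc n ==> continuous_map (simplex_top n) (simplex_top (Suc n)) (simplical_face i)"
 unfolding continuous_map_into_simplex
proof (intro conjI allI ballI)
 fix k
 show "continuous_map (simplex_top n) euclideanreal (%x. simplical_face i x k)"
  using continuous_map_coordinate[of n k] continuous_map_coordinate[of n "k - 1"]
  by (cases "k < i"; cases "k = i") (simp_all add: simplical_face_def)
qed (auto intro: simplical_face_closed)

lemma continuous_simplex_collapse:
 "i \<le> n ==> continuous_map (simplex_top (Suc n)) (simplex_top n) (simplex_collapse i)"
 unfolding continuous_map_into_simplex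
proof (intro conjI allI ballI)
 fix k
 note c = continuous_map_coordinate[of "Suc n"]
 show "continuous_map (simplex_top (Suc n)) euclideanreal (%x. simplex_collapse i x k)"
  using c[of k] c[of "Suc k"] continuous_map_add[OF c[of i] c[of "Suc i"]]
  by (cases "k < i"; cases "k = i") (simp_all add: simplex_collapse_def)
qed (auto intro: simplex_collapse_closed)

definition cells_of :: "(nat => 'a set) => (nat \<times> 'a \<times> (nat => real)) set" where
 "cells_of A = {(n, x, t). x \<in> A n & t \<in> standard_simplex n}"

definition cells_top :: "(nat => 'a set) => (nat \<times> 'a \<times> (nat => real)) topology" where
 "cells_top A = subtopology (prod_topology (discrete_topology UNIV) (prod_topology (discrete_topology UNIV) (powertop_real UNIV)))
  (cells_of A)"

lemma topspace_cells_top [simp]: "topspace (cells_top A) = cells_of A"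
 by (auto simp: cells_top_def)

lemma continuous_map_cell:
 assumes "x \<in> A n"
 shows "continuous_map (simplex_top n) (cells_top A) (%t. (n, x, t))"
proof -
 have "continuous_map (simplex_top n) (powertop_real UNIV) (%t. t)"
  by (rule continuous_map_from_subtopology) simp
 then have "continuous_map (simplex_top n) (prod_topology (discrete_topology UNIV) (prod_topology (discrete_topology UNIV) (powertop_real UNIV))) (%t. (n, x, t))"
  by (intro continuous_map_pairedI) simp_all
 then show ?thesis using assms by (auto simp: cells_top_def continuous_map_in_subtopology cells_of_def)
qed

lemma openin_cells_top:
 "openin (cells_top A) U \<longleftrightarrow> U \<subseteq> cells_of A \<and>
  (\<forall>n. \<forall>x\<in>A n. openin (simplex_top n) {t \<in> standard_simplex n. (n, x, t) \<in> U})"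
proof (intro iffI conjI allI ballI)
 assume U: "openin (cells_top A) U"
 show "U \<subseteq> cells_of A" using openin_subset[OF U] by simp
 fix n x assume "x \<in> A n"
 from openin_continuous_map_preimage[OF continuous_map_cell[of x A n, OF this] U]
 show "openin (simplex_top n) {t \<in> standard_simplex n. (n, x, t) \<in> U}" by simp
next
 assume R: "U \<subseteq> cells_of A & (\<forall>n. \<forall>x\<in>A n. openin (simplex_top n) {t \<in> standard_simplex n. (n, x, t) \<in> U})"
 show "openin (cells_top A) U"
 proof (subst openin_subopen, intro ballI)
  fix c assume c: "c \<in> U"
  then obtain n x t where c': "c = (n, x, t)" "x \<in> A n" "t \<in> standard_simplex n" using R by (auto simp: cells_of_def)
  have "openin (simplex_top n) {t \<in> standard_simplex n. (n, x, t) \<in> U}" using R c' by blast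
  then obtain V where V: "openin (powertop_real UNIV) V" "{t \<in> standard_simplex n. (n, x, t) \<in> U} = V \<inter> standard_simplex n"
   unfolding openin_subtopology by blast
  let ?T = "({n} \<times> {x} \<times> V) \<inter> cells_of A"
  have "openin (cells_top A) ?T"
   unfolding cells_top_def openin_subtopology
   by (rule exI[of _ "{n} \<times> {x} \<times> V"]) (use V(1) in \<open>simp add: openin_prod_Times_iff\<close>)
  moreover have "c \<in> ?T" using c c' V(2) by (auto simp: cells_of_def)
  moreover have "?T \<subseteq> U" using V(2) by (auto simp: cells_of_def)
  ultimately show "\<exists>T. openin (cells_top A) T & c \<in> T & T \<subseteq> U" by blast
 qed
qed

lemma closedin_cells_top:
 "closedin (cells_top A) C \<longleftrightarrow> C \<subseteq> cells_of A \<and>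
  (\<forall>n. \<forall>x\<in>A n. closedin (simplex_top n) {t \<in> standard_simplex n. (n, x, t) \<in> C})"
proof -
 have "{t \<in> standard_simplex n. (n, x, t) \<in> cells_of A - C} = standard_simplex n - {t \<in> standard_simplex n. (n, x, t) \<in> C}"
  if "x \<in> A n" for n x using that by (auto simp: cells_of_def)
 then show ?thesis by (auto simp: closedin_def openin_cells_top)
qed

lemma continuous_map_from_cells:
 assumes "\<And>n x. x \<in> A n ==> continuous_map (simplex_top n) Z (%t. f (n, x, t))"
 shows "continuous_map (cells_top A) Z f"
 unfolding continuous_map_def
proof (intro conjI allI impI)
 show "f \<in> topspace (cells_top A) \<rightarrow> topspace Z"
  using continuous_map_image_subset_topspace[OF assms] by (fastforce simp: cells_of_def)
 fix U assume "openin Z U"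
 then show "openin (cells_top A) {x \<in> topspace (cells_top A). f x \<in> U}"
  using openin_continuous_map_preimage[OF assms]
  by (auto simp: openin_cells_top cells_of_def cong: conj_cong)
qed

lemma cell_topology_eq: "cell_topology K = cells_top (simplices K)"
proof -
 have *: "openin (prod_topology (discrete_topology (simplices K n)) (simplex_top n)) {c. (n, c) \<in> U} \<longleftrightarrow>
   (\<forall>x\<in>simplices K n. openin (simplex_top n) {t \<in> standard_simplex n. (n, x, t) \<in> U})" (is "openin ?P _ \<longleftrightarrow> ?R")
  if U: "U \<subseteq> cells_of (simplices K)" for U n
 proof
  assume o: "openin ?P {c. (n, c) \<in> U}"
  show ?R
  proof
   fix x assume x: "x \<in> simplices K n"
   then have "continuous_map (simplex_top n) ?P (Pair x)" by (auto simp: continuous_map_pairwise o_def)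
   from openin_continuous_map_preimage[OF this o]
   show "openin (simplex_top n) {t \<in> standard_simplex n. (n, x, t) \<in> U}" by simp
  qed
 next
  assume R: ?R
  show "openin ?P {c. (n, c) \<in> U}"
   unfolding openin_prod_topology_alt
  proof (intro allI impI)
   fix x t assume xt: "(x, t) \<in> {c. (n, c) \<in> U}"
   then have m: "x \<in> simplices K n" "t \<in> standard_simplex n" using U by (auto simp: cells_of_def)
   show "\<exists>V W. openin (discrete_topology (simplices K n)) V & openin (simplex_top n) W & x \<in> V & t \<in> W & V \<times> W \<subseteq> {c. (n, c) \<in> U}"
    by (rule exI[of _ "{x}"], rule exI[of _ "{t \<in> standard_simplex n. (n, x, t) \<in> U}"]) (use R m xt in auto)
  qed
 qed
 have s: "U \<subseteq> cells_of (simplices K) \<longleftrightarrow> U \<subseteq> Sigma UNIV (topspace \<circ> (%n. prod_topology (discrete_topology (simplices K n)) (simplex_top n)))" for U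
  by (auto simp: cells_of_def)
 show ?thesis unfolding topology_eq cell_topology_def openin_sum_topology openin_cells_top
  using * s by auto
qed

context simplicial_set
begin

lemma cell_pts_eq: "cell_pts = cells_of (simplices K)"
 by (simp add: cell_pts_def cells_of_def)

lemma realization_quotient: "quotient_map (cells_top (simplices K)) (realization K) pt"
proof -
 have "pt = (%c. gluing_equiv K `` {c})" by (auto simp: pt_def)
 then show ?thesis using quotient_map_quotient_topology by (metis realization_def cell_topology_eq)
qed

lemma topspace_realization: "topspace (realization K) = pt ` cell_pts"
 using quotient_imp_surjective_map[OF realization_quotient] by (simp add: cell_pts_eq)

lemma realization_cases:
 assumes "p \<in> topspace (realization K)"
 obtains n x t where "p = pt (n, x, t)" "irred (n, x, t)" "x \<in> nondeg n" "t \<in> standard_simplex n" "lo {..n} t > 0"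
  "rep p = (n, x, t)"
proof -
 obtain a where a: "a \<in> cell_pts" "p = pt a" using assms by (auto simp: topspace_realization)
 obtain n x t where e: "nf a = (n, x, t)" by (cases "nf a")
 have m: "x \<in> simplices K n" "t \<in> standard_simplex n" using nf_cell[OF a(1)] e by (auto simp: cell_pts_def)
 have i: "irred (n, x, t)" using nf(2)[of a] e by simp
 show ?thesis
 proof (rule that[OF _ i])
  show "p = pt (n, x, t)" using pt_nf[of a] a e by simp
  show "x \<in> nondeg n" "lo {..n} t > 0" using irred_cell_iff[OF m] i by auto
  show "rep p = (n, x, t)" using a e by (simp add: rep_pt)
 qed (rule m)
qed

lemma skeleton_rep: "p \<in> topspace (realization K) ==> p \<in> skeleton n \<longleftrightarrow> fst (rep p) < n"
 by (auto simp: topspace_realization skeleton_iff rep_pt)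

lemma skeleton_subset: "skeleton n \<subseteq> topspace (realization K)"
 by (auto simp: skeleton_def topspace_realization)

abbreviation slice :: "(nat \<times> 'a \<times> (nat => real)) set set => nat => 'a => (nat => real) set" where
 "slice C n x \<equiv> {t \<in> standard_simplex n. pt (n, x, t) \<in> C}"

lemma closedin_realization:
 "closedin (realization K) C \<longleftrightarrow> C \<subseteq> topspace (realization K) \<and>
  (\<forall>n. \<forall>x\<in>simplices K n. closedin (simplex_top n) (slice C n x))"
proof (cases "C \<subseteq> topspace (realization K)")
 case True
 then have "closedin (realization K) C \<longleftrightarrow> closedin (cells_top (simplices K)) {c \<in> cell_pts. pt c \<in> C}"
  using realization_quotient by (auto simp: quotient_map_closedin cell_pts_eq)
 also have "\<dots> \<longleftrightarrow> (\<forall>n. \<forall>x\<in>simplices K n. closedin (simplex_top n) (slice C n x))"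
  unfolding closedin_cells_top by (auto simp: cell_pts_def cells_of_def cong: conj_cong)
 finally show ?thesis using True by simp
qed (auto dest: closedin_subset)

text \<open>Closedness needs to be tested only near the interiors of the nondegenerate cells. By induction on the
 dimension, the trace on a degenerate cell is the preimage under a collapse, and the trace on the
 boundary of a cell is a finite union of images of traces on faces.\<close>

lemma closedin_by_interiors:
 assumes C: "C \<subseteq> topspace (realization K)"
  and int: "\<And>n x. x \<in> nondeg n ==> \<exists>D. closedin (simplex_top n) D & D \<subseteq> slice C n x & {t \<in> slice C n x. lo {..n} t > 0} \<subseteq> D"
 shows "closedin (realization K) C"
proof -
 have "closedin (simplex_top n) (slice C n x)" if "x \<in> simplices K n" for n x
  using that
 proof (induction n arbitrary: x rule: less_induct)
  case (less n)
  show ?case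
  proof (cases "x \<in> degenerates K n")
   case True
   then obtain m i y where m: "n = Suc m" "x = degen K m i y" "i \<le> m" "y \<in> simplices K m"
    by (cases n) (auto simp: degenerates_def)
   have "slice C n x = {t \<in> topspace (simplex_top (Suc m)). simplex_collapse i t \<in> slice C m y}"
    using m pt_red[OF red_degen[OF m(4) _ m(3)]] simplex_collapse_closed[OF _ m(3)] by auto
   then show ?thesis
    using closedin_continuous_map_preimage[OF continuous_simplex_collapse[OF m(3)] less.IH[of m y]] m by simp
  next
   case False
   then have nd: "x \<in> nondeg n" using less.prems by (simp add: nondeg_def)
   obtain D where D: "closedin (simplex_top n) D" "D \<subseteq> slice C n x" "{t \<in> slice C n x. lo {..n} t > 0} \<subseteq> D"
    using int[OF nd] by blast
   show ?thesis
   proof (cases n)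
    case 0
    have "lo {..n} t > 0" if "t \<in> standard_simplex n" for t
     using that 0 by (simp add: standard_simplex_0 lo_def)
    then have "slice C n x = D" using D by auto
    then show ?thesis using D(1) by simp
   next
    case (Suc m)
    let ?F = "%i. simplical_face i ` slice C m (face K m i x)"
    have red: "pt (n, x, simplical_face i t) = pt (m, face K m i x, t)" if "i \<le> n" "t \<in> standard_simplex m" for i t
     using pt_red[OF red_face] that less.prems Suc by simp
    have "closedin (simplex_top n) (?F i)" if i: "i \<le> n" for i
    proof -
     have "closedin (simplex_top m) (slice C m (face K m i x))"
      using less.IH[of m "face K m i x"] less.prems Suc i by (simp add: face_closed)
     then have "compactin (simplex_top m) (slice C m (face K m i x))"
      by (rule closedin_compact_space[OF compact_simplex])
     then have "compactin (simplex_top n) (?F i)"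
      using image_compactin continuous_simplical_face[of i m] i Suc by blast
     then show ?thesis by (rule compactin_imp_closedin[OF Hausdorff_simplex])
    qed
    then have "closedin (simplex_top n) (D \<union> (\<Union>i\<le>n. ?F i))"
     using D(1) by (intro closedin_Un closedin_Union) auto
    moreover have "slice C n x = D \<union> (\<Union>i\<le>n. ?F i)"
    proof
     show "slice C n x \<subseteq> D \<union> (\<Union>i\<le>n. ?F i)"
     proof
      fix t assume t: "t \<in> slice C n x"
      show "t \<in> D \<union> (\<Union>i\<le>n. ?F i)"
      proof (cases "lo {..n} t > 0")
       case True
       then show ?thesis using D(3) t by auto
      next
       case False
       then have "t \<in> bdry_simplex n" using t by (simp add: bdry_simplex_def)
       then obtain i where i: "i \<le> n" "t i = 0" by (auto simp: bdry_iff)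
       obtain m' t' where "n = Suc m'" "t' \<in> standard_simplex m'" "t = simplical_face i t'"
        using standard_simplex_face[of t n i] t i by blast
       then show ?thesis using i red[of i t'] t Suc by auto
      qed
     qed
     show "D \<union> (\<Union>i\<le>n. ?F i) \<subseteq> slice C n x"
      using D(2) red Suc simplical_face_closed[of _ m] by auto
    qed
    ultimately show ?thesis by simp
   qed
  qed
 qed
 then show ?thesis using C by (simp add: closedin_realization)
qed

lemma pt_interior:
 assumes "x \<in> nondeg n" "t \<in> standard_simplex n" "lo {..n} t > 0"
 shows "rep (pt (n, x, t)) = (n, x, t)" "pt (n, x, t) \<in> topspace (realization K)"
 using assms irred_cell_iff[of x n t] by (auto simp: rep_pt nf_irred nondeg_def topspace_realization cell_pts_def)

lemma closedin_by_skeleton: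
 assumes C: "C \<subseteq> skeleton N" and "\<And>n x. n < N ==> x \<in> nondeg n ==> closedin (simplex_top n) (slice C n x)"
 shows "closedin (realization K) C"
proof (rule closedin_by_interiors)
 fix n x assume x: "x \<in> nondeg n"
 show "\<exists>D. closedin (simplex_top n) D & D \<subseteq> slice C n x & {t \<in> slice C n x. lo {..n} t > 0} \<subseteq> D"
 proof (cases "n < N")
  case True
  then show ?thesis using assms(2)[OF True x] by blast
 next
  case False
  have "{t \<in> slice C n x. lo {..n} t > 0} = {}"
   using C pt_interior[OF x] skeleton_rep[of _ N] False by fastforce
  then show ?thesis by (intro exI[of _ "{}"]) auto
 qed
qed (use C skeleton_subset in blast)

lemma closedin_skeleton: "closedin (realization K) (skeleton N)"
proof (rule closedin_by_skeleton[OF order_refl])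
 fix n x assume "n < N" "x \<in> nondeg n"
 then have "slice (skeleton N) n x = topspace (simplex_top n)"
  by (auto simp: skeleton_def cell_pts_def nondeg_def)
 then show "closedin (simplex_top n) (slice (skeleton N) n x)" by (metis closedin_topspace)
qed

text \<open>A set of points that is finite in each skeleton is closed, since it is finite in every cell.\<close>

lemma closedin_locally_finite:
 assumes C: "C \<subseteq> topspace (realization K)" and fin: "\<And>n. finite (C \<inter> skeleton n)"
 shows "closedin (realization K) C"
proof (rule closedin_by_interiors[OF C])
 fix n x assume x: "x \<in> nondeg n"
 let ?D = "{t \<in> slice C n x. lo {..n} t > 0}"
 have inj: "inj_on (%t. pt (n, x, t)) ?D"
  by (rule inj_on_inverseI[where g = "%p. snd (snd (rep p))"]) (use pt_interior(1)[OF x] in auto)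
 have "(%t. pt (n, x, t)) ` ?D \<subseteq> C \<inter> skeleton (Suc n)"
  using x by (auto simp: skeleton_def cell_pts_def nondeg_def)
 from finite_imageD[OF finite_subset[OF this fin] inj] have "finite ?D" .
 then have "closedin (simplex_top n) ?D" by (intro closedin_Hausdorff_finite[OF Hausdorff_simplex]) auto
 then show "\<exists>D. closedin (simplex_top n) D & D \<subseteq> slice C n x & ?D \<subseteq> D" by (intro exI[of _ ?D]) auto
qed

text \<open>Otherwise choose points of the compact set outside of all skeleta. Every subset of this sequence meets
 each skeleton in a finite set and hence is closed, so the points form an infinite closed discrete
 subset of a compact set.\<close>

lemma compact_in_skeleton:
 assumes C: "compactin (realization K) C"
 shows "\<exists>N. C \<subseteq> skeleton N"
proof (rule ccontr)
 assume "\<nexists>N. C \<subseteq> skeleton N"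
 then have "\<forall>N. \<exists>q. q \<in> C - skeleton N" by blast
 then obtain p where p: "\<And>N. p N \<in> C - skeleton N" using choice by meson
 let ?A = "range p"
 have Csub: "C \<subseteq> topspace (realization K)" by (rule compactin_subset_topspace[OF C])
 have fin: "finite (B \<inter> skeleton n)" if B: "B \<subseteq> ?A" for B n
 proof (rule finite_subset)
  show "B \<inter> skeleton n \<subseteq> p ` {..<n}"
  proof
   fix b assume b: "b \<in> B \<inter> skeleton n"
   then obtain N where N: "b = p N" using B by blast
   have "N < n" using p[of N] b N skeleton_mono[of n N] by (metis DiffE IntD2 linorder_not_le subsetD)
   then show "b \<in> p ` {..<n}" using N by blast
  qed
 qed simp
 have cl: "closedin (realization K) B" if "B \<subseteq> ?A" for B
 proof (rule closedin_locally_finite)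
  show "B \<subseteq> topspace (realization K)" using that p Csub by fast
 qed (rule fin[OF that])
 have "subtopology (realization K) ?A = discrete_topology ?A"
 proof (rule HOL.sym, subst discrete_topology_unique, intro conjI ballI)
  show t: "topspace (subtopology (realization K) ?A) = ?A" using p Csub by auto
  fix a assume "a \<in> ?A"
  have "closedin (subtopology (realization K) ?A) (?A - {a})"
   by (rule closedin_subset_topspace[OF cl]) auto
  then have "openin (subtopology (realization K) ?A) (?A - (?A - {a}))" unfolding closedin_def t by blast
  then show "openin (subtopology (realization K) ?A) {a}" using \<open>a \<in> ?A\<close> by (simp add: double_diff)
 qed
 moreover have "compactin (realization K) ?A"
  using closed_compactin[OF C _ cl[OF order_refl]] p by blast
 then have "compactin (subtopology (realization K) ?A) ?A" by (simp add: compactin_subtopology)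
 ultimately have "finite ?A" by (simp add: compactin_discrete_topology)
 then obtain n where "?A \<subseteq> skeleton n"
 proof -
  let ?n = "Suc (Max (fst ` rep ` ?A))"
  have "?A \<subseteq> skeleton ?n"
  proof
   fix a assume a: "a \<in> ?A"
   then have "a \<in> topspace (realization K)" using p Csub by blast
   moreover have "fst (rep a) \<le> Max (fst ` rep ` ?A)" using \<open>finite ?A\<close> a by (intro Max_ge) auto
   ultimately show "a \<in> skeleton ?n" by (simp add: skeleton_rep)
  qed
  then show thesis by (rule that)
 qed
 then show False using p[of n] by blast
qed

lemma singular_chain_in_skeleton:
 assumes "singular_chain p (realization K) c"
 shows "\<exists>N. singular_chain p (subtopology (realization K) (skeleton N)) c"
proof -
 have "c \<in> frees (singular_simplex_set p (realization K))" using assms by (simp add: chain_frees)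
 then show ?thesis
 proof (induction rule: frees_induct)
  case (of f)
  then have "continuous_map (simplex_top p) (realization K) f" by (simp add: singular_simplex_def)
  from image_compactin[OF _ this, of "standard_simplex p"]
  have "compactin (realization K) (f ` standard_simplex p)"
   using compact_simplex[of p] by (simp add: compact_space_def)
  then obtain N where "f ` standard_simplex p \<subseteq> skeleton N" using compact_in_skeleton by blast
  then show ?case using of by (auto simp: singular_chain_of singular_simplex_subtopology)
 next
  case (diff a b)
  then obtain M N where "singular_chain p (subtopology (realization K) (skeleton M)) a"
   "singular_chain p (subtopology (realization K) (skeleton N)) b" by blast
  then have "singular_chain p (subtopology (realization K) (skeleton (max M N))) a"
   "singular_chain p (subtopology (realization K) (skeleton (max M N))) b"
   using skeleton_mono[of M "max M N"] skeleton_mono[of N "max M N"]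
   by (auto intro: singular_chain_mono)
  then show ?case using singular_chain_diff by blast
 qed auto
qed

end

section \<open>The skeletal filtration of the realization\<close>

lemma lo_low:
 assumes "t \<in> standard_simplex m" "m < n"
 shows "lo {..n} t = 0"
proof (rule antisym)
 show "lo {..n} t \<le> 0" using lo_le[of "{..n}" n t] assms by (simp add: standard_simplex_def)
 show "0 \<le> lo {..n} t" using assms by (subst not_less[symmetric], simp add: lo_def) (auto simp: standard_simplex_def not_less)
qed

context simplicial_set
begin

abbreviation "real_top \<equiv> realization K"
abbreviation "skel_top n \<equiv> subtopology (realization K) (skeleton n)"

lemma topspace_skel: "topspace (skel_top n) = skeleton n"
 using skeleton_subset by auto

lemma nf_fst_less: "a \<in> cell_pts ==> \<not> irred a ==> fst (nf a) < fst a"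
proof -
 assume a: "a \<in> cell_pts" "\<not> irred a"
 then obtain b where b: "red a b" by (auto simp: irred_def)
 then show "fst (nf a) < fst a" using nf_red[OF b] nf_fst[of b] red_cell[OF b] red_fst[OF b] by simp
qed

context
 fixes n :: nat
begin

definition low_cells :: "nat => 'a set" where
 "low_cells m = (if m \<le> n then nondeg m else {})"

lemma low_cells_iff: "(m, x, t) \<in> cells_of low_cells \<longleftrightarrow> m \<le> n & x \<in> nondeg m & t \<in> standard_simplex m"
 by (auto simp: cells_of_def low_cells_def)

lemma low_cell_pts: "cells_of low_cells \<subseteq> cell_pts"
 by (auto simp: cells_of_def low_cells_def cell_pts_def nondeg_def split: if_splits)

lemma skeleton_low: "skeleton (Suc n) = pt ` cells_of low_cells"
proof
 show "skeleton (Suc n) \<subseteq> pt ` cells_of low_cells"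
 proof
  fix p assume p: "p \<in> skeleton (Suc n)"
  then have pt: "p \<in> topspace real_top" using skeleton_subset by blast
  obtain m x t where c: "p = pt (m, x, t)" "x \<in> nondeg m" "t \<in> standard_simplex m" "rep p = (m, x, t)"
   by (rule realization_cases[OF pt]) blast
  then have "m \<le> n" using skeleton_rep[OF pt, of "Suc n"] p by simp
  then show "p \<in> pt ` cells_of low_cells" using c low_cells_iff by blast
 qed
 show "pt ` cells_of low_cells \<subseteq> skeleton (Suc n)"
  unfolding skeleton_def using low_cell_pts by (auto simp: low_cells_iff intro!: imageI)
qed

lemma skeleton_quotient: "quotient_map (cells_top low_cells) (skel_top (Suc n)) pt"
 unfolding quotient_map_closedin topspace_skel
proof (intro conjI allI impI)
 show "pt ` topspace (cells_top low_cells) = skeleton (Suc n)" by (simp add: skeleton_low)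
 fix U assume U: "U \<subseteq> skeleton (Suc n)"
 have cl: "closedin (skel_top (Suc n)) U \<longleftrightarrow> closedin real_top U"
  using U by (simp add: closedin_closed_subtopology[OF closedin_skeleton])
 have sl: "{t \<in> standard_simplex m. (m, x, t) \<in> {c \<in> topspace (cells_top low_cells). pt c \<in> U}} = slice U m x"
  if "x \<in> low_cells m" for m x using that by (auto simp: cells_of_def)
 have "closedin (cells_top low_cells) {c \<in> topspace (cells_top low_cells). pt c \<in> U}
   \<longleftrightarrow> (\<forall>m. \<forall>x\<in>low_cells m. closedin (simplex_top m) (slice U m x))"
  unfolding closedin_cells_top using sl by auto
 also have "\<dots> \<longleftrightarrow> closedin real_top U"
 proof
  assume "\<forall>m. \<forall>x\<in>low_cells m. closedin (simplex_top m) (slice U m x)"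
  then show "closedin real_top U"
   by (intro closedin_by_skeleton[OF U]) (auto simp: low_cells_def less_Suc_eq_le)
 qed (auto simp: closedin_realization low_cells_def nondeg_def split: if_splits)
 finally show "closedin (cells_top low_cells) {c \<in> topspace (cells_top low_cells). pt c \<in> U} \<longleftrightarrow> closedin (skel_top (Suc n)) U"
  unfolding cl .
qed

definition height :: "(nat \<times> 'a \<times> (nat => real)) set => real" where
 "height p = lo {..n} (snd (snd (rep p)))"

text \<open>The deformation stretches the top-dimensional cells and leaves the lower skeleton fixed.\<close>

definition push :: "real \<times> (nat \<times> 'a \<times> (nat => real)) set => (nat \<times> 'a \<times> (nat => real)) set" where
 "push = (%(s, p). case rep p of (m, x, t) => pt (m, x, stretch {..n} (if m = n then s else 0) t))"

lemma I_n: "{..n} \<subseteq> {..n}" "{..n} \<noteq> {}" by auto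

lemma on_low_cell:
 assumes c: "(m, x, t) \<in> cells_of low_cells"
 shows "height (pt (m, x, t)) = lo {..n} t"
  and "push (s, pt (m, x, t)) = pt (m, x, stretch {..n} (if m = n then s else 0) t)"
proof -
 have m: "m \<le> n" "x \<in> nondeg m" "t \<in> standard_simplex m" using c by (auto simp: low_cells_iff)
 have cp: "(m, x, t) \<in> cell_pts" using c low_cell_pts by blast
 have "height (pt (m, x, t)) = lo {..n} t & push (s, pt (m, x, t)) = pt (m, x, stretch {..n} (if m = n then s else 0) t)"
 proof (cases "lo {..m} t > 0")
  case True
  then show ?thesis using pt_interior(1)[OF m(2,3)] by (simp add: height_def push_def)
 next
  case False
  then have "\<not> irred (m, x, t)" using irred_cell_iff[of x m t] m by (auto simp: nondeg_def)
  then have lt: "fst (nf (m, x, t)) < m" using nf_fst_less[OF cp] by simp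
  obtain m' x' t' where r: "nf (m, x, t) = (m', x', t')" by (cases "nf (m, x, t)")
  have t': "t' \<in> standard_simplex m'" using nf_cell[OF cp] r by (simp add: cell_pts_def)
  have m': "m' < m" using lt r by simp
  have "lo {..m} t = 0" using False lo_nonneg[of "{..m}" m t] m by auto
  then have lo: "lo {..n} t = 0" using m lo_low[of t m n] by (cases "m = n") auto
  have st: "stretch {..n} (if m = n then s else 0) t = t" by (rule stretch_boundary[OF I_n lo])
  have "height (pt (m, x, t)) = 0" using lo_low[OF t', of n] m' m by (simp add: height_def rep_pt r)
  moreover have "push (s, pt (m, x, t)) = pt (m, x, t)"
   using m' m pt_nf[of "(m, x, t)"] by (simp add: push_def rep_pt r stretch_0[OF I_n])
  ultimately show ?thesis using lo st by simp
 qed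
 then show "height (pt (m, x, t)) = lo {..n} t"
  and "push (s, pt (m, x, t)) = pt (m, x, stretch {..n} (if m = n then s else 0) t)" by auto
qed

lemma skeleton_height: "skeleton n = {y \<in> topspace (skel_top (Suc n)). height y \<le> 0}"
proof -
 have "p \<in> skeleton n \<longleftrightarrow> height p \<le> 0" if p: "p \<in> skeleton (Suc n)" for p
 proof -
  have pt: "p \<in> topspace real_top" using p skeleton_subset by blast
  obtain m x t where c: "t \<in> standard_simplex m" "lo {..m} t > 0" "rep p = (m, x, t)"
   by (rule realization_cases[OF pt]) blast
  have "m \<le> n" using skeleton_rep[OF pt, of "Suc n"] p c by simp
  then show ?thesis
   using skeleton_rep[OF pt, of n] c lo_low[OF c(1), of n] by (cases "m = n") (auto simp: height_def)
 qed
 then show ?thesis unfolding topspace_skel using skeleton_mono[of n "Suc n"] by auto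
qed

lemma stretch_low_cell:
 assumes "(m, x, t) \<in> cells_of low_cells" "s \<in> {0..1}"
 shows "(m, x, stretch {..n} (if m = n then s else 0) t) \<in> cells_of low_cells"
 using assms stretch_closed[OF I_n, of s t] stretch_0[OF I_n, of t] by (auto simp: low_cells_iff)

lemma continuous_push: "continuous_map (prod_topology (top_of_set {0..1::real}) (skel_top (Suc n))) (skel_top (Suc n)) push"
proof (rule continuous_compose_quotient_map)
 let ?I = "top_of_set {0..1::real}"
 let ?W = "cells_top low_cells"
 show "quotient_map (prod_topology ?I ?W) (prod_topology ?I (skel_top (Suc n))) (%(s, c). (s, pt c))"
 proof (rule quotient_map_prod_right[OF _ _ skeleton_quotient])
  show "locally_compact_space ?I"
   by (rule compact_imp_locally_compact_space) (simp add: compact_space_subtopology)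
  show "Hausdorff_space ?I \<or> regular_space ?I" by (simp add: Hausdorff_space_subtopology)
 qed
 let ?k = "%(s, m, x, t). (m, x, stretch {..n} (s * (if m = n then 1 else 0)) t) :: nat \<times> 'a \<times> (nat => real)"
 let ?P = "prod_topology ?I ?W"
 have f: "continuous_map ?P euclideanreal fst"
  by (rule continuous_map_into_fulltopology[OF continuous_map_fst])
 have s: "continuous_map ?P (prod_topology (discrete_topology UNIV) (prod_topology (discrete_topology UNIV) (powertop_real UNIV))) snd"
  using continuous_map_snd[of ?I ?W] by (simp add: cells_top_def continuous_map_in_subtopology)
 have s1: "continuous_map ?P (discrete_topology UNIV) (%z. fst (snd z))"
  using continuous_map_compose[OF s continuous_map_fst] by (simp add: o_def)
 have s2: "continuous_map ?P (discrete_topology UNIV) (%z. fst (snd (snd z)))"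
  using continuous_map_compose[OF continuous_map_compose[OF s continuous_map_snd] continuous_map_fst] by (simp add: o_def)
 have s3: "continuous_map ?P (powertop_real UNIV) (%z. snd (snd (snd z)))"
  using continuous_map_compose[OF continuous_map_compose[OF s continuous_map_snd] continuous_map_snd] by (simp add: o_def)
 have d: "continuous_map ?P euclideanreal (%z. if fst (snd z) = n then 1 else 0)"
  using continuous_map_compose[OF s1, of euclideanreal "%m. if m = n then 1 else 0"] by (simp add: o_def)
 have t: "continuous_map ?P (powertop_real UNIV) (%z. stretch {..n} (fst z * (if fst (snd z) = n then 1 else 0)) (snd (snd (snd z))))"
  unfolding continuous_map_componentwise_UNIV
 proof
  fix k
  show "continuous_map ?P euclideanreal (%z. stretch {..n} (fst z * (if fst (snd z) = n then 1 else 0)) (snd (snd (snd z))) k)"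
  proof (rule continuous_map_stretch[OF I_n continuous_map_real_mult[OF f d]])
   show "continuous_map ?P euclideanreal (%z. snd (snd (snd z)) k)" for k
    using s3 by (simp add: continuous_map_componentwise_UNIV)
   show "fst z * (if fst (snd z) = n then 1 else 0) \<in> {0..1} & snd (snd (snd z)) \<in> standard_simplex n"
    if "z \<in> topspace ?P" for z
   proof -
    obtain a m x u where z: "z = (a, m, x, u)" by (cases z)
    then have "m \<le> n" "u \<in> standard_simplex m" "a \<in> {0..1}" using that by (auto simp: low_cells_iff)
    then show ?thesis using z standard_simplex_mono[of m n] by auto
   qed
  qed
 qed
 have "continuous_map ?P (prod_topology (discrete_topology UNIV) (prod_topology (discrete_topology UNIV) (powertop_real UNIV))) ?k"
  using continuous_map_pairedI[OF s1 continuous_map_pairedI[OF s2 t]] by (simp add: case_prod_unfold)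
 moreover have keep: "?k z \<in> cells_of low_cells" if "z \<in> topspace ?P" for z
 proof -
  obtain a m x u where z: "z = (a, m, x, u)" by (cases z)
  then show ?thesis using that stretch_low_cell[of m x u a] by (auto split: if_splits)
 qed
 ultimately have "continuous_map ?P ?W ?k" by (auto simp: cells_top_def continuous_map_in_subtopology)
 from continuous_map_compose[OF this quotient_imp_continuous_map[OF skeleton_quotient]]
 have "continuous_map ?P (skel_top (Suc n)) (pt \<circ> ?k)" .
 then show "continuous_map ?P (skel_top (Suc n)) (push \<circ> (%(s, c). (s, pt c)))"
 proof (rule continuous_map_eq)
  fix z assume "z \<in> topspace ?P"
  moreover obtain a m x u where z: "z = (a, m, x, u)" by (cases z)
  ultimately show "(pt \<circ> ?k) z = (push \<circ> (%(s, c). (s, pt c))) z"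
   using on_low_cell(2)[of m x u a] by simp
 qed
qed

lemma continuous_height: "continuous_map (skel_top (Suc n)) euclideanreal height"
proof (rule continuous_compose_quotient_map[OF skeleton_quotient])
 show "continuous_map (cells_top low_cells) euclideanreal (height \<circ> pt)"
 proof (rule continuous_map_from_cells)
  fix m x assume x: "x \<in> low_cells m"
  have "continuous_map (simplex_top m) euclideanreal (%t. lo {..n} t)"
   using continuous_map_lo[of "{..n}" "simplex_top m" "%t. t"] continuous_map_coordinate by auto
  then show "continuous_map (simplex_top m) euclideanreal (%t. (height \<circ> pt) (m, x, t))"
   by (rule continuous_map_eq) (use x on_low_cell(1) in \<open>auto simp: cells_of_def\<close>)
 qed
qed

lemma cells_open_slices:
 assumes "openin (cells J n) U" "j \<in> J"
 shows "openin (simplex_top n) {t \<in> standard_simplex n. (j, t) \<in> U}"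
 using openin_continuous_map_preimage[OF cells_continuous(2)[OF assms(2)] assms(1)] by simp

text \<open>The next skeleton is obtained by attaching the nondegenerate simplices of one dimension: the
 characteristic maps are injective on the interiors by uniqueness of normal forms, and a
 neighbourhood of the lower skeleton deforms into it by stretching the cells.\<close>

theorem skeleton_attachment:
 "cell_attachment (skel_top (Suc n)) (skeleton n) (nondeg n) n (%(j, t). pt (n, j, t)) height push"
proof
 let ?e = "%(j, t). pt (n, j, t)" and ?Y = "skel_top (Suc n)"
 let ?c = "1 / (2 * real (Suc n))"
 have cI: "1 / (2 * real (card {..n})) = ?c" by simp
 show "pair_homology n" by (rule pair_homology)
 have low: "(n, j, t) \<in> cells_of low_cells" if "j \<in> nondeg n" "t \<in> standard_simplex n" for j t
  using that by (simp add: low_cells_iff)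
 have cW: "continuous_map (cells (nondeg n) n) (cells_top low_cells) (%(j, t). (n, j, t))"
 proof -
  have "continuous_map (cells (nondeg n) n) (powertop_real UNIV) snd"
   by (rule continuous_map_into_fulltopology[OF continuous_map_snd])
  moreover have "continuous_map (cells (nondeg n) n) (discrete_topology UNIV) fst"
  proof -
   have "continuous_map (discrete_topology (nondeg n)) (discrete_topology UNIV) (%x. x)" by simp
   from continuous_map_compose[OF continuous_map_fst this] show ?thesis by (simp add: o_def)
  qed
  ultimately have "continuous_map (cells (nondeg n) n) (prod_topology (discrete_topology UNIV) (prod_topology (discrete_topology UNIV) (powertop_real UNIV)))
    (%z. (n, fst z, snd z))"
   by (intro continuous_map_pairedI) auto
  then show ?thesis using low by (auto simp: cells_top_def continuous_map_in_subtopology case_prod_unfold)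
 qed
 show e: "continuous_map (cells (nondeg n) n) ?Y ?e"
  using continuous_map_compose[OF cW quotient_imp_continuous_map[OF skeleton_quotient]]
  by (simp add: o_def case_prod_unfold)
 show "continuous_map ?Y euclideanreal height" by (rule continuous_height)
 show "skeleton n = {y \<in> topspace ?Y. height y \<le> 0}" by (rule skeleton_height)
 show ge: "height (case (j, t) of (j, t) => pt (n, j, t)) = lo {..n} t" if "j \<in> nondeg n" "t \<in> standard_simplex n" for j t
  using on_low_cell(1)[OF low[OF that]] by simp
 show "homeomorphic_map (subtopology (cells (nondeg n) n) {z \<in> topspace (cells (nondeg n) n). height (?e z) > 0})
   (subtopology ?Y {y \<in> topspace ?Y. height y > 0}) ?e"
  (is "homeomorphic_map (subtopology ?C ?A) (subtopology ?Y ?B) ?e")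
  unfolding homeomorphic_map_def quotient_map_def
 proof (intro conjI allI impI)
  have A: "z \<in> ?A \<longleftrightarrow> fst z \<in> nondeg n & snd z \<in> standard_simplex n & lo {..n} (snd z) > 0" for z
   using ge by (cases z) auto
  have Atop: "topspace (subtopology ?C ?A) = ?A" "topspace (subtopology ?Y ?B) = ?B" by auto
  have inv: "rep (?e z) = (n, fst z, snd z)" if "z \<in> ?A" for z
   using that pt_interior(1)[of "fst z" n "snd z"] unfolding A by (simp add: case_prod_unfold)
  show "inj_on ?e (topspace (subtopology ?C ?A))"
   unfolding Atop by (rule inj_on_inverseI[where g = "%p. snd (rep p)"]) (simp only: inv snd_conv prod.collapse)
  show im: "?e ` topspace (subtopology ?C ?A) = topspace (subtopology ?Y ?B)"
   unfolding Atop
  proof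
   show "?e ` ?A \<subseteq> ?B" using continuous_map_image_subset_topspace[OF e] by blast
   show "?B \<subseteq> ?e ` ?A"
   proof
    fix p assume p: "p \<in> ?B"
    then have pt: "p \<in> topspace real_top" by simp
    obtain m x t where c: "p = pt (m, x, t)" "x \<in> nondeg m" "t \<in> standard_simplex m" "lo {..m} t > 0" "rep p = (m, x, t)"
     by (rule realization_cases[OF pt]) blast
    have "m \<le> n" using skeleton_rep[OF pt, of "Suc n"] p c by simp
    moreover have "\<not> m < n" using p c lo_low[OF c(3), of n] by (auto simp: height_def)
    ultimately have "m = n" by simp
    then have "(x, t) \<in> ?A" "p = ?e (x, t)" using c A[of "(x, t)"] by auto
    then show "p \<in> ?e ` ?A" by blast
   qed
  qed
  have oB: "openin ?Y ?B"
   using openin_continuous_map_preimage[OF continuous_height, of "{0<..}"] by simp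
  have oA: "openin ?C ?A"
   using openin_continuous_map_preimage[OF continuous_map_compose[OF e continuous_height], of "{0<..}"]
   by simp
  fix V assume "V \<subseteq> topspace (subtopology ?Y ?B)"
  then have V: "V \<subseteq> ?B" by auto
  show "openin (subtopology ?C ?A) {z \<in> topspace (subtopology ?C ?A). ?e z \<in> V} \<longleftrightarrow> openin (subtopology ?Y ?B) V"
  proof
   assume "openin (subtopology ?Y ?B) V"
   then have "openin ?Y V" using oB by (simp add: openin_open_subtopology)
   from openin_continuous_map_preimage[OF e this]
   have "openin ?C ({z \<in> topspace ?C. ?e z \<in> V} \<inter> ?A)" using oA by (rule openin_Int)
   moreover have "{z \<in> topspace ?C. ?e z \<in> V} \<inter> ?A = {z \<in> topspace (subtopology ?C ?A). ?e z \<in> V}" by auto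
   ultimately show "openin (subtopology ?C ?A) {z \<in> topspace (subtopology ?C ?A). ?e z \<in> V}"
    using oA by (auto simp: openin_open_subtopology)
  next
   assume "openin (subtopology ?C ?A) {z \<in> topspace (subtopology ?C ?A). ?e z \<in> V}"
   then have o: "openin ?C {z \<in> ?A. ?e z \<in> V}" unfolding Atop using oA by (simp add: openin_open_subtopology)
   have o': "openin (cells_top low_cells) {c \<in> topspace (cells_top low_cells). pt c \<in> V}"
    unfolding openin_cells_top
   proof (intro conjI allI ballI)
    fix m x assume x: "x \<in> low_cells m"
    have hV: "height p > 0" if "p \<in> V" for p using V that by auto
    have "{t \<in> standard_simplex m. (m, x, t) \<in> {c \<in> topspace (cells_top low_cells). pt c \<in> V}}
      = (if m = n then {t \<in> standard_simplex n. (x, t) \<in> {z \<in> ?A. ?e z \<in> V}} else {})"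
    proof (cases "m = n")
     case True
     have "lo {..n} t > 0" if "t \<in> standard_simplex n" "pt (n, x, t) \<in> V" for t
      using hV[OF that(2)] on_low_cell(1)[of n x t] x True that(1) by (simp add: cells_of_def)
     then show ?thesis using True x A by (auto simp: cells_of_def low_cells_def)
    next
     case False
     then have "m < n" using x by (auto simp: low_cells_def split: if_splits)
     have "pt (m, x, t) \<notin> V" if t: "t \<in> standard_simplex m" for t
      using hV[of "pt (m, x, t)"] on_low_cell(1)[of m x t] lo_low[OF t \<open>m < n\<close>] x t by (auto simp: cells_of_def)
     then show ?thesis using False by auto
    qed
    then show "openin (simplex_top m) {t \<in> standard_simplex m. (m, x, t) \<in> {c \<in> topspace (cells_top low_cells). pt c \<in> V}}"
     using cells_open_slices[OF o, of x] x by (auto simp: low_cells_def)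
   qed auto
   have "V \<subseteq> topspace ?Y" using V by fast
   then have "openin ?Y V"
    using conjunct2[OF skeleton_quotient[unfolded quotient_map_def]] o' by meson
   then show "openin (subtopology ?Y ?B) V" using V oB by (simp add: openin_open_subtopology)
  qed
 qed
 show "continuous_map (prod_topology (top_of_set {0..1::real}) ?Y) ?Y push" by (rule continuous_push)
 have cases: "\<exists>m x t. y = pt (m, x, t) & (m, x, t) \<in> cells_of low_cells & (m < n --> y \<in> skeleton n)"
  if y: "y \<in> topspace ?Y" for y
 proof -
  have pt: "y \<in> topspace real_top" using y by simp
  obtain m x t where c: "y = pt (m, x, t)" "x \<in> nondeg m" "t \<in> standard_simplex m" "rep y = (m, x, t)"
   by (rule realization_cases[OF pt]) blast
  have "m \<le> n" using skeleton_rep[OF pt, of "Suc n"] y c by simp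
  then have "(m, x, t) \<in> cells_of low_cells" using c by (simp add: low_cells_iff)
  moreover have "m < n --> y \<in> skeleton n" using skeleton_rep[OF pt, of n] c(4) by simp
  ultimately show ?thesis using c(1) by blast
 qed
 show "push (0, y) = y" if y: "y \<in> topspace ?Y" for y
 proof -
  obtain m x t where "y = pt (m, x, t)" "(m, x, t) \<in> cells_of low_cells" using cases[OF y] by blast
  then show ?thesis by (simp add: on_low_cell(2) stretch_0[OF I_n])
 qed
 have hS: "push (s, y) = y" if "y \<in> skeleton n" for s y
 proof -
  have "y \<in> topspace real_top" using that skeleton_subset by blast
  then obtain m x t where c: "y = pt (m, x, t)" "rep y = (m, x, t)" by (rule realization_cases) blast
  then have "m \<noteq> n" using skeleton_rep[of y n] that \<open>y \<in> topspace real_top\<close> by auto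
  then show ?thesis using c by (simp add: push_def stretch_0[OF I_n])
 qed
 show "push (s, y) \<in> skeleton n" if "s \<in> {0..1}" "y \<in> skeleton n" for s y using hS that by simp
 show "height (push (s, y)) < ?c" if s: "s \<in> {0..1}" and y: "y \<in> topspace ?Y" and h: "height y < ?c" for s y
 proof -
  obtain m x t where c: "y = pt (m, x, t)" "(m, x, t) \<in> cells_of low_cells" "m < n --> y \<in> skeleton n"
   using cases[OF y] by blast
  show ?thesis
  proof (cases "m < n")
   case False
   then have mn: "m = n" and t: "t \<in> standard_simplex n" using c(2) by (auto simp: low_cells_iff)
   have "lo {..n} t < 1 / (2 * real (card {..n}))" using h c on_low_cell(1)[OF c(2)] unfolding cI by simp
   from lo_stretch_less[OF I_n s t this] show ?thesis
    using on_low_cell(2)[OF c(2)] on_low_cell(1)[OF stretch_low_cell[OF c(2) s]] c mn unfolding cI by simp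
  qed (use hS c h in simp)
 qed
 show "push (1, y) \<in> skeleton n" if y: "y \<in> topspace ?Y" and h: "height y < ?c" for y
 proof -
  obtain m x t where c: "y = pt (m, x, t)" "(m, x, t) \<in> cells_of low_cells" "m < n --> y \<in> skeleton n"
   using cases[OF y] by blast
  show ?thesis
  proof (cases "m < n")
   case False
   then have mn: "m = n" and t: "t \<in> standard_simplex n" using c(2) by (auto simp: low_cells_iff)
   have "lo {..n} t < 1 / (2 * real (card {..n}))" using h c on_low_cell(1)[OF c(2)] unfolding cI by simp
   from lo_stretch_1[OF I_n t this]
   have "height (push (1, y)) = 0"
    using on_low_cell(2)[OF c(2), of 1] on_low_cell(1)[OF stretch_low_cell[OF c(2), of 1]] c mn by simp
   moreover have "push (1, y) \<in> skeleton (Suc n)"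
    using on_low_cell(2)[OF c(2), of 1] stretch_low_cell[OF c(2), of 1] c unfolding skeleton_low by auto
   ultimately show ?thesis unfolding skeleton_height topspace_skel by simp
  qed (use hS c in simp)
 qed
qed

end

end

section \<open>Cycles of simplices over a discrete set\<close>

context simplicial_set
begin

definition cell_map :: "nat => 'a => (nat => real) => (nat \<times> 'a \<times> (nat => real)) set" where
 "cell_map n x = restrict (%t. pt (n, x, t)) (standard_simplex n)"

lemma cell_map_realization:
 assumes "x \<in> simplices K n"
 shows "singular_simplex n real_top (cell_map n x)"
proof -
 have "continuous_map (simplex_top n) real_top (pt \<circ> (%t. (n, x, t)))"
  by (rule continuous_map_compose[OF continuous_map_cell[of x "simplices K" n, OF assms] quotient_imp_continuous_map[OF realization_quotient]])
 then have "continuous_map (simplex_top n) real_top (cell_map n x)"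
  by (rule continuous_map_eq) (simp add: cell_map_def)
 then show ?thesis by (simp add: singular_simplex_def cell_map_def)
qed

lemma cell_map_skeleton:
 assumes x: "x \<in> simplices K n"
 shows "singular_simplex n (skel_top (Suc n)) (cell_map n x)"
 using cell_map_realization[OF x] x
 by (auto simp: singular_simplex_subtopology cell_map_def skeleton_def cell_pts_def)

lemma cell_map_degenerate:
 assumes x: "x \<in> simplices K n" "x \<in> degenerates K n"
 shows "singular_simplex n (skel_top n) (cell_map n x)"
proof -
 have "pt (n, x, t) \<in> skeleton n" if t: "t \<in> standard_simplex n" for t
 proof -
  have c: "(n, x, t) \<in> cell_pts" using x t by (simp add: cell_pts_def)
  have "\<not> irred (n, x, t)" using irred_cell_iff[OF x(1) t] x(2) by (simp add: nondeg_def)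
  then show ?thesis using nf_fst_less[OF c] skeleton_iff[OF c] by simp
 qed
 then show ?thesis using cell_map_realization[OF x(1)]
  by (auto simp: singular_simplex_subtopology cell_map_def)
qed

lemma singular_face_cell_map:
 assumes "x \<in> simplices K (Suc n)" "i \<le> Suc n"
 shows "singular_face (Suc n) i (cell_map (Suc n) x) = cell_map n (face K n i x)"
proof
 fix t
 show "singular_face (Suc n) i (cell_map (Suc n) x) t = cell_map n (face K n i x) t"
  using simplical_face_closed[of t n i] pt_red[OF red_face[OF assms(1) _ assms(2)], of t] assms(2)
  by (simp add: singular_face_def cell_map_def)
qed

lemma boundary_cell_map:
 assumes "c \<in> frees (simplices K (Suc n))"
 shows "chain_boundary (Suc n) (flin (cell_map (Suc n)) c) = flin (cell_map n) (sbd K n c)"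
proof (rule additive_map_eqI[OF assms, where f = "%c. chain_boundary (Suc n) (flin (cell_map (Suc n)) c)"
   and g = "%c. flin (cell_map n) (sbd K n c)"])
 show "additive_map (%c. chain_boundary (Suc n) (flin (cell_map (Suc n)) c))"
  by (rule additive_map_comp[OF chain_boundary_additive additive_map_frag_extend])
 show "additive_map (%c. flin (cell_map n) (sbd K n c))"
  by (rule additive_map_comp[OF additive_map_frag_extend sbd_additive])
 fix x assume "x \<in> simplices K (Suc n)"
 then have "(\<Sum>i\<le>Suc n. frag_cmul ((-1) ^ i) (frag_of (singular_face (Suc n) i (cell_map (Suc n) x))))
   = (\<Sum>i\<le>Suc n. frag_cmul ((-1) ^ i) (frag_of (cell_map n (face K n i x))))"
  by (intro sum.cong) (simp_all add: singular_face_cell_map)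
 then show "chain_boundary (Suc n) (flin (cell_map (Suc n)) (frag_of x)) = flin (cell_map n) (sbd K n (frag_of x))"
  by (simp add: chain_boundary_of sbd_def frag_extend_sum frag_extend_cmul o_def del: sum.atMost_Suc)
qed

lemma skel_skel: "m \<le> n ==> subtopology (skel_top n) (skeleton m) = skel_top m"
 using skeleton_mono[of m n] by (simp add: subtopology_subtopology Int_absorb1)

lemma skel_chain_mono: "m \<le> n ==> singular_chain p (skel_top m) c ==> singular_chain p (skel_top n) c"
 using skeleton_mono[of m n] singular_chain_mono by blast

lemma lower_chain:
 assumes w: "singular_chain (Suc k) (skel_top (Suc N)) w" and bd: "singular_chain k (skel_top N) (chain_boundary (Suc k) w)"
  and N: "Suc k < N"
 shows "\<exists>w'. singular_chain (Suc k) (skel_top N) w' & chain_boundary (Suc k) w' = chain_boundary (Suc k) w"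
proof -
 interpret A: cell_attachment "skel_top (Suc N)" "skeleton N" "nondeg N" N "%(j, t). pt (N, j, t)" "height N" "push N"
  by (rule skeleton_attachment)
 have "singular_relcycle (Suc k) (skel_top (Suc N)) (skeleton N) w"
  using w bd skel_skel[of N "Suc N"] by (simp add: singular_relcycle)
 from A.attached_below[OF N this] obtain u w' where u: "singular_chain (Suc (Suc k)) (skel_top (Suc N)) u"
  and w': "singular_chain (Suc k) (skel_top N) w'" and e: "chain_boundary (Suc (Suc k)) u + w' = w"
  unfolding singular_relboundary using skel_skel[of N "Suc N"] by auto
 have "chain_boundary (Suc k) w = chain_boundary (Suc k) w'"
  using chain_boundary_boundary_alt[OF u] by (simp flip: e add: chain_boundary_add)
 then show ?thesis using w' by metis
qed

text \<open>Attaching cells of higher dimension creates no relative homology in low degrees, so a bounding chain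
 can be moved down to the skeleton one dimension above its boundary.\<close>

lemma lower_chains:
 assumes "singular_chain (Suc k) (skel_top N) w" "Suc (Suc k) \<le> N" "singular_chain k (skel_top (Suc k)) (chain_boundary (Suc k) w)"
 shows "\<exists>w'. singular_chain (Suc k) (skel_top (Suc (Suc k))) w' & chain_boundary (Suc k) w' = chain_boundary (Suc k) w"
 using assms(2,1,3)
proof (induction N arbitrary: w rule: dec_induct)
 case base
 then show ?case by blast
next
 case (step N)
 have "singular_chain k (skel_top N) (chain_boundary (Suc k) w)"
  using skel_chain_mono[OF _ step.prems(2), of N] step.hyps by simp
 then obtain w' where w': "singular_chain (Suc k) (skel_top N) w'" "chain_boundary (Suc k) w' = chain_boundary (Suc k) w"
  using lower_chain[OF step.prems(1)] step.hyps by auto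
 then show ?case using step.IH[of w'] step.prems(2) by simp
qed

lemma cell_map_chain:
 assumes "c \<in> frees (simplices K n)"
 shows "singular_chain n (skel_top (Suc n)) (flin (cell_map n) c)"
 unfolding chain_frees by (rule flin_closed[OF assms]) (use cell_map_skeleton in auto)

text \<open>A chain of simplices that bounds in the realization bounds in the simplicial set up to degenerate
 chains: push the bounding chain into the skeleton, where modulo the lower skeleton it is homologous
 to a combination of cells. The boundary of this combination and the given chain then differ by a
 boundary in the pair formed by two lower skeleta, in which the nondegenerate cells are independent.\<close>

theorem simplices_fill:
 assumes e: "e \<in> frees (simplices K k)"
  and w: "singular_chain (Suc k) real_top w" "chain_boundary (Suc k) w = flin (cell_map k) e"
 shows "\<exists>v\<in>frees (simplices K (Suc k)). e - sbd K k v \<in> frees (degenerates K k)"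
proof -
 obtain N where "singular_chain (Suc k) (skel_top N) w" using singular_chain_in_skeleton[OF w(1)] by blast
 then have "singular_chain (Suc k) (skel_top (max N (Suc (Suc k)))) w"
  by (rule skel_chain_mono[rotated]) simp
 from lower_chains[OF this] obtain w1 where w1: "singular_chain (Suc k) (skel_top (Suc (Suc k))) w1"
  "chain_boundary (Suc k) w1 = flin (cell_map k) e"
  using w(2) cell_map_chain[OF e] by auto
 interpret A: cell_attachment "skel_top (Suc (Suc k))" "skeleton (Suc k)" "nondeg (Suc k)" "Suc k"
   "%(j, t). pt (Suc k, j, t)" "height (Suc k)" "push (Suc k)"
  by (rule skeleton_attachment)
 interpret B: cell_attachment "skel_top (Suc k)" "skeleton k" "nondeg k" k "%(j, t). pt (k, j, t)" "height k" "push k"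
  by (rule skeleton_attachment)
 have at: "A.attached = cell_map (Suc k)" "B.attached = cell_map k" by (auto simp: cell_map_def)
 have fl: "flin A.attached c = flin (cell_map (Suc k)) c" "flin B.attached c = flin (cell_map k) c" for c
  by (rule arg_cong[OF at(1), where f = "%h. flin h c"], rule arg_cong[OF at(2), where f = "%h. flin h c"])
 have "singular_relcycle (Suc k) (skel_top (Suc (Suc k))) (skeleton (Suc k)) w1"
  using w1 skel_skel[of "Suc k" "Suc (Suc k)"] cell_map_chain[OF e] by (simp add: singular_relcycle)
 from A.attached_generate[OF this]
 have "\<exists>\<kappa>\<in>frees (nondeg (Suc k)). homologous_rel (Suc k) (skel_top (Suc (Suc k))) (skeleton (Suc k)) w1 (flin (cell_map (Suc k)) \<kappa>)"
  unfolding fl(1) .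
 then obtain \<kappa> where \<kappa>: "\<kappa> \<in> frees (nondeg (Suc k))"
  "singular_relboundary (Suc k) (skel_top (Suc (Suc k))) (skeleton (Suc k)) (w1 - flin (cell_map (Suc k)) \<kappa>)"
  unfolding homologous_rel_def by blast
 obtain u w2 where u: "singular_chain (Suc (Suc k)) (skel_top (Suc (Suc k))) u"
  and w2': "singular_chain (Suc k) (subtopology (skel_top (Suc (Suc k))) (skeleton (Suc k))) w2"
  and uw: "chain_boundary (Suc (Suc k)) u + w2 = w1 - flin (cell_map (Suc k)) \<kappa>"
  using \<kappa>(2) unfolding singular_relboundary by blast
 have w2: "singular_chain (Suc k) (skel_top (Suc k)) w2"
  using w2' skel_skel[of "Suc k" "Suc (Suc k)"] by simp
 have \<kappa>': "\<kappa> \<in> frees (simplices K (Suc k))" using frees_mono[OF \<kappa>(1)] by (auto simp: nondeg_def)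
 let ?r = "e - sbd K k \<kappa>"
 have "chain_boundary (Suc k) w2 = chain_boundary (Suc k) (w1 - flin (cell_map (Suc k)) \<kappa>)"
  using chain_boundary_boundary_alt[OF u] by (simp flip: uw add: chain_boundary_add)
 then have bw2: "chain_boundary (Suc k) w2 = flin (cell_map k) ?r"
  by (simp add: chain_boundary_diff w1(2) boundary_cell_map[OF \<kappa>'] frag_extend_diff)
 have "?r \<in> frees (simplices K k)" using e sbd_closed[OF \<kappa>'] by blast
 then have "?r \<in> frees (nondeg k \<union> (simplices K k \<inter> degenerates K k))"
  by (rule frees_mono) (auto simp: nondeg_def)
 then obtain a b where a: "a \<in> frees (nondeg k)" and b: "b \<in> frees (simplices K k \<inter> degenerates K k)" and ab: "?r = a + b"
  by (rule frees_split)
 have "singular_chain k (skel_top k) (flin (cell_map k) b)"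
  unfolding chain_frees by (rule flin_closed[OF b]) (use cell_map_degenerate in auto)
 then have "singular_chain k (subtopology (skel_top (Suc k)) (skeleton k)) (- flin (cell_map k) b)"
  using skel_skel[of k "Suc k"] by (simp add: singular_chain_minus)
 moreover have "chain_boundary (Suc k) w2 + - flin (cell_map k) b = flin B.attached a"
  unfolding bw2 ab fl(2) by (simp add: frag_extend_add)
 ultimately have "singular_relboundary k (skel_top (Suc k)) (skeleton k) (flin B.attached a)"
  unfolding singular_relboundary using w2 by blast
 then have "a = 0" by (rule B.attached_independent[OF a])
 then have "?r \<in> frees (degenerates K k)" using ab frees_mono[OF b] by simp
 then show ?thesis using \<kappa>' by blast
qed

end

lemma connected_to_discrete:
 assumes "continuous_map Z (discrete_topology U) \<phi>" "connected_space Z" "a \<in> topspace Z" "b \<in> topspace Z"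
 shows "\<phi> a = \<phi> b"
proof -
 have "connectedin (discrete_topology U) (\<phi> ` topspace Z)"
  by (rule connectedin_continuous_map_image[OF assms(1)]) (simp add: assms(2) connectedin_topspace)
 then obtain j where "\<phi> ` topspace Z \<subseteq> {j}" by (auto simp: connectedin_discrete_topology)
 then show ?thesis using assms(3,4) by auto
qed

locale sset_map = K: simplicial_set K + L: simplicial_set L
 for K :: "('a, 'm) sset_scheme" and L :: "('b, 'n) sset_scheme" +
 fixes f :: "nat => 'a => 'b"
 assumes map: "simplicial_map K L f"
begin

definition on_cells :: "nat \<times> 'a \<times> (nat => real) => nat \<times> 'b \<times> (nat => real)" where
 "on_cells = (%(n, x, t). (n, f n x, t))"

lemma red_map: "K.red a b ==> L.red (on_cells a) (on_cells b)"
proof (induction rule: K.red.induct)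
 case (red_face x n t i)
 then show ?case using L.red_face[of "f (Suc n) x" n t i] map by (simp add: on_cells_def simplicial_map_def)
next
 case (red_degen x n t i)
 then show ?case using L.red_degen[of "f n x" n t i] map by (simp add: on_cells_def simplicial_map_def)
qed

lemma pt_map: "K.pt a = K.pt b ==> L.pt (on_cells a) = L.pt (on_cells b)"
proof -
 have 1: "L.pt (on_cells a) = L.pt (on_cells (K.nf a))" for a
  using K.nf(1)[of a] by (induction rule: rtranclp_induct) (auto dest: red_map L.pt_red)
 assume "K.pt a = K.pt b"
 then show ?thesis using 1[of a] 1[of b] by (simp add: K.pt_eq_iff)
qed

lemma realization_map_pt: "realization_map L f (K.pt a) = L.pt (on_cells a)"
proof -
 have "realization_map L f (K.pt a) = (\<Union>c\<in>K.pt a. L.pt (on_cells c))"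
  by (auto simp: realization_map_def L.pt_def on_cells_def)
 also have "\<dots> = (\<Union>c\<in>K.pt a. L.pt (on_cells a))"
 proof (rule SUP_cong)
  fix c assume "c \<in> K.pt a"
  then have "(a, c) \<in> gluing_equiv K" by (simp add: K.pt_def)
  then have "K.pt c = K.pt a" using K.gluing_equiv_nf K.pt_eq_iff by metis
  then show "L.pt (on_cells c) = L.pt (on_cells a)" by (rule pt_map)
 qed simp
 also have "\<dots> = L.pt (on_cells a)"
 proof -
  have "a \<in> K.pt a" using reflD[OF K.gluing_equiv_refl, of a] by (simp add: K.pt_def)
  then show ?thesis by blast
 qed
 finally show ?thesis .
qed

end

lemma constant_squandle_simps:
 "simplices (constant_squandle X) n = carrier X" "face (constant_squandle X) n i x = x"
 "degen (constant_squandle X) n i x = x"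
 by (simp_all add: constant_squandle_def)

lemma simplicial_set_constant: "simplicial_set (constant_squandle X)"
 by unfold_locales (auto simp: constant_squandle_def)

context
 fixes X :: "('x, 'm) magma_scheme"
begin

interpretation C: simplicial_set "constant_squandle X" by (rule simplicial_set_constant)

abbreviation "vertex0 \<equiv> (%j::nat. if j = 0 then 1 else 0 :: real)"

definition const_base :: "(nat \<times> 'x \<times> (nat => real)) set => 'x" where
 "const_base p = fst (snd (C.rep p))"

lemma const_base_pt: "const_base (C.pt c) = fst (snd c)"
proof -
 have red: "fst (snd a) = fst (snd b)" if "C.red a b" for a b
  using that by (induction rule: C.red.induct) (auto simp: constant_squandle_simps)
 have "fst (snd (C.nf c)) = fst (snd c)"
  using C.nf(1)[of c] by (induction rule: rtranclp_induct) (auto dest: red)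
 then show ?thesis by (simp add: const_base_def C.rep_pt)
qed

lemma const_point:
 assumes "p \<in> topspace (realization (constant_squandle X))"
 shows "p = C.pt (0, const_base p, vertex0)" and "const_base p \<in> carrier X"
proof -
 obtain n x t where c: "p = C.pt (n, x, t)" "x \<in> C.nondeg n" "t \<in> standard_simplex n"
  by (rule C.realization_cases[OF assms]) blast
 have "n = 0" using c(2) by (cases n) (auto simp: C.nondeg_def degenerates_def constant_squandle_simps)
 then show "p = C.pt (0, const_base p, vertex0)" "const_base p \<in> carrier X"
  using c by (auto simp: const_base_pt standard_simplex_0 C.nondeg_def constant_squandle_simps)
qed

lemma const_point_closed: "x \<in> carrier X ==> C.pt (0, x, vertex0) \<in> topspace (realization (constant_squandle X))"
 by (auto simp: C.topspace_realization C.cell_pts_def constant_squandle_simps)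

lemma continuous_const_base: "continuous_map (realization (constant_squandle X)) (discrete_topology (carrier X)) const_base"
proof (rule continuous_compose_quotient_map[OF C.realization_quotient])
 show "continuous_map (cells_top (simplices (constant_squandle X))) (discrete_topology (carrier X)) (const_base \<circ> C.pt)"
  by (rule continuous_map_from_cells) (simp add: const_base_pt constant_squandle_simps)
qed

text \<open>The realization of a constant simplicial set is discrete. A homotopy inverse therefore deforms the
 identity of the realization to a map with discrete image, so cycles of simplices bound singular
 chains there, hence also chains of simplices up to degenerate ones. Surjectivity onto the
 base follows from the homotopy on the other side.\<close>

theorem weak_equivalence_acyclic:
 assumes K: "simplicial_set K" and map: "simplicial_map K (constant_squandle X) \<epsilon>"
  and we: "weak_equivalence K (constant_squandle X) \<epsilon>"
 shows "acyclic_over K (carrier X) (\<epsilon> 0)"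
proof -
 interpret sset_map K "constant_squandle X" \<epsilon>
  by (rule sset_map.intro[OF K simplicial_set_constant]) (use map in \<open>simp add: sset_map_axioms_def\<close>)
 let ?R = "realization K" and ?C = "realization (constant_squandle X)" and ?f = "realization_map (constant_squandle X) \<epsilon>"
 have \<epsilon>: "\<epsilon> n x \<in> carrier X" if "x \<in> simplices K n" for n x
  using map that by (simp add: simplicial_map_def constant_squandle_simps)
 have \<epsilon>_face: "\<epsilon> n (face K n i x) = \<epsilon> (Suc n) x" if "x \<in> simplices K (Suc n)" "i \<le> Suc n" for n i x
  using map that by (simp add: simplicial_map_def constant_squandle_simps)
 obtain g where f: "continuous_map ?R ?C ?f" and g: "continuous_map ?C ?R g"
  and gf: "homotopic_with (%h. True) ?R ?R (g \<circ> ?f) id" and fg: "homotopic_with (%h. True) ?C ?C (?f \<circ> g) id"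
  using we by (auto simp: weak_equivalence_def homotopy_equivalence_map_def)
 let ?y = "%x. C.pt (0, x, vertex0)"
 have const: "\<exists>y\<in>topspace ?R. simplex_map p (g \<circ> ?f) \<sigma> = const_simplex p y" if \<sigma>: "singular_simplex p ?R \<sigma>" for p \<sigma>
 proof -
  have \<sigma>c: "continuous_map (simplex_top p) ?R \<sigma>" using \<sigma> by (simp add: singular_simplex_def)
  have c: "continuous_map (simplex_top p) ?C (?f \<circ> \<sigma>)" by (rule continuous_map_compose[OF \<sigma>c f])
  have conn: "connected_space (simplex_top p)"
   using connectedin_standard_simplex[of p] by (simp add: connectedin_def subtopology_topspace)
  have v: "vertex0 \<in> standard_simplex p" by simp
  have im: "?f (\<sigma> t) \<in> topspace ?C" if "t \<in> standard_simplex p" for t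
   using continuous_map_image_subset_topspace[OF c] that by auto
  have eq: "?f (\<sigma> t) = ?f (\<sigma> vertex0)" if t: "t \<in> standard_simplex p" for t
  proof -
   have cb: "const_base (?f (\<sigma> t)) = const_base (?f (\<sigma> vertex0))"
    using connected_to_discrete[OF continuous_map_compose[OF c continuous_const_base] conn, of t vertex0] t v by simp
   show ?thesis
    by (rule HOL.trans[OF const_point(1)[OF im[OF t]] HOL.trans[OF _ const_point(1)[OF im[OF v], symmetric]]])
     (simp only: cb)
  qed
  have "simplex_map p (g \<circ> ?f) \<sigma> = const_simplex p (g (?f (\<sigma> vertex0)))"
   unfolding simplex_map_def const_simplex_def
  proof (rule restrict_ext)
   fix t assume t: "t \<in> standard_simplex p"
   show "(g \<circ> ?f \<circ> \<sigma>) t = g (?f (\<sigma> vertex0))" unfolding o_apply eq[OF t] ..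
  qed
  moreover have "g (?f (\<sigma> vertex0)) \<in> topspace ?R"
   using continuous_map_image_subset_topspace[OF g] im[OF v] by blast
  ultimately show ?thesis by blast
 qed
 have hom: "homotopic_with (%h. True) ?R ?R id (g \<circ> ?f)" using gf by (rule homotopic_with_symD)
 show ?thesis
 proof (intro acyclic_over.intro[OF K] acyclic_over_axioms.intro)
  show "\<epsilon> 0 ` simplices K 0 = carrier X"
  proof
   show "carrier X \<subseteq> \<epsilon> 0 ` simplices K 0"
   proof
    fix x assume x: "x \<in> carrier X"
    have xc: "?y x \<in> topspace ?C" by (rule const_point_closed[OF x])
    then have gx: "g (?y x) \<in> topspace ?R" using continuous_map_image_subset_topspace[OF g] by blast
    obtain n z t where z: "g (?y x) = K.pt (n, z, t)" "z \<in> K.nondeg n"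
     by (rule K.realization_cases[OF gx]) blast
    obtain H where H: "continuous_map (prod_topology (top_of_set {0..1::real}) ?C) ?C H"
     "\<And>c. H (0, c) = (?f \<circ> g) c" "\<And>c. H (1, c) = id c"
     using fg unfolding homotopic_with_def by (elim exE conjE) metis
    have "continuous_map (top_of_set {0..1}) (prod_topology (top_of_set {0..1::real}) ?C) (%s. (s, ?y x))"
     using xc by (intro continuous_map_pairedI) auto
    from continuous_map_compose[OF continuous_map_compose[OF this H(1)] continuous_const_base]
    have c: "continuous_map (top_of_set {0..1::real}) (discrete_topology (carrier X)) (const_base \<circ> (H \<circ> (%s. (s, ?y x))))" .
    have "connected_space (top_of_set {0..1::real})" by (simp add: connected_space_subtopology) (auto simp: is_interval_def)
    from connected_to_discrete[OF c this, of 0 1]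
    have "const_base (?f (g (?y x))) = x" by (simp add: H(2,3) const_base_pt)
    then have zx: "\<epsilon> n z = x" by (simp add: z(1) realization_map_pt on_cells_def const_base_pt)
    have "z \<in> simplices K n" using z(2) by (simp add: K.nondeg_def)
    then have "\<exists>z'\<in>simplices K 0. \<epsilon> 0 z' = \<epsilon> n z"
    proof (induction n arbitrary: z)
     case (Suc n)
     then show ?case using Suc.IH[of "face K n 0 z"] K.face_closed[of z n 0] \<epsilon>_face[of z n 0] by auto
    qed blast
    then obtain z' where "z' \<in> simplices K 0" "x = \<epsilon> 0 z'" using zx by metis
    then show "x \<in> \<epsilon> 0 ` simplices K 0" by blast
   qed
  qed (use \<epsilon> in auto)
  show "\<epsilon> 0 (face K 0 0 x) = \<epsilon> 0 (face K 0 (Suc 0) x)" if "x \<in> simplices K (Suc 0)" for x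
   using \<epsilon>_face[OF that, of 0] \<epsilon>_face[OF that, of "Suc 0"] by simp
  show "\<exists>v\<in>frees (simplices K (Suc 0)). sbd K 0 v = e" if e: "e \<in> frees (simplices K 0)" "flin (\<epsilon> 0) e = 0" for e
  proof -
   let ?z = "flin (K.cell_map 0) e"
   have "singular_chain 0 ?R ?z"
    unfolding chain_frees by (rule flin_closed[OF e(1)]) (use K.cell_map_realization in auto)
   then have cyc: "singular_relcycle 0 ?R {} ?z" by (simp add: singular_cycle chain_boundary_def)
   have "chain_map 0 (g \<circ> ?f) ?z = flin (%x. const_simplex 0 (g (?y x))) (flin (\<epsilon> 0) e)"
   proof (rule additive_map_eqI[OF e(1), where f = "%e. chain_map 0 (g \<circ> ?f) (flin (K.cell_map 0) e)"
      and g = "%e. flin (%x. const_simplex 0 (g (?y x))) (flin (\<epsilon> 0) e)"])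
    show "additive_map (%e. chain_map 0 (g \<circ> ?f) (flin (K.cell_map 0) e))"
     by (rule additive_map_comp[OF chain_map_additive additive_map_frag_extend])
    show "additive_map (%e. flin (%x. const_simplex 0 (g (?y x))) (flin (\<epsilon> 0) e))" by (rule additive_ff)
    fix x assume "x \<in> simplices K 0"
    have "simplex_map 0 (g \<circ> ?f) (K.cell_map 0 x) = const_simplex 0 (g (?y (\<epsilon> 0 x)))"
     unfolding simplex_map_def const_simplex_def
    proof (rule restrict_ext)
     fix t :: "nat => real" assume t: "t \<in> standard_simplex 0"
     then have tv: "t = vertex0" by (simp add: standard_simplex_0)
     show "(g \<circ> ?f \<circ> K.cell_map 0 x) t = g (?y (\<epsilon> 0 x))"
      using t unfolding tv by (simp add: K.cell_map_def realization_map_pt on_cells_def)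
    qed
    then show "chain_map 0 (g \<circ> ?f) (flin (K.cell_map 0) (frag_of x)) = flin (%x. const_simplex 0 (g (?y x))) (flin (\<epsilon> 0) (frag_of x))"
     by simp
   qed
   then have "chain_map 0 (g \<circ> ?f) ?z = 0" by (simp add: e(2))
   from acyclic_if_constant(1)[OF hom const cyc HOL.refl this]
   obtain w where "singular_chain (Suc 0) ?R w" "chain_boundary (Suc 0) w = ?z" by (auto simp: singular_boundary)
   from K.simplices_fill[OF e(1) this] obtain v where v: "v \<in> frees (simplices K (Suc 0))" "e - sbd K 0 v \<in> frees (degenerates K 0)"
    by blast
   then have "e - sbd K 0 v = 0" by (intro frees_empty) (simp add: degenerates_def)
   then show ?thesis using v(1) by (intro bexI[of _ v]) simp_all
  qed
  show "\<exists>v\<in>frees (simplices K (Suc (Suc n))). e - sbd K (Suc n) v \<in> frees (degenerates K (Suc n))"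
   if e: "e \<in> frees (simplices K (Suc n))" "\<And>i. i \<le> Suc n ==> flin (face K n i) e = 0" for n e
  proof -
   let ?z = "flin (K.cell_map (Suc n)) e"
   have "singular_chain (Suc n) ?R ?z"
    unfolding chain_frees by (rule flin_closed[OF e(1)]) (use K.cell_map_realization in auto)
   moreover have "sbd K n e = 0" unfolding sbd_def by (rule sum.neutral) (simp add: e(2))
   then have "chain_boundary (Suc n) ?z = 0" by (simp add: K.boundary_cell_map[OF e(1)])
   ultimately have cyc: "singular_relcycle (Suc n) ?R {} ?z" by (simp add: singular_cycle)
   from acyclic_if_constant(2)[OF hom const cyc]
   obtain w where "singular_chain (Suc (Suc n)) ?R w" "chain_boundary (Suc (Suc n)) w = ?z" by (auto simp: singular_boundary)
   from K.simplices_fill[OF e(1) this] show ?thesis .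
  qed
 qed
qed

end

section \<open>Comparing the two complexes\<close>

context trivial_fibration_span
begin

lemma across_additive: "additive_map (across n)"
 unfolding across_def by (rule additive_map_comp[OF g.f_additive f.sect_additive])

lemma across_closed: "c \<in> frees (P n) ==> across n c \<in> frees (Q n)"
 unfolding across_def by (intro g.f_closed f.sect_closed)

lemma across_commutes: "c \<in> frees (P (Suc n)) ==> G (across (Suc n) c) = across n (E c)"
 unfolding across_def using g.f_commutes[OF f.sect_closed] f.D_sect by metis

lemma across_homotopy_additive: "additive_map (across_homotopy n)"
 unfolding across_homotopy_def
 by (rule additive_map_comp[OF additive_map_comp[OF f.f_additive g.homotopy_additive] f.sect_additive])

lemma across_homotopy_closed: "c \<in> frees (P n) ==> across_homotopy n c \<in> frees (P (Suc n))"
 unfolding across_homotopy_def by (intro f.f_closed g.homotopy_closed f.sect_closed)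

text \<open>Running along the span forwards and backwards is homotopic to the identity. On one of the two
 fibrations the composite of the section with the projection is the identity, and on the other one
 it is homotopic to the identity; the homotopy is transported to the end of the span.\<close>

lemma across_back_0:
 assumes c: "c \<in> frees (P 0)"
 shows "f (g.sect 0 (across 0 c)) = c + E (across_homotopy 0 c)"
proof -
 let ?z = "f.sect 0 c"
 have z: "?z \<in> frees (S 0)" by (rule f.sect_closed[OF c])
 have "g.sect 0 (g ?z) = ?z + D (g.homotopy 0 ?z)" using g.homotopy_zero(3)[OF z] by simp
 then show ?thesis
  using f.f_sect[OF c] f.f_commutes[OF g.homotopy_closed[OF z]]
  by (simp add: across_def across_homotopy_def additive_map_add[OF f.f_additive])
qed

lemma across_back_Suc:
 assumes c: "c \<in> frees (P (Suc n))"
 shows "f (g.sect (Suc n) (across (Suc n) c)) = c + E (across_homotopy (Suc n) c) + across_homotopy n (E c)"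
proof -
 let ?z = "f.sect (Suc n) c"
 have z: "?z \<in> frees (S (Suc n))" by (rule f.sect_closed[OF c])
 have "g.sect (Suc n) (g ?z) = ?z + D (g.homotopy (Suc n) ?z) + g.homotopy n (D ?z)"
  using g.D_homotopy[OF z] by simp
 then show ?thesis
  using f.f_sect[OF c] f.f_commutes[OF g.homotopy_closed[OF z]] f.D_sect[OF c]
  by (simp add: across_def across_homotopy_def additive_map_add[OF f.f_additive])
qed

end

text \<open>The roles of rows and columns are exchanged so that the comparison with the total complex applies to
 both augmentations.\<close>

lemma double_complex_swap:
 assumes "double_complex \<beta> dh dv"
 shows "double_complex (%p q. \<beta> q p) dv dh"
proof -
 interpret double_complex \<beta> dh dv by fact
 show ?thesis
  by unfold_locales
   (use disjoint dh_additive dv_additive dh_closed dh_bottom dv_closed dv_bottom dh_dh dv_dv dh_dv in \<open>auto\<close>)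
qed

lemma tot_swap:
 assumes "double_complex \<beta> dh dv"
 shows "double_complex.tot (%p q. \<beta> q p) = double_complex.tot \<beta>"
  and "double_complex.D dv dh = double_complex.D dh dv"
proof -
 interpret A: double_complex \<beta> dh dv by fact
 interpret B: double_complex "%p q. \<beta> q p" dv dh by (rule double_complex_swap) fact
 show "B.tot = A.tot"
 proof
  fix n
  show "B.tot n = A.tot n"
  proof -
   have "(\<Union>p\<in>{0..n}. \<beta> (n - p) p) = (\<Union>p\<in>{0..n}. \<beta> p (n - p))" (is "?L = ?R")
   proof (intro equalityI subsetI)
    fix b assume "b \<in> ?L"
    then obtain p where "p \<le> n" "b \<in> \<beta> (n - p) p" by auto
    then show "b \<in> ?R" by (intro UN_I[of "n - p"]) auto
   next
    fix b assume "b \<in> ?R"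
    then obtain p where "p \<le> n" "b \<in> \<beta> p (n - p)" by auto
    then show "b \<in> ?L" by (intro UN_I[of "n - p"]) auto
   qed
   then show ?thesis by (simp add: A.tot_def B.tot_def A.strip_def B.strip_def)
  qed
 qed
 show "B.D = A.D" by (auto simp: A.D_def B.D_def add.commute)
qed

lemma alternating_double_sum:
 fixes a :: "nat => nat => 'b \<Rightarrow>\<^sub>0 int"
 assumes "\<And>i j. i < j ==> j \<le> Suc n ==> a i j = a (j - 1) i"
 shows "(\<Sum>i\<le>n. frag_cmul ((-1) ^ i) (\<Sum>j\<le>Suc n. frag_cmul ((-1) ^ j) (a i j))) = 0"
proof -
 let ?f = "%(i, j). frag_cmul ((-1) ^ (i + j)) (a i j)"
 let ?A = "{(i, j). i \<le> n & j \<le> Suc n & i < j}" and ?B = "{(i, j). i \<le> n & j \<le> Suc n & j \<le> i}"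
 have fin: "finite ?A" "finite ?B"
  by (rule finite_subset[of _ "{..n} \<times> {..Suc n}"], fastforce, simp)+
 have "(\<Sum>i\<le>n. frag_cmul ((-1) ^ i) (\<Sum>j\<le>Suc n. frag_cmul ((-1) ^ j) (a i j))) = (\<Sum>i\<le>n. \<Sum>j\<le>Suc n. ?f (i, j))"
  by (simp add: frag_cmul_sum power_add del: sum.atMost_Suc)
 also have "\<dots> = sum ?f ({..n} \<times> {..Suc n})" by (simp add: sum.cartesian_product del: sum.atMost_Suc)
 also have "{..n} \<times> {..Suc n} = ?A \<union> ?B"
 proof (rule Set.set_eqI)
  fix p :: "nat \<times> nat"
  show "p \<in> {..n} \<times> {..Suc n} \<longleftrightarrow> p \<in> ?A \<union> ?B"
   by (cases p) (simp only: mem_Sigma_iff atMost_iff Un_iff mem_Collect_eq prod.case, presburger)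
 qed
 also have "sum ?f (?A \<union> ?B) = sum ?f ?A + sum ?f ?B"
  by (rule sum.union_disjoint[OF fin]) fastforce
 also have "sum ?f ?A = (\<Sum>p\<in>?B. - ?f p)"
 proof (rule sum.reindex_bij_witness[where i = "%(i, j). (j, Suc i)" and j = "%(i, j). (j - 1, i)"])
  fix p assume "p \<in> ?A"
  then obtain i j where p: "p = (i, j)" "i < j" "j \<le> Suc n" by auto
  then show "- ?f ((%(i, j). (j - 1, i)) p) = ?f p"
   using assms[of i j] by (cases j) (auto simp: add.commute)
 qed force+
 finally show ?thesis by (simp add: sum_negf)
qed

locale quandle_resolution = simplicial_quandle F + acyclic_over F "carrier X" "\<epsilon> 0"
 for F :: "('f, 'n) squandle_scheme" and X :: "('x, 'm) magma_scheme" and \<epsilon> :: "nat => 'f => 'x" +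
 assumes base: "quandle X" and \<epsilon>_hom: "\<epsilon> 0 \<in> quandle_hom (level F 0) X"
  and rows: "row_exact (level F q)"
begin

lemma level_carrier [simp]: "carrier (level F q) = simplices F q"
 by (simp add: level_def)

lemma ntuples_nlists: "ntuples_of (level F q) n = nlists (simplices F q) n"
 by (auto simp: ntuples_of_def ntuples_def nlists_def lists_of_def)

lemma ntuples_nlists_X: "ntuples_of X n = nlists (carrier X) n"
 by (auto simp: ntuples_of_def ntuples_def nlists_def lists_of_def)

abbreviation "NT q n \<equiv> ntuples_of (level F q) n"

lemma face_map: "i \<le> Suc q ==> face F q i \<in> carrier (level F (Suc q)) \<rightarrow> carrier (level F q)"
 using face_closed by auto

lemma nsbd_closed: "c \<in> frees (NT (Suc q) n) ==> nsbd F q c \<in> frees (NT q n)"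
 unfolding nsbd_def by (intro frees_sum frees_cmul Nmap_closed[OF face_map]) auto

lemma nsbd_Nbd: "c \<in> frees (NT (Suc q) n) ==> Nbd (level F q) (nsbd F q c) = nsbd F q (Nbd (level F (Suc q)) c)"
 unfolding nsbd_def
 using Nbd_natural[OF quandle_level quandle_level face_hom frees_ntuples_of]
 by (simp add: frag_extend_sum frag_extend_cmul o_def del: sum.atMost_Suc)

lemma nsbd_nsbd:
 assumes c: "c \<in> frees (NT (Suc (Suc q)) n)"
 shows "nsbd F q (nsbd F (Suc q) c) = 0"
proof -
 have "Nmap (face F q i) (Nmap (face F (Suc q) j) c) = Nmap (face F q (j - 1)) (Nmap (face F (Suc q) i) c)"
  if "i < j" "j \<le> Suc (Suc q)" for i j
  unfolding Nmap_Nmap using face_face[of _ q i j] that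
  by (intro Nmap_cong[OF c]) (auto simp: ntuples_of_def ntuples_def)
 from alternating_double_sum[of "Suc q" "%i j. Nmap (face F q i) (Nmap (face F (Suc q) j) c)", OF this]
 show ?thesis unfolding nsbd_def
  by (simp add: frag_extend_sum frag_extend_cmul o_def del: sum.atMost_Suc)
qed

definition \<beta> :: "nat => nat => (nat \<times> 'f list) set" where
 "\<beta> p q = Pair q ` NT q (Suc p)"

definition dh :: "(nat \<times> 'f list \<Rightarrow>\<^sub>0 int) => (nat \<times> 'f list \<Rightarrow>\<^sub>0 int)" where
 "dh = frag_extend (%(q, xs). flin (Pair q) (nbd (level F q) xs))"

definition dv :: "(nat \<times> 'f list \<Rightarrow>\<^sub>0 int) => (nat \<times> 'f list \<Rightarrow>\<^sub>0 int)" where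
 "dv = frag_extend (%(q, xs). case q of 0 => 0
  | Suc m => frag_cmul ((-1) ^ Suc (length xs)) (flin (Pair m) (nsbd F m (frag_of xs))))"

lemma dh_additive: "additive_map dh" and dv_additive: "additive_map dv"
 by (simp_all add: dh_def dv_def)

lemma dh_Pair: "dh (flin (Pair q) c) = flin (Pair q) (Nbd (level F q) c)"
 by (rule additive_map_eqI[where S = UNIV and c = c and f = "%c. dh (flin (Pair q) c)" and g = "%c. flin (Pair q) (Nbd (level F q) c)"])
  (auto simp: frees_def dh_def additive_ff)

lemma dv_Pair_0: "dv (flin (Pair 0) c) = 0"
 by (rule additive_map_zeroI[where S = UNIV and c = c and f = "%c. dv (flin (Pair 0) c)"])
  (auto simp: frees_def dv_def additive_ff)

lemma dv_Pair_Suc: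
 assumes "c \<in> frees (NT (Suc m) n)"
 shows "dv (flin (Pair (Suc m)) c) = frag_cmul ((-1) ^ Suc n) (flin (Pair m) (nsbd F m c))"
proof (rule additive_map_eqI[OF assms, where f = "%c. dv (flin (Pair (Suc m)) c)"
   and g = "%c. frag_cmul ((-1) ^ Suc n) (flin (Pair m) (nsbd F m c))"])
 show "additive_map (%c. dv (flin (Pair (Suc m)) c))" by (simp add: dv_def additive_ff)
 show "additive_map (%c. frag_cmul ((-1) ^ Suc n) (flin (Pair m) (nsbd F m c)))"
  by (intro additive_map_cmul_map additive_map_comp[OF additive_map_frag_extend nsbd_additive])
qed (simp add: dv_def ntuples_of_def)

lemma \<beta>_frees:
 assumes "c \<in> frees (\<beta> p q)"
 obtains c' where "c' \<in> frees (NT q (Suc p))" "c = flin (Pair q) c'"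
proof
 show "flin snd c \<in> frees (NT q (Suc p))" by (rule flin_closed[OF assms]) (auto simp: \<beta>_def)
 show "c = flin (Pair q) (flin snd c)"
  unfolding flin_flin by (rule HOL.sym, rule flin_id[OF assms]) (auto simp: \<beta>_def)
qed

lemma flin_Pair_closed: "c \<in> frees (NT q (Suc p)) ==> flin (Pair q) c \<in> frees (\<beta> p q)"
 by (erule flin_closed) (auto simp: \<beta>_def)

lemma flin_Pair_zero: "flin (Pair q) c = 0 ==> c = 0"
proof -
 assume "flin (Pair q) c = 0"
 then have "flin snd (flin (Pair q) c) = 0" by simp
 then show "c = 0" using flin_id[of c UNIV "%x. x"] by (simp add: flin_flin frees_def)
qed

lemma \<beta>E:
 assumes "b \<in> \<beta> p q"
 obtains xs where "xs \<in> NT q (Suc p)" "frag_of b = flin (Pair q) (frag_of xs)"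
 using assms by (auto simp: \<beta>_def)

lemma nbd_singleton: "Nbd Y c = 0" if "c \<in> frees (ntuples_of Y (Suc 0))"
proof (rule additive_map_zeroI[OF that additive_map_frag_extend])
 fix xs assume "xs \<in> ntuples_of Y (Suc 0)"
 then obtain x where "xs = [x]" by (auto simp: ntuples_of_def length_Suc_conv)
 then show "Nbd Y (frag_of xs) = 0" by simp
qed

lemma level_Nbd_closed: "c \<in> frees (NT q (Suc p)) ==> Nbd (level F q) c \<in> frees (NT q p)"
 by (rule quandle.Nbd_closed[OF quandle_level])

text \<open>The differentials anticommute because the simplicial faces are quandle homomorphisms and the
 boundary is natural; the vertical sign depends on the length of the tuple.\<close>

lemma double: "double_complex \<beta> dh dv"
proof
 show "\<beta> p q \<inter> \<beta> p' q' \<noteq> {} ==> p = p' & q = q'" for p q p' q'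
  by (auto simp: \<beta>_def ntuples_of_def)
 show "additive_map dh" "additive_map dv" by (rule dh_additive dv_additive)+
 show "dh (frag_of b) \<in> frees (\<beta> p q)" if "b \<in> \<beta> (Suc p) q" for b p q
  using that by (elim \<beta>E) (simp only: dh_Pair, intro flin_Pair_closed level_Nbd_closed, simp)
 show "dh (frag_of b) = 0" if "b \<in> \<beta> 0 q" for b q
  using that by (elim \<beta>E) (simp only: dh_Pair, simp only: nbd_singleton frees_of, simp)
 show "dv (frag_of b) = 0" if "b \<in> \<beta> p 0" for b p
  using that by (elim \<beta>E) (simp only: dv_Pair_0)
 show "dv (frag_of b) \<in> frees (\<beta> p q)" if b: "b \<in> \<beta> p (Suc q)" for b p q
 proof -
  obtain xs where xs: "frag_of xs \<in> frees (NT (Suc q) (Suc p))" "frag_of b = flin (Pair (Suc q)) (frag_of xs)"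
   using b by (elim \<beta>E) simp
  show ?thesis unfolding xs(2) dv_Pair_Suc[OF xs(1)]
   by (intro frees_cmul flin_Pair_closed nsbd_closed xs(1))
 qed
 show "dh (dh (frag_of b)) = 0" if b: "b \<in> \<beta> p q" for b p q
 proof -
  obtain xs where xs: "frag_of xs \<in> frees (NT q (Suc p))" "frag_of b = flin (Pair q) (frag_of xs)"
   using b by (elim \<beta>E) simp
  show ?thesis unfolding xs(2) dh_Pair
   using quandle.Nbd_Nbd[OF quandle_level frees_ntuples_of[OF xs(1)]] by simp
 qed
 fix b p q assume b: "b \<in> \<beta> p q"
 obtain xs where xs: "frag_of xs \<in> frees (NT q (Suc p))" "frag_of b = flin (Pair q) (frag_of xs)"
  using b by (elim \<beta>E) simp
 show "dv (dv (frag_of b)) = 0"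
 proof (cases q)
  case 0
  show ?thesis unfolding xs(2) 0 dv_Pair_0 by (rule additive_map_zero[OF dv_additive])
 next
  case (Suc m)
  have x: "frag_of xs \<in> frees (NT (Suc m) (Suc p))" using xs(1) Suc by simp
  have 1: "dv (dv (frag_of b)) = frag_cmul ((-1) ^ Suc (Suc p)) (dv (flin (Pair m) (nsbd F m (frag_of xs))))"
   unfolding xs(2) Suc dv_Pair_Suc[OF x] by (rule additive_map_cmul[OF dv_additive])
  show ?thesis
  proof (cases m)
   case 0
   then show ?thesis unfolding 1 by (simp add: dv_Pair_0)
  next
   case (Suc l)
   have x': "frag_of xs \<in> frees (NT (Suc (Suc l)) (Suc p))" using x Suc by simp
   show ?thesis unfolding 1 Suc dv_Pair_Suc[OF nsbd_closed[OF x']] nsbd_nsbd[OF x'] by simp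
  qed
 qed
 show "dh (dv (frag_of b)) = - dv (dh (frag_of b))"
 proof (cases q)
  case 0
  show ?thesis unfolding xs(2) 0 dv_Pair_0 dh_Pair additive_map_zero[OF dh_additive] by simp
 next
  case (Suc m)
  have x: "frag_of xs \<in> frees (NT (Suc m) (Suc p))" using xs(1) Suc by simp
  have "dh (dv (frag_of b)) = frag_cmul ((-1) ^ Suc (Suc p)) (flin (Pair m) (nsbd F m (Nbd (level F (Suc m)) (frag_of xs))))"
   unfolding xs(2) Suc dv_Pair_Suc[OF x] additive_map_cmul[OF dh_additive] dh_Pair nsbd_Nbd[OF x] ..
  moreover have "dv (dh (frag_of b)) = frag_cmul ((-1) ^ Suc p) (flin (Pair m) (nsbd F m (Nbd (level F (Suc m)) (frag_of xs))))"
   unfolding xs(2) Suc dh_Pair by (rule dv_Pair_Suc[OF level_Nbd_closed[OF x]])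
  ultimately show ?thesis by simp
 qed
qed

text \<open>The faces act on orbits, which are sets without a distinguished element; a representative is chosen.\<close>

definition orep :: "nat => 'f set => 'f" where
 "orep q u = (SOME x. x \<in> simplices F q & orbit (level F q) x = u)"

lemma orep:
 assumes "u \<in> orbits (level F q)"
 shows "orep q u \<in> simplices F q & orbit (level F q) (orep q u) = u"
 unfolding orep_def by (rule someI_ex) (use assms in \<open>auto simp: orbits_def\<close>)

definition RQ :: "nat => (nat \<times> 'f set) set" where "RQ q = Pair q ` orbits (level F q)"

definition orb_face :: "nat => nat => 'f => nat \<times> 'f set" where
 "orb_face m i x = (m, orbit (level F m) (face F m i x))"

definition EQ :: "(nat \<times> 'f set \<Rightarrow>\<^sub>0 int) => (nat \<times> 'f set \<Rightarrow>\<^sub>0 int)" where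
 "EQ = frag_extend (%(q, u). case q of 0 => 0
  | Suc m => (\<Sum>i\<le>Suc m. frag_cmul ((-1) ^ i) (frag_of (orb_face m i (orep q u)))))"

definition \<epsilon>Q :: "(nat \<times> 'f list \<Rightarrow>\<^sub>0 int) => (nat \<times> 'f set \<Rightarrow>\<^sub>0 int)" where
 "\<epsilon>Q = frag_extend (%(q, xs). if length xs = 1 then frag_of (q, orbit (level F q) (hd xs)) else 0)"

lemma orbit_in: "x \<in> simplices F q ==> orbit (level F q) x \<in> orbits (level F q)"
 by (simp add: orbits_def)

lemma orb_face_cong:
 assumes "x \<in> simplices F (Suc m)" "y \<in> simplices F (Suc m)" "orbit (level F (Suc m)) x = orbit (level F (Suc m)) y" "i \<le> Suc m"
 shows "orb_face m i x = orb_face m i y"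
proof -
 have "x \<in> orbit (level F (Suc m)) y" using orbit_self[of x "level F (Suc m)"] assms(3) by simp
 then show ?thesis using hom_orbit[OF face_hom[OF assms(4)]] assms(2) by (simp add: orb_face_def)
qed

lemma EQ_orbit:
 assumes x: "x \<in> simplices F (Suc m)"
 shows "EQ (frag_of (Suc m, orbit (level F (Suc m)) x)) = (\<Sum>i\<le>Suc m. frag_cmul ((-1) ^ i) (frag_of (orb_face m i x)))"
proof -
 have "orb_face m i (orep (Suc m) (orbit (level F (Suc m)) x)) = orb_face m i x" if "i \<le> Suc m" for i
  using orep[OF orbit_in[OF x]] x that by (intro orb_face_cong) auto
 then show ?thesis by (simp add: EQ_def del: sum.atMost_Suc)
qed

lemma EQ_additive: "additive_map EQ" by (simp add: EQ_def)

lemma orb_face_closed: "x \<in> simplices F (Suc m) ==> i \<le> Suc m ==> orb_face m i x \<in> RQ m"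
 by (simp add: orb_face_def RQ_def orbit_in face_closed)

lemma RQ_E:
 assumes "r \<in> RQ q"
 obtains x where "x \<in> simplices F q" "r = (q, orbit (level F q) x)"
 using assms by (auto simp: RQ_def orbits_def)

lemma chain_complex_RQ: "chain_complex RQ EQ"
proof
 show "additive_map EQ" by (rule EQ_additive)
 have cl: "EQ (frag_of r) \<in> frees (RQ n)" if "r \<in> RQ (Suc n)" for r n
  using that by (elim RQ_E) (simp only: EQ_orbit, auto intro!: frees_sum frees_cmul orb_face_closed simp del: sum.atMost_Suc)
 show "EQ c \<in> frees (RQ n)" if "c \<in> frees (RQ (Suc n))" for c n
  by (rule additive_map_closedI[OF that EQ_additive cl])
 show "EQ c = 0" if "c \<in> frees (RQ 0)" for c
  by (rule additive_map_zeroI[OF that EQ_additive]) (auto simp: RQ_def EQ_def)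
 show "EQ (EQ c) = 0" if c: "c \<in> frees (RQ n)" for c n
 proof (rule additive_map_zeroI[OF c additive_map_comp[OF EQ_additive EQ_additive]])
  fix r assume "r \<in> RQ n"
  then obtain x where x: "x \<in> simplices F n" "r = (n, orbit (level F n) x)" by (rule RQ_E)
  show "EQ (EQ (frag_of r)) = 0"
  proof (cases n)
   case 0
   then show ?thesis using x(2) by (simp add: EQ_def)
  next
   case (Suc m)
   note xs = x(1)[unfolded Suc]
   have 1: "EQ (EQ (frag_of r)) = (\<Sum>i\<le>Suc m. frag_cmul ((-1) ^ i) (EQ (frag_of (orb_face m i x))))"
    unfolding x(2) Suc EQ_orbit[OF xs]
    by (simp add: additive_map_sum[OF EQ_additive] additive_map_cmul[OF EQ_additive] del: sum.atMost_Suc)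
   show ?thesis
   proof (cases m)
    case 0
    then show ?thesis unfolding 1 by (simp add: orb_face_def EQ_def)
   next
    case (Suc l)
    have "EQ (frag_of (orb_face m i x)) = (\<Sum>j\<le>Suc l. frag_cmul ((-1) ^ j) (frag_of (orb_face l j (face F m i x))))"
     if "i \<le> Suc m" for i
     unfolding orb_face_def Suc using EQ_orbit[of "face F (Suc l) i x" l] face_closed[of x "Suc l" i] xs that Suc
     by (simp add: orb_face_def del: sum.atMost_Suc)
    then have "EQ (EQ (frag_of r)) = (\<Sum>i\<le>Suc (Suc l). frag_cmul ((-1) ^ i)
      (\<Sum>j\<le>Suc l. frag_cmul ((-1) ^ j) (frag_of (orb_face l j (face F (Suc l) i x)))))"
     unfolding 1 Suc by (simp del: sum.atMost_Suc)
    also have "\<dots> = (\<Sum>i\<le>Suc (Suc l). \<Sum>j\<le>Suc l. frag_cmul ((-1) ^ (j + i)) (frag_of (orb_face l j (face F (Suc l) i x))))"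
     by (simp add: frag_cmul_sum power_add mult.commute del: sum.atMost_Suc)
    also have "\<dots> = (\<Sum>j\<le>Suc l. \<Sum>i\<le>Suc (Suc l). frag_cmul ((-1) ^ (j + i)) (frag_of (orb_face l j (face F (Suc l) i x))))"
     by (rule sum.swap)
    also have "\<dots> = (\<Sum>j\<le>Suc l. frag_cmul ((-1) ^ j) (\<Sum>i\<le>Suc (Suc l). frag_cmul ((-1) ^ i) (frag_of (orb_face l j (face F (Suc l) i x)))))"
     by (simp add: frag_cmul_sum power_add del: sum.atMost_Suc)
    also have "\<dots> = 0"
     by (rule alternating_double_sum) (use face_face[of x l] xs Suc in \<open>simp add: orb_face_def\<close>)
    finally show ?thesis .
   qed
  qed
 qed
qed

lemma \<epsilon>Q_Pair: "c \<in> frees (NT q (Suc 0)) ==> \<epsilon>Q (flin (Pair q) c) = flin (Pair q) (frag_extend (%xs. frag_of (orbit (level F q) (hd xs))) c)"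
 by (erule additive_map_eqI[where f = "%c. \<epsilon>Q (flin (Pair q) c)" and g = "%c. flin (Pair q) (frag_extend (%xs. frag_of (orbit (level F q) (hd xs))) c)"])
  (auto simp: \<epsilon>Q_def additive_ff ntuples_of_def)

text \<open>The rows consist of the normalized quandle chains of the simplicial degrees of the resolution. They are
 exact in positive degrees, and their cokernels are free on the orbits, because every degree is a
 retract of a free quandle.\<close>

theorem orbit_fibration: "trivial_fibration (double_complex.tot \<beta>) (double_complex.D dh dv) RQ EQ \<epsilon>Q"
proof (rule augmented_double_complex.trivial_fibration_\<epsilon>,
  rule augmented_double_complex.intro[OF double chain_complex_RQ], unfold_locales)
 show "additive_map \<epsilon>Q" by (simp add: \<epsilon>Q_def)
 show "\<epsilon>Q (frag_of b) \<in> frees (RQ q)" if "b \<in> \<beta> 0 q" for b q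
  using that by (auto simp: \<beta>_def \<epsilon>Q_def RQ_def ntuples_of_def ntuples_def length_Suc_conv orbit_in)
 show "\<epsilon>Q (frag_of b) = 0" if "b \<in> \<beta> (Suc p) q" for b p q
  using that by (auto simp: \<beta>_def \<epsilon>Q_def ntuples_of_def)
 show "\<epsilon>Q (dv (frag_of b)) = EQ (\<epsilon>Q (frag_of b))" if b: "b \<in> \<beta> 0 q" for b q
 proof -
  obtain x where x: "x \<in> simplices F q" "b = (q, [x])" "[x] \<in> NT q (Suc 0)"
   using b by (auto simp: \<beta>_def ntuples_of_def ntuples_def length_Suc_conv)
  show ?thesis
  proof (cases q)
   case 0
   then show ?thesis using x(2) by (simp add: dv_def \<epsilon>Q_def EQ_def)
  next
   case (Suc m)
   have "\<epsilon>Q (dv (frag_of b)) = (\<Sum>i\<le>Suc m. frag_cmul ((-1) ^ i) (frag_of (orb_face m i x)))"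
    unfolding x(2) Suc
    by (simp add: dv_def nsbd_def nmap_def frag_extend_sum frag_extend_cmul o_def \<epsilon>Q_def orb_face_def del: sum.atMost_Suc)
   then show ?thesis using EQ_orbit[of x m] x Suc by (simp add: \<epsilon>Q_def)
  qed
 qed
 show "\<epsilon>Q (dh (frag_of b)) = 0" if b: "b \<in> \<beta> 1 q" for b q
 proof -
  interpret L: quandle "level F q" by (rule quandle_level)
  obtain x y where x: "x \<in> simplices F q" "y \<in> simplices F q" "b = (q, [x, y])"
   using b by (auto simp: \<beta>_def ntuples_of_def ntuples_def length_Suc_conv numeral_2_eq_2)
  have "orbit (level F q) (x \<rhd>\<^bsub>level F q\<^esub> y) = orbit (level F q) y" using orbit_lact[of x "level F q" y] x by simp
  then show ?thesis using x(3) by (simp add: dh_def \<epsilon>Q_def frag_extend_diff)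
 qed
 show "\<exists>c'\<in>frees (\<beta> (Suc (Suc p)) q). dh c' = c" if c: "c \<in> frees (\<beta> (Suc p) q)" "dh c = 0" for c p q
 proof -
  obtain c' where c': "c' \<in> frees (NT q (Suc (Suc p)))" "c = flin (Pair q) c'" using c(1) by (rule \<beta>_frees)
  have "Nbd (level F q) c' = 0" using c(2) unfolding c'(2) dh_Pair by (rule flin_Pair_zero)
  then obtain e where "e \<in> frees (NT q (Suc (Suc (Suc p))))" "Nbd (level F q) e = c'"
   using rows[of q] c'(1) unfolding row_exact_def by blast
  then show ?thesis using flin_Pair_closed dh_Pair c'(2) by metis
 qed
 show "\<exists>c'\<in>frees (\<beta> 1 q). dh c' = c" if c: "c \<in> frees (\<beta> 0 q)" "\<epsilon>Q c = 0" for c q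
 proof -
  obtain c' where c': "c' \<in> frees (NT q (Suc 0))" "c = flin (Pair q) c'" using c(1) by (rule \<beta>_frees)
  have "frag_extend (%xs. frag_of (orbit (level F q) (hd xs))) c' = 0"
   using c(2) unfolding c'(2) \<epsilon>Q_Pair[OF c'(1)] by (rule flin_Pair_zero)
  then obtain e where "e \<in> frees (NT q (Suc 1))" "Nbd (level F q) e = c'"
   using rows[of q] c'(1) unfolding row_exact_def by (auto simp: numeral_2_eq_2)
  then show ?thesis using flin_Pair_closed dh_Pair c'(2) by metis
 qed
 show "\<exists>c\<in>frees (\<beta> 0 q). \<epsilon>Q c = r" if r: "r \<in> frees (RQ q)" for r q
 proof
  show "flin (%(q, u). (q, [orep q u])) r \<in> frees (\<beta> 0 q)"
   by (rule flin_closed[OF r]) (use orep in \<open>auto simp: RQ_def \<beta>_def ntuples_of_def ntuples_def\<close>)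
  show "\<epsilon>Q (flin (%(q, u). (q, [orep q u])) r) = r"
   by (rule additive_map_eqI[OF r, where f = "%r. \<epsilon>Q (flin (%(q, u). (q, [orep q u])) r)" and g = "%r. r"])
    (use orep in \<open>auto simp: RQ_def \<epsilon>Q_def additive_ff\<close>)
 qed
qed

definition \<epsilon>P :: "(nat \<times> 'f list \<Rightarrow>\<^sub>0 int) => ('x list \<Rightarrow>\<^sub>0 int)" where
 "\<epsilon>P = frag_extend (%(q, xs). if q = 0 then nmap (\<epsilon> 0) xs else 0)"

abbreviation RP :: "nat => 'x list set" where "RP n \<equiv> ntuples_of X (Suc n)"

lemma \<epsilon>P_Pair_0: "\<epsilon>P (flin (Pair 0) c) = Nmap (\<epsilon> 0) c"
 by (rule additive_map_eqI[where S = UNIV and c = c and f = "%c. \<epsilon>P (flin (Pair 0) c)" and g = "Nmap (\<epsilon> 0)"])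
  (auto simp: frees_def \<epsilon>P_def additive_ff)

lemma chain_complex_RP: "chain_complex RP (Nbd X)"
 by unfold_locales
  (auto intro: quandle.Nbd_closed[OF base] quandle.Nbd_Nbd[OF base] frees_ntuples_of nbd_singleton)

lemma sign_cancel: "frag_cmul ((-1) ^ k) x = 0 ==> x = 0"
 by (metis frag_cmul_cmul frag_cmul_one frag_cmul_zero2 minus_one_mult_self)

lemma \<epsilon>_map: "\<epsilon> 0 \<in> carrier (level F 0) \<rightarrow> carrier X"
 using \<epsilon>_hom by (simp add: quandle_hom_def)

text \<open>The columns consist of the normalized tuples of fixed length; they resolve the normalized tuples in the
 base because the tensor powers inherit the contraction of the simplicial chains.\<close>

theorem tuple_fibration: "trivial_fibration (double_complex.tot \<beta>) (double_complex.D dh dv) RP (Nbd X) \<epsilon>P"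
proof -
 have "trivial_fibration (double_complex.tot (%p q. \<beta> q p)) (double_complex.D dv dh) RP (Nbd X) \<epsilon>P"
 proof (rule augmented_double_complex.trivial_fibration_\<epsilon>,
   rule augmented_double_complex.intro[OF double_complex_swap[OF double] chain_complex_RP], unfold_locales)
  show "additive_map \<epsilon>P" by (simp add: \<epsilon>P_def)
  show "\<epsilon>P (frag_of b) \<in> frees (RP q)" if "b \<in> \<beta> q 0" for b q
   using that by (elim \<beta>E) (simp only: \<epsilon>P_Pair_0, intro Nmap_closed[OF \<epsilon>_map], simp)
  show "\<epsilon>P (frag_of b) = 0" if "b \<in> \<beta> q (Suc p)" for b p q
   using that by (auto simp: \<beta>_def \<epsilon>P_def)
  show "\<epsilon>P (dh (frag_of b)) = Nbd X (\<epsilon>P (frag_of b))" if b: "b \<in> \<beta> q 0" for b q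
  proof -
   obtain xs where xs: "frag_of xs \<in> frees (NT 0 (Suc q))" "frag_of b = flin (Pair 0) (frag_of xs)"
    using b by (elim \<beta>E) simp
   show ?thesis unfolding xs(2) dh_Pair \<epsilon>P_Pair_0
    by (rule Nbd_natural[OF quandle_level base \<epsilon>_hom frees_ntuples_of[OF xs(1)]])
  qed
  show "\<epsilon>P (dv (frag_of b)) = 0" if b: "b \<in> \<beta> q 1" for b q
  proof -
   obtain xs where xs: "frag_of xs \<in> frees (NT (Suc 0) (Suc q))" "frag_of b = flin (Pair (Suc 0)) (frag_of xs)"
    using b by (elim \<beta>E) simp
   have "Nmap (\<epsilon> 0) (Nmap (face F 0 0) (frag_of xs)) = Nmap (\<epsilon> 0) (Nmap (face F 0 (Suc 0)) (frag_of xs))"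
    unfolding Nmap_Nmap by (rule Nmap_cong[OF xs(1)]) (use eps_face in \<open>auto simp: ntuples_of_def ntuples_def\<close>)
   then have "Nmap (\<epsilon> 0) (nsbd F 0 (frag_of xs)) = 0"
    by (simp add: nsbd_def frag_extend_diff)
   then have "\<epsilon>P (flin (Pair 0) (nsbd F 0 (frag_of xs))) = 0" by (simp only: \<epsilon>P_Pair_0)
   moreover have "additive_map \<epsilon>P" by (simp add: \<epsilon>P_def)
   ultimately show ?thesis unfolding xs(2) dv_Pair_Suc[OF xs(1)]
    by (simp only: additive_map_cmul frag_cmul_zero2)
  qed
  show "\<exists>c'\<in>frees (\<beta> q (Suc (Suc p))). dv c' = c" if c: "c \<in> frees (\<beta> q (Suc p))" "dv c = 0" for c p q
  proof -
   obtain c' where c': "c' \<in> frees (NT (Suc p) (Suc q))" "c = flin (Pair (Suc p)) c'" using c(1) by (rule \<beta>_frees)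
   have "flin (Pair p) (nsbd F p c') = 0"
    using c(2) unfolding c'(2) dv_Pair_Suc[OF c'(1)] by (rule sign_cancel)
   then have "nsbd F p c' = 0" by (rule flin_Pair_zero)
   then obtain e where e: "e \<in> frees (NT (Suc (Suc p)) (Suc q))" "nsbd F (Suc p) e = c'"
    using columns_exact_Suc c'(1) unfolding ntuples_nlists by blast
   show ?thesis
   proof (rule bexI[of _ "frag_cmul ((-1) ^ Suc (Suc q)) (flin (Pair (Suc (Suc p))) e)"])
    show "dv (frag_cmul ((-1) ^ Suc (Suc q)) (flin (Pair (Suc (Suc p))) e)) = c"
     unfolding additive_map_cmul[OF dv_additive] dv_Pair_Suc[OF e(1)] e(2) c'(2)
     by (simp only: frag_cmul_cmul minus_one_mult_self frag_cmul_one)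
   qed (intro frees_cmul flin_Pair_closed e(1))
  qed
  show "\<exists>c'\<in>frees (\<beta> q 1). dv c' = c" if c: "c \<in> frees (\<beta> q 0)" "\<epsilon>P c = 0" for c q
  proof -
   obtain c' where c': "c' \<in> frees (NT 0 (Suc q))" "c = flin (Pair 0) c'" using c(1) by (rule \<beta>_frees)
   have "Nmap (\<epsilon> 0) c' = 0" using c(2) unfolding c'(2) \<epsilon>P_Pair_0 .
   then obtain e where e: "e \<in> frees (NT (Suc 0) (Suc q))" "nsbd F 0 e = c'"
    using columns_exact_0 c'(1) unfolding ntuples_nlists by blast
   show ?thesis
   proof (rule bexI[of _ "frag_cmul ((-1) ^ Suc (Suc q)) (flin (Pair (Suc 0)) e)"])
    show "dv (frag_cmul ((-1) ^ Suc (Suc q)) (flin (Pair (Suc 0)) e)) = c"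
     unfolding additive_map_cmul[OF dv_additive] dv_Pair_Suc[OF e(1)] e(2) c'(2)
     by (simp only: frag_cmul_cmul minus_one_mult_self frag_cmul_one)
    show "frag_cmul ((-1) ^ Suc (Suc q)) (flin (Pair (Suc 0)) e) \<in> frees (\<beta> q 1)"
     using flin_Pair_closed[OF e(1)] by (intro frees_cmul) simp
   qed
  qed
  show "\<exists>c\<in>frees (\<beta> q 0). \<epsilon>P c = r" if r: "r \<in> frees (RP q)" for r q
  proof -
   obtain e where e: "e \<in> frees (NT 0 (Suc q))" "Nmap (\<epsilon> 0) e = r"
    using columns_surjective r unfolding ntuples_nlists ntuples_nlists_X by blast
   then show ?thesis using flin_Pair_closed \<epsilon>P_Pair_0 by metis
  qed
 qed
 then show ?thesis using tot_swap[OF double] by simp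
qed

end

section \<open>Cohomology\<close>

lemma hom_group_simps:
 "f \<in> carrier (hom_group G A) \<longleftrightarrow> f \<in> hom G A & f \<in> extensional (carrier G)"
 "x \<in> carrier G ==> (f \<otimes>\<^bsub>hom_group G A\<^esub> g) x = f x \<otimes>\<^bsub>A\<^esub> g x"
 "x \<in> carrier G ==> \<one>\<^bsub>hom_group G A\<^esub> x = \<one>\<^bsub>A\<^esub>"
 "(f \<otimes>\<^bsub>hom_group G A\<^esub> g) \<in> extensional (carrier G)" "\<one>\<^bsub>hom_group G A\<^esub> \<in> extensional (carrier G)"
 by (simp_all add: hom_group_def)

lemma hom_group_I:
 assumes "group G" "\<And>x. x \<in> carrier G ==> f x \<in> carrier A"
  "\<And>x y. x \<in> carrier G ==> y \<in> carrier G ==> f (x \<otimes>\<^bsub>G\<^esub> y) = f x \<otimes>\<^bsub>A\<^esub> f y"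
 shows "restrict f (carrier G) \<in> carrier (hom_group G A)"
proof -
 interpret group G by fact
 show ?thesis using assms(2,3) by (auto simp: hom_group_simps hom_def)
qed

lemma hom_group_eqI:
 assumes "f \<in> extensional (carrier G)" "g \<in> extensional (carrier G)" "\<And>x. x \<in> carrier G ==> f x = g x"
 shows "f = g"
 using assms by (rule extensionalityI)

lemma comm_group_hom_group:
 assumes G: "group G" and A: "comm_group A"
 shows "comm_group (hom_group G A)"
proof -
 interpret G: group G by fact
 interpret A: comm_group A by fact
 note s = hom_group_simps
 have c: "f x \<in> carrier A" if "f \<in> carrier (hom_group G A)" "x \<in> carrier G" for f x
  using that by (auto simp: s hom_def)
 have m: "f (x \<otimes>\<^bsub>G\<^esub> y) = f x \<otimes>\<^bsub>A\<^esub> f y" if "f \<in> carrier (hom_group G A)" "x \<in> carrier G" "y \<in> carrier G" for f x y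
  using that by (auto simp: s hom_def)
 have e: "f \<in> extensional (carrier G)" if "f \<in> carrier (hom_group G A)" for f using that by (simp add: s)
 show ?thesis
 proof (rule comm_groupI)
  fix f g assume f: "f \<in> carrier (hom_group G A)" and g: "g \<in> carrier (hom_group G A)"
  have "restrict (%x. f x \<otimes>\<^bsub>A\<^esub> g x) (carrier G) \<in> carrier (hom_group G A)"
   by (rule hom_group_I[OF G]) (use c[OF f] c[OF g] m[OF f] m[OF g] in \<open>simp_all add: A.m_ac\<close>)
  then show "f \<otimes>\<^bsub>hom_group G A\<^esub> g \<in> carrier (hom_group G A)" by (simp add: hom_group_def)
  show "f \<otimes>\<^bsub>hom_group G A\<^esub> g = g \<otimes>\<^bsub>hom_group G A\<^esub> f"
   by (rule hom_group_eqI[of _ G]) (use c[OF f] c[OF g] in \<open>simp_all add: s A.m_comm\<close>)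
  fix h assume h: "h \<in> carrier (hom_group G A)"
  show "f \<otimes>\<^bsub>hom_group G A\<^esub> g \<otimes>\<^bsub>hom_group G A\<^esub> h = f \<otimes>\<^bsub>hom_group G A\<^esub> (g \<otimes>\<^bsub>hom_group G A\<^esub> h)"
   by (rule hom_group_eqI[of _ G]) (use c[OF f] c[OF g] c[OF h] in \<open>simp_all add: s A.m_assoc\<close>)
 next
  have "restrict (%x. \<one>\<^bsub>A\<^esub>) (carrier G) \<in> carrier (hom_group G A)" by (rule hom_group_I[OF G]) simp_all
  then show "\<one>\<^bsub>hom_group G A\<^esub> \<in> carrier (hom_group G A)" by (simp add: hom_group_def)
  fix f assume f: "f \<in> carrier (hom_group G A)"
  show "\<one>\<^bsub>hom_group G A\<^esub> \<otimes>\<^bsub>hom_group G A\<^esub> f = f"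
   by (rule hom_group_eqI[of _ G]) (use c[OF f] e[OF f] in \<open>simp_all add: s\<close>)
  show "\<exists>g\<in>carrier (hom_group G A). g \<otimes>\<^bsub>hom_group G A\<^esub> f = \<one>\<^bsub>hom_group G A\<^esub>"
  proof
   show "restrict (%x. inv\<^bsub>A\<^esub> f x) (carrier G) \<in> carrier (hom_group G A)"
    by (rule hom_group_I[OF G]) (use c[OF f] m[OF f] in \<open>simp_all add: A.inv_mult\<close>)
   show "restrict (%x. inv\<^bsub>A\<^esub> f x) (carrier G) \<otimes>\<^bsub>hom_group G A\<^esub> f = \<one>\<^bsub>hom_group G A\<^esub>"
    by (rule hom_group_eqI[of _ G]) (use c[OF f] in \<open>simp_all add: s\<close>)
  qed
 qed
qed

locale cochain_complex =
 fixes C :: "nat => ('a, 'm) monoid_scheme" and d :: "nat => 'a => 'a"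
 assumes group: "comm_group (C n)" and d_hom: "d n \<in> hom (C n) (C (Suc n))"
  and d_d: "x \<in> carrier (C n) ==> d (Suc n) (d n x) = \<one>\<^bsub>C (Suc (Suc n))\<^esub>"
begin

abbreviation "cocycles n \<equiv> kernel (C n) (C (Suc n)) (d n)"
abbreviation "cocycle_group n \<equiv> (C n)\<lparr>carrier := cocycles n\<rparr>"

lemma is_group: "Group.group (C n)"
 using group comm_group_def by blast

lemma d_group_hom: "group_hom (C n) (C (Suc n)) (d n)"
 by (simp add: group_hom_def group_hom_axioms_def is_group d_hom)

lemma cocycles_subgroup: "subgroup (cocycles n) (C n)"
 by (rule group_hom.subgroup_kernel[OF d_group_hom])

lemma coboundaries_subgroup: "subgroup (coboundaries C d n) (C n)"
proof (cases n)
 case 0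
 then show ?thesis by (simp add: coboundaries_def Group.group.triv_subgroup[OF is_group])
next
 case (Suc m)
 then show ?thesis using group_hom.img_is_subgroup[OF d_group_hom[of m]] by (simp add: coboundaries_def)
qed

lemma coboundaries_cocycles: "coboundaries C d n \<subseteq> cocycles n"
proof (cases n)
 case 0
 have "d n \<one>\<^bsub>C n\<^esub> = \<one>\<^bsub>C (Suc n)\<^esub>" by (rule hom_one[OF d_hom is_group is_group])
 then show ?thesis using 0 monoid.one_closed[OF Group.group.is_monoid[OF is_group[of 0]]]
  by (auto simp: coboundaries_def kernel_def)
next
 case (Suc m)
 then show ?thesis using d_d hom_carrier[OF d_hom[of m]] by (auto simp: coboundaries_def kernel_def)
qed

lemma cocycle_group: "Group.group (cocycle_group n)"
 by (rule subgroup.subgroup_is_group[OF cocycles_subgroup is_group])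

lemma cocycle_comm_group: "comm_group (cocycle_group n)"
proof -
 interpret comm_group "C n" by (rule group)
 show ?thesis
  by (rule group.group_comm_groupI[OF cocycle_group])
   (use subgroup.subset[OF cocycles_subgroup[of n]] in \<open>auto simp: m_comm subset_iff\<close>)
qed

lemma coboundaries_normal: "coboundaries C d n \<lhd> cocycle_group n"
proof -
 have "subgroup (coboundaries C d n) (cocycle_group n)"
  by (rule Group.group.subgroup_incl[OF is_group coboundaries_subgroup cocycles_subgroup coboundaries_cocycles])
 then show ?thesis using cocycle_comm_group by (rule comm_group.normal_iff_subgroup[THEN iffD2, rotated])
qed

end

lemma cohomology_iso:
 assumes C: "cochain_complex C d" and C': "cochain_complex C' d'"
  and hom: "\<alpha> \<in> hom (C n) (C' n)"
  and cyc: "\<And>z. z \<in> kernel (C n) (C (Suc n)) (d n) ==> \<alpha> z \<in> kernel (C' n) (C' (Suc n)) (d' n)"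
  and inj: "\<And>z. z \<in> kernel (C n) (C (Suc n)) (d n) ==> \<alpha> z \<in> coboundaries C' d' n \<longleftrightarrow> z \<in> coboundaries C d n"
  and surj: "\<And>z'. z' \<in> kernel (C' n) (C' (Suc n)) (d' n) ==>
   \<exists>z\<in>kernel (C n) (C (Suc n)) (d n). \<exists>b\<in>coboundaries C' d' n. z' = b \<otimes>\<^bsub>C' n\<^esub> \<alpha> z"
 shows "cohomology C d n \<cong> cohomology C' d' n"
proof -
 interpret C: cochain_complex C d by fact
 interpret C': cochain_complex C' d' by fact
 let ?G = "C.cocycle_group n" and ?G' = "C'.cocycle_group n"
 let ?B = "coboundaries C d n" and ?B' = "coboundaries C' d' n"
 let ?H = "?G' Mod ?B'"
 interpret G': Group.group ?G' by (rule C'.cocycle_group)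
 interpret N: normal ?B' ?G' by (rule C'.coboundaries_normal)
 have sub: "z \<in> carrier (C n)" if "z \<in> C.cocycles n" for z using that by (simp add: kernel_def)
 have h: "\<alpha> \<in> hom ?G ?G'" using cyc hom sub by (auto simp: hom_def)
 let ?\<psi> = "%z. ?B' #>\<^bsub>?G'\<^esub> \<alpha> z"
 have "?\<psi> \<in> hom ?G ?H" using hom_compose[OF h N.r_coset_hom_Mod] by (simp add: o_def)
 then interpret P: group_hom ?G ?H ?\<psi>
  by (simp add: group_hom_def group_hom_axioms_def C.cocycle_group N.factorgroup_is_group)
 have one: "\<one>\<^bsub>?H\<^esub> = ?B'" by (simp add: FactGroup_def)
 have "kernel ?G ?H ?\<psi> = ?B"
 proof -
  have "?\<psi> z = ?B' \<longleftrightarrow> z \<in> ?B" if z: "z \<in> C.cocycles n" for z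
  proof -
   have a: "\<alpha> z \<in> carrier ?G'" using cyc[OF z] by simp
   have "?\<psi> z = ?B' \<longleftrightarrow> \<alpha> z \<in> ?B'"
    using G'.coset_join2[OF a N.subgroup_axioms] G'.coset_join1[OF _ a N.subgroup_axioms] by blast
   then show ?thesis using inj[OF z] by simp
  qed
  then show ?thesis using C.coboundaries_cocycles[of n] by (auto simp: kernel_def[of ?G] one)
 qed
 moreover have "?\<psi> ` carrier ?G = carrier ?H"
 proof
  show "?\<psi> ` carrier ?G \<subseteq> carrier ?H" using P.hom_closed by blast
  show "carrier ?H \<subseteq> ?\<psi> ` carrier ?G"
  proof
   fix K assume "K \<in> carrier ?H"
   then obtain z' where z': "z' \<in> C'.cocycles n" "K = ?B' #>\<^bsub>?G'\<^esub> z'" by (auto simp: carrier_FactGroup)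
   obtain z b where zb: "z \<in> C.cocycles n" "b \<in> ?B'" "z' = b \<otimes>\<^bsub>C' n\<^esub> \<alpha> z" using surj[OF z'(1)] by blast
   have a: "\<alpha> z \<in> carrier ?G'" using cyc[OF zb(1)] by simp
   have "b \<otimes>\<^bsub>?G'\<^esub> \<alpha> z \<in> ?B' #>\<^bsub>?G'\<^esub> \<alpha> z" using zb(2) by (auto simp: r_coset_def)
   then have "z' \<in> ?\<psi> z" using zb(3) by simp
   then have "?\<psi> z = K" using G'.repr_independence[OF _ a N.subgroup_axioms] z'(2) by simp
   then show "K \<in> ?\<psi> ` carrier ?G" using zb(1) by auto
  qed
 qed
 ultimately show ?thesis using P.FactGroup_iso unfolding cohomology_def by simp
qed

text \<open>The isomorphism on cochain groups restricts to cocycles and matches coboundaries.\<close>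

lemma cohomology_iso_levelwise:
 assumes C: "cochain_complex C d" and C': "cochain_complex C' d'"
  and iso: "\<And>n. \<alpha> n \<in> iso (C n) (C' n)"
  and comm: "\<And>n x. x \<in> carrier (C n) ==> \<alpha> (Suc n) (d n x) = d' n (\<alpha> n x)"
 shows "cohomology C d n \<cong> cohomology C' d' n"
proof -
 interpret C: cochain_complex C d by fact
 interpret C': cochain_complex C' d' by fact
 have bij: "bij_betw (\<alpha> n) (carrier (C n)) (carrier (C' n))" and hom: "\<alpha> n \<in> hom (C n) (C' n)" for n
  using iso[of n] by (auto simp: iso_def)
 have one: "\<alpha> n \<one>\<^bsub>C n\<^esub> = \<one>\<^bsub>C' n\<^esub>" for n using hom_one[OF hom C.is_group C'.is_group] .
 have inj1: "\<alpha> n x = \<alpha> n y ==> x \<in> carrier (C n) ==> y \<in> carrier (C n) ==> x = y" for n x y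
  using bij[of n] by (auto simp: bij_betw_def inj_on_def)
 have dc: "d n x \<in> carrier (C (Suc n))" if "x \<in> carrier (C n)" for n x
  using hom_carrier[OF C.d_hom] that by blast
 have oc: "\<one>\<^bsub>C n\<^esub> \<in> carrier (C n)" for n using Group.group.is_monoid[OF C.is_group[of n]] monoid.one_closed by blast
 have cyc: "\<alpha> n z \<in> C'.cocycles n \<longleftrightarrow> z \<in> C.cocycles n" if z: "z \<in> carrier (C n)" for z
 proof -
  have "d' n (\<alpha> n z) = \<one>\<^bsub>C' (Suc n)\<^esub> \<longleftrightarrow> \<alpha> (Suc n) (d n z) = \<alpha> (Suc n) \<one>\<^bsub>C (Suc n)\<^esub>"
   unfolding comm[OF z] one ..
  also have "\<dots> \<longleftrightarrow> d n z = \<one>\<^bsub>C (Suc n)\<^esub>" using inj1[of "Suc n"] dc[OF z] oc by metis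
  finally show ?thesis using z bij_betwE[OF bij[of n]] by (simp add: kernel_def)
 qed
 show ?thesis
 proof (rule cohomology_iso[OF C C' hom])
  show "\<alpha> n z \<in> C'.cocycles n" if "z \<in> C.cocycles n" for z
   using cyc that by (simp add: kernel_def)
  show "\<alpha> n z \<in> coboundaries C' d' n \<longleftrightarrow> z \<in> coboundaries C d n" if "z \<in> C.cocycles n" for z
  proof -
   have z: "z \<in> carrier (C n)" using that by (simp add: kernel_def)
   show ?thesis
   proof (cases n)
    case 0
    then show ?thesis using one[of 0] inj1[of 0 z "\<one>\<^bsub>C 0\<^esub>"] z oc[of 0] by (auto simp: coboundaries_def)
   next
    case (Suc m)
    have "\<alpha> n z \<in> d' m ` carrier (C' m) \<longleftrightarrow> (\<exists>y\<in>carrier (C m). \<alpha> (Suc m) z = d' m (\<alpha> m y))"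
     unfolding bij_betw_imp_surj_on[OF bij[of m], symmetric] Suc by auto
    also have "\<dots> \<longleftrightarrow> (\<exists>y\<in>carrier (C m). \<alpha> (Suc m) z = \<alpha> (Suc m) (d m y))" using comm by simp
    also have "\<dots> \<longleftrightarrow> z \<in> d m ` carrier (C m)" using inj1[of "Suc m" z] z dc Suc by blast
    finally show ?thesis using Suc by (simp add: coboundaries_def)
   qed
  qed
  show "\<exists>z\<in>C.cocycles n. \<exists>b\<in>coboundaries C' d' n. z' = b \<otimes>\<^bsub>C' n\<^esub> \<alpha> n z" if z': "z' \<in> C'.cocycles n" for z'
  proof -
   obtain z where z: "z \<in> carrier (C n)" "z' = \<alpha> n z"
    using z' bij_betw_imp_surj_on[OF bij[of n]] by (auto simp: kernel_def)
   interpret G: Group.group "C' n" by (rule C'.is_group)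
   have "\<one>\<^bsub>C' n\<^esub> \<in> coboundaries C' d' n" by (rule subgroup.one_closed[OF C'.coboundaries_subgroup])
   then show ?thesis using z z' cyc[OF z(1)] by (intro bexI[of _ z] bexI[of _ "\<one>\<^bsub>C' n\<^esub>"]) (auto simp: kernel_def)
  qed
 qed
qed

subsection \<open>Cochains of chain complexes of free abelian groups\<close>

lemma carrier_free_frees: "carrier (free_Abelian_group S) = frees S"
 by (auto simp: frees_def)

definition cochains :: "('a, 'm) monoid_scheme => (nat => 'b set) => nat => (('b \<Rightarrow>\<^sub>0 int) => 'a) monoid" where
 "cochains A S n = hom_group (free_Abelian_group (S n)) A"

definition codiff :: "(nat => 'b set) => (('b \<Rightarrow>\<^sub>0 int) => ('b \<Rightarrow>\<^sub>0 int)) => nat => (('b \<Rightarrow>\<^sub>0 int) => 'a) => (('b \<Rightarrow>\<^sub>0 int) => 'a)" where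
 "codiff S D n \<phi> = restrict (%c. \<phi> (D c)) (frees (S (Suc n)))"

lemma cochains_iff:
 "\<phi> \<in> carrier (cochains A S n) \<longleftrightarrow> \<phi> \<in> extensional (frees (S n)) & (\<forall>c\<in>frees (S n). \<phi> c \<in> carrier A) \<and>
  (\<forall>x\<in>frees (S n). \<forall>y\<in>frees (S n). \<phi> (x + y) = \<phi> x \<otimes>\<^bsub>A\<^esub> \<phi> y)"
 unfolding cochains_def hom_group_simps carrier_free_frees hom_def by auto

lemma cochains_mult: "c \<in> frees (S n) ==> (\<phi> \<otimes>\<^bsub>cochains A S n\<^esub> \<psi>) c = \<phi> c \<otimes>\<^bsub>A\<^esub> \<psi> c"
 and cochains_one: "c \<in> frees (S n) ==> \<one>\<^bsub>cochains A S n\<^esub> c = \<one>\<^bsub>A\<^esub>"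
 and cochains_ext: "\<phi> \<otimes>\<^bsub>cochains A S n\<^esub> \<psi> \<in> extensional (frees (S n))" "\<one>\<^bsub>cochains A S n\<^esub> \<in> extensional (frees (S n))"
 using hom_group_simps[where G = "free_Abelian_group (S n)" and A = A] by (simp_all add: cochains_def carrier_free_frees)

lemma cochains_group: "comm_group A ==> comm_group (cochains A S n)"
 unfolding cochains_def by (rule comm_group_hom_group[OF group_free_Abelian_group])

lemma cochains_zero:
 assumes "comm_group A" "\<phi> \<in> carrier (cochains A S n)"
 shows "\<phi> 0 = \<one>\<^bsub>A\<^esub>"
proof -
 interpret comm_group A by fact
 have "\<phi> 0 \<otimes>\<^bsub>A\<^esub> \<phi> 0 = \<phi> 0" "\<phi> 0 \<in> carrier A" using assms(2) unfolding cochains_iff by (metis add_0 frees_zero)+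
 then show ?thesis using l_cancel_one by simp
qed

lemma pull_cochain:
 assumes \<phi>: "\<phi> \<in> carrier (cochains A T m)" and f: "additive_map f" "\<And>c. c \<in> frees (S n) ==> f c \<in> frees (T m)"
 shows "restrict (%c. \<phi> (f c)) (frees (S n)) \<in> carrier (cochains A S n)"
 using \<phi> f by (auto simp: cochains_iff additive_map_add)

lemma cochains_complex:
 assumes "chain_complex S D" and A: "comm_group A"
 shows "cochain_complex (cochains A S) (codiff S D)"
proof -
 interpret chain_complex S D by fact
 have cl: "codiff S D n \<phi> \<in> carrier (cochains A S (Suc n))" if "\<phi> \<in> carrier (cochains A S n)" for \<phi> n
  unfolding codiff_def by (rule pull_cochain[OF that D_additive D_closed])
 show ?thesis
 proof (rule cochain_complex.intro)
  show "comm_group (cochains A S n)" for n by (rule cochains_group[OF A])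
  show "codiff S D n \<in> hom (cochains A S n) (cochains A S (Suc n))" for n
  proof -
   have "codiff S D n (\<phi> \<otimes>\<^bsub>cochains A S n\<^esub> \<psi>) = codiff S D n \<phi> \<otimes>\<^bsub>cochains A S (Suc n)\<^esub> codiff S D n \<psi>" for \<phi> \<psi>
    by (rule extensionalityI[of _ "frees (S (Suc n))"])
     (simp_all add: codiff_def cochains_ext cochains_mult D_closed)
   then show ?thesis using cl by (auto simp: hom_def)
  qed
  show "codiff S D (Suc n) (codiff S D n \<phi>) = \<one>\<^bsub>cochains A S (Suc (Suc n))\<^esub>" if "\<phi> \<in> carrier (cochains A S n)" for n \<phi>
   by (rule extensionalityI[of _ "frees (S (Suc (Suc n)))"])
    (simp_all add: codiff_def cochains_ext cochains_one D_closed D_D cochains_zero[OF A that])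
 qed
qed

context trivial_fibration_span
begin

lemma swapped: "trivial_fibration_span S D Q G g P E f"
 by (intro trivial_fibration_span.intro f.trivial_fibration_axioms g.trivial_fibration_axioms)

definition pull :: "nat => (('c \<Rightarrow>\<^sub>0 int) => 'x) => (('b \<Rightarrow>\<^sub>0 int) => 'x)" where
 "pull n \<psi> = restrict (%c. \<psi> (across n c)) (frees (P n))"

context
 fixes A :: "('x, 'k) monoid_scheme"
 assumes A: "comm_group A"
begin

interpretation P: cochain_complex "cochains A P" "codiff P E"
 by (rule cochains_complex[OF f.T.chain_complex_axioms A])
interpretation Q: cochain_complex "cochains A Q" "codiff Q G"
 by (rule cochains_complex[OF g.T.chain_complex_axioms A])

lemma pull_closed: "\<psi> \<in> carrier (cochains A Q n) ==> pull n \<psi> \<in> carrier (cochains A P n)"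
 unfolding pull_def by (rule pull_cochain[OF _ across_additive across_closed])

lemma pull_hom: "pull n \<in> hom (cochains A Q n) (cochains A P n)"
proof -
 have "pull n (\<phi> \<otimes>\<^bsub>cochains A Q n\<^esub> \<psi>) = pull n \<phi> \<otimes>\<^bsub>cochains A P n\<^esub> pull n \<psi>" for \<phi> \<psi>
  by (rule extensionalityI[of _ "frees (P n)"]) (simp_all add: pull_def cochains_ext cochains_mult across_closed)
 then show ?thesis using pull_closed by (auto simp: hom_def)
qed

lemma pull_codiff: "pull (Suc n) (codiff Q G n \<psi>) = codiff P E n (pull n \<psi>)"
 by (rule extensionalityI[of _ "frees (P (Suc n))"])
  (simp_all add: pull_def codiff_def across_closed across_commutes f.T.D_closed)

lemma pull_one: "pull n \<one>\<^bsub>cochains A Q n\<^esub> = \<one>\<^bsub>cochains A P n\<^esub>"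
 by (rule hom_one[OF pull_hom Q.is_group P.is_group])

lemma pull_cocycles: "\<psi> \<in> Q.cocycles n ==> pull n \<psi> \<in> P.cocycles n"
 by (simp add: kernel_def pull_closed pull_one flip: pull_codiff)

lemma pull_coboundaries: "\<psi> \<in> coboundaries (cochains A Q) (codiff Q G) n ==> pull n \<psi> \<in> coboundaries (cochains A P) (codiff P E) n"
 by (cases n) (auto simp: coboundaries_def pull_closed pull_codiff pull_one)

text \<open>A cocycle that is pulled back along the span and returned differs from the original by the coboundary
 of its composite with the homotopy.\<close>

lemma pull_back:
 assumes z: "z \<in> P.cocycles n"
 shows "\<exists>b\<in>coboundaries (cochains A P) (codiff P E) n.
  restrict (%c. z (f (g.sect n (across n c)))) (frees (P n)) = z \<otimes>\<^bsub>cochains A P n\<^esub> b"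
proof -
 interpret A: comm_group A by (rule A)
 have zc: "z \<in> carrier (cochains A P n)" and zE: "codiff P E n z = \<one>\<^bsub>cochains A P (Suc n)\<^esub>"
  using z by (auto simp: kernel_def)
 note zi = zc[unfolded cochains_iff]
 have zE': "z (E c) = \<one>\<^bsub>A\<^esub>" if "c \<in> frees (P (Suc n))" for c
  using fun_cong[OF zE, of c] that by (simp add: codiff_def cochains_one)
 show ?thesis
 proof (cases n)
  case 0
  have "restrict (%c. z (f (g.sect n (across n c)))) (frees (P n)) = z \<otimes>\<^bsub>cochains A P n\<^esub> \<one>\<^bsub>cochains A P n\<^esub>"
  proof (rule extensionalityI[of _ "frees (P n)"])
   fix c assume c: "c \<in> frees (P n)"
   have "z (c + E (across_homotopy 0 c)) = z c \<otimes>\<^bsub>A\<^esub> \<one>\<^bsub>A\<^esub>"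
    using zi c zE'[of "across_homotopy 0 c"] across_homotopy_closed[of c 0] f.T.D_closed 0 by metis
   then show "restrict (%c. z (f (g.sect n (across n c)))) (frees (P n)) c = (z \<otimes>\<^bsub>cochains A P n\<^esub> \<one>\<^bsub>cochains A P n\<^esub>) c"
    using c across_back_0[of c] 0 by (simp add: cochains_mult cochains_one)
  qed (simp_all add: cochains_ext)
  then show ?thesis using 0 by (intro bexI[of _ "\<one>\<^bsub>cochains A P n\<^esub>"]) (auto simp: coboundaries_def)
 next
  case (Suc m)
  let ?y = "restrict (%c. z (across_homotopy m c)) (frees (P m))"
  have y: "?y \<in> carrier (cochains A P m)"
   by (rule pull_cochain[OF zc across_homotopy_additive]) (use across_homotopy_closed Suc in auto)
  have "restrict (%c. z (f (g.sect n (across n c)))) (frees (P n)) = z \<otimes>\<^bsub>cochains A P n\<^esub> codiff P E m ?y"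
  proof (rule extensionalityI[of _ "frees (P n)"])
   fix c assume c: "c \<in> frees (P n)"
   have k: "across_homotopy n c \<in> frees (P (Suc n))" "E c \<in> frees (P m)" "across_homotopy m (E c) \<in> frees (P n)"
    using across_homotopy_closed[OF c] f.T.D_closed[of c m] across_homotopy_closed[of "E c" m] c Suc by auto
   have "z (c + E (across_homotopy n c) + across_homotopy m (E c)) = z c \<otimes>\<^bsub>A\<^esub> \<one>\<^bsub>A\<^esub> \<otimes>\<^bsub>A\<^esub> z (across_homotopy m (E c))"
    using zi c k f.T.D_closed[OF k(1)] zE'[OF k(1)] by (metis frees_add)
   then have "z (f (g.sect n (across n c))) = z c \<otimes>\<^bsub>A\<^esub> z (across_homotopy m (E c))"
    using across_back_Suc[of c m] c Suc zi by simp
   then show "restrict (%c. z (f (g.sect n (across n c)))) (frees (P n)) c = (z \<otimes>\<^bsub>cochains A P n\<^esub> codiff P E m ?y) c"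
    using c k Suc by (simp add: cochains_mult codiff_def)
  qed (simp_all add: cochains_ext)
  then show ?thesis using y Suc by (intro bexI[of _ "codiff P E m ?y"]) (auto simp: coboundaries_def)
 qed
qed

end

end

lemma (in trivial_fibration_span) cohomology_span:
 assumes A: "comm_group A"
 shows "cohomology (cochains A P) (codiff P E) n \<cong> cohomology (cochains A Q) (codiff Q G) n"
proof -
 interpret B: trivial_fibration_span S D Q G g P E f by (rule swapped)
 interpret P: cochain_complex "cochains A P" "codiff P E" by (rule cochains_complex[OF f.T.chain_complex_axioms A])
 interpret Q: cochain_complex "cochains A Q" "codiff Q G" by (rule cochains_complex[OF g.T.chain_complex_axioms A])
 let ?BP = "coboundaries (cochains A P) (codiff P E) n" and ?BQ = "coboundaries (cochains A Q) (codiff Q G) n"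
 have PQ: "\<exists>b\<in>?BP. pull n (B.pull n z) = z \<otimes>\<^bsub>cochains A P n\<^esub> b" if "z \<in> P.cocycles n" for z
 proof -
  have "pull n (B.pull n z) = restrict (%c. z (f (g.sect n (across n c)))) (frees (P n))"
   by (rule extensionalityI[of _ "frees (P n)"]) (simp_all add: pull_def B.pull_def B.across_def across_closed)
  then show ?thesis using pull_back[OF A that] by simp
 qed
 have QP: "\<exists>b\<in>?BQ. B.pull n (pull n z) = z \<otimes>\<^bsub>cochains A Q n\<^esub> b" if "z \<in> Q.cocycles n" for z
 proof -
  have "B.pull n (pull n z) = restrict (%c. z (g (f.sect n (B.across n c)))) (frees (Q n))"
   by (rule extensionalityI[of _ "frees (Q n)"]) (simp_all add: pull_def B.pull_def across_def B.across_closed)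
  then show ?thesis using B.pull_back[OF A that] by simp
 qed
 have Pc: "z \<in> carrier (cochains A P n)" if "z \<in> P.cocycles n" for z using that by (simp add: kernel_def)
 have Qc: "z \<in> carrier (cochains A Q n)" if "z \<in> Q.cocycles n" for z using that by (simp add: kernel_def)
 interpret PG: comm_group "cochains A P n" by (rule P.group)
 interpret QG: comm_group "cochains A Q n" by (rule Q.group)
 note bP = subgroup.mem_carrier[OF P.coboundaries_subgroup] and bQ = subgroup.mem_carrier[OF Q.coboundaries_subgroup]
 show ?thesis
 proof (rule cohomology_iso[OF P.cochain_complex_axioms Q.cochain_complex_axioms B.pull_hom[OF A]])
  show "B.pull n z \<in> Q.cocycles n" if "z \<in> P.cocycles n" for z using B.pull_cocycles[OF A that] .
  show "B.pull n z \<in> ?BQ \<longleftrightarrow> z \<in> ?BP" if z: "z \<in> P.cocycles n" for z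
  proof
   assume "B.pull n z \<in> ?BQ"
   then have "pull n (B.pull n z) \<in> ?BP" by (rule pull_coboundaries[OF A])
   moreover obtain b where b: "b \<in> ?BP" "pull n (B.pull n z) = z \<otimes>\<^bsub>cochains A P n\<^esub> b" using PQ[OF z] by blast
   moreover have "z = (z \<otimes>\<^bsub>cochains A P n\<^esub> b) \<otimes>\<^bsub>cochains A P n\<^esub> inv\<^bsub>cochains A P n\<^esub> b"
    using Pc[OF z] bP[OF b(1)] by (simp add: PG.m_assoc)
   ultimately show "z \<in> ?BP"
    using subgroup.m_closed[OF P.coboundaries_subgroup] subgroup.m_inv_closed[OF P.coboundaries_subgroup] by metis
  qed (rule B.pull_coboundaries[OF A])
  show "\<exists>z\<in>P.cocycles n. \<exists>b\<in>?BQ. z' = b \<otimes>\<^bsub>cochains A Q n\<^esub> B.pull n z" if z': "z' \<in> Q.cocycles n" for z'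
  proof -
   obtain b where b: "b \<in> ?BQ" "B.pull n (pull n z') = z' \<otimes>\<^bsub>cochains A Q n\<^esub> b" using QP[OF z'] by blast
   have "z' = inv\<^bsub>cochains A Q n\<^esub> b \<otimes>\<^bsub>cochains A Q n\<^esub> (z' \<otimes>\<^bsub>cochains A Q n\<^esub> b)"
    using Qc[OF z'] bQ[OF b(1)] by (simp add: QG.m_lcomm[of "inv\<^bsub>cochains A Q n\<^esub> b" z' b])
   then show ?thesis
    using b subgroup.m_inv_closed[OF Q.coboundaries_subgroup b(1)] pull_cocycles[OF A z'] by metis
  qed
 qed
qed

text \<open>A family of groups with differentials inherits the structure of a cochain complex along levelwise
 isomorphisms that respect the differentials. In this way the coboundary of Quillen cochains need not
 be shown to be a homomorphism of square zero by itself.\<close>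

lemma cochain_complex_transfer:
 assumes C': "cochain_complex C' d'" and C: "\<And>n. comm_group (C n)"
  and closed: "\<And>n x. x \<in> carrier (C n) ==> d n x \<in> carrier (C (Suc n))"
  and iso: "\<And>n. \<alpha> n \<in> iso (C n) (C' n)"
  and comm: "\<And>n x. x \<in> carrier (C n) ==> \<alpha> (Suc n) (d n x) = d' n (\<alpha> n x)"
 shows "cochain_complex C d"
proof -
 interpret C': cochain_complex C' d' by fact
 have G: "Group.group (C n)" for n using C comm_group_def by blast
 have bij: "bij_betw (\<alpha> n) (carrier (C n)) (carrier (C' n))" and hom: "\<alpha> n \<in> hom (C n) (C' n)" for n
  using iso[of n] by (auto simp: iso_def)
 have inj: "\<alpha> n x = \<alpha> n y ==> x \<in> carrier (C n) ==> y \<in> carrier (C n) ==> x = y" for n x y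
  using bij[of n] by (auto simp: bij_betw_def inj_on_def)
 have ac: "\<alpha> n x \<in> carrier (C' n)" if "x \<in> carrier (C n)" for n x using bij_betwE[OF bij] that by blast
 have mc: "x \<otimes>\<^bsub>C n\<^esub> y \<in> carrier (C n)" if "x \<in> carrier (C n)" "y \<in> carrier (C n)" for n x y
  using monoid.m_closed[OF Group.group.is_monoid[OF G[of n]] that] .
 have oc: "\<one>\<^bsub>C n\<^esub> \<in> carrier (C n)" for n using monoid.one_closed[OF Group.group.is_monoid[OF G[of n]]] .
 show ?thesis
 proof (rule cochain_complex.intro)
  show "comm_group (C n)" for n by (rule C)
  show "d n \<in> hom (C n) (C (Suc n))" for n
  proof (rule homI)
   fix x y assume x: "x \<in> carrier (C n)" and y: "y \<in> carrier (C n)"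
   show "d n x \<in> carrier (C (Suc n))" by (rule closed[OF x])
   have "\<alpha> (Suc n) (d n (x \<otimes>\<^bsub>C n\<^esub> y)) = \<alpha> (Suc n) (d n x \<otimes>\<^bsub>C (Suc n)\<^esub> d n y)"
    unfolding comm[OF mc[OF x y]] hom_mult[OF hom x y] hom_mult[OF hom closed[OF x] closed[OF y]]
     hom_mult[OF C'.d_hom ac[OF x] ac[OF y]] comm[OF x] comm[OF y] ..
   then show "d n (x \<otimes>\<^bsub>C n\<^esub> y) = d n x \<otimes>\<^bsub>C (Suc n)\<^esub> d n y"
    by (rule inj) (intro closed mc x y)+
  qed
  fix n x assume x: "x \<in> carrier (C n)"
  have "\<alpha> (Suc (Suc n)) (d (Suc n) (d n x)) = \<alpha> (Suc (Suc n)) \<one>\<^bsub>C (Suc (Suc n))\<^esub>"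
   unfolding comm[OF closed[OF x]] comm[OF x] C'.d_d[OF ac[OF x]] hom_one[OF hom G C'.is_group] ..
  then show "d (Suc n) (d n x) = \<one>\<^bsub>C (Suc (Suc n))\<^esub>" by (rule inj) (intro closed x oc)+
 qed
qed

lemma cohomology_iso_transfer:
 assumes C': "cochain_complex C' d'" and C: "\<And>n. comm_group (C n)"
  and closed: "\<And>n x. x \<in> carrier (C n) ==> d n x \<in> carrier (C (Suc n))"
  and iso: "\<And>n. \<alpha> n \<in> iso (C n) (C' n)"
  and comm: "\<And>n x. x \<in> carrier (C n) ==> \<alpha> (Suc n) (d n x) = d' n (\<alpha> n x)"
 shows "cohomology C d n \<cong> cohomology C' d' n"
 by (rule cohomology_iso_levelwise[where \<alpha> = \<alpha>, OF cochain_complex_transfer[where \<alpha> = \<alpha>, OF assms] C' iso comm])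

section \<open>Quandle cochains\<close>

context quandle
begin

abbreviation normalize :: "('a list \<Rightarrow>\<^sub>0 int) => ('a list \<Rightarrow>\<^sub>0 int)" where
 "normalize \<equiv> Nmap (%x. x)"

lemma rack_boundary_Cons:
 "rack_boundary X (Suc n) (frag_of (x # xs))
  = frag_of (map (lact X x) xs) - frag_of xs - flin (Cons x) (rack_boundary X n (frag_of xs))"
proof -
 have 1: "(\<Sum>j=1..m. f j) = (\<Sum>k<m. f (Suc k))" for f :: "nat => ('a list \<Rightarrow>\<^sub>0 int)" and m
  unfolding One_nat_def by (rule sum.atLeast1_atMost_eq)
 have s: "(\<Sum>j=1..Suc n. f j) = f (Suc 0) + (\<Sum>k<n. f (Suc (Suc k)))" "(\<Sum>j=1..n. f j) = (\<Sum>k<n. f (Suc k))"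
  for f :: "nat => ('a list \<Rightarrow>\<^sub>0 int)"
  by (simp_all only: 1 sum.lessThan_Suc_shift)
 have neg: "frag_cmul (- k) z = - frag_cmul k z" for k and z :: "'a list \<Rightarrow>\<^sub>0 int"
  by (rule poly_mapping_eqI) simp
 have neg_sum: "(\<Sum>k<n. frag_cmul (- g k) (z k)) = - (\<Sum>k<n. frag_cmul (g k) (z k))"
  for g and z :: "nat => ('a list \<Rightarrow>\<^sub>0 int)"
  by (simp only: neg sum_negf)
 show ?thesis
  unfolding rack_boundary_def frag_extend_of s
  by (simp add: delta0_def delta1_def frag_extend_diff frag_extend_sum frag_extend_cmul o_def neg_sum)
qed

lemma normalize_flin_Cons: "normalize (flin (Cons x) c) = Ncons x (normalize c)"
 by (rule additive_map_eqI[where S = UNIV and c = c and f = "%c. normalize (flin (Cons x) c)" and g = "%c. Ncons x (normalize c)"])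
  (auto simp: frees_def additive_ff nmap_Cons)

lemma nmap_in_ntuples: "set xs \<subseteq> carrier X ==> nmap (%x. x) xs \<in> frees (ntuples_of X (length xs))"
 by (auto simp: nmap_def ntuples_of_def ntuples_def)

text \<open>Normalization commutes with the boundary by induction on the length of the tuple: both sides satisfy
 the same recursion for prepending an entry, on normalized chains because of \<open>x \<rhd> x = x\<close>.\<close>

lemma normalize_boundary_tuple:
 "set xs \<subseteq> carrier X ==> normalize (rack_boundary X (length xs) (frag_of xs)) = Nbd X (nmap (%x. x) xs)"
proof (induction xs)
 case Nil
 then show ?case by (simp add: rack_boundary_def)
next
 case (Cons x xs)
 then have x: "x \<in> carrier X" and c: "nmap (%x. x) xs \<in> frees (ntuples X)"
  using nmap_in_ntuples[of xs] frees_ntuples_of by auto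
 have "nmap (%x. x) (map (lact X x) xs) = Nmap (lact X x) (nmap (%x. x) xs)"
  by (auto simp: Nmap_nmap o_def nmap_def dest: distinct_adj_mapD)
 then show ?case
  using Cons by (simp add: rack_boundary_Cons frag_extend_diff normalize_flin_Cons nmap_Cons[of _ x] Nbd_Ncons[OF x c])
qed

lemma rack_boundary_additive: "additive_map (rack_boundary X n)"
 unfolding rack_boundary_def by (intro additive_map_minus_map additive_map_frag_extend)

lemma normalize_boundary:
 assumes "c \<in> frees (tuples X n)"
 shows "normalize (rack_boundary X n c) = Nbd X (normalize c)"
 by (rule additive_map_eqI[OF assms, where f = "%c. normalize (rack_boundary X n c)" and g = "%c. Nbd X (normalize c)"])
  (use normalize_boundary_tuple in \<open>auto simp: additive_ff tuples_def intro!: additive_map_comp[OF additive_map_frag_extend rack_boundary_additive]\<close>)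

lemma rack_boundary_closed:
 assumes "c \<in> frees (tuples X (Suc n))"
 shows "rack_boundary X (Suc n) c \<in> frees (tuples X n)"
proof (rule additive_map_closedI[OF assms rack_boundary_additive])
 have *: "set xs \<subseteq> carrier X ==> length xs = m ==> rack_boundary X m (frag_of xs) \<in> frees (tuples X (m - 1))" for xs m
 proof (induction xs arbitrary: m)
  case Nil
  then show ?case by (simp add: rack_boundary_def)
 next
  case (Cons x xs)
  then obtain k where k: "m = Suc k" "length xs = k" by auto
  have xs: "xs \<in> tuples X k" "map (lact X x) xs \<in> tuples X k" using Cons.prems k by (auto simp: tuples_def)
  have fl: "flin (Cons x) (rack_boundary X k (frag_of xs)) \<in> frees (tuples X k)"
  proof (cases k)
   case 0
   then show ?thesis by (simp add: rack_boundary_def)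
  next
   case (Suc l)
   then show ?thesis using Cons.IH[of k] Cons.prems k
    by (intro flin_closed[where S = "tuples X l"]) (auto simp: tuples_def)
  qed
  show ?case unfolding k(1) rack_boundary_Cons diff_Suc_1
   by (intro frees_diff fl) (simp_all add: xs)
 qed
 show "rack_boundary X (Suc n) (frag_of xs) \<in> frees (tuples X n)" if "xs \<in> tuples X (Suc n)" for xs
  using *[of xs "Suc n"] that by (simp add: tuples_def)
qed

lemma normalize_closed_tuples: "c \<in> frees (tuples X n) ==> normalize c \<in> frees (ntuples_of X n)"
 by (erule additive_map_closedI) (use nmap_in_ntuples in \<open>auto simp: tuples_def\<close>)

lemma ntuples_tuples: "c \<in> frees (ntuples_of X n) ==> c \<in> frees (tuples X n)"
 by (erule frees_mono) (auto simp: ntuples_of_def ntuples_def tuples_def)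

lemma normalize_ntuples: "c \<in> frees (ntuples_of X n) ==> normalize c = c"
 by (rule Nmap_id[where f = "%x. x"]) (auto dest: frees_ntuples_of)

lemma group_CR: "Group.group (CR X n)" and carrier_CR: "carrier (CR X n) = frees (tuples X n)"
 and mult_CR: "x \<otimes>\<^bsub>CR X n\<^esub> y = x + y" and one_CR: "\<one>\<^bsub>CR X n\<^esub> = 0"
 by (simp_all add: CR_def carrier_free_frees)

lemma inv_CR: "x \<in> frees (tuples X n) ==> inv\<^bsub>CR X n\<^esub> x = - x"
 by (rule Group.group.inv_equality[OF group_CR]) (simp_all add: mult_CR one_CR carrier_CR frees_minus)

text \<open>Normalization is the identity on tuples without equal neighbours and annihilates the other tuples, so
 its kernel is the subgroup generated by the degenerate tuples.\<close>

lemma CD_eq: "CD X n = {c \<in> frees (tuples X n). normalize c = 0}" (is "_ = ?N")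
proof
 let ?S = "frag_of ` {xs \<in> tuples X n. \<exists>i. Suc i < n & xs ! i = xs ! Suc i}"
 interpret G: Group.group "CR X n" by (rule group_CR)
 have S: "?S \<subseteq> carrier (CR X n)" by (auto simp: carrier_CR)
 have dist: "(\<exists>i. Suc i < n & xs ! i = xs ! Suc i) \<longleftrightarrow> \<not> distinct_adj xs" if "xs \<in> tuples X n" for xs
  using that by (auto simp: tuples_def distinct_adj_conv_nth)
 have N: "subgroup ?N (CR X n)"
 proof (rule G.subgroupI)
  show "?N \<subseteq> carrier (CR X n)" by (simp add: carrier_CR Collect_mono_iff subset_iff)
  have "0 \<in> ?N" by simp
  then show "?N \<noteq> {}" by blast
  show "inv\<^bsub>CR X n\<^esub> a \<in> ?N" if "a \<in> ?N" for a
   using that by (simp add: inv_CR frag_extend_minus frees_minus)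
  show "a \<otimes>\<^bsub>CR X n\<^esub> b \<in> ?N" if "a \<in> ?N" "b \<in> ?N" for a b
   using that by (simp add: mult_CR frag_extend_add frees_add)
 qed
 show "CD X n \<subseteq> ?N"
  unfolding CD_def
 proof (rule G.generate_subgroup_incl[OF _ N], rule image_subsetI)
  fix xs assume "xs \<in> {xs \<in> tuples X n. \<exists>i. Suc i < n & xs ! i = xs ! Suc i}"
  then have xs: "xs \<in> tuples X n" "\<not> distinct_adj xs" using dist[of xs] by blast+
  then show "frag_of xs \<in> ?N" by (simp add: nmap_def)
 qed
 have sub: "subgroup (CD X n) (CR X n)" unfolding CD_def by (rule G.generate_is_subgroup[OF S])
 have "c - normalize c \<in> CD X n" if "c \<in> frees (tuples X n)" for c
  using that
 proof (induction rule: frees_induct)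
  case zero
  then show ?case using subgroup.one_closed[OF sub] by (simp add: one_CR)
 next
  case (of xs)
  show ?case
  proof (cases "distinct_adj xs")
   case True
   then show ?thesis using subgroup.one_closed[OF sub] by (simp add: one_CR nmap_def)
  next
   case False
   then have "frag_of xs \<in> CD X n" unfolding CD_def using of dist[OF of] by (intro generate.incl) auto
   then show ?thesis using False by (simp add: nmap_def)
  qed
 next
  case (diff a b)
  have "inv\<^bsub>CR X n\<^esub> (b - normalize b) = - (b - normalize b)"
   using subgroup.mem_carrier[OF sub diff(2)] by (simp add: carrier_CR inv_CR)
  then have m: "(a - normalize a) + - (b - normalize b) \<in> CD X n"
   using subgroup.m_closed[OF sub diff(1) subgroup.m_inv_closed[OF sub diff(2)]] by (simp add: mult_CR)
  have eq: "(a - normalize a) + - (b - normalize b) = a - b - normalize (a - b)"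
   by (simp add: frag_extend_diff)
  show ?case using m unfolding eq .
 qed
 then have d: "c - normalize c \<in> CD X n" if "c \<in> frees (tuples X n)" for c using that by blast
 show "?N \<subseteq> CD X n"
 proof
  fix c assume "c \<in> ?N"
  then have "c \<in> frees (tuples X n)" "normalize c = 0" by simp_all
  then show "c \<in> CD X n" using d[of c] by simp
 qed
qed

lemma normal_CD: "CD X n \<lhd> CR X n"
proof -
 interpret G: Group.group "CR X n" by (rule group_CR)
 have "comm_group (CR X n)" unfolding CR_def by (rule abelian_free_Abelian_group)
 moreover have "subgroup (CD X n) (CR X n)"
  unfolding CD_def by (rule G.generate_is_subgroup) (auto simp: carrier_CR)
 ultimately show ?thesis by (simp add: comm_group.normal_iff_subgroup)
qed

abbreviation coset :: "nat => ('a list \<Rightarrow>\<^sub>0 int) => ('a list \<Rightarrow>\<^sub>0 int) set" where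
 "coset n c \<equiv> CD X n #>\<^bsub>CR X n\<^esub> c"

lemma in_coset: "c \<in> frees (tuples X n) ==> c' \<in> coset n c \<longleftrightarrow> c' \<in> frees (tuples X n) & normalize c' = normalize c"
proof
 assume c: "c \<in> frees (tuples X n)" and "c' \<in> frees (tuples X n) & normalize c' = normalize c"
 then have "c' - c \<in> CD X n" by (auto simp: CD_eq frag_extend_diff)
 moreover have "c' = (c' - c) + c" by simp
 ultimately show "c' \<in> coset n c" unfolding r_coset_def mult_CR by blast
qed (auto simp: r_coset_def mult_CR CD_eq frag_extend_add)

lemma coset_eqI:
 assumes "a \<in> frees (tuples X n)" "b \<in> frees (tuples X n)" "normalize a = normalize b"
 shows "coset n a = coset n b"
 using assms by (intro Set.set_eqI) (simp add: in_coset)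

lemma carrier_CQ: "carrier (CQ X n) = coset n ` frees (tuples X n)"
 by (auto simp: CQ_def carrier_FactGroup carrier_CR)

lemma group_CQ: "Group.group (CQ X n)"
 unfolding CQ_def by (rule normal.factorgroup_is_group[OF normal_CD])

lemma mult_CQ:
 "a \<in> frees (tuples X n) ==> b \<in> frees (tuples X n) ==> coset n a \<otimes>\<^bsub>CQ X n\<^esub> coset n b = coset n (a + b)"
 using normal.rcos_sum[OF normal_CD, of a n b] by (simp add: CQ_def FactGroup_def carrier_CR mult_CR)

lemma quandle_boundary_coset:
 assumes c: "c \<in> frees (tuples X (Suc n))"
 shows "quandle_boundary X n (coset (Suc n) c) = coset n (rack_boundary X (Suc n) c)"
proof -
 have "coset n (rack_boundary X (Suc n) c') = coset n (rack_boundary X (Suc n) c)" if "c' \<in> coset (Suc n) c" for c'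
  using that in_coset[OF c] normalize_boundary rack_boundary_closed c by (intro coset_eqI) auto
 moreover have "c \<in> coset (Suc n) c" using in_coset[OF c] c by simp
 ultimately show ?thesis unfolding quandle_boundary_def by blast
qed

context
 fixes A :: "('v, 'w) monoid_scheme"
 assumes A: "comm_group A"
begin

abbreviation "RX n \<equiv> ntuples_of X (Suc n)"

definition normal_cochain :: "nat => (('a list \<Rightarrow>\<^sub>0 int) set => 'v) => (('a list \<Rightarrow>\<^sub>0 int) => 'v)" where
 "normal_cochain n f = restrict (%c. f (coset (Suc n) c)) (frees (RX n))"

lemma quandle_cochain_D:
 assumes "f \<in> carrier (quandle_cochains X A n)"
 shows "c \<in> frees (tuples X n) ==> f (coset n c) \<in> carrier A"
  and "a \<in> frees (tuples X n) ==> b \<in> frees (tuples X n) ==> f (coset n (a + b)) = f (coset n a) \<otimes>\<^bsub>A\<^esub> f (coset n b)"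
  and "f \<in> extensional (carrier (CQ X n))"
proof -
 have f: "f \<in> hom (CQ X n) A" and ext: "f \<in> extensional (carrier (CQ X n))"
  using assms by (simp_all add: quandle_cochains_def hom_group_simps)
 show "c \<in> frees (tuples X n) ==> f (coset n c) \<in> carrier A" using hom_carrier[OF f] carrier_CQ by blast
 show "f \<in> extensional (carrier (CQ X n))" by (rule ext)
 assume a: "a \<in> frees (tuples X n)" and b: "b \<in> frees (tuples X n)"
 have "coset n a \<in> carrier (CQ X n)" "coset n b \<in> carrier (CQ X n)" using a b carrier_CQ by blast+
 from hom_mult[OF f this] show "f (coset n (a + b)) = f (coset n a) \<otimes>\<^bsub>A\<^esub> f (coset n b)"
  unfolding mult_CQ[OF a b] .
qed

lemma quandle_cochain_I:
 assumes "\<And>c. c \<in> frees (tuples X n) ==> \<phi> (normalize c) \<in> carrier A"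
  and "\<And>a b. a \<in> frees (tuples X n) ==> b \<in> frees (tuples X n) ==> \<phi> (normalize a + normalize b) = \<phi> (normalize a) \<otimes>\<^bsub>A\<^esub> \<phi> (normalize b)"
 shows "\<exists>f\<in>carrier (quandle_cochains X A n). \<forall>c\<in>frees (tuples X n). f (coset n c) = \<phi> (normalize c)"
proof -
 let ?f = "restrict (%K. \<phi> (normalize (SOME c. c \<in> K))) (carrier (CQ X n))"
 have f: "?f (coset n c) = \<phi> (normalize c)" if c: "c \<in> frees (tuples X n)" for c
 proof -
  have "(SOME c'. c' \<in> coset n c) \<in> coset n c" by (rule someI[of _ c]) (simp add: in_coset[OF c] c)
  then show ?thesis using c in_coset[OF c] by (simp add: carrier_CQ)
 qed
 have "?f \<in> carrier (quandle_cochains X A n)"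
  unfolding quandle_cochains_def
 proof (rule hom_group_I[OF group_CQ])
  fix K L assume "K \<in> carrier (CQ X n)" "L \<in> carrier (CQ X n)"
  then obtain a b where ab: "a \<in> frees (tuples X n)" "K = coset n a" "b \<in> frees (tuples X n)" "L = coset n b"
   unfolding carrier_CQ by blast
  have K: "K \<in> carrier (CQ X n)" "L \<in> carrier (CQ X n)" "coset n (a + b) \<in> carrier (CQ X n)" using ab frees_add by (auto simp: carrier_CQ)
  note f1 = f[unfolded restrict_def]
  show "\<phi> (normalize (SOME c. c \<in> K)) \<in> carrier A"
   using f[OF ab(1)] assms(1)[OF ab(1)] K ab(2) by simp
  show "\<phi> (normalize (SOME c. c \<in> K \<otimes>\<^bsub>CQ X n\<^esub> L)) = \<phi> (normalize (SOME c. c \<in> K)) \<otimes>\<^bsub>A\<^esub> \<phi> (normalize (SOME c. c \<in> L))"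
   using f[OF ab(1)] f[OF ab(3)] f[OF frees_add[OF ab(1,3)]] assms(2)[OF ab(1,3)] K ab(2,4) mult_CQ[OF ab(1,3)]
   by (simp add: frag_extend_add)
 qed
 then show ?thesis using f by (intro bexI[of _ ?f]) simp_all
qed

lemma normal_cochain_closed:
 assumes f: "f \<in> carrier (quandle_cochains X A (Suc n))"
 shows "normal_cochain n f \<in> carrier (cochains A RX n)"
 unfolding cochains_iff
proof (intro conjI ballI)
 show "normal_cochain n f \<in> extensional (frees (RX n))" by (simp add: normal_cochain_def)
 fix x assume x: "x \<in> frees (RX n)"
 show "normal_cochain n f x \<in> carrier A"
  using quandle_cochain_D(1)[OF f ntuples_tuples[OF x]] x by (simp add: normal_cochain_def)
 fix y assume y: "y \<in> frees (RX n)"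
 show "normal_cochain n f (x + y) = normal_cochain n f x \<otimes>\<^bsub>A\<^esub> normal_cochain n f y"
  using quandle_cochain_D(2)[OF f ntuples_tuples[OF x] ntuples_tuples[OF y]] x y frees_add[OF x y]
  by (simp add: normal_cochain_def)
qed

lemma normal_cochain_normalize:
 assumes "c \<in> frees (tuples X (Suc n))"
 shows "normal_cochain n f (normalize c) = f (coset (Suc n) c)"
proof -
 have "normalize (normalize c) = normalize c" by (rule normalize_ntuples[OF normalize_closed_tuples[OF assms]])
 then have "coset (Suc n) (normalize c) = coset (Suc n) c"
  using ntuples_tuples[OF normalize_closed_tuples[OF assms]] assms by (intro coset_eqI)
 then show ?thesis using normalize_closed_tuples[OF assms] by (simp add: normal_cochain_def)
qed

lemma normal_cochain_iso: "normal_cochain n \<in> iso (quandle_cochains X A (Suc n)) (cochains A RX n)"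
proof -
 have hom: "normal_cochain n \<in> hom (quandle_cochains X A (Suc n)) (cochains A RX n)"
 proof (rule homI[OF normal_cochain_closed])
  fix f g
  have "(f \<otimes>\<^bsub>quandle_cochains X A (Suc n)\<^esub> g) (coset (Suc n) c) = f (coset (Suc n) c) \<otimes>\<^bsub>A\<^esub> g (coset (Suc n) c)"
   if "c \<in> frees (RX n)" for c
   using ntuples_tuples[OF that] by (simp add: quandle_cochains_def hom_group_simps carrier_CQ)
  then show "normal_cochain n (f \<otimes>\<^bsub>quandle_cochains X A (Suc n)\<^esub> g) = normal_cochain n f \<otimes>\<^bsub>cochains A RX n\<^esub> normal_cochain n g"
   by (intro extensionalityI[of _ "frees (RX n)"]) (simp_all add: normal_cochain_def cochains_ext[where S = RX] cochains_mult[where S = RX])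
 qed
 have inj: "inj_on (normal_cochain n) (carrier (quandle_cochains X A (Suc n)))"
 proof (rule inj_onI)
  fix f g assume f: "f \<in> carrier (quandle_cochains X A (Suc n))" and g: "g \<in> carrier (quandle_cochains X A (Suc n))"
   and eq: "normal_cochain n f = normal_cochain n g"
  show "f = g"
  proof (rule extensionalityI[OF quandle_cochain_D(3)[OF f] quandle_cochain_D(3)[OF g]])
   fix K assume "K \<in> carrier (CQ X (Suc n))"
   then obtain c where c: "c \<in> frees (tuples X (Suc n))" "K = coset (Suc n) c" unfolding carrier_CQ by blast
   show "f K = g K" unfolding c(2) normal_cochain_normalize[OF c(1), symmetric] eq ..
  qed
 qed
 have surj: "\<exists>f\<in>carrier (quandle_cochains X A (Suc n)). normal_cochain n f = \<phi>" if \<phi>: "\<phi> \<in> carrier (cochains A RX n)" for \<phi>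
 proof -
  note \<phi>' = \<phi>[unfolded cochains_iff]
  have "\<exists>f\<in>carrier (quandle_cochains X A (Suc n)). \<forall>c\<in>frees (tuples X (Suc n)). f (coset (Suc n) c) = \<phi> (normalize c)"
  proof (rule quandle_cochain_I)
   fix a assume a: "a \<in> frees (tuples X (Suc n))"
   note na = normalize_closed_tuples[OF a]
   show "\<phi> (normalize a) \<in> carrier A" using \<phi>' na by simp
   fix b assume b: "b \<in> frees (tuples X (Suc n))"
   show "\<phi> (normalize a + normalize b) = \<phi> (normalize a) \<otimes>\<^bsub>A\<^esub> \<phi> (normalize b)"
    using \<phi>' na normalize_closed_tuples[OF b] by simp
  qed
  then obtain f where f: "f \<in> carrier (quandle_cochains X A (Suc n))"
   "\<And>c. c \<in> frees (tuples X (Suc n)) ==> f (coset (Suc n) c) = \<phi> (normalize c)" by blast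
  have "normal_cochain n f = \<phi>"
  proof (rule extensionalityI[of _ "frees (RX n)"])
   fix c assume c: "c \<in> frees (RX n)"
   show "normal_cochain n f c = \<phi> c"
    using c by (simp add: normal_cochain_def f(2)[OF ntuples_tuples[OF c]] normalize_ntuples[OF c])
  qed (use \<phi>' in \<open>simp_all add: normal_cochain_def\<close>)
  then show ?thesis using f(1) by blast
 qed
 have "normal_cochain n ` carrier (quandle_cochains X A (Suc n)) = carrier (cochains A RX n)"
  using surj normal_cochain_closed by blast
 then show ?thesis using hom inj by (simp add: iso_def bij_betw_def)
qed

lemma quandle_coboundary_coset:
 "c \<in> frees (tuples X (Suc n)) ==> quandle_coboundary X n f (coset (Suc n) c) = f (coset n (rack_boundary X (Suc n) c))"
 by (simp add: quandle_coboundary_def carrier_CQ quandle_boundary_coset)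

lemma quandle_coboundary_closed:
 assumes f: "f \<in> carrier (quandle_cochains X A n)"
 shows "quandle_coboundary X n f \<in> carrier (quandle_cochains X A (Suc n))"
 unfolding quandle_coboundary_def quandle_cochains_def
proof (rule hom_group_I[OF group_CQ])
 note D = quandle_cochain_D[OF f]
 fix K L assume "K \<in> carrier (CQ X (Suc n))" "L \<in> carrier (CQ X (Suc n))"
 then obtain a b where ab: "a \<in> frees (tuples X (Suc n))" "K = coset (Suc n) a" "b \<in> frees (tuples X (Suc n))" "L = coset (Suc n) b"
  unfolding carrier_CQ by blast
 note r = rack_boundary_closed[OF ab(1)] rack_boundary_closed[OF ab(3)]
 show "f (quandle_boundary X n K) \<in> carrier A" using ab(1,2) r(1) D(1) by (simp add: quandle_boundary_coset)
 show "f (quandle_boundary X n (K \<otimes>\<^bsub>CQ X (Suc n)\<^esub> L)) = f (quandle_boundary X n K) \<otimes>\<^bsub>A\<^esub> f (quandle_boundary X n L)"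
  unfolding ab(2,4) mult_CQ[OF ab(1,3)] quandle_boundary_coset[OF ab(1)] quandle_boundary_coset[OF ab(3)]
   quandle_boundary_coset[OF frees_add[OF ab(1,3)]] additive_map_add[OF rack_boundary_additive] by (rule D(2)[OF r])
qed

text \<open>A homomorphism on the quotient by the degenerate chains is determined by its values on the tuples
 without equal neighbours, and these can be prescribed.\<close>

theorem HQ_normalized: "HQ X A (Suc n) \<cong> cohomology (cochains A RX) (codiff RX (Nbd X)) n"
proof -
 have grp: "comm_group (quandle_cochains X A n)" for n
  unfolding quandle_cochains_def by (rule comm_group_hom_group[OF group_CQ A])
 have RX: "chain_complex RX (Nbd X)"
 proof
  show "Nbd X c = 0" if "c \<in> frees (RX 0)" for c
   by (rule additive_map_zeroI[OF that additive_map_frag_extend]) (auto simp: ntuples_of_def length_Suc_conv)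
 qed (auto intro: Nbd_closed Nbd_Nbd frees_ntuples_of)
 have "cohomology (%n. quandle_cochains X A (Suc n)) (%n. quandle_coboundary X (Suc n)) n
   \<cong> cohomology (cochains A RX) (codiff RX (Nbd X)) n"
 proof (rule cohomology_iso_transfer[where \<alpha> = normal_cochain, OF cochains_complex[OF RX A] grp quandle_coboundary_closed normal_cochain_iso])
  fix n f assume f: "f \<in> carrier (quandle_cochains X A (Suc n))"
  show "normal_cochain (Suc n) (quandle_coboundary X (Suc n) f) = codiff RX (Nbd X) n (normal_cochain n f)"
  proof (rule extensionalityI[of _ "frees (RX (Suc n))"])
   fix c assume c: "c \<in> frees (RX (Suc n))"
   note t = ntuples_tuples[OF c]
   have "normal_cochain n f (normalize (rack_boundary X (Suc (Suc n)) c)) = f (coset (Suc n) (rack_boundary X (Suc (Suc n)) c))"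
    by (rule normal_cochain_normalize[OF rack_boundary_closed[OF t]])
   then show "normal_cochain (Suc n) (quandle_coboundary X (Suc n) f) c = codiff RX (Nbd X) n (normal_cochain n f) c"
    using c by (simp add: normal_cochain_def[of "Suc n"] quandle_coboundary_coset[OF t] codiff_def normalize_boundary[OF t] normalize_ntuples[OF c])
  qed (simp_all add: normal_cochain_def codiff_def)
 qed
 moreover have "HQ X A (Suc n) = cohomology (%n. quandle_cochains X A (Suc n)) (%n. quandle_coboundary X (Suc n)) n"
 proof -
  have "coboundaries (quandle_cochains X A) (quandle_coboundary X) (Suc n)
    = coboundaries (%n. quandle_cochains X A (Suc n)) (%n. quandle_coboundary X (Suc n)) n"
  proof (cases n)
   case 0
   have "quandle_coboundary X 0 f = \<one>\<^bsub>quandle_cochains X A (Suc 0)\<^esub>" if f: "f \<in> carrier (quandle_cochains X A 0)" for f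
   proof (rule extensionalityI[of _ "carrier (CQ X (Suc 0))"])
    fix K assume "K \<in> carrier (CQ X (Suc 0))"
    then obtain c where c: "c \<in> frees (tuples X (Suc 0))" "K = coset (Suc 0) c" unfolding carrier_CQ by blast
    interpret AA: comm_group A by (rule A)
    have "normalize (rack_boundary X (Suc 0) c) = 0"
     unfolding normalize_boundary[OF c(1)] using chain_complex.D_bottom[OF RX] normalize_closed_tuples[OF c(1)] by simp
    then have "coset 0 (rack_boundary X (Suc 0) c) = coset 0 0" using rack_boundary_closed[OF c(1)] by (intro coset_eqI) auto
    moreover have "f (coset 0 0) = \<one>\<^bsub>A\<^esub>"
     using quandle_cochain_D(1)[OF f, of 0] quandle_cochain_D(2)[OF f, of 0 0] AA.l_cancel_one[of "f (coset 0 0)" "f (coset 0 0)"] by simp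
    moreover have "\<one>\<^bsub>quandle_cochains X A (Suc 0)\<^esub> K = \<one>\<^bsub>A\<^esub>"
     using c by (simp add: quandle_cochains_def hom_group_simps carrier_CQ)
    ultimately show "quandle_coboundary X 0 f K = \<one>\<^bsub>quandle_cochains X A (Suc 0)\<^esub> K"
     unfolding c(2) by (simp add: quandle_coboundary_coset[OF c(1)])
   qed (simp_all add: quandle_coboundary_def quandle_cochains_def hom_group_simps)
   moreover have "carrier (quandle_cochains X A 0) \<noteq> {}"
    using monoid.one_closed[OF Group.group.is_monoid[OF comm_group.axioms(2)[OF grp[of 0]]]] by blast
   ultimately show ?thesis using 0 by (auto simp: coboundaries_def)
  qed (simp add: coboundaries_def)
  then show ?thesis by (simp add: HQ_def cohomology_def)
 qed
 ultimately show ?thesis by simp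
qed

end

end

section \<open>Quillen cochains\<close>

lemma cochains_add: "\<phi> \<in> carrier (cochains A S n) ==> x \<in> frees (S n) ==> y \<in> frees (S n) ==> \<phi> (x + y) = \<phi> x \<otimes>\<^bsub>A\<^esub> \<phi> y"
 and cochains_closed: "\<phi> \<in> carrier (cochains A S n) ==> x \<in> frees (S n) ==> \<phi> x \<in> carrier A"
 and cochains_extensional: "\<phi> \<in> carrier (cochains A S n) ==> \<phi> \<in> extensional (frees (S n))"
 by (simp_all add: cochains_iff)

lemma cochains_minus:
 assumes A: "comm_group A" and \<phi>: "\<phi> \<in> carrier (cochains A S n)" and x: "x \<in> frees (S n)"
 shows "\<phi> (- x) = inv\<^bsub>A\<^esub> \<phi> x"
proof -
 interpret comm_group A by fact
 have "\<phi> (- x) \<otimes>\<^bsub>A\<^esub> \<phi> x = \<one>\<^bsub>A\<^esub>"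
  using cochains_add[OF \<phi> frees_minus[OF x] x] cochains_zero[OF A \<phi>] by simp
 then show ?thesis
  using inv_equality cochains_closed[OF \<phi> x] cochains_closed[OF \<phi> frees_minus[OF x]] by metis
qed

lemma cochains_eqI:
 assumes A: "comm_group A" and \<phi>: "\<phi> \<in> carrier (cochains A S n)" and \<psi>: "\<psi> \<in> carrier (cochains A S n)"
  and eq: "\<And>x. x \<in> S n ==> \<phi> (frag_of x) = \<psi> (frag_of x)"
 shows "\<phi> = \<psi>"
proof (rule extensionalityI[OF cochains_extensional[OF \<phi>] cochains_extensional[OF \<psi>]])
 fix c assume "c \<in> frees (S n)"
 then have "c \<in> frees (S n) & \<phi> c = \<psi> c"
 proof (induction rule: frees_induct)
  case zero
  show ?case using cochains_zero[OF A \<phi>] cochains_zero[OF A \<psi>] by simp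
 next
  case (of x)
  then show ?case using eq by simp
 next
  case (diff a b)
  then have a: "a \<in> frees (S n)" and b: "b \<in> frees (S n)" by auto
  have "\<phi> (a + - b) = \<psi> (a + - b)"
   unfolding cochains_add[OF \<phi> a frees_minus[OF b]] cochains_add[OF \<psi> a frees_minus[OF b]]
    cochains_minus[OF A \<phi> b] cochains_minus[OF A \<psi> b] using diff by simp
  then show ?case using frees_diff[OF a b] by simp
 qed
 then show "\<phi> c = \<psi> c" by blast
qed

lemma group_pow_sign:
 assumes "Group.group A" "a \<in> carrier A"
 shows "a [^]\<^bsub>A\<^esub> ((-1) ^ i :: int) = (if even i then a else inv\<^bsub>A\<^esub> a)"
proof -
 interpret Group.group A by fact
 have "a [^]\<^bsub>A\<^esub> (1 :: int) = a" using assms(2) by (simp add: int_pow_1)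
 moreover have "a [^]\<^bsub>A\<^esub> (- 1 :: int) = inv\<^bsub>A\<^esub> (a [^]\<^bsub>A\<^esub> (1 :: int))" using assms(2) int_pow_neg[of a 1] by simp
 ultimately show ?thesis by simp
qed

lemma cochains_alternating_sum:
 assumes A: "comm_group A" and \<phi>: "\<phi> \<in> carrier (cochains A S n)" and c: "\<And>i. i \<in> I ==> c i \<in> frees (S n)" and "finite I"
 shows "\<phi> (\<Sum>i\<in>I. frag_cmul ((-1) ^ i) (c i)) = (\<Otimes>\<^bsub>A\<^esub>i\<in>I. \<phi> (c i) [^]\<^bsub>A\<^esub> ((-1) ^ i :: int))"
proof -
 interpret comm_group A by fact
 show ?thesis using \<open>finite I\<close> c
 proof (induction I rule: finite_induct)
  case empty
  then show ?case using cochains_zero[OF A \<phi>] by simp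
 next
  case (insert j I)
  have cj: "c j \<in> frees (S n)" using insert.prems by simp
  have s: "(\<Sum>i\<in>I. frag_cmul ((-1) ^ i) (c i)) \<in> frees (S n)" using insert.prems by (intro frees_sum frees_cmul) simp
  have pc: "\<phi> (c i) [^]\<^bsub>A\<^esub> ((-1) ^ i :: int) \<in> carrier A" if "i \<in> insert j I" for i
   using cochains_closed[OF \<phi> insert.prems[OF that]] by (rule int_pow_closed)
  have sg: "\<phi> (frag_cmul ((-1) ^ j) (c j)) = \<phi> (c j) [^]\<^bsub>A\<^esub> ((-1) ^ j :: int)"
   using cochains_minus[OF A \<phi> cj] group_pow_sign[OF is_group cochains_closed[OF \<phi> cj], of j] by simp
  have "\<phi> (\<Sum>i\<in>insert j I. frag_cmul ((-1) ^ i) (c i))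
    = \<phi> (frag_cmul ((-1) ^ j) (c j) + (\<Sum>i\<in>I. frag_cmul ((-1) ^ i) (c i)))"
   using insert.hyps by simp
  also have "\<dots> = \<phi> (frag_cmul ((-1) ^ j) (c j)) \<otimes>\<^bsub>A\<^esub> \<phi> (\<Sum>i\<in>I. frag_cmul ((-1) ^ i) (c i))"
   by (rule cochains_add[OF \<phi> frees_cmul[OF cj] s])
  also have "\<dots> = \<phi> (c j) [^]\<^bsub>A\<^esub> ((-1) ^ j :: int) \<otimes>\<^bsub>A\<^esub> (\<Otimes>\<^bsub>A\<^esub>i\<in>I. \<phi> (c i) [^]\<^bsub>A\<^esub> ((-1) ^ i :: int))"
   using insert.IH insert.prems sg by simp
  also have "\<dots> = (\<Otimes>\<^bsub>A\<^esub>i\<in>insert j I. \<phi> (c i) [^]\<^bsub>A\<^esub> ((-1) ^ i :: int))"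
   by (rule finprod_insert[symmetric]) (use insert.hyps pc in auto)
  finally show ?case .
 qed
qed

lemma hom_alternating_product:
 assumes G: "comm_group G" and A: "comm_group A" and e: "e \<in> hom G A"
  and f: "\<And>i. i \<in> I ==> f i \<in> carrier G" and "finite I"
 shows "e (\<Otimes>\<^bsub>G\<^esub>i\<in>I. f i [^]\<^bsub>G\<^esub> ((-1) ^ i :: int)) = (\<Otimes>\<^bsub>A\<^esub>i\<in>I. e (f i) [^]\<^bsub>A\<^esub> ((-1) ^ i :: int))"
proof -
 interpret G: comm_group G by fact
 interpret A: comm_group A by fact
 interpret E: group_hom G A e by (simp add: group_hom_def group_hom_axioms_def e G.is_group A.is_group)
 show ?thesis using \<open>finite I\<close> f
 proof (induction I rule: finite_induct)
  case empty
  then show ?case by simp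
 next
  case (insert j I)
  have fc: "f i [^]\<^bsub>G\<^esub> ((-1) ^ i :: int) \<in> carrier G" if "i \<in> insert j I" for i
   using insert.prems[OF that] by (rule G.int_pow_closed)
  have ec: "e (f i) [^]\<^bsub>A\<^esub> ((-1) ^ i :: int) \<in> carrier A" if "i \<in> insert j I" for i
   using E.hom_closed[OF insert.prems[OF that]] by (rule A.int_pow_closed)
  have fj: "f j \<in> carrier G" using insert.prems by simp
  have sg: "e (f j [^]\<^bsub>G\<^esub> ((-1) ^ j :: int)) = e (f j) [^]\<^bsub>A\<^esub> ((-1) ^ j :: int)"
   unfolding group_pow_sign[OF G.is_group fj] group_pow_sign[OF A.is_group E.hom_closed[OF fj]]
   using fj by simp
  have fp: "(\<Otimes>\<^bsub>G\<^esub>i\<in>I. f i [^]\<^bsub>G\<^esub> ((-1) ^ i :: int)) \<in> carrier G" by (rule G.finprod_closed) (use fc in auto)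
  have "e (\<Otimes>\<^bsub>G\<^esub>i\<in>insert j I. f i [^]\<^bsub>G\<^esub> ((-1) ^ i :: int))
    = e (f j [^]\<^bsub>G\<^esub> ((-1) ^ j :: int) \<otimes>\<^bsub>G\<^esub> (\<Otimes>\<^bsub>G\<^esub>i\<in>I. f i [^]\<^bsub>G\<^esub> ((-1) ^ i :: int)))"
   by (rule arg_cong[where f = e], rule G.finprod_insert) (use insert.hyps fc in auto)
  also have "\<dots> = e (f j) [^]\<^bsub>A\<^esub> ((-1) ^ j :: int) \<otimes>\<^bsub>A\<^esub> (\<Otimes>\<^bsub>A\<^esub>i\<in>I. e (f i) [^]\<^bsub>A\<^esub> ((-1) ^ i :: int))"
   using E.hom_mult[OF fc fp] sg insert.IH insert.prems by simp
  also have "\<dots> = (\<Otimes>\<^bsub>A\<^esub>i\<in>insert j I. e (f i) [^]\<^bsub>A\<^esub> ((-1) ^ i :: int))"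
   by (rule A.finprod_insert[symmetric]) (use insert.hyps ec in auto)
  finally show ?case .
 qed
qed

lemma (in cochain_complex) group_cohomology: "Group.group (cohomology C d n)"
 unfolding cohomology_def by (rule normal.factorgroup_is_group[OF coboundaries_normal])

text \<open>The setting of the comparison: every degree of \<open>F\<close> has exact rows, \<open>F\<close> is acyclic over the underlying
 set of \<open>X\<close>, and the augmentation is compatible with the quandle structure.\<close>

locale augmented_resolution = quandle_resolution F X \<epsilon>
 for F :: "('f, 'n) squandle_scheme" and X :: "('x, 'm) magma_scheme" and \<epsilon> :: "nat => 'f => 'x" +
 assumes \<epsilon>_homs: "\<epsilon> n \<in> quandle_hom (level F n) X"
  and \<epsilon>_face: "[|x \<in> simplices F (Suc n); i \<le> Suc n|] ==> \<epsilon> n (face F n i x) = \<epsilon> (Suc n) x"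
begin

lemma over: "quandle_over X (level F n) (\<epsilon> n)"
 by (intro quandle_over.intro base quandle_level quandle_over_axioms.intro \<epsilon>_homs)

abbreviation "Om n \<equiv> Omega X (level F n) (\<epsilon> n)"
abbreviation "unit n x \<equiv> Omega_unit X (level F n) (\<epsilon> n) x"

lemma Om_module: "beck_module X (Om n)"
 by (rule quandle_over.beck_module_Omega[OF over])

lemma unit_slice: "Omega_unit X (level F n) (\<epsilon> n) \<in> slice_hom (level F n) (\<epsilon> n) (Om n) (proj (Om n))"
 by (rule quandle_over.Omega_unit_slice_hom[OF over])

lemma unit_closed: "x \<in> simplices F n ==> unit n x \<in> carrier (Om n)"
 and unit_proj: "x \<in> simplices F n ==> proj (Om n) (unit n x) = \<epsilon> n x"
 and unit_lact: "x \<in> simplices F n ==> y \<in> simplices F n ==> unit n (x \<rhd>\<^bsub>level F n\<^esub> y) = unit n x \<rhd>\<^bsub>Om n\<^esub> unit n y"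
 using unit_slice[of n] by (auto simp: slice_hom_def quandle_hom_def)

context
 fixes A :: "('b, 'k) monoid_scheme"
 assumes A: "comm_group A"
begin

abbreviation "TB \<equiv> trivial_beck A X"
abbreviation "QC n \<equiv> quillen_cochains X F \<epsilon> TB n"

lemma TB_module: "beck_module X TB"
 by (rule beck_module_trivial_beck[OF base A])

lemma QC_iff: "h \<in> carrier (QC n) \<longleftrightarrow> h \<in> beck_hom (Om n) TB & h \<in> extensional (carrier (Om n))"
 by (simp add: quillen_cochains_def beck_hom_group_def cotangent_def)

lemma QC_mult: "a \<in> carrier (Om n) ==> (h \<otimes>\<^bsub>QC n\<^esub> h') a = badd TB (h a) (h' a)"
 by (simp add: quillen_cochains_def beck_hom_group_def cotangent_def)

lemma QC_group: "comm_group (QC n)"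
 unfolding quillen_cochains_def cotangent_def by (rule comm_group_beck_hom_group[OF Om_module TB_module])

text \<open>A morphism of Beck modules over \<open>X\<close> from the cotangent module to the trivial module \<open>A \<times> X\<close> is
 determined by the \<open>A\<close>-components of its values on the universal derivation.\<close>

definition val :: "nat => (('f, 'x) beck_term set => 'b \<times> 'x) => 'f => 'b" where
 "val n h x = fst (h (unit n x))"

lemma val_unit:
 assumes "h \<in> carrier (QC n)" "x \<in> simplices F n"
 shows "h (unit n x) = (val n h x, \<epsilon> n x)" and "val n h x \<in> carrier A"
 using beck_homD(2)[OF conjunct1[OF assms(1)[unfolded QC_iff]] unit_closed[OF assms(2)]] unit_proj[OF assms(2)]
 by (auto simp: val_def prod_eq_iff)

lemma val_lact:
 assumes h: "h \<in> carrier (QC n)" and x: "x \<in> simplices F n" and y: "y \<in> simplices F n"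
 shows "val n h (x \<rhd>\<^bsub>level F n\<^esub> y) = val n h y"
proof -
 have "h (unit n (x \<rhd>\<^bsub>level F n\<^esub> y)) = h (unit n x) \<rhd>\<^bsub>TB\<^esub> h (unit n y)"
  unfolding unit_lact[OF x y]
  by (rule beck_homD(3)[OF conjunct1[OF h[unfolded QC_iff]] unit_closed[OF x] unit_closed[OF y]])
 then have "h (unit n (x \<rhd>\<^bsub>level F n\<^esub> y)) = (val n h y, \<epsilon> n x \<rhd>\<^bsub>X\<^esub> \<epsilon> n y)"
  unfolding val_unit(1)[OF h x] val_unit(1)[OF h y] by simp
 then show ?thesis unfolding val_def[of n h "x \<rhd>\<^bsub>level F n\<^esub> y"] by simp
qed

text \<open>The trivial operation on \<open>A\<close> makes these components invariant under translations.\<close>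

lemma val_orbit:
 assumes h: "h \<in> carrier (QC n)" and "orbit (level F n) x = orbit (level F n) y"
 shows "val n h x = val n h y"
proof (rule orbit_invariant[where f = "val n h" and X = "level F n"])
 show "x \<in> orbit (level F n) y" using orbit_self[of x "level F n"] assms(2) by simp
 show "val n h (u \<rhd>\<^bsub>level F n\<^esub> v) = val n h v" if "u \<in> carrier (level F n)" "v \<in> carrier (level F n)" for u v
  using val_lact[OF h] that by simp
qed

lemma to_TB:
 assumes "\<And>x. x \<in> simplices F n ==> v x \<in> carrier A"
  and "\<And>x y. x \<in> simplices F n ==> y \<in> simplices F n ==> v (x \<rhd>\<^bsub>level F n\<^esub> y) = v y"
 shows "quandle_over_to_beck X (level F n) (\<epsilon> n) TB (%x. (v x, \<epsilon> n x))"
proof (intro quandle_over_to_beck.intro over TB_module quandle_over_to_beck_axioms.intro)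
 show "(%x. (v x, \<epsilon> n x)) \<in> slice_hom (level F n) (\<epsilon> n) TB (proj TB)"
  using assms \<epsilon>_homs[of n] by (auto simp: slice_hom_def quandle_hom_def)
qed

lemma QC_eqI:
 assumes h: "h \<in> carrier (QC n)" and h': "h' \<in> carrier (QC n)" and eq: "\<And>x. x \<in> simplices F n ==> val n h x = val n h' x"
 shows "h = h'"
proof -
 interpret quandle_over_to_beck X "level F n" "\<epsilon> n" TB "%x. (val n h x, \<epsilon> n x)"
  by (rule to_TB) (use val_unit(2)[OF h] val_lact[OF h] in auto)
 show ?thesis
 proof (rule extensionalityI[OF conjunct2[OF h[unfolded QC_iff]] conjunct2[OF h'[unfolded QC_iff]]])
  fix C assume C: "C \<in> carrier (Om n)"
  have "h C = Omega_lift TB (%x. (val n h x, \<epsilon> n x)) C"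
   by (rule Omega_lift_unique[OF conjunct1[OF h[unfolded QC_iff]] _ C]) (use val_unit(1)[OF h] in simp)
  moreover have "h' C = Omega_lift TB (%x. (val n h x, \<epsilon> n x)) C"
   by (rule Omega_lift_unique[OF conjunct1[OF h'[unfolded QC_iff]] _ C]) (use val_unit(1)[OF h'] eq in simp)
  ultimately show "h C = h' C" by simp
 qed
qed

lemma restrict_beck_hom:
 assumes N: "beck_module X N" and h: "h \<in> beck_hom N M"
 shows "restrict h (carrier N) \<in> beck_hom N M"
proof -
 interpret N: beck_module X N by fact
 interpret NQ: quandle N by (rule N.total_quandle)
 show ?thesis using beck_homD[OF h] N.fibre_closed(4)
  by (auto simp: beck_hom_def slice_hom_def quandle_hom_def)
qed

lemma QC_exists:
 assumes "\<And>x. x \<in> simplices F n ==> v x \<in> carrier A"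
  and "\<And>x y. x \<in> simplices F n ==> y \<in> simplices F n ==> v (x \<rhd>\<^bsub>level F n\<^esub> y) = v y"
 shows "\<exists>h\<in>carrier (QC n). \<forall>x\<in>simplices F n. val n h x = v x"
proof -
 interpret quandle_over_to_beck X "level F n" "\<epsilon> n" TB "%x. (v x, \<epsilon> n x)"
  by (rule to_TB[OF assms])
 let ?h = "restrict (Omega_lift TB (%x. (v x, \<epsilon> n x))) (carrier (Om n))"
 have "?h \<in> carrier (QC n)" unfolding QC_iff using restrict_beck_hom[OF Om_module Omega_lift_hom] by simp
 moreover have "val n ?h x = v x" if "x \<in> simplices F n" for x
  using unit_closed[OF that] Omega_lift_unit[of x] that by (simp add: val_def)
 ultimately show ?thesis by blast
qed

text \<open>Invariant functions on a quandle are functions on its orbits, and these are the homomorphisms from the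
 free abelian group on the orbits; the values determine the homomorphism.\<close>

definition orbit_cochain :: "nat => (('f, 'x) beck_term set => 'b \<times> 'x) => (nat \<times> 'f set \<Rightarrow>\<^sub>0 int) => 'b" where
 "orbit_cochain n h = (SOME \<phi>. \<phi> \<in> carrier (cochains A RQ n) \<and>
  (\<forall>x\<in>simplices F n. \<phi> (frag_of (n, orbit (level F n) x)) = val n h x))"

lemma orbit_cochain:
 assumes h: "h \<in> carrier (QC n)"
 shows "orbit_cochain n h \<in> carrier (cochains A RQ n)"
  and "x \<in> simplices F n ==> orbit_cochain n h (frag_of (n, orbit (level F n) x)) = val n h x"
proof -
 interpret A: comm_group A by (rule A)
 have "(%r. val n h (orep n (snd r))) ` RQ n \<subseteq> carrier A"
  using val_unit(2)[OF h] orep by (auto simp: RQ_def)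
 then obtain \<phi> where \<phi>: "\<phi> \<in> hom (free_Abelian_group (RQ n)) A" "\<And>r. r \<in> RQ n ==> \<phi> (frag_of r) = val n h (orep n (snd r))"
  using A.free_Abelian_group_universal by blast
 let ?\<phi> = "restrict \<phi> (frees (RQ n))"
 have "?\<phi> \<in> carrier (cochains A RQ n)"
  unfolding cochains_iff
 proof (intro conjI ballI)
  fix a assume a: "a \<in> frees (RQ n)"
  show "?\<phi> a \<in> carrier A" using hom_carrier[OF \<phi>(1)] a unfolding carrier_free_frees by auto
  fix b assume b: "b \<in> frees (RQ n)"
  have "\<phi> (a + b) = \<phi> a \<otimes>\<^bsub>A\<^esub> \<phi> b" using hom_mult[OF \<phi>(1), of a b] a b by (simp add: frees_def)
  then show "?\<phi> (a + b) = ?\<phi> a \<otimes>\<^bsub>A\<^esub> ?\<phi> b" using a b frees_add[OF a b] by simp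
 qed simp
 moreover have "?\<phi> (frag_of (n, orbit (level F n) x)) = val n h x" if x: "x \<in> simplices F n" for x
 proof -
  have r: "(n, orbit (level F n) x) \<in> RQ n" using orbit_in[OF x] by (simp add: RQ_def)
  have "val n h (orep n (orbit (level F n) x)) = val n h x"
   by (rule val_orbit[OF h]) (use orep[OF orbit_in[OF x]] in simp)
  then show ?thesis using \<phi>(2)[OF r] r by simp
 qed
 ultimately have "\<exists>\<phi>. \<phi> \<in> carrier (cochains A RQ n) & (\<forall>x\<in>simplices F n. \<phi> (frag_of (n, orbit (level F n) x)) = val n h x)"
  by blast
 from someI_ex[OF this]
 show "orbit_cochain n h \<in> carrier (cochains A RQ n)"
  and "x \<in> simplices F n ==> orbit_cochain n h (frag_of (n, orbit (level F n) x)) = val n h x"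
  by (auto simp: orbit_cochain_def)
qed

lemma RQ_eqI:
 assumes "\<phi> \<in> carrier (cochains A RQ n)" "\<psi> \<in> carrier (cochains A RQ n)"
  and "\<And>x. x \<in> simplices F n ==> \<phi> (frag_of (n, orbit (level F n) x)) = \<psi> (frag_of (n, orbit (level F n) x))"
 shows "\<phi> = \<psi>"
 by (rule cochains_eqI[OF A assms(1,2)]) (use assms(3) in \<open>auto elim: RQ_E\<close>)

lemma RQ_mem: "x \<in> simplices F n ==> frag_of (n, orbit (level F n) x) \<in> frees (RQ n)"
 using orbit_in by (simp add: RQ_def)

lemma val_mult:
 assumes "h \<in> carrier (QC n)" "h' \<in> carrier (QC n)" "x \<in> simplices F n"
 shows "val n (h \<otimes>\<^bsub>QC n\<^esub> h') x = val n h x \<otimes>\<^bsub>A\<^esub> val n h' x"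
proof -
 have "(h \<otimes>\<^bsub>QC n\<^esub> h') (unit n x) = badd TB (h (unit n x)) (h' (unit n x))"
  by (rule QC_mult[OF unit_closed[OF assms(3)]])
 then have "(h \<otimes>\<^bsub>QC n\<^esub> h') (unit n x) = (val n h x \<otimes>\<^bsub>A\<^esub> val n h' x, \<epsilon> n x)"
  unfolding val_unit(1)[OF assms(1,3)] val_unit(1)[OF assms(2,3)] by simp
 then show ?thesis unfolding val_def[of n "h \<otimes>\<^bsub>QC n\<^esub> h'" x] by simp
qed

lemma orbit_cochain_iso: "orbit_cochain n \<in> iso (QC n) (cochains A RQ n)"
proof -
 interpret Q: comm_group "QC n" by (rule QC_group)
 interpret R: comm_group "cochains A RQ n" by (rule cochains_group[OF A])
 have "orbit_cochain n \<in> hom (QC n) (cochains A RQ n)"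
 proof (rule homI[OF orbit_cochain(1)])
  fix h h' assume h: "h \<in> carrier (QC n)" and h': "h' \<in> carrier (QC n)"
  show "orbit_cochain n (h \<otimes>\<^bsub>QC n\<^esub> h') = orbit_cochain n h \<otimes>\<^bsub>cochains A RQ n\<^esub> orbit_cochain n h'"
   by (rule RQ_eqI[OF orbit_cochain(1)[OF Q.m_closed[OF h h']] R.m_closed[OF orbit_cochain(1)[OF h] orbit_cochain(1)[OF h']]])
    (simp add: cochains_mult[where S = RQ and n = n, OF RQ_mem] orbit_cochain(2)[OF Q.m_closed[OF h h']] orbit_cochain(2)[OF h] orbit_cochain(2)[OF h'] val_mult[OF h h'])
 qed
 moreover have "inj_on (orbit_cochain n) (carrier (QC n))"
 proof (rule inj_onI)
  fix h h' assume h: "h \<in> carrier (QC n)" and h': "h' \<in> carrier (QC n)" and eq: "orbit_cochain n h = orbit_cochain n h'"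
  show "h = h'"
  proof (rule QC_eqI[OF h h'])
   fix x assume x: "x \<in> simplices F n"
   show "val n h x = val n h' x" using orbit_cochain(2)[OF h x] orbit_cochain(2)[OF h' x] eq by simp
  qed
 qed
 moreover have surj: "\<exists>h\<in>carrier (QC n). orbit_cochain n h = \<phi>" if \<phi>: "\<phi> \<in> carrier (cochains A RQ n)" for \<phi>
 proof -
  have "\<exists>h\<in>carrier (QC n). \<forall>x\<in>simplices F n. val n h x = \<phi> (frag_of (n, orbit (level F n) x))"
  proof (rule QC_exists)
   show "\<phi> (frag_of (n, orbit (level F n) x)) \<in> carrier A" if "x \<in> simplices F n" for x
    by (rule cochains_closed[OF \<phi> RQ_mem[OF that]])
   show "\<phi> (frag_of (n, orbit (level F n) (x \<rhd>\<^bsub>level F n\<^esub> y))) = \<phi> (frag_of (n, orbit (level F n) y))"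
    if "x \<in> simplices F n" "y \<in> simplices F n" for x y
    using orbit_lact[of x "level F n" y] that by simp
  qed
  then obtain h where h: "h \<in> carrier (QC n)" "\<And>x. x \<in> simplices F n ==> val n h x = \<phi> (frag_of (n, orbit (level F n) x))"
   by blast
  have "orbit_cochain n h = \<phi>"
   by (rule RQ_eqI[OF orbit_cochain(1)[OF h(1)] \<phi>]) (simp add: orbit_cochain(2)[OF h(1)] h(2))
  then show ?thesis using h(1) by blast
 qed
 have "orbit_cochain n ` carrier (QC n) = carrier (cochains A RQ n)"
 proof
  show "orbit_cochain n ` carrier (QC n) \<subseteq> carrier (cochains A RQ n)"
   by (rule image_subsetI) (rule orbit_cochain(1))
  show "carrier (cochains A RQ n) \<subseteq> orbit_cochain n ` carrier (QC n)" using surj by (metis image_eqI subsetI)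
 qed
 ultimately show ?thesis by (simp add: iso_def bij_betw_def)
qed

definition face_pull :: "nat => (('f, 'x) beck_term set => 'b \<times> 'x) => nat => (('f, 'x) beck_term set => 'b \<times> 'x)" where
 "face_pull n h i = restrict (%\<omega>. h (cotangent_face X F \<epsilon> n i \<omega>)) (carrier (Om (Suc n)))"

lemma face_pull:
 assumes h: "h \<in> carrier (QC n)" and i: "i \<le> Suc n"
 shows "face_pull n h i \<in> carrier (QC (Suc n))"
  and "x \<in> simplices F (Suc n) ==> val (Suc n) (face_pull n h i) x = val n h (face F n i x)"
proof -
 have fc: "face F n i x \<in> simplices F n" if "x \<in> simplices F (Suc n)" for x using face_closed[OF that i] .
 have fl: "face F n i (x \<rhd>\<^bsub>level F (Suc n)\<^esub> y) = face F n i x \<rhd>\<^bsub>level F n\<^esub> face F n i y"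
  if "x \<in> simplices F (Suc n)" "y \<in> simplices F (Suc n)" for x y
  using quandle_hom_lact[OF face_hom[OF i]] that by simp
 interpret quandle_over_to_beck X "level F (Suc n)" "\<epsilon> (Suc n)" "Om n" "%y. unit n (face F n i y)"
 proof (intro quandle_over_to_beck.intro over Om_module quandle_over_to_beck_axioms.intro)
  show "(%y. unit n (face F n i y)) \<in> slice_hom (level F (Suc n)) (\<epsilon> (Suc n)) (Om n) (proj (Om n))"
   using fc fl unit_closed unit_proj unit_lact \<epsilon>_face[OF _ i] by (simp add: slice_hom_def quandle_hom_def)
 qed
 have ct: "cotangent_face X F \<epsilon> n i = Omega_lift (Om n) (%y. unit n (face F n i y))"
  by (simp add: cotangent_face_def Omega_map_def)
 note L = beck_homD[OF Omega_lift_hom]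
 note H = beck_homD[OF conjunct1[OF h[unfolded QC_iff]]]
 have "(%\<omega>. h (cotangent_face X F \<epsilon> n i \<omega>)) \<in> beck_hom (Om (Suc n)) TB"
  unfolding ct beck_hom_def slice_hom_def quandle_hom_def
  using L(2-4) H(2-4) by (simp add: Pi_iff)
 then show "face_pull n h i \<in> carrier (QC (Suc n))"
  unfolding QC_iff face_pull_def using restrict_beck_hom[OF Om_module] by simp
 show "val (Suc n) (face_pull n h i) x = val n h (face F n i x)" if x: "x \<in> simplices F (Suc n)"
  using unit_closed[OF x] Omega_lift_unit[of x] x by (simp add: val_def face_pull_def ct)
qed

lemma quillen_coboundary_eq:
 "quillen_coboundary X F \<epsilon> TB n h = (\<Otimes>\<^bsub>QC (Suc n)\<^esub>i\<in>{..Suc n}. face_pull n h i [^]\<^bsub>QC (Suc n)\<^esub> ((-1) ^ i :: int))"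
 unfolding quillen_coboundary_def face_pull_def cotangent_def ..

lemma quillen_coboundary_closed:
 assumes h: "h \<in> carrier (QC n)"
 shows "quillen_coboundary X F \<epsilon> TB n h \<in> carrier (QC (Suc n))"
proof -
 interpret Q: comm_group "QC (Suc n)" by (rule QC_group)
 show ?thesis unfolding quillen_coboundary_eq
  by (rule Q.finprod_closed) (use face_pull(1)[OF h] in \<open>auto intro: Q.int_pow_closed\<close>)
qed

text \<open>The faces of the cotangent complex are induced by the faces of \<open>F\<close>, on values as on orbits, and the
 alternating products in the group of cochains turn into alternating sums of faces.\<close>

lemma orbit_cochain_coboundary:
 assumes h: "h \<in> carrier (QC n)"
 shows "orbit_cochain (Suc n) (quillen_coboundary X F \<epsilon> TB n h) = codiff RQ EQ n (orbit_cochain n h)"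
proof (rule RQ_eqI[where n = "Suc n"])
 show "orbit_cochain (Suc n) (quillen_coboundary X F \<epsilon> TB n h) \<in> carrier (cochains A RQ (Suc n))"
  by (rule orbit_cochain(1)[OF quillen_coboundary_closed[OF h]])
 have RQc: "chain_complex RQ EQ" by (rule chain_complex_RQ)
 show "codiff RQ EQ n (orbit_cochain n h) \<in> carrier (cochains A RQ (Suc n))"
  unfolding codiff_def
  by (rule pull_cochain[OF orbit_cochain(1)[OF h] chain_complex.D_additive[OF RQc] chain_complex.D_closed[OF RQc]])
 fix x assume x: "x \<in> simplices F (Suc n)"
 have hom: "(%h. val (Suc n) h x) \<in> hom (QC (Suc n)) A"
  by (rule homI) (use val_unit(2) val_mult x in auto)
 have "orbit_cochain (Suc n) (quillen_coboundary X F \<epsilon> TB n h) (frag_of (Suc n, orbit (level F (Suc n)) x))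
   = val (Suc n) (quillen_coboundary X F \<epsilon> TB n h) x"
  by (rule orbit_cochain(2)[OF quillen_coboundary_closed[OF h] x])
 also have "\<dots> = (\<Otimes>\<^bsub>A\<^esub>i\<in>{..Suc n}. val (Suc n) (face_pull n h i) x [^]\<^bsub>A\<^esub> ((-1) ^ i :: int))"
  unfolding quillen_coboundary_eq
  by (rule hom_alternating_product[OF QC_group A hom]) (use face_pull(1)[OF h] in auto)
 also have "\<dots> = (\<Otimes>\<^bsub>A\<^esub>i\<in>{..Suc n}. orbit_cochain n h (frag_of (orb_face n i x)) [^]\<^bsub>A\<^esub> ((-1) ^ i :: int))"
 proof -
  interpret A: comm_group A by (rule A)
  show ?thesis
  proof (rule A.finprod_cong')
   show "(%i. orbit_cochain n h (frag_of (orb_face n i x)) [^]\<^bsub>A\<^esub> ((-1) ^ i :: int)) \<in> {..Suc n} \<rightarrow> carrier A"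
   proof
    fix i assume "i \<in> {..Suc n}"
    then have "frag_of (orb_face n i x) \<in> frees (RQ n)" using orb_face_closed[OF x] by simp
    then show "orbit_cochain n h (frag_of (orb_face n i x)) [^]\<^bsub>A\<^esub> ((-1) ^ i :: int) \<in> carrier A"
     by (intro A.int_pow_closed cochains_closed[OF orbit_cochain(1)[OF h]])
   qed
  next
   fix i assume i: "i \<in> {..Suc n}"
   then show "val (Suc n) (face_pull n h i) x [^]\<^bsub>A\<^esub> ((-1) ^ i :: int) = orbit_cochain n h (frag_of (orb_face n i x)) [^]\<^bsub>A\<^esub> ((-1) ^ i :: int)"
    using face_pull(2)[OF h _ x, of i] orbit_cochain(2)[OF h face_closed[OF x, of i]] by (simp add: orb_face_def)
  qed simp
 qed
 also have "\<dots> = orbit_cochain n h (\<Sum>i\<in>{..Suc n}. frag_cmul ((-1) ^ i) (frag_of (orb_face n i x)))"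
  by (rule cochains_alternating_sum[OF A orbit_cochain(1)[OF h], symmetric]) (use orb_face_closed[OF x] in auto)
 also have "\<dots> = codiff RQ EQ n (orbit_cochain n h) (frag_of (Suc n, orbit (level F (Suc n)) x))"
  using RQ_mem[OF x] by (simp only: codiff_def restrict_apply' EQ_orbit[OF x])
 finally show "orbit_cochain (Suc n) (quillen_coboundary X F \<epsilon> TB n h) (frag_of (Suc n, orbit (level F (Suc n)) x))
   = codiff RQ EQ n (orbit_cochain n h) (frag_of (Suc n, orbit (level F (Suc n)) x))" .
qed

text \<open>The quandle cochains are the cochains of the tuples in \<open>X\<close>, the Quillen cochains are the cochains of
 the orbits in \<open>F\<close>, and the span of trivial fibrations through the total complex relates both.\<close>

theorem HQ_quillen: "HQ X A (Suc n) \<cong> quillen_cohomology X F \<epsilon> TB n"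
proof -
 interpret X: quandle X by (rule base)
 interpret span: trivial_fibration_span "double_complex.tot \<beta>" "double_complex.D dh dv" RP "Nbd X" \<epsilon>P RQ EQ \<epsilon>Q
  by (intro trivial_fibration_span.intro tuple_fibration orbit_fibration)
 note orb = orbit_cochain_iso quillen_coboundary_closed orbit_cochain_coboundary
 note RQc = cochains_complex[OF chain_complex_RQ A]
 have "quillen_cohomology X F \<epsilon> TB n \<cong> cohomology (cochains A RQ) (codiff RQ EQ) n"
  unfolding quillen_cohomology_def
  by (rule cohomology_iso_transfer[where \<alpha> = orbit_cochain, OF RQc QC_group orb(2,1,3)])
 moreover have "Group.group (quillen_cohomology X F \<epsilon> TB n)"
  unfolding quillen_cohomology_def
  by (rule cochain_complex.group_cohomology, rule cochain_complex_transfer[where \<alpha> = orbit_cochain, OF RQc QC_group orb(2,1,3)])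
 ultimately have "cohomology (cochains A RQ) (codiff RQ EQ) n \<cong> quillen_cohomology X F \<epsilon> TB n"
  using Group.group.iso_sym by blast
 then show ?thesis
  using iso_trans[OF iso_trans[OF X.HQ_normalized[OF A, of n] span.cohomology_span[OF A, of n]]] by blast
qed

end

end

section \<open>The comparison theorem\<close>

lemma row_exact_bij:
 assumes Y: "quandle Y" and Z: "quandle Z" and f: "f \<in> quandle_hom Y Z" "bij_betw f (carrier Y) (carrier Z)"
  and ex: "row_exact Y"
 shows "row_exact Z"
proof -
 interpret Y: quandle Y by fact
 let ?g = "inv_into (carrier Y) f"
 have g: "?g z \<in> carrier Y" "f (?g z) = z" if "z \<in> carrier Z" for z
  using that bij_betw_imp_surj_on[OF f(2)] inv_into_into[of z f "carrier Y"] f_inv_into_f[of z f "carrier Y"] by auto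
 have gf: "?g (f y) = y" if "y \<in> carrier Y" for y using bij_betw_inv_into_left[OF f(2) that] .
 have "?g \<in> quandle_hom Z Y"
  unfolding quandle_hom_def
 proof (intro CollectI conjI ballI funcsetI g(1))
  fix z w assume z: "z \<in> carrier Z" and w: "w \<in> carrier Z"
  have "f (?g z \<rhd>\<^bsub>Y\<^esub> ?g w) = z \<rhd>\<^bsub>Z\<^esub> w" using quandle_hom_lact[OF f(1) g(1)[OF z] g(1)[OF w]] g(2)[OF z] g(2)[OF w] by simp
  then show "?g (z \<rhd>\<^bsub>Z\<^esub> w) = ?g z \<rhd>\<^bsub>Y\<^esub> ?g w" using gf[of "?g z \<rhd>\<^bsub>Y\<^esub> ?g w"] g(1)[OF z] g(1)[OF w] by simp
 qed
 from row_exact_retract[OF Z Y this f(1) g(2) ex] show ?thesis by simp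
qed

lemma row_exact_free_squandle:
 assumes G: "free_squandle G"
 shows "row_exact (level G q)"
proof -
 have GQ: "quandle (level G q)"
  by (rule simplicial_quandle.quandle_level) (use G in \<open>simp add: free_squandle_def\<close>)
 have "\<exists>B. B q \<subseteq> simplices G q & bij_betw (free_quandle_lift (level G q) id) (carrier (free_quandle (B q))) (carrier (level G q))"
  using G unfolding free_squandle_def by metis
 then show ?thesis
 proof (elim exE conjE)
  fix B
  assume B: "B q \<subseteq> simplices G q"
   "bij_betw (free_quandle_lift (level G q) id) (carrier (free_quandle (B q))) (carrier (level G q))"
  have "id \<in> B q \<rightarrow> carrier (level G q)" using B(1) by (auto simp: level_def)
  note lift = free_quandle_universal(1)[OF GQ this]
  show ?thesis by (rule row_exact_bij[OF quandle_free_quandle GQ lift B(2) row_exact_free_quandle])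
 qed
qed

text \<open>A cofibrant simplicial quandle is a retract of a free one, degree by degree.\<close>

lemma row_exact_cofibrant:
 fixes F :: "('f, 'm) squandle_scheme"
 assumes "cofibrant TYPE('g) F"
 shows "row_exact (level F q)"
proof -
 have "\<exists>(G :: 'g squandle) i r. free_squandle G & simplicial_quandle_map F G i & simplicial_quandle_map G F r \<and>
   (\<forall>q. \<forall>x\<in>simplices F q. r q (i q x) = x) & simplicial_quandle F"
  using assms unfolding cofibrant_def retract_of_squandle_def by blast
 then show ?thesis
 proof (elim exE conjE)
  fix G :: "'g squandle" and i r
  assume G: "free_squandle G" and i: "simplicial_quandle_map F G i" and r: "simplicial_quandle_map G F r"
   and ri: "\<forall>q. \<forall>x\<in>simplices F q. r q (i q x) = x" and F: "simplicial_quandle F"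
  have GQ: "quandle (level G q)"
   by (rule simplicial_quandle.quandle_level) (use G in \<open>simp add: free_squandle_def\<close>)
  have ih: "i q \<in> quandle_hom (level F q) (level G q)" using i by (simp add: simplicial_quandle_map_def)
  have rh: "r q \<in> quandle_hom (level G q) (level F q)" using r by (simp add: simplicial_quandle_map_def)
  have rr: "r q (i q x) = x" if "x \<in> carrier (level F q)" for x using ri that by (simp add: level_def)
  show ?thesis
   by (rule row_exact_retract[OF simplicial_quandle.quandle_level[OF F] GQ ih rh rr row_exact_free_squandle[OF G]])
 qed
qed

theorem theorem3p3:
  fixes X :: "('x, 'm) magma_scheme"
    and A :: "('a, 'k) monoid_scheme"
    and F :: "'f squandle"
    and \<epsilon> :: "nat \<Rightarrow> 'f \<Rightarrow> 'x"
    and n :: nat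
  assumes "quandle X"
    and "comm_group A"
    and "cofibrant_replacement TYPE('g) X F \<epsilon>"
  shows "HQ X A (n + 1) \<cong> quillen_cohomology X F \<epsilon> (trivial_beck A X) n"
proof -
  have cof: "cofibrant TYPE('g) F" and map: "simplicial_quandle_map F (constant_squandle X) \<epsilon>"
    and we: "weak_equivalence F (constant_squandle X) \<epsilon>"
    using assms(3) by (auto simp: cofibrant_replacement_def)
  have F: "simplicial_quandle F" using cof by (simp add: cofibrant_def)
  then have K: "simplicial_set F" by (simp add: simplicial_quandle_def)
  have smap: "simplicial_map F (constant_squandle X) \<epsilon>" using map by (simp add: simplicial_quandle_map_def)
  have hom: "\<epsilon> q \<in> quandle_hom (level F q) X" for q
    using map by (simp add: simplicial_quandle_map_def quandle_hom_def level_def constant_squandle_def)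
  have ac: "acyclic_over F (carrier X) (\<epsilon> 0)" by (rule weak_equivalence_acyclic[OF K smap we])
  have fc: "\<epsilon> q (face F q i x) = \<epsilon> (Suc q) x" if "x \<in> simplices F (Suc q)" "i \<le> Suc q" for q i x
    using smap that by (auto simp: simplicial_map_def constant_squandle_simps)
  have "augmented_resolution F X \<epsilon>"
    by (intro augmented_resolution.intro quandle_resolution.intro quandle_resolution_axioms.intro
        augmented_resolution_axioms.intro F ac assms(1) hom row_exact_cofibrant[OF cof] fc)
  from augmented_resolution.HQ_quillen[OF this assms(2), of n] show ?thesis by simp
qed

end
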